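(* Let $\Omega\Subset\mathbb{C}^{n}$, $n\geq 1$, be a bounded domain with smooth ($\mathcal{C}^{\infty}$) boundary, and let $B$ be its Bergman projection. Suppose that for a given pair $(k_{1},k_{2})\in\mathbb{N}_{0}^{2}$ there exists a constant $C>0$ such that $$\|Bf\|_{k_{2}}\leq C\|f\|_{k_{1}}\qquad\text{for all } f\in H^{k_{1}}(\Omega).$$ Let $k\in\mathbb{N}$ and $g\in\mathcal{C}^{\infty}(\overline{\Omega})$ be given. Then the Bergman projection extends to an $H^{k_{2}}(\Omega)$-bounded operator on $\overline{A^{-k}_{g}(\Omega)}$; that is, there exist a linear operator $\widetilde{B}:\overline{A^{-k}_{g}(\Omega)}\to H^{k_{2}}(\Omega)$ and a constant $\widetilde{C}>0$ such that $\widetilde{B}(\mu g)=B(\mu g)$ for all $\mu\in\overline{A^{0}(\Omega)}$ and $$\|\widetilde{B}(\mu g)\|_{k_{2}}\leq\widetilde{C}\,\|\mu\|_{-k}\qquad\text{for all }\mu\in\overline{A^{-k}(\Omega)}.$$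
   Context: $\mathbb{N}=\{1,2,\dots\}$, $\mathbb{N}_0=\mathbb{N}\cup\{0\}$. $\mathcal{O}(\Omega)$ is the space of holomorphic functions on $\Omega$; $\mathcal{C}^{\infty}(\overline{\Omega})$ is the space of (complex-valued) functions smooth up to the boundary of $\Omega$. $L^2(\Omega)$ is taken with respect to Euclidean volume $dV$, with inner product $(f,g)=\int_\Omega f\overline{g}\,dV$. The Bergman projection $B:L^{2}(\Omega)\to L^{2}(\Omega)\cap\mathcal{O}(\Omega)$ is the orthogonal projection of $L^2(\Omega)$ onto its closed subspace of holomorphic functions. For $\ell\in\mathbb{N}_0$, $H^{\ell}(\Omega)$ is the $L^2$-Sobolev space of functions $f\in L^2(\Omega)$ whose distributional derivatives $D^\alpha f$ (in the $2n$ real coordinates) lie in $L^2(\Omega)$ for all $|\alpha|\le \ell$, with norm $\|f\|_\ell^2=\sum_{|\alpha|\le \ell}\|D^\alpha f\|_{L^2(\Omega)}^2$; $H^0(\Omega)=L^2(\Omega)$. An inequality $\|F\|_{\ell}\le M$ with $M<\infty$ includes the assertion $F\in H^\ell(\Omega)$. For $k\in\mathbb{N}$, $H^k_0(\Omega)$ is the closure of $\mathcal{C}^\infty_c(\Omega)$ in $H^k(\Omega)$, and $H^{-k}(\Omega)$ is the dual space of $H^k_0(\Omega)$ with the operator norm $\|f\|_{-k}=\sup\{|(f,g)|: g\in H^k_0(\Omega),\ \|g\|_k\le 1\}$, where $L^2(\Omega)\subset H^{-k}(\Omega)$ via the $L^2$ pairing. $A^{0}(\Omega)=L^{2}(\Omega)\cap\mathcal{O}(\Omega)$,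 and $\overline{A^{0}(\Omega)}$ is the space of functions whose complex conjugates belong to $A^{0}(\Omega)$ (here the bar denotes complex conjugation). $\overline{A^{-k}(\Omega)}$ is the closure of $\overline{A^{0}(\Omega)}$ in $H^{-k}(\Omega)$ with respect to $\|\cdot\|_{-k}$. $\overline{A^{-k}_{g}(\Omega)}=\{\mu g:\mu\in\overline{A^{-k}(\Omega)}\}$ is the space of products of $g$ with elements of $\overline{A^{-k}(\Omega)}$. *)

theory Defs
  imports "HOL-Analysis.Analysis" "HOL-Library.Multiset"
begin

section \<open>Smooth functions and smoothly bounded domains\<close>

fun iter_deriv ::
  "'a::real_normed_vector list \<Rightarrow> ('a \<Rightarrow> 'b::real_normed_vector) \<Rightarrow> 'a \<Rightarrow> 'b" where
  "iter_deriv [] f = f"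
| "iter_deriv (v # vs) f = (\<lambda>x. frechet_derivative (iter_deriv vs f) (at x) v)"

text \<open>Used for open \<open>U\<close> only: all iterated directional derivatives exist and are Frechet
  differentiable, hence continuous, on \<open>U\<close>. This is \<open>C\<^sup>\<infinity>(U)\<close>.\<close>

definition smooth_on :: "'a::real_normed_vector set \<Rightarrow> ('a \<Rightarrow> 'b::real_normed_vector) \<Rightarrow> bool" where
  "smooth_on U f \<longleftrightarrow> (\<forall>vs. \<forall>x\<in>U. iter_deriv vs f differentiable (at x))"

definition smooth_boundary :: "'a::euclidean_space set \<Rightarrow> bool" where
  "smooth_boundary \<Omega> \<longleftrightarrow>
     (\<forall>p\<in>frontier \<Omega>. \<exists>U (r :: 'a \<Rightarrow> real). open U \<and> p \<in> U \<and> smooth_on U r \<and>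
        (\<forall>x\<in>U. frechet_derivative r (at x) \<noteq> (\<lambda>v. 0)) \<and> \<Omega> \<inter> U = {x\<in>U. r x < 0})"

definition smooth_bounded_domain :: "'a::euclidean_space set \<Rightarrow> bool" where
  "smooth_bounded_domain \<Omega> \<longleftrightarrow>
     open \<Omega> \<and> connected \<Omega> \<and> \<Omega> \<noteq> {} \<and> bounded \<Omega> \<and> smooth_boundary \<Omega>"

text \<open>\<open>C\<^sup>\<infinity>\<close> of the closure: every derivative extends continuously from \<open>\<Omega>\<close> to its closure.
  The values of \<open>g\<close> outside \<open>\<Omega>\<close> are irrelevant.\<close>

definition smooth_up_to_boundary ::
  "'a::euclidean_space set \<Rightarrow> ('a \<Rightarrow> 'b::real_normed_vector) \<Rightarrow> bool" where
  "smooth_up_to_boundary \<Omega> g \<longleftrightarrow> smooth_on \<Omega> g \<and>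
     (\<forall>vs. \<exists>G. continuous_on (closure \<Omega>) G \<and> (\<forall>x\<in>\<Omega>. G x = iter_deriv vs g x))"

definition test_functions :: "'a::euclidean_space set \<Rightarrow> ('a \<Rightarrow> complex) set" where
  "test_functions \<Omega> =
     {\<phi>. smooth_on UNIV \<phi> \<and> (\<exists>K. compact K \<and> K \<subseteq> \<Omega> \<and> (\<forall>x. x \<notin> K \<longrightarrow> \<phi> x = 0))}"


section \<open>Square-integrable functions and Sobolev spaces\<close>

text \<open>Elements of \<open>L\<^sup>2(\<Omega>)\<close> are represented by functions on the whole space, of which only the
  values on \<open>\<Omega>\<close>, up to null sets, matter.\<close>

definition L2 :: "'a::euclidean_space set \<Rightarrow> ('a \<Rightarrow> complex) set" where
  "L2 \<Omega> = {f. f \<in> borel_measurable (lebesgue_on \<Omega>) \<and>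
             integrable (lebesgue_on \<Omega>) (\<lambda>x. (cmod (f x))\<^sup>2)}"

definition L2_inner ::
  "'a::euclidean_space set \<Rightarrow> ('a \<Rightarrow> complex) \<Rightarrow> ('a \<Rightarrow> complex) \<Rightarrow> complex" where
  "L2_inner \<Omega> f h = (LINT x|lebesgue_on \<Omega>. f x * cnj (h x))"

definition L2_norm :: "'a::euclidean_space set \<Rightarrow> ('a \<Rightarrow> complex) \<Rightarrow> real" where
  "L2_norm \<Omega> f = sqrt (LINT x|lebesgue_on \<Omega>. (cmod (f x))\<^sup>2)"

text \<open>A multi-index is a multiset of basis vectors; the multiplicity of \<open>b\<close> is the order of
  differentiation in the coordinate direction \<open>b\<close>.\<close>

definition multi_indices :: "nat \<Rightarrow> 'a::euclidean_space multiset set" where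
  "multi_indices l = {\<alpha>. set_mset \<alpha> \<subseteq> Basis \<and> size \<alpha> \<le> l}"

lemma finite_multi_indices: "finite (multi_indices l :: 'a::euclidean_space multiset set)"
proof -
  have "finite (mset ` {xs :: 'a list. set xs \<subseteq> Basis \<and> length xs \<le> l})"
    by (intro finite_imageI finite_lists_length_le finite_Basis)
  moreover have "multi_indices l \<subseteq> mset ` {xs :: 'a list. set xs \<subseteq> Basis \<and> length xs \<le> l}"
  proof
    fix \<alpha> :: "'a multiset"
    assume "\<alpha> \<in> multi_indices l"
    moreover obtain xs where "\<alpha> = mset xs"
      using ex_mset by metis
    ultimately show "\<alpha> \<in> mset ` {xs :: 'a list. set xs \<subseteq> Basis \<and> length xs \<le> l}"
      by (auto simp: multi_indices_def)
  qed
  ultimately show ?thesis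
    by (rule finite_subset[rotated])
qed

text \<open>Only applied to smooth functions, for which the order of differentiation is immaterial.\<close>

definition partial_deriv ::
  "'a::euclidean_space multiset \<Rightarrow> ('a \<Rightarrow> complex) \<Rightarrow> 'a \<Rightarrow> complex" where
  "partial_deriv \<alpha> \<phi> = iter_deriv (SOME vs. mset vs = \<alpha>) \<phi>"

definition has_weak_deriv ::
  "'a::euclidean_space set \<Rightarrow> 'a multiset \<Rightarrow> ('a \<Rightarrow> complex) \<Rightarrow> ('a \<Rightarrow> complex) \<Rightarrow> bool" where
  "has_weak_deriv \<Omega> \<alpha> f w \<longleftrightarrow>
     (\<forall>\<phi>\<in>test_functions \<Omega>.
        (LINT x|lebesgue_on \<Omega>. f x * partial_deriv \<alpha> \<phi> x)
        = (-1) ^ size \<alpha> * (LINT x|lebesgue_on \<Omega>. w x * \<phi> x))"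

definition weak_deriv ::
  "'a::euclidean_space set \<Rightarrow> 'a multiset \<Rightarrow> ('a \<Rightarrow> complex) \<Rightarrow> 'a \<Rightarrow> complex" where
  "weak_deriv \<Omega> \<alpha> f = (SOME w. w \<in> L2 \<Omega> \<and> has_weak_deriv \<Omega> \<alpha> f w)"

definition sobolev :: "'a::euclidean_space set \<Rightarrow> nat \<Rightarrow> ('a \<Rightarrow> complex) set" where
  "sobolev \<Omega> l = {f \<in> L2 \<Omega>. \<forall>\<alpha>\<in>multi_indices l. \<exists>w\<in>L2 \<Omega>. has_weak_deriv \<Omega> \<alpha> f w}"

definition sobolev_norm :: "'a::euclidean_space set \<Rightarrow> nat \<Rightarrow> ('a \<Rightarrow> complex) \<Rightarrow> real" where
  "sobolev_norm \<Omega> l f = sqrt (\<Sum>\<alpha>\<in>multi_indices l. (L2_norm \<Omega> (weak_deriv \<Omega> \<alpha> f))\<^sup>2)"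

definition sobolev0 :: "'a::euclidean_space set \<Rightarrow> nat \<Rightarrow> ('a \<Rightarrow> complex) set" where
  "sobolev0 \<Omega> k =
     {f \<in> sobolev \<Omega> k. \<forall>\<epsilon>>0. \<exists>\<phi>\<in>test_functions \<Omega>. sobolev_norm \<Omega> k (\<lambda>x. f x - \<phi> x) < \<epsilon>}"


section \<open>Sobolev spaces of negative order\<close>

text \<open>The pairing \<open>(f, h)\<close> is conjugate linear in \<open>h\<close>, so elements of the dual are bounded
  conjugate-linear functionals on \<open>sobolev0 \<Omega> k\<close>. They are set to \<open>0\<close> outside that space, which
  makes equality of functionals on \<open>sobolev0 \<Omega> k\<close> the same as HOL equality. Boundedness forces
  such a functional to respect equality almost everywhere.\<close>

type_synonym 'a functional = "('a \<Rightarrow> complex) \<Rightarrow> complex"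

definition neg_sobolev :: "'a::euclidean_space set \<Rightarrow> nat \<Rightarrow> 'a functional set" where
  "neg_sobolev \<Omega> k =
     {T. (\<forall>h. h \<notin> sobolev0 \<Omega> k \<longrightarrow> T h = 0) \<and>
         (\<forall>h1\<in>sobolev0 \<Omega> k. \<forall>h2\<in>sobolev0 \<Omega> k. T (\<lambda>x. h1 x + h2 x) = T h1 + T h2) \<and>
         (\<forall>c. \<forall>h\<in>sobolev0 \<Omega> k. T (\<lambda>x. c * h x) = cnj c * T h) \<and>
         (\<exists>M. \<forall>h\<in>sobolev0 \<Omega> k. cmod (T h) \<le> M * sobolev_norm \<Omega> k h)}"

definition neg_sobolev_norm :: "'a::euclidean_space set \<Rightarrow> nat \<Rightarrow> 'a functional \<Rightarrow> real" where
  "neg_sobolev_norm \<Omega> k T = (SUP h\<in>{h \<in> sobolev0 \<Omega> k. sobolev_norm \<Omega> k h \<le> 1}. cmod (T h))"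

definition embed_L2 ::
  "'a::euclidean_space set \<Rightarrow> nat \<Rightarrow> ('a \<Rightarrow> complex) \<Rightarrow> 'a functional" where
  "embed_L2 \<Omega> k f = (\<lambda>h. if h \<in> sobolev0 \<Omega> k then L2_inner \<Omega> f h else 0)"

text \<open>The product of a functional and a function \<open>g\<close>, smooth up to the boundary, extends
  \<open>(\<mu> g, h) = (\<mu>, g\<^sup>* h)\<close> for square-integrable \<open>\<mu>\<close>, where \<open>g\<^sup>*\<close> is the conjugate of \<open>g\<close>.\<close>

definition mult_functional ::
  "'a::euclidean_space set \<Rightarrow> nat \<Rightarrow> 'a functional \<Rightarrow> ('a \<Rightarrow> complex) \<Rightarrow> 'a functional" where
  "mult_functional \<Omega> k T g = (\<lambda>h. if h \<in> sobolev0 \<Omega> k then T (\<lambda>x. cnj (g x) * h x) else 0)"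


section \<open>Holomorphic functions and the Bergman projection\<close>

definition holomorphic_several :: "(complex ^ 'n \<Rightarrow> complex) \<Rightarrow> (complex ^ 'n) set \<Rightarrow> bool" where
  "holomorphic_several f \<Omega> \<longleftrightarrow>
     (\<forall>z\<in>\<Omega>. \<exists>f'. (f has_derivative f') (at z) \<and> (\<forall>c v. f' (c *s v) = c * f' v))"

definition bergman_space :: "(complex ^ 'n) set \<Rightarrow> (complex ^ 'n \<Rightarrow> complex) set" where
  "bergman_space \<Omega> = {f \<in> L2 \<Omega>. holomorphic_several f \<Omega>}"

text \<open>The orthogonal projection onto \<open>bergman_space \<Omega>\<close>; the value \<open>0\<close> outside \<open>\<Omega>\<close> selects a
  unique representative.\<close>

definition bergman_projection ::
  "(complex ^ 'n) set \<Rightarrow> (complex ^ 'n \<Rightarrow> complex) \<Rightarrow> complex ^ 'n \<Rightarrow> complex" where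
  "bergman_projection \<Omega> f =
     (THE h. h \<in> bergman_space \<Omega> \<and> (\<forall>u\<in>bergman_space \<Omega>. L2_inner \<Omega> (\<lambda>z. f z - h z) u = 0) \<and>
             (\<forall>z. z \<notin> \<Omega> \<longrightarrow> h z = 0))"

definition conj_bergman :: "(complex ^ 'n) set \<Rightarrow> (complex ^ 'n \<Rightarrow> complex) set" where
  "conj_bergman \<Omega> = {f. (\<lambda>z. cnj (f z)) \<in> bergman_space \<Omega>}"

definition conj_bergman_neg :: "(complex ^ 'n) set \<Rightarrow> nat \<Rightarrow> (complex ^ 'n) functional set" where
  "conj_bergman_neg \<Omega> k =
     {T \<in> neg_sobolev \<Omega> k. \<forall>\<epsilon>>0. \<exists>\<mu>\<in>conj_bergman \<Omega>.
        neg_sobolev_norm \<Omega> k (\<lambda>h. T h - embed_L2 \<Omega> k \<mu> h) < \<epsilon>}"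

definition conj_bergman_neg_mult ::
  "(complex ^ 'n) set \<Rightarrow> nat \<Rightarrow> (complex ^ 'n \<Rightarrow> complex) \<Rightarrow> (complex ^ 'n) functional set" where
  "conj_bergman_neg_mult \<Omega> k g = {mult_functional \<Omega> k \<mu> g |\<mu>. \<mu> \<in> conj_bergman_neg \<Omega> k}"

text \<open>Linearity of an operator from a space of functionals to functions on \<open>\<Omega>\<close> that are identified
  when they agree almost everywhere.\<close>

definition linear_op_on ::
  "'a::euclidean_space set \<Rightarrow> 'a functional set \<Rightarrow> ('a functional \<Rightarrow> 'a \<Rightarrow> complex) \<Rightarrow> bool" where
  "linear_op_on \<Omega> X A \<longleftrightarrow>
     (\<forall>S\<in>X. \<forall>T\<in>X. AE x in lebesgue_on \<Omega>. A (\<lambda>h. S h + T h) x = A S x + A T x) \<and>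
     (\<forall>c. \<forall>S\<in>X. AE x in lebesgue_on \<Omega>. A (\<lambda>h. c * S h) x = c * A S x)"

end

theory Submission
  imports Defs "HOL-Complex_Analysis.Complex_Analysis"
begin

text \<open>Let \<open>r\<close> be a local defining function of \<open>\<Omega>\<close>. A Wirtinger derivative \<open>wirt v\<close> that annihilates
  conjugates of holomorphic functions and is transversal to the boundary lets one write
  \<open>r\<^sup>n f = wirt v (r\<^sup>n\<^sup>+\<^sup>1 c) + r\<^sup>n\<^sup>+\<^sup>1 f'\<close>, where the first term is orthogonal to all
  conjugates of integrable holomorphic functions. Repeating this and using a partition of unity,
  \<open>g\<close> is replaced by a function \<open>G\<close> that vanishes to high order at the boundary and satisfies
  \<open>B (\<mu> g) = B (\<mu> G)\<close> for square-integrable conjugate holomorphic \<open>\<mu>\<close>. By the mean value property,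
  an element of the closure of these \<open>\<mu>\<close> in \<open>H\<^sup>-\<^sup>k\<close> is a conjugate holomorphic function \<open>m\<close> whose
  derivatives grow at most polynomially in the inverse distance to the boundary, with constants
  controlled by the negative Sobolev norm. Hence \<open>\<mu> \<mapsto> m G\<close> is bounded into \<open>H\<^sup>k\<^sup>1\<close>, and
  \<open>B (m G)\<close> is the required extension.\<close>

section \<open>Calculus of smooth functions\<close>

text \<open>A limit \<mu> in \<open>neg_sobolev\<close> is too singular at the boundary for \<mu> g
  to be square-integrable, so the projection cannot be applied to it directly. For square-integrable
  \<mu>, the product \<mu> (g - G) is tested against a holomorphic u by pairing g - G with the
  conjugate of cnj \<mu> u, which is holomorphic but merely integrable. It has no usable boundary
  values; hence the orthogonality is proved with cutoffs. The order to which G vanishes is DIM + k +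
  k1, with DIM the real dimension: a normalised kernel at the scale of the boundary distance d(z)
  has derivatives up to order k of size d(z)^-(DIM + k), which bounds the growth of m, and k1
  further orders keep k1 derivatives of m G bounded. The assumed estimate for B is then used once,
  on m G. The operator is given only the product \<mu> g, and g may have zeros of any kind;
  therefore G is built from g by local operations, so that m G depends on the product alone. The
  mean value property also supplies the interior estimates and the existence of the
  projection.\<close>

definition dir_deriv :: "'a::real_normed_vector \<Rightarrow> ('a \<Rightarrow> 'b::real_normed_vector) \<Rightarrow> 'a \<Rightarrow> 'b" where
  "dir_deriv v f = (\<lambda>x. frechet_derivative f (at x) v)"

lemma dir_deriv_eqI: "(f has_derivative f') (at x) \<Longrightarrow> dir_deriv v f x = f' v"
  unfolding dir_deriv_def using frechet_derivative_at by metis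

lemma has_derivative_dir_deriv:
  "f differentiable (at x) \<Longrightarrow> (f has_derivative (\<lambda>v. dir_deriv v f x)) (at x)"
  unfolding dir_deriv_def using frechet_derivative_works by auto

text \<open>\<open>frechet_derivative\<close> is defined by choice; f and g have the same candidates
  at x, so the chosen values agree even where no derivative exists.\<close>

lemma dir_deriv_cong:
  assumes "open U" "x \<in> U" "\<And>y. y \<in> U \<Longrightarrow> f y = g y"
  shows "dir_deriv v f x = dir_deriv v g x"
proof -
  have "(f has_derivative f') (at x) \<longleftrightarrow> (g has_derivative f') (at x)" for f'
    using assms by (metis has_derivative_transform_within_open)
  then show ?thesis
    unfolding dir_deriv_def frechet_derivative_def by simp
qed

lemma differentiable_cong:
  assumes "open U" "x \<in> U" "\<And>y. y \<in> U \<Longrightarrow> f y = g y" "f differentiable (at x)"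
  shows "g differentiable (at x)"
  using assms unfolding differentiable_def by (metis has_derivative_transform_within_open)

lemma iter_deriv_Cons: "iter_deriv (v # vs) f = dir_deriv v (iter_deriv vs f)"
  by (simp add: dir_deriv_def)

text \<open>The head of the list is applied last, so the last entry is the derivative that acts on f
  itself. Inductions on the order peel off this entry.\<close>

lemma iter_deriv_snoc: "iter_deriv (vs @ [v]) f = iter_deriv vs (dir_deriv v f)"
  by (induction vs) (simp_all add: dir_deriv_def)

lemma iter_deriv_cong:
  assumes "open U" "\<And>y. y \<in> U \<Longrightarrow> f y = g y" "x \<in> U"
  shows "iter_deriv vs f x = iter_deriv vs g x"
  using assms(3)
proof (induction vs arbitrary: x)
  case (Cons v vs)
  then show ?case
    unfolding iter_deriv_Cons by (intro dir_deriv_cong[OF assms(1)]) auto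
qed (use assms in auto)

text \<open>The flag \<open>b\<close> requires all derivatives up to order \<open>n\<close> to be bounded on \<open>U\<close>. Counting the
  order makes the closure properties provable by induction.\<close>

fun diff_order ::
  "bool \<Rightarrow> nat \<Rightarrow> 'a::real_normed_vector set \<Rightarrow> ('a \<Rightarrow> 'b::real_normed_vector) \<Rightarrow> bool" where
  "diff_order b 0 U f \<longleftrightarrow> (b \<longrightarrow> bounded (f ` U))"
| "diff_order b (Suc n) U f \<longleftrightarrow> (b \<longrightarrow> bounded (f ` U)) \<and> (\<forall>x\<in>U. f differentiable (at x)) \<and>
     (\<forall>v. diff_order b n U (dir_deriv v f))"

text \<open>Stands in for smoothness up to the boundary: bounds on all derivatives are what the
  estimates use, and they can be checked on the open set alone.\<close>

definition bsmooth_on :: "'a::real_normed_vector set \<Rightarrow> ('a \<Rightarrow> 'b::real_normed_vector) \<Rightarrow> bool" where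
  "bsmooth_on U f \<longleftrightarrow> smooth_on U f \<and> (\<forall>vs. bounded (iter_deriv vs f ` U))"

lemma diff_order_iff:
  "diff_order b n U f \<longleftrightarrow>
     (\<forall>vs. length vs < n \<longrightarrow> (\<forall>x\<in>U. iter_deriv vs f differentiable (at x))) \<and>
     (b \<longrightarrow> (\<forall>vs. length vs \<le> n \<longrightarrow> bounded (iter_deriv vs f ` U)))"
proof (induction n arbitrary: f)
  case (Suc n)
  \<comment> \<open>Nonempty lists are split at the last entry, to match the recursion of
    \<open>diff_order\<close>.\<close>
  have split: "(\<forall>vs. length vs < Suc m \<longrightarrow> P vs) \<longleftrightarrow>
      P [] \<and> (\<forall>v vs. length vs < m \<longrightarrow> P (vs @ [v]))" for m and P :: "'a list \<Rightarrow> bool"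
    by (metis Suc_less_eq length_append_singleton list.size(3) rev_exhaust zero_less_Suc)
  show ?case
    unfolding diff_order.simps Suc split less_Suc_eq_le[symmetric] iter_deriv_snoc by auto
qed auto

lemma smooth_on_iff: "smooth_on U f \<longleftrightarrow> (\<forall>n. diff_order False n U f)"
  unfolding smooth_on_def diff_order_iff by auto

lemma bsmooth_on_iff: "bsmooth_on U f \<longleftrightarrow> (\<forall>n. diff_order True n U f)"
  unfolding bsmooth_on_def smooth_on_def diff_order_iff by auto

lemma diff_order_SucD: "diff_order b (Suc n) U f \<Longrightarrow> diff_order b n U f"
  unfolding diff_order_iff by auto

lemma diff_order_cong:
  assumes "open U" "\<And>y. y \<in> U \<Longrightarrow> f y = g y"
  shows "diff_order b n U f \<longleftrightarrow> diff_order b n U g"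
proof -
  have "bounded (iter_deriv vs f ` U) \<longleftrightarrow> bounded (iter_deriv vs g ` U)" for vs
    by (intro arg_cong[of _ _ bounded] image_cong refl iter_deriv_cong[OF assms])
  moreover have "iter_deriv vs f differentiable (at x) \<longleftrightarrow> iter_deriv vs g differentiable (at x)"
    if "x \<in> U" for vs x
    using iter_deriv_cong[OF assms, where vs = vs]
    by (intro iffI) (erule differentiable_cong[OF assms(1) that, rotated], simp)+
  ultimately show ?thesis
    unfolding diff_order_iff by auto
qed

section \<open>Closure of finite-order differentiability under algebra and composition\<close>

lemma diff_order_const: "open U \<Longrightarrow> diff_order b n U (\<lambda>_. c)"
proof (induction n arbitrary: c)
  case 0
  then show ?case by (auto simp: bounded_iff)
next
  case (Suc n)
  have "dir_deriv v (\<lambda>_. c) = (\<lambda>_. 0)" for v :: 'a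
    by (intro ext dir_deriv_eqI[where f' = "\<lambda>_. 0"]) simp
  then show ?case
    using Suc by (auto simp: bounded_iff)
qed

lemma diff_order_add:
  assumes "open U" "diff_order b n U f" "diff_order b n U g"
  shows "diff_order b n U (\<lambda>x. f x + g x)"
  using assms(2,3)
proof (induction n arbitrary: f g)
  case 0
  then show ?case by (auto intro: bounded_plus_comp)
next
  case (Suc n)
  \<comment> \<open>The formula for the derivative is available on U only;
    \<open>diff_order_cong\<close> transfers it to the derivative as a globally defined function.
    The next closure lemmas do the same.\<close>
  have eq: "dir_deriv v (\<lambda>x. f x + g x) x = dir_deriv v f x + dir_deriv v g x" if "x \<in> U" for x v
    using Suc.prems that
    by (intro dir_deriv_eqI[where f' = "\<lambda>v. dir_deriv v f x + dir_deriv v g x"])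
       (auto intro!: derivative_intros has_derivative_dir_deriv)
  show ?case
    unfolding diff_order.simps(2)
  proof (intro conjI allI)
    fix v
    show "diff_order b n U (dir_deriv v (\<lambda>x. f x + g x))"
      using Suc by (subst diff_order_cong[OF assms(1) eq]) auto
  qed (use Suc.prems in \<open>auto intro: bounded_plus_comp\<close>)
qed

lemma diff_order_linear:
  fixes L :: "'b::real_normed_vector \<Rightarrow> 'c::real_normed_vector"
  assumes "open U" "bounded_linear L" "diff_order b n U f"
  shows "diff_order b n U (\<lambda>x. L (f x))"
  using assms(3)
proof (induction n arbitrary: f)
  case 0
  then show ?case using bounded_linear_image[OF _ assms(2), of "f ` U"] by (auto simp: image_image)
next
  case (Suc n)
  have D: "((\<lambda>x. L (f x)) has_derivative (\<lambda>v. L (dir_deriv v f x))) (at x)" if "x \<in> U" for x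
    using Suc.prems that by (intro bounded_linear.has_derivative[OF assms(2)] has_derivative_dir_deriv) auto
  have eq: "dir_deriv v (\<lambda>x. L (f x)) x = L (dir_deriv v f x)" if "x \<in> U" for x v
    by (rule dir_deriv_eqI[OF D[OF that]])
  show ?case
    unfolding diff_order.simps(2)
  proof (intro conjI allI)
    fix v
    show "diff_order b n U (dir_deriv v (\<lambda>x. L (f x)))"
      using Suc by (subst diff_order_cong[OF assms(1) eq]) auto
    show "b \<longrightarrow> bounded ((\<lambda>x. L (f x)) ` U)"
      using Suc.prems bounded_linear_image[OF _ assms(2), of "f ` U"] by (auto simp: image_image)
    show "\<forall>x\<in>U. (\<lambda>x. L (f x)) differentiable (at x)"
      using D differentiable_def by blast
  qed
qed

lemma bounded_mult_image:
  fixes f g :: "'a \<Rightarrow> 'b::real_normed_algebra"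
  assumes "bounded (f ` U)" "bounded (g ` U)"
  shows "bounded ((\<lambda>x. f x * g x) ` U)"
proof -
  obtain B C where B: "\<And>x. x \<in> U \<Longrightarrow> norm (f x) \<le> B" and C: "\<And>x. x \<in> U \<Longrightarrow> norm (g x) \<le> C"
    using assms unfolding bounded_iff by auto
  have "norm (f x * g x) \<le> B * C" if "x \<in> U" for x
    using mult_mono[OF B[OF that] C[OF that]] norm_mult_ineq[of "f x" "g x"]
      order_trans[OF norm_ge_zero B[OF that]] by auto
  then show ?thesis unfolding bounded_iff by blast
qed

lemma diff_order_mult:
  fixes f g :: "'a::real_normed_vector \<Rightarrow> 'b::real_normed_algebra"
  assumes "open U" "diff_order b n U f" "diff_order b n U g"
  shows "diff_order b n U (\<lambda>x. f x * g x)"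
  using assms(2,3)
proof (induction n arbitrary: f g)
  case 0
  then show ?case by (auto intro: bounded_mult_image)
next
  case (Suc n)
  have D: "((\<lambda>x. f x * g x) has_derivative (\<lambda>v. f x * dir_deriv v g x + dir_deriv v f x * g x)) (at x)"
    if "x \<in> U" for x
    using Suc.prems that by (auto intro!: has_derivative_mult has_derivative_dir_deriv)
  have eq: "dir_deriv v (\<lambda>x. f x * g x) x = f x * dir_deriv v g x + dir_deriv v f x * g x"
    if "x \<in> U" for x v
    by (rule dir_deriv_eqI[OF D[OF that]])
  show ?case
    unfolding diff_order.simps(2)
  proof (intro conjI allI)
    fix v
    have "diff_order b n U f" "diff_order b n U g"
      using Suc.prems diff_order_SucD by blast+
    then show "diff_order b n U (dir_deriv v (\<lambda>x. f x * g x))"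
      using Suc by (subst diff_order_cong[OF assms(1) eq]) (auto intro!: diff_order_add assms(1))
    show "\<forall>x\<in>U. (\<lambda>x. f x * g x) differentiable (at x)"
      using D differentiable_def by blast
  qed (use Suc.prems in \<open>auto intro: bounded_mult_image\<close>)
qed

text \<open>Generalised over h, because the chain rule turns h into its derivative
  \<open>dir_deriv 1 h\<close>, to which the induction hypothesis applies at one order less.\<close>

lemma diff_order_compose:
  fixes h :: "real \<Rightarrow> real"
  assumes "open U" "diff_order b n U f" "diff_order b n UNIV h"
  shows "diff_order b n U (\<lambda>x. h (f x))"
  using assms(2,3)
proof (induction n arbitrary: h)
  case 0
  then show ?case by (auto intro: bounded_subset)
next
  case (Suc n)
  have D: "((\<lambda>x. h (f x)) has_derivative (\<lambda>v. dir_deriv 1 h (f x) * dir_deriv v f x)) (at x)"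
    if "x \<in> U" for x
  proof -
    have f: "(f has_derivative (\<lambda>v. dir_deriv v f x)) (at x)"
      using Suc.prems that by (auto intro!: has_derivative_dir_deriv)
    have h: "(h has_derivative (\<lambda>v. dir_deriv v h (f x))) (at (f x))"
      using Suc.prems by (auto intro!: has_derivative_dir_deriv)
    have "((\<lambda>x. h (f x)) has_derivative (\<lambda>v. dir_deriv (dir_deriv v f x) h (f x))) (at x)"
      by (rule has_derivative_compose[OF f h])
    moreover have "(\<lambda>v. dir_deriv (dir_deriv v f x) h (f x)) = (\<lambda>v. dir_deriv 1 h (f x) * dir_deriv v f x)"
    proof
      fix v
      show "dir_deriv (dir_deriv v f x) h (f x) = dir_deriv 1 h (f x) * dir_deriv v f x"
        using linear_scale[OF has_derivative_linear[OF h], of "dir_deriv v f x" 1] by (simp add: mult.commute)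
    qed
    ultimately show ?thesis by simp
  qed
  have eq: "dir_deriv v (\<lambda>x. h (f x)) x = dir_deriv 1 h (f x) * dir_deriv v f x"
    if "x \<in> U" for x v
    by (rule dir_deriv_eqI[OF D[OF that]])
  show ?case
    unfolding diff_order.simps(2)
  proof (intro conjI allI)
    fix v
    have "diff_order b n U f"
      using Suc.prems diff_order_SucD by blast
    then show "diff_order b n U (dir_deriv v (\<lambda>x. h (f x)))"
      using Suc by (subst diff_order_cong[OF assms(1) eq]) (auto intro!: diff_order_mult assms(1))
    show "\<forall>x\<in>U. (\<lambda>x. h (f x)) differentiable (at x)"
      using D differentiable_def by blast
  qed (use Suc.prems in \<open>auto intro: bounded_subset\<close>)
qed

text \<open>The derivative of 1/f contains 1/f itself, so the induction hypothesis at order n,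
  together with the product rule, gives order n + 1. With the flag \<open>b\<close> set, a bound on
  1/f has to be supplied.\<close>

lemma diff_order_inverse:
  fixes f :: "'a::real_normed_vector \<Rightarrow> 'b::real_normed_field"
  assumes "open U" "diff_order b n U f" "\<And>x. x \<in> U \<Longrightarrow> f x \<noteq> 0" "b \<longrightarrow> bounded ((\<lambda>x. inverse (f x)) ` U)"
  shows "diff_order b n U (\<lambda>x. inverse (f x))"
  using assms(2)
proof (induction n)
  case 0
  then show ?case using assms by auto
next
  case (Suc n)
  have D: "((\<lambda>x. inverse (f x)) has_derivative
      (\<lambda>v. - (inverse (f x) * dir_deriv v f x * inverse (f x)))) (at x)" if "x \<in> U" for x
    using Suc.prems that assms(3) by (auto intro!: derivative_intros has_derivative_dir_deriv)
  have eq: "dir_deriv v (\<lambda>x. inverse (f x)) x = - (inverse (f x) * dir_deriv v f x * inverse (f x))"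
    if "x \<in> U" for x v
    by (rule dir_deriv_eqI[OF D[OF that]])
  show ?case
    unfolding diff_order.simps(2)
  proof (intro conjI allI)
    fix v
    have "diff_order b n U (\<lambda>x. inverse (f x))"
      using Suc diff_order_SucD by blast
    then have "diff_order b n U (\<lambda>x. inverse (f x) * dir_deriv v f x * inverse (f x))"
      using Suc.prems by (auto intro!: diff_order_mult assms(1))
    then show "diff_order b n U (dir_deriv v (\<lambda>x. inverse (f x)))"
      by (subst diff_order_cong[OF assms(1) eq])
        (auto intro: diff_order_linear[OF assms(1) bounded_linear_minus[OF bounded_linear_ident]])
    show "\<forall>x\<in>U. (\<lambda>x. inverse (f x)) differentiable (at x)"
      using D differentiable_def by blast
  qed (use assms in auto)
qed

lemma bounded_linear_diff_order:
  assumes "bounded_linear L" "open U" "b \<longrightarrow> bounded U"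
  shows "diff_order b n U L"
proof -
  have bd: "b \<longrightarrow> bounded (L ` U)"
    using bounded_linear_image assms by blast
  have "dir_deriv v L = (\<lambda>_. L v)" for v
    using dir_deriv_eqI[OF bounded_linear_imp_has_derivative[OF assms(1)]] by auto
  then show ?thesis
    using bd diff_order_const[OF assms(2)] bounded_linear_imp_differentiable[OF assms(1)]
    by (cases n) auto
qed

section \<open>Calculus rules for smooth functions\<close>

lemma smooth_on_const: "open U \<Longrightarrow> smooth_on U (\<lambda>_. c)"
  unfolding smooth_on_iff by (auto intro: diff_order_const)

lemma smooth_on_add: "open U \<Longrightarrow> smooth_on U f \<Longrightarrow> smooth_on U g \<Longrightarrow> smooth_on U (\<lambda>x. f x + g x)"
  unfolding smooth_on_iff by (auto intro: diff_order_add)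

lemma smooth_on_linear:
  "open U \<Longrightarrow> bounded_linear L \<Longrightarrow> smooth_on U f \<Longrightarrow> smooth_on U (\<lambda>x. L (f x))"
  unfolding smooth_on_iff by (auto intro: diff_order_linear)

lemma smooth_on_mult:
  fixes f g :: "'a::real_normed_vector \<Rightarrow> 'b::real_normed_algebra"
  shows "open U \<Longrightarrow> smooth_on U f \<Longrightarrow> smooth_on U g \<Longrightarrow> smooth_on U (\<lambda>x. f x * g x)"
  unfolding smooth_on_iff by (auto intro: diff_order_mult)

lemma smooth_on_compose:
  fixes h :: "real \<Rightarrow> real"
  shows "open U \<Longrightarrow> smooth_on U f \<Longrightarrow> smooth_on UNIV h \<Longrightarrow> smooth_on U (\<lambda>x. h (f x))"
  unfolding smooth_on_iff by (auto intro: diff_order_compose)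

lemma smooth_on_inverse:
  fixes f :: "'a::real_normed_vector \<Rightarrow> 'b::real_normed_field"
  shows "open U \<Longrightarrow> smooth_on U f \<Longrightarrow> (\<And>x. x \<in> U \<Longrightarrow> f x \<noteq> 0) \<Longrightarrow> smooth_on U (\<lambda>x. inverse (f x))"
  unfolding smooth_on_iff by (auto intro: diff_order_inverse)

lemma smooth_on_bounded_linear: "open U \<Longrightarrow> bounded_linear L \<Longrightarrow> smooth_on U L"
  unfolding smooth_on_iff by (auto intro: bounded_linear_diff_order)

lemma smooth_on_of_real:
  "open U \<Longrightarrow> smooth_on U f \<Longrightarrow> smooth_on U (\<lambda>x. of_real (f x) :: 'b::{real_normed_algebra_1})"
  using smooth_on_linear[OF _ bounded_linear_of_real] .

lemma smooth_on_cnj: "open U \<Longrightarrow> smooth_on U f \<Longrightarrow> smooth_on U (\<lambda>x. cnj (f x))"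
  using smooth_on_linear[OF _ bounded_linear_cnj] .

lemma smooth_on_uminus: "open U \<Longrightarrow> smooth_on U f \<Longrightarrow> smooth_on U (\<lambda>x. - f x)"
  using smooth_on_linear[OF _ bounded_linear_minus[OF bounded_linear_ident]] .

lemma smooth_on_diff: "open U \<Longrightarrow> smooth_on U f \<Longrightarrow> smooth_on U g \<Longrightarrow> smooth_on U (\<lambda>x. f x - g x)"
  using smooth_on_add[OF _ _ smooth_on_uminus, of U f g] by simp

lemma smooth_on_cong: "open U \<Longrightarrow> (\<And>y. y \<in> U \<Longrightarrow> f y = g y) \<Longrightarrow> smooth_on U f \<longleftrightarrow> smooth_on U g"
  unfolding smooth_on_iff by (metis diff_order_cong)

lemma smooth_on_subset: "smooth_on U f \<Longrightarrow> V \<subseteq> U \<Longrightarrow> smooth_on V f"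
  unfolding smooth_on_def by auto

lemma smooth_on_Un: "smooth_on U f \<Longrightarrow> smooth_on V f \<Longrightarrow> smooth_on (U \<union> V) f"
  unfolding smooth_on_def by auto

lemma smooth_on_iter_deriv: "smooth_on U f \<Longrightarrow> smooth_on U (iter_deriv vs f)"
proof (induction vs)
  case (Cons v vs)
  then show ?case
    unfolding smooth_on_def by (metis iter_deriv_Cons iter_deriv_snoc)
qed auto

lemma smooth_on_dir_deriv: "smooth_on U f \<Longrightarrow> smooth_on U (dir_deriv v f)"
  using smooth_on_iter_deriv[of U f "[v]"] by (simp add: dir_deriv_def)

lemma smooth_on_differentiable: "smooth_on U f \<Longrightarrow> x \<in> U \<Longrightarrow> f differentiable (at x)"
  unfolding smooth_on_def by (metis iter_deriv.simps(1))

lemma smooth_on_has_derivative: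
  "smooth_on U f \<Longrightarrow> x \<in> U \<Longrightarrow> (f has_derivative (\<lambda>v. dir_deriv v f x)) (at x)"
  by (intro has_derivative_dir_deriv smooth_on_differentiable)

lemma smooth_on_imp_continuous_on: "smooth_on U f \<Longrightarrow> continuous_on U f"
  by (meson continuous_at_imp_continuous_on differentiable_imp_continuous_within smooth_on_differentiable)

lemma smooth_on_dir_deriv_add:
  "smooth_on U f \<Longrightarrow> smooth_on U g \<Longrightarrow> x \<in> U \<Longrightarrow>
    dir_deriv v (\<lambda>x. f x + g x) x = dir_deriv v f x + dir_deriv v g x"
  by (rule dir_deriv_eqI) (intro derivative_intros smooth_on_has_derivative)

lemma smooth_on_dir_deriv_mult:
  fixes f g :: "'a::real_normed_vector \<Rightarrow> 'b::real_normed_algebra"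
  shows "smooth_on U f \<Longrightarrow> smooth_on U g \<Longrightarrow> x \<in> U \<Longrightarrow>
    dir_deriv v (\<lambda>x. f x * g x) x = f x * dir_deriv v g x + dir_deriv v f x * g x"
  by (rule dir_deriv_eqI[where f' = "\<lambda>v. f x * dir_deriv v g x + dir_deriv v f x * g x"])
     (intro has_derivative_mult smooth_on_has_derivative)

lemma smooth_on_dir_deriv_linear:
  "bounded_linear L \<Longrightarrow> smooth_on U f \<Longrightarrow> x \<in> U \<Longrightarrow> dir_deriv v (\<lambda>x. L (f x)) x = L (dir_deriv v f x)"
  by (rule dir_deriv_eqI[where f' = "\<lambda>v. L (dir_deriv v f x)"])
     (intro bounded_linear.has_derivative[of L] smooth_on_has_derivative)

lemma iter_deriv_linear:
  assumes "bounded_linear L" "smooth_on U f" "open U" "x \<in> U"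
  shows "iter_deriv vs (\<lambda>x. L (f x)) x = L (iter_deriv vs f x)"
  using assms(4)
proof (induction vs arbitrary: x)
  case (Cons v vs)
  have "dir_deriv v (iter_deriv vs (\<lambda>x. L (f x))) x = dir_deriv v (\<lambda>x. L (iter_deriv vs f x)) x"
    by (rule dir_deriv_cong[OF assms(3) Cons.prems Cons.IH])
  also have "\<dots> = L (dir_deriv v (iter_deriv vs f) x)"
    by (rule smooth_on_dir_deriv_linear[OF assms(1) smooth_on_iter_deriv[OF assms(2)] Cons.prems])
  finally show ?case
    unfolding iter_deriv_Cons .
qed auto

lemma iter_deriv_add:
  assumes "smooth_on U f" "smooth_on U g" "open U" "x \<in> U"
  shows "iter_deriv vs (\<lambda>x. f x + g x) x = iter_deriv vs f x + iter_deriv vs g x"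
  using assms(4)
proof (induction vs arbitrary: x)
  case (Cons v vs)
  have "dir_deriv v (iter_deriv vs (\<lambda>x. f x + g x)) x = dir_deriv v (\<lambda>x. iter_deriv vs f x + iter_deriv vs g x) x"
    by (rule dir_deriv_cong[OF assms(3) Cons.prems Cons.IH])
  also have "\<dots> = dir_deriv v (iter_deriv vs f) x + dir_deriv v (iter_deriv vs g) x"
    by (rule smooth_on_dir_deriv_add[OF smooth_on_iter_deriv[OF assms(1)] smooth_on_iter_deriv[OF assms(2)] Cons.prems])
  finally show ?case
    unfolding iter_deriv_Cons .
qed auto

lemma iter_deriv_0: "iter_deriv vs (\<lambda>_. 0) = (\<lambda>_. 0)"
proof (induction vs)
  case (Cons v vs)
  have "dir_deriv v (\<lambda>_::'a. 0::'b) = (\<lambda>_. 0)"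
    by (intro ext dir_deriv_eqI[where f' = "\<lambda>_. 0"]) simp
  then show ?case unfolding iter_deriv_Cons Cons .
qed auto

text \<open>Each derivative brings down one factor c; with c = 1/r this is the source of the powers
  of r in the kernel bounds.\<close>

lemma iter_deriv_affine:
  fixes f :: "'a::real_normed_vector \<Rightarrow> 'b::real_normed_vector"
  assumes "smooth_on UNIV f"
  shows "iter_deriv vs (\<lambda>x. f (c *\<^sub>R x + a)) x = c ^ length vs *\<^sub>R iter_deriv vs f (c *\<^sub>R x + a)"
proof (induction vs arbitrary: x)
  case (Cons v vs)
  have "((\<lambda>x. iter_deriv vs f (c *\<^sub>R x + a)) has_derivative
      (\<lambda>v. dir_deriv (c *\<^sub>R v) (iter_deriv vs f) (c *\<^sub>R x + a))) (at x)"
    by (rule has_derivative_compose[OF _ smooth_on_has_derivative[OF smooth_on_iter_deriv[OF assms]]])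
       (auto intro!: derivative_eq_intros)
  then have "((\<lambda>x. c ^ length vs *\<^sub>R iter_deriv vs f (c *\<^sub>R x + a)) has_derivative
      (\<lambda>v. c ^ length vs *\<^sub>R dir_deriv (c *\<^sub>R v) (iter_deriv vs f) (c *\<^sub>R x + a))) (at x)"
    by (rule has_derivative_scaleR_right)
  then have "dir_deriv v (\<lambda>x. c ^ length vs *\<^sub>R iter_deriv vs f (c *\<^sub>R x + a)) x =
      c ^ length vs *\<^sub>R dir_deriv (c *\<^sub>R v) (iter_deriv vs f) (c *\<^sub>R x + a)"
    by (rule dir_deriv_eqI)
  moreover have "dir_deriv (c *\<^sub>R v) (iter_deriv vs f) y = c *\<^sub>R dir_deriv v (iter_deriv vs f) y" for y
    using linear_scale[OF has_derivative_linear[OF smooth_on_has_derivative[OF smooth_on_iter_deriv[OF assms]]]]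
    by blast
  ultimately show ?case
    unfolding iter_deriv_Cons Cons[abs_def] by (simp only: length_Cons power_Suc2 scaleR_scaleR)
qed auto

lemma smooth_on_affine:
  fixes f :: "'a::real_normed_vector \<Rightarrow> 'b::real_normed_vector"
  assumes "smooth_on UNIV f"
  shows "smooth_on UNIV (\<lambda>x. f (c *\<^sub>R x + a))"
  unfolding smooth_on_def
proof (intro allI ballI)
  fix vs x
  have "((\<lambda>x. c *\<^sub>R x + a) has_derivative (\<lambda>x. c *\<^sub>R x)) (at x)"
    by (auto intro!: derivative_eq_intros)
  note D = has_derivative_compose[OF this smooth_on_has_derivative[OF smooth_on_iter_deriv[OF assms] UNIV_I]]
  have "(\<lambda>x. c ^ length vs *\<^sub>R iter_deriv vs f (c *\<^sub>R x + a)) differentiable (at x)"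
    by (rule differentiableI[OF has_derivative_scaleR_right[OF D]])
  then show "iter_deriv vs (\<lambda>x. f (c *\<^sub>R x + a)) differentiable (at x)"
    unfolding iter_deriv_affine[OF assms, abs_def] .
qed

section \<open>Functions with all derivatives bounded\<close>

lemma bsmooth_on_compactI:
  assumes "smooth_on V f" "compact K" "U \<subseteq> K" "K \<subseteq> V"
  shows "bsmooth_on U f"
  unfolding bsmooth_on_def
proof (intro conjI allI)
  show "smooth_on U f" by (rule smooth_on_subset[OF assms(1) subset_trans[OF assms(3,4)]])
  fix vs
  have "continuous_on K (iter_deriv vs f)"
    by (rule continuous_on_subset[OF smooth_on_imp_continuous_on[OF smooth_on_iter_deriv[OF assms(1)]] assms(4)])
  then have "bounded (iter_deriv vs f ` K)"
    by (intro compact_imp_bounded compact_continuous_image assms(2))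
  then show "bounded (iter_deriv vs f ` U)"
    by (rule bounded_subset) (rule image_mono[OF assms(3)])
qed

lemma bsmooth_on_smooth_on: "bsmooth_on U f \<Longrightarrow> smooth_on U f"
  unfolding bsmooth_on_def by auto

lemma bsmooth_on_bounded: "bsmooth_on U f \<Longrightarrow> bounded (iter_deriv vs f ` U)"
  unfolding bsmooth_on_def by auto

lemma bsmooth_on_subset: "bsmooth_on U f \<Longrightarrow> V \<subseteq> U \<Longrightarrow> bsmooth_on V f"
  unfolding bsmooth_on_def by (blast intro: smooth_on_subset bounded_subset[OF _ image_mono])

lemma bsmooth_on_Un: "bsmooth_on U f \<Longrightarrow> bsmooth_on V f \<Longrightarrow> bsmooth_on (U \<union> V) f"
  unfolding bsmooth_on_def by (simp add: image_Un smooth_on_Un)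

lemma bsmooth_on_const: "open U \<Longrightarrow> bsmooth_on U (\<lambda>_. c)"
  unfolding bsmooth_on_iff by (auto intro: diff_order_const)

lemma bsmooth_on_add: "open U \<Longrightarrow> bsmooth_on U f \<Longrightarrow> bsmooth_on U g \<Longrightarrow> bsmooth_on U (\<lambda>x. f x + g x)"
  unfolding bsmooth_on_iff by (auto intro: diff_order_add)

lemma bsmooth_on_mult:
  fixes f g :: "'a::real_normed_vector \<Rightarrow> 'b::real_normed_algebra"
  shows "open U \<Longrightarrow> bsmooth_on U f \<Longrightarrow> bsmooth_on U g \<Longrightarrow> bsmooth_on U (\<lambda>x. f x * g x)"
  unfolding bsmooth_on_iff by (auto intro: diff_order_mult)

lemma bsmooth_on_cong: "open U \<Longrightarrow> (\<And>y. y \<in> U \<Longrightarrow> f y = g y) \<Longrightarrow> bsmooth_on U f \<longleftrightarrow> bsmooth_on U g"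
  unfolding bsmooth_on_iff by (metis diff_order_cong)

lemma bsmooth_on_dir_deriv: "bsmooth_on U f \<Longrightarrow> bsmooth_on U (dir_deriv v f)"
  unfolding bsmooth_on_def using smooth_on_dir_deriv by (auto simp: iter_deriv_snoc[symmetric])

section \<open>Bump functions\<close>

text \<open>The polynomial factor makes the family closed under differentiation, so that smoothness
  of exp (-1/t), extended by 0, becomes an induction over all \<open>P\<close> at once.\<close>

definition flat_exp :: "real poly \<Rightarrow> real \<Rightarrow> real" where
  "flat_exp P t = (if t > 0 then poly P (1 / t) * exp (- (1 / t)) else 0)"

lemma poly_times_exp_tendsto_0: "((\<lambda>x::real. poly P x * exp (- x)) \<longlongrightarrow> 0) at_top"
proof -
  have "((\<lambda>x. \<Sum>i\<le>degree P. coeff P i * (x ^ i / exp x)) \<longlongrightarrow> (\<Sum>i\<le>degree P. coeff P i * 0)) at_top"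
    by (intro tendsto_sum tendsto_mult tendsto_const tendsto_power_div_exp_0)
  moreover have "(\<Sum>i\<le>degree P. coeff P i * (x ^ i / exp x)) = poly P x * exp (- x)" for x
    by (simp add: poly_altdef exp_minus divide_inverse sum_distrib_right mult.assoc)
  ultimately show ?thesis by simp
qed

lemma flat_exp_tendsto_0: "(flat_exp P \<longlongrightarrow> 0) (at 0)"
proof -
  have "((\<lambda>t. poly P (1 / t) * exp (- (1 / t))) \<longlongrightarrow> 0) (at_right 0)"
    using filterlim_compose[OF poly_times_exp_tendsto_0[of P] filterlim_inverse_at_top_right]
    by (simp add: inverse_eq_divide)
  then have "(flat_exp P \<longlongrightarrow> 0) (at_right 0)"
    by (rule Lim_transform_eventually)
       (auto simp: flat_exp_def eventually_at_filter)
  moreover have "(flat_exp P \<longlongrightarrow> 0) (at_left 0)"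
    by (rule Lim_transform_eventually[OF tendsto_const])
       (auto simp: flat_exp_def eventually_at_filter)
  ultimately show ?thesis
    using filterlim_split_at by blast
qed

text \<open>With s = 1/t one has d/dt = - s^2 d/ds, and applying this to P(s) exp (-s) gives s^2 (P
  - P') exp (-s).\<close>

lemma DERIV_flat_exp:
  "(flat_exp P has_real_derivative flat_exp ([:0, 0, 1:] * (P - pderiv P)) t) (at t)"
proof (cases t "0 :: real" rule: linorder_cases)
  case less
  have "((\<lambda>_. 0) has_real_derivative 0) (at t)" by simp
  then have "(flat_exp P has_real_derivative 0) (at t)"
    by (rule has_field_derivative_transform_within_open[where S = "{..<0}"])
       (use less in \<open>auto simp: flat_exp_def\<close>)
  then show ?thesis using less by (simp add: flat_exp_def)
next
  case equal
  have "((\<lambda>h. (flat_exp P (0 + h) - flat_exp P 0) / h) \<longlongrightarrow> 0) (at 0)"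
    \<comment> \<open>The difference quotient at 0 multiplies by 1/h, so it is again a
      \<open>flat_exp\<close>, with polynomial x P.\<close>
    by (rule Lim_transform_eventually[OF flat_exp_tendsto_0[of "[:0, 1:] * P"]])
       (auto simp: flat_exp_def eventually_at_filter)
  then show ?thesis using equal by (simp add: DERIV_def flat_exp_def)
next
  case greater
  have "((\<lambda>t. poly P (1 / t) * exp (- (1 / t))) has_real_derivative
      flat_exp ([:0, 0, 1:] * (P - pderiv P)) t) (at t)"
    using greater
    by (auto intro!: derivative_eq_intros poly_DERIV[THEN DERIV_chain2]
        simp: flat_exp_def field_simps power2_eq_square)
  then show ?thesis
    by (rule has_field_derivative_transform_within_open[where S = "{0<..}"])
       (use greater in \<open>auto simp: flat_exp_def\<close>)
qed

lemma smooth_on_flat_exp: "smooth_on UNIV (flat_exp P)"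
  unfolding smooth_on_iff
proof
  fix n
  show "diff_order False n UNIV (flat_exp P)"
  proof (induction n arbitrary: P)
    case (Suc n)
    have D: "(flat_exp P has_derivative (\<lambda>v. flat_exp ([:0, 0, 1:] * (P - pderiv P)) t * v)) (at t)" for t
      using DERIV_flat_exp[of P t] unfolding has_field_derivative_def .
    have "dir_deriv v (flat_exp P) = (\<lambda>t. flat_exp ([:0, 0, 1:] * (P - pderiv P)) t * v)" for v
      by (intro ext dir_deriv_eqI[OF D])
    moreover have "flat_exp P differentiable (at t)" for t
      using D differentiable_def by blast
    ultimately show ?case
      using Suc by (auto intro!: diff_order_mult diff_order_const simp del: mult_pCons_left)
  qed simp
qed

text \<open>Runs from 0 for t \<le> 1 to 1 for t \<ge> 2. The denominator is positive everywhere,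
  because t > 1 or t < 2 always holds.\<close>

definition smooth_step :: "real \<Rightarrow> real" where
  "smooth_step t = flat_exp 1 (t - 1) * inverse (flat_exp 1 (t - 1) + flat_exp 1 (2 - t))"

lemma smooth_step_eq_0: "t \<le> 1 \<Longrightarrow> smooth_step t = 0"
  by (simp add: smooth_step_def flat_exp_def)

lemma smooth_step_eq_1: "t \<ge> 2 \<Longrightarrow> smooth_step t = 1"
  by (simp add: smooth_step_def flat_exp_def)

lemma smooth_step_ge_0: "0 \<le> smooth_step t"
  by (simp add: smooth_step_def flat_exp_def)

lemma smooth_step_le_1: "smooth_step t \<le> 1"
proof -
  have "a * inverse (a + b) \<le> 1" if "a \<ge> 0" "b \<ge> 0" for a b :: real
    using that by (cases "a + b = 0") (auto simp: field_simps)
  then show ?thesis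
    unfolding smooth_step_def by (simp add: flat_exp_def)
qed

lemma smooth_on_smooth_step: "smooth_on UNIV smooth_step"
proof -
  have 1: "smooth_on UNIV (\<lambda>t. flat_exp 1 (t - 1))"
    using smooth_on_affine[OF smooth_on_flat_exp, of 1 1 "-1"] by simp
  have 2: "smooth_on UNIV (\<lambda>t. flat_exp 1 (2 - t))"
    using smooth_on_affine[OF smooth_on_flat_exp, of 1 "-1" 2] by simp
  have "flat_exp 1 (t - 1) + flat_exp 1 (2 - t) \<noteq> 0" for t
  proof -
    have "flat_exp 1 (t - 1) \<ge> 0" "flat_exp 1 (2 - t) \<ge> 0"
      "flat_exp 1 (t - 1) > 0 \<or> flat_exp 1 (2 - t) > 0"
      by (auto simp: flat_exp_def)
    then show ?thesis by linarith
  qed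
  then show ?thesis
    unfolding smooth_step_def[abs_def]
    by (intro smooth_on_mult smooth_on_inverse smooth_on_add open_UNIV 1 2) auto
qed

lemma smooth_step_deriv_eq_0:
  assumes "t < 1 \<or> t > 2"
  shows "dir_deriv v smooth_step t = 0"
proof -
  have "dir_deriv v smooth_step t = dir_deriv v (\<lambda>_. smooth_step t) t"
    using assms
  proof
    assume "t < 1"
    then show ?thesis
      by (intro dir_deriv_cong[of "{..<1}"]) (auto simp: smooth_step_eq_0)
  next
    assume "t > 2"
    then show ?thesis
      by (intro dir_deriv_cong[of "{2<..}"]) (auto simp: smooth_step_eq_1)
  qed
  also have "\<dots> = 0"
    by (intro dir_deriv_eqI[where f' = "\<lambda>_. 0"]) simp
  finally show ?thesis .
qed

lemma smooth_step_deriv_bounded: obtains C where "C \<ge> 0" "\<And>t. \<bar>dir_deriv 1 smooth_step t\<bar> \<le> C"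
proof -
  have "continuous_on {1..2} (dir_deriv 1 smooth_step)"
    by (rule continuous_on_subset[OF smooth_on_imp_continuous_on[OF smooth_on_dir_deriv[OF smooth_on_smooth_step]]]) simp
  then have "bounded (dir_deriv 1 smooth_step ` {1..2})"
    by (intro compact_imp_bounded compact_continuous_image) simp_all
  then obtain C where C: "\<And>t. t \<in> {1..2} \<Longrightarrow> \<bar>dir_deriv 1 smooth_step t\<bar> \<le> C"
    unfolding bounded_iff by (auto simp del: atLeastAtMost_iff)
  have "\<bar>dir_deriv 1 smooth_step t\<bar> \<le> max C 0" for t
  proof (cases "t \<in> {1..2}")
    case True
    then show ?thesis using C[of t] by auto
  next
    case False
    then show ?thesis using smooth_step_deriv_eq_0[of t 1] by auto
  qed
  then show ?thesis using that[of "max C 0"] by auto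
qed

lemma smooth_on_norm_power2: "smooth_on UNIV (\<lambda>x::'a::real_inner. (norm x)\<^sup>2)"
  unfolding smooth_on_iff
proof
  fix n
  have D: "((\<lambda>x::'a. (norm x)\<^sup>2) has_derivative (\<lambda>v. 2 * inner v x)) (at x)" for x
    unfolding power2_norm_eq_inner
    by (auto intro!: derivative_eq_intros simp: inner_commute)
  have "dir_deriv v (\<lambda>x::'a. (norm x)\<^sup>2) = (\<lambda>x. 2 * inner v x)" for v
    by (intro ext dir_deriv_eqI[OF D])
  moreover have "diff_order False n UNIV (\<lambda>x::'a. 2 * inner v x)" for n v
    by (intro bounded_linear_diff_order bounded_linear_mult_right[THEN bounded_linear_compose] bounded_linear_inner_right) auto
  moreover have "(\<lambda>x::'a. (norm x)\<^sup>2) differentiable (at x)" for x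
    using D differentiable_def by blast
  ultimately show "diff_order False n UNIV (\<lambda>x::'a. (norm x)\<^sup>2)"
    by (cases n) auto
qed

text \<open>For 0 < a < b the argument of the step is 1 at distance a from p and 2 at distance b.
  Using the squared norm keeps the function smooth at p and makes it invariant under rotations about
  p.\<close>

definition bump :: "'a::real_inner \<Rightarrow> real \<Rightarrow> real \<Rightarrow> 'a \<Rightarrow> real" where
  "bump p a b x = 1 - smooth_step (1 + ((norm (x - p))\<^sup>2 - a\<^sup>2) / (b\<^sup>2 - a\<^sup>2))"

lemma smooth_on_bump: "smooth_on UNIV (bump p a b)"
proof -
  have 1: "smooth_on UNIV (\<lambda>x. (norm (x - p))\<^sup>2)"
    using smooth_on_affine[OF smooth_on_norm_power2, of 1 "- p"] by simp
  have "smooth_on UNIV (\<lambda>x. (norm (x - p))\<^sup>2 * (1 / (b\<^sup>2 - a\<^sup>2)) + (1 - a\<^sup>2 / (b\<^sup>2 - a\<^sup>2)))"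
    by (intro smooth_on_add smooth_on_mult smooth_on_const 1 open_UNIV)
  moreover have "(norm (x - p))\<^sup>2 * (1 / (b\<^sup>2 - a\<^sup>2)) + (1 - a\<^sup>2 / (b\<^sup>2 - a\<^sup>2)) =
      1 + ((norm (x - p))\<^sup>2 - a\<^sup>2) / (b\<^sup>2 - a\<^sup>2)" for x
    by (simp add: diff_divide_distrib)
  ultimately have "smooth_on UNIV (\<lambda>x. 1 + ((norm (x - p))\<^sup>2 - a\<^sup>2) / (b\<^sup>2 - a\<^sup>2))"
    by (simp only:)
  then show ?thesis
    unfolding bump_def[abs_def]
    by (intro smooth_on_diff smooth_on_const smooth_on_compose[OF _ _ smooth_on_smooth_step] open_UNIV)
qed

lemma bump_eq_1:
  assumes "0 < a" "a < b" "norm (x - p) \<le> a"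
  shows "bump p a b x = 1"
proof -
  have "(norm (x - p))\<^sup>2 \<le> a\<^sup>2" "a\<^sup>2 < b\<^sup>2"
    using assms by (auto intro: power_mono power_strict_mono)
  then show ?thesis
    unfolding bump_def by (subst smooth_step_eq_0) (auto simp: divide_nonpos_pos)
qed

lemma bump_eq_0:
  assumes "0 < a" "a < b" "b \<le> norm (x - p)"
  shows "bump p a b x = 0"
proof -
  have "b\<^sup>2 \<le> (norm (x - p))\<^sup>2" "a\<^sup>2 < b\<^sup>2"
    using assms by (auto intro: power_mono power_strict_mono)
  then show ?thesis
    unfolding bump_def by (subst smooth_step_eq_1) (auto simp: field_simps)
qed

lemma bump_ge_0: "0 \<le> bump p a b x"
  by (simp add: bump_def smooth_step_le_1)

lemma bump_le_1: "bump p a b x \<le> 1"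
  by (simp add: bump_def smooth_step_ge_0)

text \<open>A test function for the open box: it vanishes within distance 1/j of the faces, and at
  each interior point it equals 1 once j is large.\<close>

definition box_bump :: "real \<Rightarrow> 'a::euclidean_space \<Rightarrow> 'a \<Rightarrow> 'a \<Rightarrow> real" where
  "box_bump j a b x = (\<Prod>i\<in>Basis. smooth_step (j * (x \<bullet> i - a \<bullet> i)) * smooth_step (j * (b \<bullet> i - x \<bullet> i)))"

lemma smooth_on_prod:
  fixes f :: "'i \<Rightarrow> 'a::real_normed_vector \<Rightarrow> 'b::{real_normed_algebra,comm_ring_1}"
  assumes "open U" "finite I" "\<And>i. i \<in> I \<Longrightarrow> smooth_on U (f i)"
  shows "smooth_on U (\<lambda>x. \<Prod>i\<in>I. f i x)"
  using assms(2,3)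
proof (induction I)
  case empty
  then show ?case using smooth_on_const[OF assms(1)] by simp
next
  case (insert i I)
  then show ?case using smooth_on_mult[OF assms(1), of "f i" "\<lambda>x. \<Prod>i\<in>I. f i x"] by simp
qed

lemma smooth_on_box_bump: "smooth_on UNIV (box_bump j a b)"
proof -
  have lin: "smooth_on UNIV (\<lambda>x::'a. x \<bullet> i)" for i
    by (intro smooth_on_bounded_linear bounded_linear_inner_left) simp
  have "smooth_on UNIV (\<lambda>x. smooth_step (j * (x \<bullet> i - a \<bullet> i)) * smooth_step (j * (b \<bullet> i - x \<bullet> i)))" for i
    by (intro smooth_on_mult smooth_on_compose[OF _ _ smooth_on_smooth_step] smooth_on_diff
        smooth_on_const lin open_UNIV)
  then show ?thesis
    unfolding box_bump_def[abs_def] by (intro smooth_on_prod open_UNIV finite_Basis)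
qed

lemma box_bump_ge_0: "0 \<le> box_bump j a b x"
  unfolding box_bump_def by (intro prod_nonneg) (simp add: smooth_step_ge_0)

lemma box_bump_le_1: "box_bump j a b x \<le> 1"
  unfolding box_bump_def
  by (intro prod_le_1) (simp add: smooth_step_ge_0 smooth_step_le_1 mult_le_one)

lemma box_bump_eq_0:
  assumes "0 < j" "x \<notin> cbox (a + (1 / j) *\<^sub>R One) (b - (1 / j) *\<^sub>R One)"
  shows "box_bump j a b x = 0"
proof -
  obtain i where i: "i \<in> Basis" "\<not> (a \<bullet> i + 1 / j \<le> x \<bullet> i \<and> x \<bullet> i \<le> b \<bullet> i - 1 / j)"
    using assms(2) by (auto simp: mem_box inner_add_left inner_diff_left)
  then have "smooth_step (j * (x \<bullet> i - a \<bullet> i)) * smooth_step (j * (b \<bullet> i - x \<bullet> i)) = 0"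
    using assms(1) by (auto simp: smooth_step_eq_0 field_simps)
  then show ?thesis
    unfolding box_bump_def using i(1) by (intro prod_zero) auto
qed

lemma shrunk_cbox_subset_box:
  assumes "e > 0"
  shows "cbox (a + e *\<^sub>R One) (b - e *\<^sub>R One) \<subseteq> box a b"
proof
  fix y assume y: "y \<in> cbox (a + e *\<^sub>R One) (b - e *\<^sub>R One)"
  show "y \<in> box a b"
    unfolding mem_box
  proof
    fix i :: 'a assume i: "i \<in> Basis"
    have "a \<bullet> i + e \<le> y \<bullet> i" "y \<bullet> i \<le> b \<bullet> i - e"
      using y i by (auto simp: mem_box inner_add_left inner_diff_left)
    then show "a \<bullet> i < y \<bullet> i \<and> y \<bullet> i < b \<bullet> i" using assms by linarith
  qed
qed

lemma box_bump_tendsto: "(\<lambda>n. box_bump (real (Suc n)) a b x) \<longlonglongrightarrow> indicator (box a b) x"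
proof (cases "x \<in> box a b")
  case True
  have "\<forall>\<^sub>F n in sequentially. \<forall>i\<in>Basis. 2 \<le> real (Suc n) * (x \<bullet> i - a \<bullet> i) \<and> 2 \<le> real (Suc n) * (b \<bullet> i - x \<bullet> i)"
  proof (intro eventually_ball_finite finite_Basis ballI eventually_conj)
    fix i :: 'a assume "i \<in> Basis"
    then have "x \<bullet> i - a \<bullet> i > 0" "b \<bullet> i - x \<bullet> i > 0"
      using True by (auto simp: mem_box)
    then have *: "\<exists>N. 2 \<le> real N * (x \<bullet> i - a \<bullet> i)" "\<exists>N. 2 \<le> real N * (b \<bullet> i - x \<bullet> i)"
      by (meson ex_less_of_nat_mult less_imp_le)+
    have **: "\<forall>\<^sub>F n in sequentially. 2 \<le> real (Suc n) * d" if ex: "\<exists>N. 2 \<le> real N * d" and "d > 0" for d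
    proof -
      obtain N where "2 \<le> real N * d" using ex ..
      then have "2 \<le> real (Suc n) * d" if "n \<ge> N" for n
        using that \<open>d > 0\<close> mult_right_mono[of "real N" "real (Suc n)" d] by linarith
      then show ?thesis by (auto simp: eventually_sequentially)
    qed
    show "\<forall>\<^sub>F n in sequentially. 2 \<le> real (Suc n) * (x \<bullet> i - a \<bullet> i)"
      "\<forall>\<^sub>F n in sequentially. 2 \<le> real (Suc n) * (b \<bullet> i - x \<bullet> i)"
      using ** * \<open>x \<bullet> i - a \<bullet> i > 0\<close> \<open>b \<bullet> i - x \<bullet> i > 0\<close> by auto
  qed
  then have "\<forall>\<^sub>F n in sequentially. 1 = box_bump (real (Suc n)) a b x"
    by (rule eventually_mono) (auto simp: box_bump_def smooth_step_eq_1 simp del: of_nat_Suc intro!: prod.neutral)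
  from Lim_transform_eventually[OF tendsto_const this] show ?thesis
    using True by (simp only: indicator_simps)
next
  case False
  then have "x \<notin> cbox (a + (1 / real (Suc n)) *\<^sub>R One) (b - (1 / real (Suc n)) *\<^sub>R One)" for n
    using shrunk_cbox_subset_box[of "1 / real (Suc n)" a b] by (auto simp del: of_nat_Suc)
  then have "box_bump (real (Suc n)) a b x = 0" for n
    by (intro box_bump_eq_0) auto
  then show ?thesis using False by simp
qed

section \<open>Integration\<close>

text \<open>Dominated convergence applied to difference quotients: the Lipschitz majorant
  \<open>B\<close> controls the quotients and, in the limit, the derivative.\<close>

lemma has_derivative_integral_dominated:
  fixes f :: "'h::euclidean_space \<Rightarrow> 'a \<Rightarrow> complex"
  assumes S: "open S" "p \<in> S"
    and int: "\<And>x. x \<in> S \<Longrightarrow> integrable M (f x)"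
    and der: "\<And>w. w \<in> space M \<Longrightarrow> ((\<lambda>x. f x w) has_derivative f' w) (at p)"
    and lip: "\<And>x w. x \<in> S \<Longrightarrow> w \<in> space M \<Longrightarrow> norm (f x w - f p w) \<le> B w * norm (x - p)"
    and B: "integrable M B"
  shows "((\<lambda>x. \<integral>w. f x w \<partial>M) has_derivative (\<lambda>h. \<integral>w. f' w h \<partial>M)) (at p)"
    and "integrable M (\<lambda>w. f' w h)"
proof -
  have shift: "\<exists>N. \<forall>n\<ge>N. p + X n \<in> S" if "X \<longlonglongrightarrow> 0" for X
  proof -
    have "(\<lambda>n. p + X n) \<longlonglongrightarrow> p" using tendsto_add[OF tendsto_const that, of p] by simp
    from topological_tendstoD[OF this S] show ?thesis
      by (simp add: eventually_sequentially)
  qed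
  have quot: "(\<lambda>n. (f (p + X n) w - f p w - f' w (X n)) /\<^sub>R norm (X n)) \<longlonglongrightarrow> 0"
    if "X \<longlonglongrightarrow> 0" "\<And>n. X n \<noteq> 0" "w \<in> space M" for X w
  proof -
    have "((\<lambda>h. (f (p + h) w - f p w - f' w h) /\<^sub>R norm h) \<longlongrightarrow> 0) (at 0)"
      using der[OF that(3)] unfolding has_derivative_at
      by (simp add: tendsto_norm_zero_iff[symmetric, of "\<lambda>h. _ h /\<^sub>R norm h"] divide_inverse mult.commute)
    then show ?thesis
      using that(1,2) unfolding tendsto_at_iff_sequentially by (auto simp: o_def)
  qed
  have f'0: "f' w 0 = 0" if "w \<in> space M" for w
    using has_derivative_linear[OF der[OF that]] linear_0 by blast
  \<comment> \<open>f' w h is a limit of quotients along 1/(n + N + 1), which hands both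
    measurability and the majorant over to it. The shift N keeps the evaluation points inside
    \<open>S\<close>.\<close>
  have dirquot: "(\<lambda>n. real (Suc (n + N)) *\<^sub>R (f (p + (1 / real (Suc (n + N))) *\<^sub>R h) w - f p w)) \<longlonglongrightarrow> f' w h"
    if w: "w \<in> space M" for w h N
  proof (cases "h = 0")
    case True
    then show ?thesis using f'0[OF w] by simp
  next
    case False
    let ?t = "\<lambda>n. 1 / real (Suc (n + N))"
    have t: "?t \<longlonglongrightarrow> 0"
      using LIMSEQ_ignore_initial_segment[OF lim_1_over_n[THEN LIMSEQ_Suc], of N] by simp
    have lin: "f' w (c *\<^sub>R h) = c *\<^sub>R f' w h" for c
      using has_derivative_linear[OF der[OF w]] linear_scale by blast
    have "(\<lambda>n. (f (p + ?t n *\<^sub>R h) w - f p w - f' w (?t n *\<^sub>R h)) /\<^sub>R norm (?t n *\<^sub>R h)) \<longlonglongrightarrow> 0"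
      using tendsto_scaleR[OF t tendsto_const, of h] False w by (intro quot) auto
    then have "(\<lambda>n. norm h *\<^sub>R ((f (p + ?t n *\<^sub>R h) w - f p w - f' w (?t n *\<^sub>R h)) /\<^sub>R norm (?t n *\<^sub>R h)) + f' w h)
        \<longlonglongrightarrow> norm h *\<^sub>R 0 + f' w h"
      by (intro tendsto_intros)
    moreover have "norm h *\<^sub>R ((f (p + ?t n *\<^sub>R h) w - f p w - f' w (?t n *\<^sub>R h)) /\<^sub>R norm (?t n *\<^sub>R h)) + f' w h
        = real (Suc (n + N)) *\<^sub>R (f (p + ?t n *\<^sub>R h) w - f p w)" for n
    proof -
      have "norm h *\<^sub>R ((f (p + ?t n *\<^sub>R h) w - f p w - f' w (?t n *\<^sub>R h)) /\<^sub>R norm (?t n *\<^sub>R h))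
          = real (Suc (n + N)) *\<^sub>R (f (p + ?t n *\<^sub>R h) w - f p w - f' w (?t n *\<^sub>R h))"
        using False by simp
      also have "\<dots> = real (Suc (n + N)) *\<^sub>R (f (p + ?t n *\<^sub>R h) w - f p w) - f' w h"
        unfolding lin by (simp add: scaleR_diff_right del: of_nat_Suc)
      finally show ?thesis by simp
    qed
    ultimately show ?thesis by simp
  qed
  have inS: "\<exists>N. \<forall>n. p + (1 / real (Suc (n + N))) *\<^sub>R h \<in> S" for h
  proof -
    have "(\<lambda>n. (1 / real (Suc n)) *\<^sub>R h) \<longlonglongrightarrow> 0"
      using tendsto_scaleR[OF lim_1_over_n[THEN LIMSEQ_Suc] tendsto_const, of h] by simp
    then show ?thesis using shift by (metis le_add2)
  qed
  have meas: "(\<lambda>w. f' w h) \<in> borel_measurable M" for h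
  proof -
    obtain N where N: "\<And>n. p + (1 / real (Suc (n + N))) *\<^sub>R h \<in> S" using inS by blast
    show ?thesis
    proof (rule borel_measurable_LIMSEQ_metric[OF _ dirquot[of _ N h]])
      fix n
      show "(\<lambda>w. real (Suc (n + N)) *\<^sub>R (f (p + (1 / real (Suc (n + N))) *\<^sub>R h) w - f p w)) \<in> borel_measurable M"
        using int[OF N] int[OF S(2)]
        by (intro borel_measurable_scaleR borel_measurable_diff borel_measurable_const) auto
    qed
  qed
  have bound: "norm (f' w h) \<le> B w * norm h" if w: "w \<in> space M" for w h
  proof -
    obtain N where N: "\<And>n. p + (1 / real (Suc (n + N))) *\<^sub>R h \<in> S" using inS by blast
    have "norm (real (Suc (n + N)) *\<^sub>R (f (p + (1 / real (Suc (n + N))) *\<^sub>R h) w - f p w)) \<le> B w * norm h" for n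
    proof -
      have "norm (real (Suc (n + N)) *\<^sub>R (f (p + (1 / real (Suc (n + N))) *\<^sub>R h) w - f p w))
          = real (Suc (n + N)) * norm (f (p + (1 / real (Suc (n + N))) *\<^sub>R h) w - f p w)"
        by (simp only: norm_scaleR abs_of_nat)
      also have "\<dots> \<le> real (Suc (n + N)) * (B w * norm (p + (1 / real (Suc (n + N))) *\<^sub>R h - p))"
        by (intro mult_left_mono lip N w) simp
      also have "\<dots> = B w * norm h" by (simp del: of_nat_Suc)
      finally show ?thesis .
    qed
    then show ?thesis
      using tendsto_upperbound[OF tendsto_norm[OF dirquot[OF w, of N h]]] by simp
  qed
  show int': "integrable M (\<lambda>w. f' w h)" for h
  proof (rule Bochner_Integration.integrable_bound)
    show "integrable M (\<lambda>w. B w * norm h)" using B by simp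
    show "AE w in M. norm (f' w h) \<le> norm (B w * norm h)"
      using bound by (intro AE_I2) (smt (verit) real_norm_def)
  qed (rule meas)
  show "((\<lambda>x. \<integral>w. f x w \<partial>M) has_derivative (\<lambda>h. \<integral>w. f' w h \<partial>M)) (at p)"
    unfolding has_derivative_at
  proof
    have lin: "linear (f' w)" if "w \<in> space M" for w
      using has_derivative_linear[OF der[OF that]] .
    have "linear (\<lambda>h. \<integral>w. f' w h \<partial>M)"
    proof
      fix h1 h2
      have "(\<integral>w. f' w (h1 + h2) \<partial>M) = (\<integral>w. f' w h1 + f' w h2 \<partial>M)"
        using linear_add[OF lin] by (intro Bochner_Integration.integral_cong) auto
      then show "(\<integral>w. f' w (h1 + h2) \<partial>M) = (\<integral>w. f' w h1 \<partial>M) + (\<integral>w. f' w h2 \<partial>M)"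
        using int' by simp
    next
      fix r h
      have "(\<integral>w. f' w (r *\<^sub>R h) \<partial>M) = (\<integral>w. r *\<^sub>R f' w h \<partial>M)"
        using linear_scale[OF lin] by (intro Bochner_Integration.integral_cong) auto
      then show "(\<integral>w. f' w (r *\<^sub>R h) \<partial>M) = r *\<^sub>R (\<integral>w. f' w h \<partial>M)" by simp
    qed
    then show "bounded_linear (\<lambda>h. \<integral>w. f' w h \<partial>M)"
      by (simp add: linear_conv_bounded_linear)
    show "(\<lambda>h. norm ((\<integral>w. f (p + h) w \<partial>M) - (\<integral>w. f p w \<partial>M) - (\<integral>w. f' w h \<partial>M)) / norm h) \<midarrow>0\<rightarrow> 0"
      unfolding tendsto_at_iff_sequentially o_def
    proof (intro allI impI)
      fix X :: "nat \<Rightarrow> 'h"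
      assume X: "\<forall>i. X i \<in> UNIV - {0}" "X \<longlonglongrightarrow> 0"
      obtain N where N: "\<And>n. n \<ge> N \<Longrightarrow> p + X n \<in> S" using shift[OF X(2)] by blast
      let ?Y = "\<lambda>n. X (n + N)"
      let ?s = "\<lambda>n w. (f (p + ?Y n) w - f p w - f' w (?Y n)) /\<^sub>R norm (?Y n)"
      have S': "p + ?Y n \<in> S" for n using N by simp
      have "(\<lambda>n. \<integral>w. ?s n w \<partial>M) \<longlonglongrightarrow> (\<integral>w. 0 \<partial>M)"
      proof (rule integral_dominated_convergence[where w = "\<lambda>w. 2 * B w"])
        show "?s n \<in> borel_measurable M" for n
          using int[OF S'] int[OF S(2)] meas
          by (intro borel_measurable_scaleR borel_measurable_diff borel_measurable_const) auto
        show "AE w in M. (\<lambda>n. ?s n w) \<longlonglongrightarrow> 0"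
          using X LIMSEQ_ignore_initial_segment[OF X(2), of N] by (intro AE_I2 quot) auto
        \<comment> \<open>One B w comes from the Lipschitz bound on f, the other from the bound on
          f' w.\<close>
        show "AE w in M. norm (?s n w) \<le> 2 * B w" for n
        proof (intro AE_I2)
          fix w assume w: "w \<in> space M"
          have l: "norm (f (p + ?Y n) w - f p w) \<le> B w * norm (?Y n)"
            using lip[OF S'[of n] w] by simp
          have "norm (f (p + ?Y n) w - f p w - f' w (?Y n)) \<le> 2 * B w * norm (?Y n)"
            using norm_triangle_ineq4[of "f (p + ?Y n) w - f p w" "f' w (?Y n)"] l bound[OF w, of "?Y n"]
            by linarith
          moreover have "norm (?Y n) > 0" using X(1) by auto
          ultimately have "norm (f (p + ?Y n) w - f p w - f' w (?Y n)) / norm (?Y n) \<le> 2 * B w"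
            by (simp only: pos_divide_le_eq)
          then show "norm (?s n w) \<le> 2 * B w"
            by (simp only: norm_scaleR abs_norm_cancel abs_inverse divide_inverse mult.commute)
        qed
      qed (use B in auto)
      moreover have "norm (\<integral>w. ?s n w \<partial>M) =
          norm ((\<integral>w. f (p + ?Y n) w \<partial>M) - (\<integral>w. f p w \<partial>M) - (\<integral>w. f' w (?Y n) \<partial>M)) / norm (?Y n)" for n
      proof -
        have "(\<integral>w. ?s n w \<partial>M) = ((\<integral>w. f (p + ?Y n) w \<partial>M) - (\<integral>w. f p w \<partial>M) - (\<integral>w. f' w (?Y n) \<partial>M)) /\<^sub>R norm (?Y n)"
          by (subst integral_scaleR_right, (subst Bochner_Integration.integral_diff,
              (intro Bochner_Integration.integrable_diff int S' S(2) int')+)+) (rule refl)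
        then show ?thesis
          by (simp only: norm_scaleR abs_norm_cancel abs_inverse divide_inverse mult.commute)
      qed
      ultimately have "(\<lambda>n. norm ((\<integral>w. f (p + ?Y n) w \<partial>M) - (\<integral>w. f p w \<partial>M) - (\<integral>w. f' w (?Y n) \<partial>M)) / norm (?Y n)) \<longlonglongrightarrow> 0"
        using tendsto_norm[of "\<lambda>n. \<integral>w. ?s n w \<partial>M" 0 sequentially] by simp
      then show "(\<lambda>n. norm ((\<integral>w. f (p + X n) w \<partial>M) - (\<integral>w. f p w \<partial>M) - (\<integral>w. f' w (X n) \<partial>M)) / norm (X n)) \<longlonglongrightarrow> 0"
        by (rule LIMSEQ_offset)
    qed
  qed
qed

text \<open>Each coordinate of v is at most norm v, so summing over the basis bounds the operator
  norm of the derivative. The crude factor DIM is harmless, since only the existence of a constant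
  matters.\<close>

lemma lipschitz_of_dir_derivs:
  fixes f :: "'a::euclidean_space \<Rightarrow> complex"
  assumes "convex S" "\<And>x. x \<in> S \<Longrightarrow> f differentiable (at x)"
    and "\<And>x i. x \<in> S \<Longrightarrow> i \<in> Basis \<Longrightarrow> norm (dir_deriv i f x) \<le> C"
    and "x \<in> S" "y \<in> S"
  shows "norm (f x - f y) \<le> C * DIM('a) * norm (x - y)"
proof -
  have "C \<ge> 0"
    using assms(3)[OF assms(4)] norm_ge_zero nonempty_Basis by (meson ex_in_conv order_trans)
  have D: "(f has_derivative (\<lambda>v. dir_deriv v f x)) (at x within S)" if "x \<in> S" for x
    using has_derivative_at_withinI[OF has_derivative_dir_deriv[OF assms(2)[OF that]]] .
  have "onorm (\<lambda>v. dir_deriv v f x) \<le> C * DIM('a)" if "x \<in> S" for x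
  proof (rule onorm_le)
    fix v
    have lin: "linear (\<lambda>v. dir_deriv v f x)" using has_derivative_linear[OF D[OF that]] .
    have "dir_deriv v f x = dir_deriv (\<Sum>i\<in>Basis. (v \<bullet> i) *\<^sub>R i) f x"
      by (simp add: euclidean_representation)
    also have "\<dots> = (\<Sum>i\<in>Basis. (v \<bullet> i) *\<^sub>R dir_deriv i f x)"
      by (simp add: linear_sum[OF lin] linear_scale[OF lin])
    also have "norm \<dots> \<le> (\<Sum>i\<in>(Basis::'a set). norm v * C)"
      using assms(3)[OF that] \<open>C \<ge> 0\<close>
      by (intro order_trans[OF norm_sum] sum_mono) (auto intro!: mult_mono Basis_le_norm)
    finally show "norm (dir_deriv v f x) \<le> C * DIM('a) * norm v" by (simp add: mult.commute mult.left_commute)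
  qed
  then show ?thesis
    using differentiable_bound[OF assms(1) D _ assms(4,5)] by (simp add: norm_minus_commute)
qed

section \<open>Functions with compact support\<close>

lemma compact_support_bounded:
  fixes f :: "'a::euclidean_space \<Rightarrow> 'b::real_normed_vector"
  assumes "continuous_on UNIV f" "compact K" "\<And>x. x \<notin> K \<Longrightarrow> f x = 0"
  obtains C where "C \<ge> 0" "\<And>x. norm (f x) \<le> C"
proof -
  have "bounded (f ` K)"
    by (intro compact_imp_bounded compact_continuous_image assms(2) continuous_on_subset[OF assms(1)]) simp
  then obtain C where "\<And>x. x \<in> K \<Longrightarrow> norm (f x) \<le> C" unfolding bounded_iff by auto
  then have "norm (f x) \<le> max C 0" for x using assms(3)[of x] by (cases "x \<in> K") fastforce+
  then show ?thesis using that[of "max C 0"] by simp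
qed

lemma iter_deriv_outside_support:
  assumes "closed K" "\<And>x. x \<notin> K \<Longrightarrow> f x = 0" "x \<notin> K"
  shows "iter_deriv vs f x = 0"
  using iter_deriv_cong[of "- K" f "\<lambda>_. 0" x vs] assms by (simp add: iter_deriv_0 open_Compl)

lemma smooth_compact_support_bounded:
  fixes f :: "'a::euclidean_space \<Rightarrow> 'b::real_normed_vector"
  assumes "smooth_on UNIV f" "compact K" "\<And>x. x \<notin> K \<Longrightarrow> f x = 0"
  obtains C where "C \<ge> 0" "\<And>x. norm (iter_deriv vs f x) \<le> C"
  using compact_support_bounded[OF smooth_on_imp_continuous_on[OF smooth_on_iter_deriv[OF assms(1)]] assms(2)
      iter_deriv_outside_support[OF compact_imp_closed[OF assms(2)] assms(3)]] by blast

lemma smooth_compact_support_lipschitz: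
  fixes f :: "'a::euclidean_space \<Rightarrow> complex"
  assumes "smooth_on UNIV f" "compact K" "\<And>x. x \<notin> K \<Longrightarrow> f x = 0"
  obtains L where "L \<ge> 0" "\<And>x y. norm (f x - f y) \<le> L * norm (x - y)"
proof -
  have "\<exists>C. C \<ge> 0 \<and> (\<forall>x. norm (iter_deriv [i] f x) \<le> C)" for i
    using smooth_compact_support_bounded[OF assms(1,2), of "[i]"] assms(3) by blast
  then have "\<exists>C. \<forall>i. C i \<ge> 0 \<and> (\<forall>x. norm (iter_deriv [i] f x) \<le> C i)"
    by (intro choice) blast
  then obtain C where C: "\<And>i. C i \<ge> 0" "\<And>i x. norm (dir_deriv i f x) \<le> C i"
    by (auto simp: dir_deriv_def)
  have "norm (dir_deriv i f x) \<le> sum C Basis" if "i \<in> Basis" for i x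
    using C(2)[of i x] member_le_sum[OF that, of C] C(1) by fastforce
  then have "norm (f x - f y) \<le> sum C Basis * DIM('a) * norm (x - y)" for x y
    using lipschitz_of_dir_derivs[of UNIV f "sum C Basis" x y] smooth_on_differentiable[OF assms(1)] by simp
  moreover have "sum C Basis * DIM('a) \<ge> 0" using C(1) by (simp add: sum_nonneg)
  ultimately show ?thesis using that by blast
qed

lemma integrable_lborel_compact_support:
  fixes f :: "'a::euclidean_space \<Rightarrow> 'b::{banach, second_countable_topology}"
  assumes "f \<in> borel_measurable borel" "compact K" "\<And>x. x \<notin> K \<Longrightarrow> f x = 0" "\<And>x. norm (f x) \<le> C"
  shows "integrable lborel f"
proof (rule Bochner_Integration.integrable_bound)
  show "integrable lborel (\<lambda>x. C * indicator K x)"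
    using emeasure_compact_finite[OF assms(2)] borel_compact[OF assms(2)]
    by (intro integrable_mult_right integrable_real_indicator) auto
  show "AE x in lborel. norm (f x) \<le> norm (C * indicator K x)"
    using assms(3,4) order_trans[OF norm_ge_zero assms(4)] by (intro AE_I2) (auto simp: indicator_def)
qed (use assms in auto)

text \<open>By translation invariance the integral of f (w + t v) does not depend on t;
  differentiating under the integral at t = 0 gives the claim, without iterated integrals.\<close>

lemma integral_dir_deriv_eq_0:
  fixes f :: "'a::euclidean_space \<Rightarrow> complex"
  assumes diff: "\<And>x. f differentiable (at x)"
    and K: "compact K" "\<And>x. x \<notin> K \<Longrightarrow> f x = 0"
    and L: "\<And>x y. norm (f x - f y) \<le> L * norm (x - y)"
  shows "(\<integral>x. dir_deriv v f x \<partial>lborel) = 0" "integrable lborel (dir_deriv v f)"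
proof -
  have cont: "continuous_on UNIV f"
    using diff by (simp add: continuous_at_imp_continuous_on differentiable_imp_continuous_within)
  have meas: "f \<in> borel_measurable borel" using cont by (rule borel_measurable_continuous_onI)
  obtain C where C: "\<And>x. norm (f x) \<le> C"
    using compact_support_bounded[OF cont K] by blast
  \<comment> \<open>Contains the supports of all translates with |t| \<le> 1, so that L norm v times
    its indicator is an integrable majorant.\<close>
  define K' where "K' = {x + y |x y. x \<in> K \<and> y \<in> cball 0 (norm v)}"
  have K': "compact K'" unfolding K'_def by (intro compact_sums K compact_cball)
  have outside: "f (w + t *\<^sub>R v) = 0" if "w \<notin> K'" "\<bar>t\<bar> \<le> 1" for w t
  proof (rule K(2), rule notI)
    assume *: "w + t *\<^sub>R v \<in> K"
    have "w = (w + t *\<^sub>R v) + (- t *\<^sub>R v)" "- t *\<^sub>R v \<in> cball 0 (norm v)"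
      using that(2) by (auto simp: mult_left_le_one_le)
    then show False using * that(1) unfolding K'_def by blast
  qed
  let ?F = "\<lambda>(t::real) w. f (w + t *\<^sub>R v)"
  have int: "integrable lborel (?F t)" for t
  proof (rule integrable_lborel_compact_support[where K = "(+) (- t *\<^sub>R v) ` K" and C = C])
    show "compact ((+) (- t *\<^sub>R v) ` K)" using K(1) by (rule compact_translation)
    show "?F t \<in> borel_measurable borel" using meas by measurable
    show "f (w + t *\<^sub>R v) = 0" if "w \<notin> (+) (- t *\<^sub>R v) ` K" for w
      using that by (intro K(2)) (force simp: image_iff)
  qed (rule C)
  have Dw: "((\<lambda>t. ?F t w) has_derivative (\<lambda>h. dir_deriv (h *\<^sub>R v) f w)) (at 0)" for w
  proof (rule has_derivative_compose[of "\<lambda>t. w + t *\<^sub>R v" "\<lambda>h. h *\<^sub>R v" 0 UNIV f "\<lambda>u. dir_deriv u f w"])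
    show "((\<lambda>t. w + t *\<^sub>R v) has_derivative (\<lambda>h. h *\<^sub>R v)) (at 0)"
      by (auto intro!: derivative_eq_intros)
  qed (use has_derivative_dir_deriv[OF diff, of w] in simp)
  have lip: "norm (?F t w - ?F 0 w) \<le> (L * norm v * indicator K' w) * norm (t - 0)" if "t \<in> ball 0 1" for t w
    using L[of "w + t *\<^sub>R v" w] that outside[of w t] outside[of w 0] by (auto simp: indicator_def field_simps)
  have B: "integrable lborel (\<lambda>w. L * norm v * indicator K' w)"
    using emeasure_compact_finite[OF K'] borel_compact[OF K']
    by (intro integrable_mult_right integrable_real_indicator) auto
  note D = has_derivative_integral_dominated[where S = "ball 0 1" and p = "0::real" and M = lborel and f = ?F,
      OF _ _ int Dw lip B]
  have const: "(\<integral>w. ?F t w \<partial>lborel) = (\<integral>w. f w \<partial>lborel)" for t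
  proof -
    have "(\<integral>w. f w \<partial>lborel) = (\<integral>w. f w \<partial>distr lborel borel ((+) (t *\<^sub>R v)))"
      by (simp add: lborel_distr_plus)
    also have "\<dots> = (\<integral>w. f (t *\<^sub>R v + w) \<partial>lborel)"
      using meas by (intro integral_distr) auto
    finally show ?thesis by (simp add: add.commute)
  qed
  have "((\<lambda>t::real. \<integral>w. f w \<partial>lborel) has_derivative (\<lambda>h. \<integral>w. dir_deriv (h *\<^sub>R v) f w \<partial>lborel)) (at 0)"
    using D(1) unfolding const by simp
  then have "(\<lambda>h::real. \<integral>w. dir_deriv (h *\<^sub>R v) f w \<partial>lborel) = (\<lambda>_. 0)"
    using has_derivative_unique has_derivative_const by blast
  from fun_cong[OF this, of 1] show "(\<integral>x. dir_deriv v f x \<partial>lborel) = 0" by simp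
  show "integrable lborel (dir_deriv v f)"
    using D(2)[of 1] by simp
qed

lemma integral_smooth_dir_deriv_eq_0:
  fixes f :: "'a::euclidean_space \<Rightarrow> complex"
  assumes "smooth_on UNIV f" and K: "compact K" "\<And>x. x \<notin> K \<Longrightarrow> f x = 0"
  shows "(\<integral>x. dir_deriv v f x \<partial>lborel) = 0"
proof -
  obtain L where "\<And>x y. norm (f x - f y) \<le> L * norm (x - y)"
    using smooth_compact_support_lipschitz[OF assms] by blast
  then show ?thesis
    by (intro integral_dir_deriv_eq_0(1)[where K = K and L = L] smooth_on_differentiable[OF assms(1)] K) auto
qed

section \<open>Lebesgue integrals over open sets and criteria for vanishing almost
  everywhere\<close>

lemma open_in_lebesgue: "open \<Omega> \<Longrightarrow> \<Omega> \<inter> space lebesgue \<in> sets (lebesgue :: 'a::euclidean_space measure)"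
  by simp

text \<open>The function spaces are defined over completed Lebesgue measure, whereas translation
  arguments run over \<open>lborel\<close>; functions that are Borel after extension by zero pass
  between the two.\<close>

lemma integral_lebesgue_on_eq_lborel:
  fixes f :: "'a::euclidean_space \<Rightarrow> 'b::{banach, second_countable_topology}"
  assumes "open \<Omega>" "(\<lambda>x. indicator \<Omega> x *\<^sub>R f x) \<in> borel_measurable borel"
  shows "(LINT x|lebesgue_on \<Omega>. f x) = (\<integral>x. indicator \<Omega> x *\<^sub>R f x \<partial>lborel)"
    and "integrable (lebesgue_on \<Omega>) f \<longleftrightarrow> integrable lborel (\<lambda>x. indicator \<Omega> x *\<^sub>R f x)"
  using assms integral_completion[of "\<lambda>x. indicator \<Omega> x *\<^sub>R f x" lborel]
    integrable_completion[of "\<lambda>x. indicator \<Omega> x *\<^sub>R f x" lborel]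
  by (simp_all add: integral_restrict_space integrable_restrict_space)

lemma borel_measurable_lebesgue_on_continuous:
  fixes f :: "'a::euclidean_space \<Rightarrow> 'b::{second_countable_topology,real_normed_vector}"
  assumes "open \<Omega>" "continuous_on \<Omega> f"
  shows "f \<in> borel_measurable (lebesgue_on \<Omega>)"
    and "(\<lambda>x. indicator \<Omega> x *\<^sub>R f x) \<in> borel_measurable borel"
  using assms continuous_imp_measurable_on_sets_lebesgue[of \<Omega> f]
    borel_measurable_continuous_on_indicator[of \<Omega> f] by auto

lemma borel_measurable_lborelI: "f \<in> borel_measurable borel \<Longrightarrow> f \<in> borel_measurable lborel"
  by simp

lemma finite_measure_lebesgue_on: "bounded \<Omega> \<Longrightarrow> open \<Omega> \<Longrightarrow> finite_measure (lebesgue_on \<Omega>)"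
  by (rule finite_measure_lebesgue_on) (simp add: lmeasurable_open)

lemma test_functionsI:
  "smooth_on UNIV \<phi> \<Longrightarrow> compact K \<Longrightarrow> K \<subseteq> \<Omega> \<Longrightarrow> (\<And>x. x \<notin> K \<Longrightarrow> \<phi> x = 0) \<Longrightarrow> \<phi> \<in> test_functions \<Omega>"
  unfolding test_functions_def by blast

lemma test_functions_boxI:
  assumes "box a b \<subseteq> \<Omega>"
  shows "(\<lambda>x. complex_of_real (box_bump (real (Suc n)) a b x)) \<in> test_functions \<Omega>"
proof -
  let ?K = "cbox (a + (1 / real (Suc n)) *\<^sub>R One) (b - (1 / real (Suc n)) *\<^sub>R One)"
  have "?K \<subseteq> box a b" by (rule shrunk_cbox_subset_box) simp
  moreover have "complex_of_real (box_bump (real (Suc n)) a b x) = 0" if "x \<notin> ?K" for x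
    using box_bump_eq_0[OF _ that] by simp
  ultimately show ?thesis
    by (intro test_functionsI[of _ ?K] smooth_on_of_real smooth_on_box_bump open_UNIV compact_cbox
        order_trans[OF _ assms])
qed

text \<open>Boxes are stable under intersection and generate the Borel sets, so inside one box the
  vanishing spreads from boxes to all Borel subsets. Countably many boxes exhaust \<Omega>.\<close>

lemma AE_eq_0_if_integral_boxes_eq_0:
  fixes f :: "'a::euclidean_space \<Rightarrow> real"
  assumes "open \<Omega>" and int: "integrable lebesgue f"
    and box: "\<And>a b. box a b \<subseteq> \<Omega> \<Longrightarrow> (LINT x:box a b|lebesgue. f x) = 0"
  shows "AE x in lebesgue. x \<in> \<Omega> \<longrightarrow> f x = 0"
proof -
  have AE_box: "AE x in lebesgue. x \<in> box a b \<longrightarrow> f x = 0" if "box a b \<subseteq> \<Omega>" for a b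
  proof -
    define h where "h x = indicator (box a b) x *\<^sub>R f x" for x
    have h: "integrable lebesgue h"
      unfolding h_def by (intro integrable_mult_indicator int) simp
    have hA: "integrable lebesgue (\<lambda>x. indicator A x *\<^sub>R h x)" if "A \<in> sets lebesgue" for A
      by (intro integrable_mult_indicator h that)
    have borel: "(LINT x:A|lebesgue. h x) = 0" if A: "A \<in> sets borel" for A
    proof -
      have "Int_stable (range (\<lambda>(a, b). box a b))"
        by (auto simp: Int_stable_def box_Int_box)
      moreover have "(range (\<lambda>(a, b). box a b)) \<subseteq> Pow UNIV" by auto
      moreover have "A \<in> sigma_sets UNIV (range (\<lambda>(a, b). box a b))"
        using A unfolding borel_eq_box by simp
      ultimately show ?thesis
      proof (induction rule: sigma_sets_induct_disjoint)
        case (basic A)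
        then obtain c d where A: "A = box c d" by auto
        obtain c' d' where cd: "box c d \<inter> box a b = box c' d'" using box_Int_box[of c d a b] that by blast
        have "(LINT x:A|lebesgue. h x) = (LINT x:box c' d'|lebesgue. f x)"
          unfolding set_lebesgue_integral_def h_def A cd[symmetric] by (simp add: indicator_inter_arith mult.assoc)
        also have "\<dots> = 0" using box[of c' d'] cd \<open>box a b \<subseteq> \<Omega>\<close> by blast
        finally show ?case .
      next
        case empty
        then show ?case by (simp add: set_lebesgue_integral_def)
      next
        case (compl A)
        then have "A \<in> sets borel" by (simp add: borel_eq_box)
        then have A: "A \<in> sets lebesgue" by simp
        have "(LINT x:UNIV - A|lebesgue. h x) = (LINT x|lebesgue. h x - indicator A x *\<^sub>R h x)"
          unfolding set_lebesgue_integral_def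
          by (intro Bochner_Integration.integral_cong) (auto simp: indicator_def)
        also have "\<dots> = (LINT x|lebesgue. h x) - (LINT x:A|lebesgue. h x)"
          unfolding set_lebesgue_integral_def by (intro Bochner_Integration.integral_diff h hA A)
        also have "(LINT x|lebesgue. h x) = 0"
          using box[OF \<open>box a b \<subseteq> \<Omega>\<close>] by (simp add: h_def set_lebesgue_integral_def)
        finally show ?case using compl by simp
      next
        case (union F)
        then have "F i \<in> sets borel" for i by (simp add: borel_eq_box subset_eq)
        then have F: "F i \<in> sets lebesgue" for i by simp
        have "(LINT x:(\<Union>i. F i)|lebesgue. h x) = (\<Sum>i. LINT x:F i|lebesgue. h x)"
          using union(1) F hA[of "\<Union>i. F i"]
          by (intro lebesgue_integral_countable_add) (auto simp: disjoint_family_on_def set_integrable_def)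
        then show ?case using union by simp
      qed
    qed
    have "AE x in lebesgue. h x = 0"
    proof (rule density_unique_real[OF h, of "\<lambda>_. 0"])
      fix A :: "'a set" assume "A \<in> sets lebesgue"
      \<comment> \<open>A Lebesgue set differs from a Borel set by a null set, which the integral
        ignores.\<close>
      then obtain B N N' where A: "A = B \<union> N" "N \<subseteq> N'" "N' \<in> null_sets lborel" "B \<in> sets lborel"
        by (rule sets_completionE)
      have "N \<in> null_sets lebesgue" using null_sets_completion_subset[OF A(2) null_sets_completionI[OF A(3)]] .
      then have ae: "AE x in lebesgue. x \<notin> N" by (rule AE_not_in)
      have "(LINT x:A|lebesgue. h x) = (LINT x:B|lebesgue. h x)"
        unfolding set_lebesgue_integral_def
      proof (rule integral_cong_AE)
        show "AE x in lebesgue. indicat_real A x *\<^sub>R h x = indicat_real B x *\<^sub>R h x"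
          using ae by eventually_elim (auto simp: A indicator_def)
        show "(\<lambda>x. indicat_real A x *\<^sub>R h x) \<in> borel_measurable lebesgue"
          using hA[OF \<open>A \<in> sets lebesgue\<close>] by auto
        show "(\<lambda>x. indicat_real B x *\<^sub>R h x) \<in> borel_measurable lebesgue"
          using hA[of B] A by auto
      qed
      then show "(LINT x:A|lebesgue. h x) = (LINT x:A|lebesgue. 0)"
        using borel[of B] A by (simp add: set_lebesgue_integral_def)
    qed simp
    then show ?thesis by eventually_elim (auto simp: h_def)
  qed
  obtain D where D: "countable D" "D \<subseteq> Pow \<Omega>" "\<And>X. X \<in> D \<Longrightarrow> \<exists>a b. X = box a b" "\<Union>D = \<Omega>"
    using open_countable_Union_open_box[OF \<open>open \<Omega>\<close>] by metis
  have "AE x in lebesgue. \<forall>X\<in>D. x \<in> X \<longrightarrow> f x = 0"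
    unfolding AE_ball_countable[OF D(1)]
  proof
    fix X assume "X \<in> D"
    then obtain a b where "X = box a b" "box a b \<subseteq> \<Omega>" using D(2,3) by blast
    then show "AE x in lebesgue. x \<in> X \<longrightarrow> f x = 0" using AE_box by simp
  qed
  then show ?thesis by eventually_elim (use D(4) in auto)
qed

text \<open>Fundamental lemma of the calculus of variations. The test functions
  \<open>box_bump\<close> converge boundedly to the indicator of a box, which reduces the claim to
  integrals over boxes, for real and imaginary part separately.\<close>

lemma AE_eq_0_if_integral_test_functions_eq_0:
  fixes f :: "'a::euclidean_space \<Rightarrow> complex"
  assumes "open \<Omega>" and int: "integrable (lebesgue_on \<Omega>) f"
    and test: "\<And>\<phi>. \<phi> \<in> test_functions \<Omega> \<Longrightarrow> (LINT x|lebesgue_on \<Omega>. f x * \<phi> x) = 0"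
  shows "AE x in lebesgue_on \<Omega>. f x = 0"
proof -
  define h where "h x = indicator \<Omega> x *\<^sub>R f x" for x
  have h: "integrable lebesgue h"
    using int integrable_restrict_space[OF open_in_lebesgue[OF assms(1)], of f] by (simp add: h_def[abs_def])
  have box0: "(LINT x:box a b|lebesgue. h x) = 0" if "box a b \<subseteq> \<Omega>" for a b
  proof -
    let ?\<phi> = "\<lambda>n x. complex_of_real (box_bump (real (Suc n)) a b x)"
    have meas: "?\<phi> n \<in> borel_measurable lebesgue" for n
      by (intro measurable_completion borel_measurable_continuous_onI[THEN borel_measurable_lborelI]
          smooth_on_imp_continuous_on smooth_on_of_real smooth_on_box_bump open_UNIV)
    have eq: "(LINT x|lebesgue. h x * ?\<phi> n x) = 0" for n
      using test[OF test_functions_boxI[OF that, of n]]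
        integral_restrict_space[OF open_in_lebesgue[OF assms(1)], of "\<lambda>x. f x * ?\<phi> n x"]
      by (simp add: h_def)
    have "(\<lambda>n. LINT x|lebesgue. h x * ?\<phi> n x) \<longlonglongrightarrow> (LINT x|lebesgue. h x * of_real (indicator (box a b) x))"
    proof (rule integral_dominated_convergence[where w = "\<lambda>x. norm (h x)"])
      show "(\<lambda>x. h x * of_real (indicat_real (box a b) x)) \<in> borel_measurable lebesgue"
        by (intro borel_measurable_times borel_measurable_integrable[OF h]
            measurable_compose[OF borel_measurable_indicator borel_measurable_of_real]) simp
      show "(\<lambda>x. h x * ?\<phi> n x) \<in> borel_measurable lebesgue" for n
        using h meas by (intro borel_measurable_times) auto
      show "integrable lebesgue (\<lambda>x. norm (h x))" using h by simp
      show "AE x in lebesgue. (\<lambda>n. h x * ?\<phi> n x) \<longlonglongrightarrow> h x * of_real (indicat_real (box a b) x)"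
        by (intro AE_I2 tendsto_mult tendsto_const tendsto_of_real box_bump_tendsto)
      show "AE x in lebesgue. norm (h x * ?\<phi> n x) \<le> norm (h x)" for n
        by (intro AE_I2)
          (auto simp: norm_mult abs_of_nonneg box_bump_ge_0 box_bump_le_1 intro!: mult_left_le simp del: of_nat_Suc)
    qed
    then have "(LINT x|lebesgue. h x * of_real (indicator (box a b) x)) = 0"
      unfolding eq using LIMSEQ_unique tendsto_const by blast
    then show ?thesis
      by (simp add: set_lebesgue_integral_def scaleR_conv_of_real mult.commute)
  qed
  have hbox: "integrable lebesgue (\<lambda>x. indicator (box a b) x *\<^sub>R h x)" for a b
    by (intro integrable_mult_indicator h) simp
  have "AE x in lebesgue. x \<in> \<Omega> \<longrightarrow> Re (h x) = 0"
  proof (rule AE_eq_0_if_integral_boxes_eq_0[OF assms(1)])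
    show "(LINT x:box a b|lebesgue. Re (h x)) = 0" if "box a b \<subseteq> \<Omega>" for a b
      using arg_cong[OF box0[OF that], of Re] integral_Re[OF hbox[of a b]] by (simp add: set_lebesgue_integral_def)
  qed (use h in simp)
  moreover have "AE x in lebesgue. x \<in> \<Omega> \<longrightarrow> Im (h x) = 0"
  proof (rule AE_eq_0_if_integral_boxes_eq_0[OF assms(1)])
    show "(LINT x:box a b|lebesgue. Im (h x)) = 0" if "box a b \<subseteq> \<Omega>" for a b
      using arg_cong[OF box0[OF that], of Im] integral_Im[OF hbox[of a b]] by (simp add: set_lebesgue_integral_def)
  qed (use h in simp)
  ultimately have "AE x in lebesgue. x \<in> \<Omega> \<longrightarrow> f x = 0"
    by eventually_elim (auto simp: h_def complex_eq_iff)
  then show ?thesis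
    using AE_restrict_space_iff[OF open_in_lebesgue[OF assms(1)]] by blast
qed

section \<open>Square-integrable functions\<close>

lemma L2_measurable: "f \<in> L2 \<Omega> \<Longrightarrow> f \<in> borel_measurable (lebesgue_on \<Omega>)"
  by (simp add: L2_def)

lemma L2_integrable_power2: "f \<in> L2 \<Omega> \<Longrightarrow> integrable (lebesgue_on \<Omega>) (\<lambda>x. (cmod (f x))\<^sup>2)"
  by (simp add: L2_def)

lemma L2_norm_nonneg: "L2_norm \<Omega> f \<ge> 0"
  by (simp add: L2_norm_def)

lemma L2_norm_power2: "(L2_norm \<Omega> f)\<^sup>2 = (LINT x|lebesgue_on \<Omega>. (cmod (f x))\<^sup>2)"
  by (simp add: L2_norm_def integral_nonneg_AE)

lemma mult_le_sum_power2: "(a::real) * b \<le> a\<^sup>2 + b\<^sup>2"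
  using sum_squares_bound[of a b] zero_le_power2[of a] zero_le_power2[of b] by linarith

lemma L2_mult_integrable:
  assumes "f \<in> L2 \<Omega>" "g \<in> L2 \<Omega>"
  shows "integrable (lebesgue_on \<Omega>) (\<lambda>x. f x * g x)"
proof (rule Bochner_Integration.integrable_bound)
  show "integrable (lebesgue_on \<Omega>) (\<lambda>x. (cmod (f x))\<^sup>2 + (cmod (g x))\<^sup>2)"
    using assms by (simp add: L2_def)
  show "AE x in lebesgue_on \<Omega>. norm (f x * g x) \<le> norm ((cmod (f x))\<^sup>2 + (cmod (g x))\<^sup>2)"
    using mult_le_sum_power2 by (intro AE_I2) (simp add: norm_mult)
qed (intro borel_measurable_times L2_measurable assms)

lemma L2_cnj: "f \<in> L2 \<Omega> \<Longrightarrow> (\<lambda>x. cnj (f x)) \<in> L2 \<Omega>"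
  unfolding L2_def
  using measurable_compose[OF _ borel_measurable_continuous_onI[OF continuous_on_cnj[OF continuous_on_id]]] by auto

lemma L2_inner_integrable:
  "f \<in> L2 \<Omega> \<Longrightarrow> g \<in> L2 \<Omega> \<Longrightarrow> integrable (lebesgue_on \<Omega>) (\<lambda>x. f x * cnj (g x))"
  using L2_mult_integrable[OF _ L2_cnj] .

lemma L2_bounded_mult:
  assumes "f \<in> L2 \<Omega>" "h \<in> borel_measurable (lebesgue_on \<Omega>)" "\<And>x. x \<in> \<Omega> \<Longrightarrow> cmod (h x) \<le> C"
  shows "(\<lambda>x. f x * h x) \<in> L2 \<Omega>"
proof -
  have "integrable (lebesgue_on \<Omega>) (\<lambda>x. (cmod (f x * h x))\<^sup>2)"
  proof (rule Bochner_Integration.integrable_bound)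
    show "integrable (lebesgue_on \<Omega>) (\<lambda>x. (cmod (f x))\<^sup>2 * C\<^sup>2)"
      using L2_integrable_power2[OF assms(1)] by simp
    show "(\<lambda>x. (cmod (f x * h x))\<^sup>2) \<in> borel_measurable (lebesgue_on \<Omega>)"
      using L2_measurable[OF assms(1)] assms(2) by measurable
    show "AE x in lebesgue_on \<Omega>. norm ((cmod (f x * h x))\<^sup>2) \<le> norm ((cmod (f x))\<^sup>2 * C\<^sup>2)"
      using assms(3) by (intro AE_I2) (auto simp: norm_mult power_mult_distrib intro!: mult_left_mono power_mono)
  qed
  then show ?thesis using assms L2_measurable[OF assms(1)] unfolding L2_def by auto
qed

lemma L2_scale: "f \<in> L2 \<Omega> \<Longrightarrow> (\<lambda>x. c * f x) \<in> L2 \<Omega>"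
  using L2_bounded_mult[of f \<Omega> "\<lambda>_. c" "cmod c"] by (simp add: mult.commute)

lemma L2_add:
  assumes "f \<in> L2 \<Omega>" "g \<in> L2 \<Omega>"
  shows "(\<lambda>x. f x + g x) \<in> L2 \<Omega>"
proof -
  have "integrable (lebesgue_on \<Omega>) (\<lambda>x. (cmod (f x + g x))\<^sup>2)"
  proof (rule Bochner_Integration.integrable_bound)
    show "integrable (lebesgue_on \<Omega>) (\<lambda>x. 2 * (cmod (f x))\<^sup>2 + 2 * (cmod (g x))\<^sup>2)"
      using assms by (simp add: L2_def)
    have "(cmod (u + v))\<^sup>2 \<le> 2 * (cmod u)\<^sup>2 + 2 * (cmod v)\<^sup>2" for u v
    proof -
      have "(cmod (u + v))\<^sup>2 \<le> (cmod u + cmod v)\<^sup>2"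
        by (intro power_mono norm_triangle_ineq) simp
      also have "\<dots> \<le> 2 * (cmod u)\<^sup>2 + 2 * (cmod v)\<^sup>2"
        using sum_squares_bound[of "cmod u" "cmod v"] by (simp add: power2_sum)
      finally show ?thesis .
    qed
    then show "AE x in lebesgue_on \<Omega>. norm ((cmod (f x + g x))\<^sup>2) \<le> norm (2 * (cmod (f x))\<^sup>2 + 2 * (cmod (g x))\<^sup>2)"
      by (intro AE_I2) simp
    show "(\<lambda>x. (cmod (f x + g x))\<^sup>2) \<in> borel_measurable (lebesgue_on \<Omega>)"
      using L2_measurable[OF assms(1)] L2_measurable[OF assms(2)] by measurable
  qed
  then show ?thesis using L2_measurable[OF assms(1)] L2_measurable[OF assms(2)] unfolding L2_def by auto
qed

lemma L2_diff: "f \<in> L2 \<Omega> \<Longrightarrow> g \<in> L2 \<Omega> \<Longrightarrow> (\<lambda>x. f x - g x) \<in> L2 \<Omega>"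
  using L2_add[OF _ L2_scale[of g \<Omega> "-1"], of f] by simp

lemma L2_boundedI:
  assumes "open \<Omega>" "bounded \<Omega>" "f \<in> borel_measurable (lebesgue_on \<Omega>)" "\<And>x. x \<in> \<Omega> \<Longrightarrow> cmod (f x) \<le> C"
  shows "f \<in> L2 \<Omega>"
proof -
  interpret finite_measure "lebesgue_on \<Omega>" by (rule finite_measure_lebesgue_on[OF assms(2,1)])
  have "(\<lambda>_. 1) \<in> L2 \<Omega>" by (simp add: L2_def)
  from L2_bounded_mult[OF this assms(3,4)] show ?thesis by simp
qed

lemma L2_integrable:
  assumes "open \<Omega>" "bounded \<Omega>" "f \<in> L2 \<Omega>"
  shows "integrable (lebesgue_on \<Omega>) f"
  using L2_mult_integrable[OF assms(3) L2_boundedI[OF assms(1,2), of "\<lambda>_. 1" 1]] by simp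

lemma L2_norm_boundedI:
  assumes "open \<Omega>" "bounded \<Omega>" "f \<in> borel_measurable (lebesgue_on \<Omega>)" "\<And>x. x \<in> \<Omega> \<Longrightarrow> cmod (f x) \<le> C" "C \<ge> 0"
  shows "L2_norm \<Omega> f \<le> C * sqrt (measure lebesgue \<Omega>)"
proof -
  interpret finite_measure "lebesgue_on \<Omega>" by (rule finite_measure_lebesgue_on[OF assms(2,1)])
  have "(LINT x|lebesgue_on \<Omega>. (cmod (f x))\<^sup>2) \<le> (LINT x|lebesgue_on \<Omega>. C\<^sup>2)"
    using L2_integrable_power2[OF L2_boundedI[OF assms(1-4)]] assms(4)
    by (intro integral_mono_AE) (auto intro!: AE_I2 power_mono)
  also have "\<dots> = C\<^sup>2 * measure lebesgue \<Omega>"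
    using assms(1) by (simp add: measure_restrict_space)
  finally have "L2_norm \<Omega> f \<le> sqrt (C\<^sup>2 * measure lebesgue \<Omega>)"
    unfolding L2_norm_def by (rule real_sqrt_le_mono)
  then show ?thesis using assms(5) by (simp add: real_sqrt_mult)
qed

lemma L2_inner_Cauchy_Schwarz:
  assumes "f \<in> L2 \<Omega>" "g \<in> L2 \<Omega>"
  shows "cmod (L2_inner \<Omega> f g) \<le> L2_norm \<Omega> f * L2_norm \<Omega> g"
proof -
  let ?M = "lebesgue_on \<Omega>"
  define a b c where "a = (LINT x|?M. (cmod (f x))\<^sup>2)" and "b = (LINT x|?M. (cmod (g x))\<^sup>2)"
    and "c = (LINT x|?M. cmod (f x) * cmod (g x))"
  have int: "integrable ?M (\<lambda>x. cmod (f x) * cmod (g x))"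
    using integrable_norm[OF L2_mult_integrable[OF assms]] by (simp add: norm_mult)
  have quad: "0 \<le> a - 2 * s * c + s\<^sup>2 * b" for s
  proof -
    have "0 \<le> (LINT x|?M. (cmod (f x) - s * cmod (g x))\<^sup>2)" by (intro integral_nonneg_AE AE_I2) simp
    also have "\<dots> = (LINT x|?M. (cmod (f x))\<^sup>2 - 2 * s * (cmod (f x) * cmod (g x)) + s\<^sup>2 * (cmod (g x))\<^sup>2)"
      by (intro Bochner_Integration.integral_cong) (auto simp: power2_eq_square algebra_simps)
    also have "\<dots> = a - 2 * s * c + s\<^sup>2 * b"
      using int assms unfolding a_def b_def c_def L2_def by simp
    finally show ?thesis .
  qed
  have "a \<ge> 0" "b \<ge> 0" "c \<ge> 0"
    unfolding a_def b_def c_def by (intro integral_nonneg_AE AE_I2; simp)+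
  have "c\<^sup>2 \<le> a * b"
  proof (cases "b = 0")
    case True
    have "c = 0"
    proof (rule ccontr)
      assume "c \<noteq> 0"
      then have "c > 0" using \<open>c \<ge> 0\<close> by simp
      \<comment> \<open>This value of s makes the quadratic equal to -1 when b = 0.\<close>
      then show False using quad[of "(a + 1) / (2 * c)"] True by simp
    qed
    then show ?thesis using True by simp
  next
    case False
    then have "b > 0" using \<open>b \<ge> 0\<close> by simp
    \<comment> \<open>c / b is the minimiser of the quadratic in s.\<close>
    then show ?thesis using quad[of "c / b"] by (simp add: power2_eq_square field_simps)
  qed
  then have "c \<le> sqrt a * sqrt b"
    by (metis real_le_rsqrt real_sqrt_mult)
  moreover have "cmod (L2_inner \<Omega> f g) \<le> c"
    unfolding L2_inner_def c_def
    by (rule order_trans[OF integral_norm_bound]) (simp add: norm_mult)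
  ultimately show ?thesis
    unfolding L2_norm_def a_def b_def by linarith
qed

lemma L2_inner_self: "L2_inner \<Omega> f f = of_real ((L2_norm \<Omega> f)\<^sup>2)"
  unfolding L2_norm_power2 L2_inner_def complex_norm_square[symmetric] by (simp flip: of_real_power)

lemma L2_norm_cong_AE:
  assumes "f \<in> borel_measurable (lebesgue_on \<Omega>)" "g \<in> borel_measurable (lebesgue_on \<Omega>)"
    "AE x in lebesgue_on \<Omega>. f x = g x"
  shows "L2_norm \<Omega> f = L2_norm \<Omega> g"
  unfolding L2_norm_def using assms
  by (intro arg_cong[of _ _ sqrt] integral_cong_AE) (auto elim: eventually_mono)

section \<open>Holomorphic functions of several variables\<close>

lemma norm_vector_smult: "norm (c *s v) = cmod c * norm (v :: complex ^ 'n::finite)"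
  by (simp add: norm_vec_def norm_mult L2_set_right_distrib)

lemma bounded_linear_vector_smult_right: "bounded_linear ((*s) c :: complex ^ 'n::finite \<Rightarrow> complex ^ 'n)"
  by (rule bounded_linear_intro[where K = "cmod c"])
     (auto simp: norm_vector_smult vec_eq_iff algebra_simps)

lemma bounded_linear_vector_smult_left: "bounded_linear (\<lambda>c. c *s (v :: complex ^ 'n::finite))"
  by (rule bounded_linear_intro[where K = "norm v"])
     (auto simp: norm_vector_smult vec_eq_iff algebra_simps)

lemma inner_i_smult_self: "(\<i> *s v) \<bullet> (v :: complex ^ 'n::finite) = 0"
  unfolding inner_vec_def by (intro sum.neutral) (auto simp: inner_complex_def)

lemma holomorphic_several_differentiable:
  "holomorphic_several f \<Omega> \<Longrightarrow> z \<in> \<Omega> \<Longrightarrow> f differentiable (at z)"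
  unfolding holomorphic_several_def differentiable_def by blast

lemma holomorphic_several_has_derivative:
  "holomorphic_several f \<Omega> \<Longrightarrow> z \<in> \<Omega> \<Longrightarrow> (f has_derivative (\<lambda>v. dir_deriv v f z)) (at z)"
  by (intro has_derivative_dir_deriv holomorphic_several_differentiable)

lemma holomorphic_several_dir_deriv_smult:
  assumes "holomorphic_several f \<Omega>" "z \<in> \<Omega>"
  shows "dir_deriv (c *s v) f z = c * dir_deriv v f z"
proof -
  obtain f' where f': "(f has_derivative f') (at z)" "\<And>c v. f' (c *s v) = c * f' v"
    using assms unfolding holomorphic_several_def by blast
  then show ?thesis by (simp add: dir_deriv_eqI[OF f'(1)])
qed

lemma holomorphic_severalI:
  assumes "\<And>z. z \<in> \<Omega> \<Longrightarrow> f differentiable (at z)"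
    and "\<And>z c v. z \<in> \<Omega> \<Longrightarrow> dir_deriv (c *s v) f z = c * dir_deriv v f z"
  shows "holomorphic_several f \<Omega>"
  unfolding holomorphic_several_def
proof
  fix z assume z: "z \<in> \<Omega>"
  show "\<exists>f'. (f has_derivative f') (at z) \<and> (\<forall>c v. f' (c *s v) = c * f' v)"
    using has_derivative_dir_deriv[OF assms(1)[OF z]] assms(2)[OF z]
    by (intro exI[of _ "\<lambda>v. dir_deriv v f z"]) simp
qed

lemma holomorphic_several_continuous_on: "holomorphic_several f \<Omega> \<Longrightarrow> continuous_on \<Omega> f"
  by (intro continuous_at_imp_continuous_on ballI differentiable_imp_continuous_within
      holomorphic_several_differentiable)

lemma holomorphic_several_add:
  assumes "holomorphic_several f \<Omega>" "holomorphic_several g \<Omega>"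
  shows "holomorphic_several (\<lambda>z. f z + g z) \<Omega>"
  unfolding holomorphic_several_def
proof
  fix z assume z: "z \<in> \<Omega>"
  show "\<exists>h. ((\<lambda>z. f z + g z) has_derivative h) (at z) \<and> (\<forall>c v. h (c *s v) = c * h v)"
    using has_derivative_add[OF holomorphic_several_has_derivative[OF assms(1) z]
        holomorphic_several_has_derivative[OF assms(2) z]]
      holomorphic_several_dir_deriv_smult[OF assms(1) z] holomorphic_several_dir_deriv_smult[OF assms(2) z]
    by (intro exI[of _ "\<lambda>v. dir_deriv v f z + dir_deriv v g z"]) (simp add: distrib_left)
qed

lemma holomorphic_several_mult:
  assumes "holomorphic_several f \<Omega>" "holomorphic_several g \<Omega>"
  shows "holomorphic_several (\<lambda>z. f z * g z) \<Omega>"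
  unfolding holomorphic_several_def
proof
  fix z assume z: "z \<in> \<Omega>"
  show "\<exists>h. ((\<lambda>z. f z * g z) has_derivative h) (at z) \<and> (\<forall>c v. h (c *s v) = c * h v)"
    using has_derivative_mult[OF holomorphic_several_has_derivative[OF assms(1) z]
        holomorphic_several_has_derivative[OF assms(2) z]]
      holomorphic_several_dir_deriv_smult[OF assms(1) z] holomorphic_several_dir_deriv_smult[OF assms(2) z]
    by (intro exI[of _ "\<lambda>v. f z * dir_deriv v g z + dir_deriv v f z * g z"]) (simp add: distrib_left mult_ac)
qed

lemma holomorphic_several_const: "holomorphic_several (\<lambda>_. c) \<Omega>"
  unfolding holomorphic_several_def by (intro ballI exI[of _ "\<lambda>_. 0"]) auto

lemma holomorphic_several_line:
  assumes "holomorphic_several f \<Omega>" "z + t *s v \<in> \<Omega>"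
  shows "((\<lambda>t. f (z + t *s v)) has_field_derivative dir_deriv v f (z + t *s v)) (at t)"
proof -
  have "((\<lambda>t. z + t *s v) has_derivative (\<lambda>h. h *s v)) (at t)"
    using has_derivative_add[OF has_derivative_const
        bounded_linear_imp_has_derivative[OF bounded_linear_vector_smult_left[of v]], of z] by simp
  from has_derivative_compose[OF this holomorphic_several_has_derivative[OF assms]]
  show ?thesis
    unfolding has_field_derivative_def holomorphic_several_dir_deriv_smult[OF assms]
    by (simp add: mult.commute[of _ "dir_deriv v f (z + t *s v)"])
qed

text \<open>The one-variable Cauchy inequality for t \<mapsto> f (z + t v) on the disc of radius r /
  norm v, whose image stays in the ball.\<close>

lemma holomorphic_several_Cauchy_bound:
  assumes hol: "holomorphic_several f \<Omega>" and "r > 0" "cball z r \<subseteq> \<Omega>" "\<And>u. u \<in> cball z r \<Longrightarrow> cmod (f u) \<le> M"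
  shows "cmod (dir_deriv v f z) \<le> M / r * norm v"
proof (cases "v = 0")
  case True
  have "z \<in> \<Omega>" using assms by auto
  then show ?thesis
    using linear_0[OF has_derivative_linear[OF holomorphic_several_has_derivative[OF hol]]] True by simp
next
  case False
  define s where "s = r / norm v"
  have s: "s > 0" using False \<open>r > 0\<close> by (simp add: s_def)
  have in_cball: "z + t *s v \<in> cball z r" if "t \<in> cball 0 s" for t
    using that False by (auto simp: dist_norm norm_vector_smult s_def pos_le_divide_eq)
  let ?g = "\<lambda>t. f (z + t *s v)"
  have D: "(?g has_field_derivative dir_deriv v f (z + t *s v)) (at t)" if "t \<in> cball 0 s" for t
    using in_cball[OF that] assms(3) by (intro holomorphic_several_line[OF hol]) auto
  have "cmod ((deriv ^^ 1) ?g 0) \<le> fact 1 * M / s ^ 1"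
  proof (rule Cauchy_inequality[OF _ _ s])
    show "?g holomorphic_on ball 0 s"
      unfolding holomorphic_on_open[OF open_ball] by (intro ballI exI, rule D) simp
    show "continuous_on (cball 0 s) ?g"
      by (intro continuous_at_imp_continuous_on ballI DERIV_isCont[OF D])
    show "cmod (?g x) \<le> M" if "cmod (0 - x) = s" for x
      using that by (intro assms(4) in_cball) simp
  qed
  moreover have "deriv ?g 0 = dir_deriv v f z"
    using DERIV_imp_deriv[OF D[of 0]] s by simp
  ultimately show ?thesis by (simp add: s_def)
qed

lemma holomorphic_several_lipschitz:
  assumes hol: "holomorphic_several f \<Omega>" and "R > 0" "cball z (2 * R) \<subseteq> \<Omega>"
  obtains L where "L \<ge> 0" "\<And>u v. u \<in> cball z R \<Longrightarrow> cmod (dir_deriv v f u) \<le> L * norm v"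
    "\<And>x y. x \<in> cball z R \<Longrightarrow> y \<in> cball z R \<Longrightarrow> cmod (f x - f y) \<le> L * norm (x - y)"
proof -
  have "bounded (f ` cball z (2 * R))"
    by (intro compact_imp_bounded compact_continuous_image compact_cball
        continuous_on_subset[OF holomorphic_several_continuous_on[OF hol] assms(3)])
  then obtain M where M: "\<And>u. u \<in> cball z (2 * R) \<Longrightarrow> cmod (f u) \<le> M"
    unfolding bounded_iff by (auto simp del: mem_cball)
  have "0 \<le> M" using M[of z] \<open>R > 0\<close> by (force intro: order_trans[OF norm_ge_zero])
  have sub: "cball u R \<subseteq> cball z (2 * R)" if "u \<in> cball z R" for u
    using that by (simp add: cball_subset_cball_iff dist_commute)
  have 1: "cmod (dir_deriv v f u) \<le> M / R * norm v" if "u \<in> cball z R" for u v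
    using sub[OF that] assms(3) M \<open>R > 0\<close> by (intro holomorphic_several_Cauchy_bound[OF hol]) auto
  have 2: "cmod (f x - f y) \<le> M / R * norm (x - y)" if "x \<in> cball z R" "y \<in> cball z R" for x y
  proof (rule differentiable_bound[OF convex_cball[of z R]])
    fix u assume u: "u \<in> cball z R"
    then have "u \<in> \<Omega>" using sub[OF u] assms(2,3) by auto
    show "(f has_derivative (\<lambda>v. dir_deriv v f u)) (at u within cball z R)"
      by (rule has_derivative_at_withinI[OF holomorphic_several_has_derivative[OF hol \<open>u \<in> \<Omega>\<close>]])
    show "onorm (\<lambda>v. dir_deriv v f u) \<le> M / R"
      using 1[OF u] by (rule onorm_le)
  qed (use that in auto)
  show ?thesis
    using that[OF _ 1 2] \<open>R > 0\<close> \<open>0 \<le> M\<close> by simp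
qed

section \<open>The mean value property against rotation-invariant weights\<close>

lemma holomorphic_mult_compact_support:
  fixes f \<phi> :: "complex ^ 'n::finite \<Rightarrow> complex"
  assumes hol: "holomorphic_several f \<Omega>" and r: "r > 0" "cball z (4 * r) \<subseteq> \<Omega>" and t: "\<bar>t\<bar> \<le> 3 / 2"
    and \<phi>: "smooth_on UNIV \<phi>" "\<And>w. norm w \<ge> r \<Longrightarrow> \<phi> w = 0"
  shows "integrable lborel (\<lambda>w. f (z + t *\<^sub>R w) * \<phi> w)"
    and "integrable lborel (\<lambda>w. f (z + t *\<^sub>R w) * dir_deriv v \<phi> w + t *\<^sub>R dir_deriv v f (z + t *\<^sub>R w) * \<phi> w)"
    and "(\<integral>w. f (z + t *\<^sub>R w) * dir_deriv v \<phi> w + t *\<^sub>R dir_deriv v f (z + t *\<^sub>R w) * \<phi> w \<partial>lborel) = 0"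
proof -
  let ?G = "\<lambda>w. f (z + t *\<^sub>R w) * \<phi> w"
  obtain L where L: "L \<ge> 0" "\<And>u v. u \<in> cball z (2 * r) \<Longrightarrow> cmod (dir_deriv v f u) \<le> L * norm v"
    "\<And>x y. x \<in> cball z (2 * r) \<Longrightarrow> y \<in> cball z (2 * r) \<Longrightarrow> cmod (f x - f y) \<le> L * norm (x - y)"
    using holomorphic_several_lipschitz[OF hol, of "2 * r" z] r by auto
  have supp: "\<phi> w = 0" if "w \<notin> cball 0 r" for w using that by (intro \<phi>(2)) simp
  obtain P where P: "P \<ge> 0" "\<And>w. cmod (\<phi> w) \<le> P"
    using smooth_compact_support_bounded[OF \<phi>(1) compact_cball[of 0 r] supp, of "[]"] by auto
  obtain K where K: "K \<ge> 0" "\<And>x y. cmod (\<phi> x - \<phi> y) \<le> K * norm (x - y)"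
    using smooth_compact_support_lipschitz[OF \<phi>(1) compact_cball[of 0 r] supp] by auto
  \<comment> \<open>The margin up to 4/3 r gives an open set that contains the support of \<phi> and
    overlaps the region where \<phi> vanishes. Since |t| \<le> 3/2, the arguments of f then stay in
    the ball of radius 2 r, where f is Lipschitz.\<close>
  have in_cball: "z + t *\<^sub>R w \<in> cball z (2 * r)" if "norm w < 4 / 3 * r" for w
    using that mult_mono[of "\<bar>t\<bar>" "3 / 2" "norm w" "4 / 3 * r"] t r by (simp add: dist_norm)
  have in\<Omega>: "z + t *\<^sub>R w \<in> \<Omega>" if "norm w < 4 / 3 * r" for w
    using in_cball[OF that] r subset_cball[of "2 * r" "4 * r" z] by auto
  define A where "A = cmod (f z) + L * (2 * r)"
  have A: "cmod (f (z + t *\<^sub>R w)) \<le> A" if "norm w < 4 / 3 * r" for w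
  proof -
    have "cmod (f (z + t *\<^sub>R w) - f z) \<le> L * norm (t *\<^sub>R w)"
      using L(3)[OF in_cball[OF that], of z] r by simp
    also have "\<dots> \<le> L * (2 * r)"
      using in_cball[OF that] L(1) by (intro mult_left_mono) (auto simp: dist_norm)
    finally show ?thesis unfolding A_def using norm_triangle_sub[of "f (z + t *\<^sub>R w)" "f z"] by linarith
  qed
  have "A \<ge> 0" using L(1) r by (simp add: A_def)
  have DG: "(?G has_derivative (\<lambda>v. f (z + t *\<^sub>R w) * dir_deriv v \<phi> w + t *\<^sub>R dir_deriv v f (z + t *\<^sub>R w) * \<phi> w)) (at w)" for w
  proof (cases "norm w < 4 / 3 * r")
    case True
    have "((\<lambda>w. z + t *\<^sub>R w) has_derivative (\<lambda>w. t *\<^sub>R w)) (at w)"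
      by (auto intro!: derivative_eq_intros)
    from has_derivative_mult[OF has_derivative_compose[OF this
          holomorphic_several_has_derivative[OF hol in\<Omega>[OF True]]] smooth_on_has_derivative[OF \<phi>(1) UNIV_I]]
    show ?thesis
      using linear_scale[OF has_derivative_linear[OF holomorphic_several_has_derivative[OF hol in\<Omega>[OF True]]]] by simp
  next
    case False
    then have w: "w \<in> - cball 0 r" using r by simp
    have "dir_deriv v \<phi> w = 0" for v
      using iter_deriv_outside_support[of "cball 0 r" \<phi> w "[v]"] supp w by (simp add: dir_deriv_def)
    moreover have "((\<lambda>w. 0) has_derivative (\<lambda>v. 0)) (at w)" by simp
    then have "(?G has_derivative (\<lambda>v. 0)) (at w)"
      by (rule has_derivative_transform_within_open[of _ _ _ _ "- cball 0 r"]) (use w supp in \<open>auto simp: open_Compl\<close>)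
    ultimately show ?thesis using supp w by simp
  qed
  have lip: "cmod (?G x - ?G y) \<le> (A * K + 3 / 2 * L * P) * norm (x - y)" for x y
  proof -
    have one: "cmod (?G x - ?G y) \<le> (A * K + 3 / 2 * L * P) * norm (x - y)" if "norm x < 4 / 3 * r" for x y
    proof (cases "norm y < 4 / 3 * r")
      case True
      have "?G x - ?G y = f (z + t *\<^sub>R x) * (\<phi> x - \<phi> y) + (f (z + t *\<^sub>R x) - f (z + t *\<^sub>R y)) * \<phi> y"
        by (simp add: algebra_simps)
      also have "cmod \<dots> \<le> A * (K * norm (x - y)) + 3 / 2 * L * norm (x - y) * P"
      proof (intro norm_triangle_mono)
        show "cmod (f (z + t *\<^sub>R x) * (\<phi> x - \<phi> y)) \<le> A * (K * norm (x - y))"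
          unfolding norm_mult using A[OF that] K \<open>A \<ge> 0\<close> by (intro mult_mono) auto
        have "cmod (f (z + t *\<^sub>R x) - f (z + t *\<^sub>R y)) \<le> L * norm (t *\<^sub>R (x - y))"
          using L(3)[OF in_cball[OF that] in_cball[OF True]] by (simp add: scaleR_diff_right)
        also have "\<dots> \<le> 3 / 2 * L * norm (x - y)"
          using mult_left_mono[OF mult_right_mono[OF t, of "norm (x - y)"] L(1)] by simp
        finally show "cmod ((f (z + t *\<^sub>R x) - f (z + t *\<^sub>R y)) * \<phi> y) \<le> 3 / 2 * L * norm (x - y) * P"
          unfolding norm_mult using P L(1) by (intro mult_mono) auto
      qed
      finally show ?thesis by (simp add: algebra_simps)
    next
      case False
      then have "\<phi> y = 0" using r by (intro \<phi>(2)) simp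
      then have "cmod (?G x - ?G y) = cmod (f (z + t *\<^sub>R x)) * cmod (\<phi> x - \<phi> y)" by (simp add: norm_mult)
      also have "\<dots> \<le> A * (K * norm (x - y))"
        using A[OF that] K \<open>A \<ge> 0\<close> by (intro mult_mono) auto
      also have "\<dots> \<le> (A * K + 3 / 2 * L * P) * norm (x - y)"
        using L(1) P(1) by (simp add: algebra_simps)
      finally show ?thesis .
    qed
    show ?thesis
    proof (cases "norm x < 4 / 3 * r \<or> norm y < 4 / 3 * r")
      case True
      then show ?thesis using one[of x y] one[of y x] by (auto simp: norm_minus_commute)
    next
      case False
      then have "\<phi> x = 0" "\<phi> y = 0" using r by (auto intro!: \<phi>(2))
      then show ?thesis using \<open>A \<ge> 0\<close> K L P by simp
    qed
  qed
  have diff: "?G differentiable (at w)" for w using DG differentiable_def by blast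
  have supp': "?G w = 0" if "w \<notin> cball 0 r" for w using supp[OF that] by simp
  have eq: "dir_deriv v ?G = (\<lambda>w. f (z + t *\<^sub>R w) * dir_deriv v \<phi> w + t *\<^sub>R dir_deriv v f (z + t *\<^sub>R w) * \<phi> w)" for v
    by (intro ext dir_deriv_eqI[OF DG])
  show "integrable lborel (\<lambda>w. f (z + t *\<^sub>R w) * dir_deriv v \<phi> w + t *\<^sub>R dir_deriv v f (z + t *\<^sub>R w) * \<phi> w)"
    "(\<integral>w. f (z + t *\<^sub>R w) * dir_deriv v \<phi> w + t *\<^sub>R dir_deriv v f (z + t *\<^sub>R w) * \<phi> w \<partial>lborel) = 0"
    using integral_dir_deriv_eq_0[of ?G, OF diff compact_cball[of 0 r] supp' lip, of v] unfolding eq by auto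
  have cont: "continuous_on UNIV ?G"
    by (intro continuous_at_imp_continuous_on ballI differentiable_imp_continuous_within diff)
  obtain C where C: "\<And>w. cmod (?G w) \<le> C"
    by (rule compact_support_bounded[OF cont compact_cball[of 0 r] supp']) (assumption, rule that, blast)
  show "integrable lborel ?G"
    by (rule integrable_lborel_compact_support[OF borel_measurable_continuous_onI[OF cont] compact_cball[of 0 r] supp' C])
qed

text \<open>The vector field \<open>w \<mapsto> \<i> w\<close> is divergence free and tangent to the level sets of \<open>\<phi>\<close>;
  integrating by parts along it kills the radial derivative of \<open>f\<close>, by complex linearity.\<close>

lemma integral_radial_deriv_eq_0:
  fixes f \<phi> :: "complex ^ 'n::finite \<Rightarrow> complex"
  assumes hol: "holomorphic_several f \<Omega>" and r: "r > 0" "cball z (4 * r) \<subseteq> \<Omega>" and t: "0 < t" "t \<le> 1"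
    and \<phi>: "smooth_on UNIV \<phi>" "\<And>w. norm w \<ge> r \<Longrightarrow> \<phi> w = 0"
    and inv: "\<And>w. dir_deriv (\<i> *s w) \<phi> w = 0"
  shows "(\<integral>w. dir_deriv w f (z + t *\<^sub>R w) * \<phi> w \<partial>lborel) = 0"
proof -
  \<comment> \<open>\<open>l b\<close> is the component along b of the vector field w \<mapsto> \<i>
    w.\<close>
  define l where "l b w = complex_of_real ((\<i> *s w) \<bullet> b)" for b w :: "complex ^ 'n"
  have bl: "bounded_linear (l b)" for b
    unfolding l_def
    by (rule bounded_linear_compose[OF bounded_linear_of_real
          bounded_linear_compose[OF bounded_linear_inner_left bounded_linear_vector_smult_right]])
  have smooth: "smooth_on UNIV (\<lambda>w. \<phi> w * l b w)" for b
    by (intro smooth_on_mult \<phi>(1) smooth_on_bounded_linear bl open_UNIV)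
  note props = holomorphic_mult_compact_support[OF hol r _ smooth]
  have Dl: "dir_deriv b (\<lambda>w. \<phi> w * l b w) w = l b w * dir_deriv b \<phi> w" for b w
  proof -
    have "dir_deriv b (\<lambda>w. \<phi> w * l b w) w = \<phi> w * l b b + dir_deriv b \<phi> w * l b w"
      by (rule dir_deriv_eqI[where f' = "\<lambda>v. \<phi> w * l b v + dir_deriv v \<phi> w * l b w"])
         (intro has_derivative_mult smooth_on_has_derivative[OF \<phi>(1)] UNIV_I
           bounded_linear_imp_has_derivative bl)
    \<comment> \<open>The diagonal derivatives of the field vanish, so its divergence is
      zero.\<close>
    also have "l b b = 0" by (simp add: l_def inner_i_smult_self)
    finally show ?thesis by (simp add: mult.commute)
  qed
  let ?g = "\<lambda>b w. f (z + t *\<^sub>R w) * (l b w * dir_deriv b \<phi> w) + t *\<^sub>R dir_deriv b f (z + t *\<^sub>R w) * (\<phi> w * l b w)"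
  have g: "integrable lborel (?g b)" "(\<integral>w. ?g b w \<partial>lborel) = 0" for b
    using props(2,3)[of t b b] t \<phi>(2) unfolding Dl by auto
  have sum_dir: "(\<Sum>b\<in>Basis. l b w * dir_deriv b h x) = dir_deriv (\<i> *s w) h x"
    if "(h has_derivative (\<lambda>v. dir_deriv v h x)) (at x)" for h :: "complex ^ 'n \<Rightarrow> complex" and w x
  proof -
    have lin: "linear (\<lambda>v. dir_deriv v h x)" using has_derivative_linear[OF that] .
    have "dir_deriv (\<i> *s w) h x = dir_deriv (\<Sum>b\<in>Basis. ((\<i> *s w) \<bullet> b) *\<^sub>R b) h x"
      by (simp add: euclidean_representation)
    then show ?thesis
      unfolding linear_sum[OF lin] linear_scale[OF lin] by (simp add: l_def scaleR_conv_of_real)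
  qed
  \<comment> \<open>The terms with derivatives of \<phi> add up to the derivative of \<phi> along
    \<i> w, which is zero by \<open>inv\<close>; those with derivatives of f add up to the
    derivative along \<i> w, which is \<i> times the radial one.\<close>
  have sum_g: "(\<Sum>b\<in>Basis. ?g b w) = (of_real t * \<i>) * (dir_deriv w f (z + t *\<^sub>R w) * \<phi> w)" for w
  proof (cases "norm w < r")
    case True
    have "norm (t *\<^sub>R w) \<le> 4 * r"
      using True t r mult_left_le_one_le[of "norm w" t] by simp
    then have "z + t *\<^sub>R w \<in> \<Omega>" using r by (auto simp: dist_norm)
    note D = holomorphic_several_has_derivative[OF hol this]
    have "(\<Sum>b\<in>Basis. ?g b w) = f (z + t *\<^sub>R w) * (\<Sum>b\<in>Basis. l b w * dir_deriv b \<phi> w)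
        + of_real t * \<phi> w * (\<Sum>b\<in>Basis. l b w * dir_deriv b f (z + t *\<^sub>R w))"
      by (simp add: sum.distrib sum_distrib_left scaleR_conv_of_real mult_ac)
    also have "\<dots> = of_real t * \<phi> w * dir_deriv (\<i> *s w) f (z + t *\<^sub>R w)"
      using sum_dir[OF smooth_on_has_derivative[OF \<phi>(1) UNIV_I], of w] sum_dir[OF D, of w] inv by simp
    also have "\<dots> = (of_real t * \<i>) * (dir_deriv w f (z + t *\<^sub>R w) * \<phi> w)"
      using holomorphic_several_dir_deriv_smult[OF hol \<open>z + t *\<^sub>R w \<in> \<Omega>\<close>] by simp
    finally show ?thesis .
  next
    case False
    have "(\<Sum>b\<in>Basis. ?g b w) = f (z + t *\<^sub>R w) * (\<Sum>b\<in>Basis. l b w * dir_deriv b \<phi> w)"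
      using False \<phi>(2) by (simp add: sum_distrib_left)
    then show ?thesis
      using sum_dir[OF smooth_on_has_derivative[OF \<phi>(1) UNIV_I], of w w] inv False \<phi>(2) by simp
  qed
  have "(of_real t * \<i>) * (\<integral>w. dir_deriv w f (z + t *\<^sub>R w) * \<phi> w \<partial>lborel) = (\<integral>w. (\<Sum>b\<in>Basis. ?g b w) \<partial>lborel)"
    unfolding sum_g by simp
  also have "\<dots> = (\<Sum>b\<in>Basis. \<integral>w. ?g b w \<partial>lborel)"
    by (rule Bochner_Integration.integral_sum) (rule g(1))
  also have "\<dots> = 0" using g(2) by simp
  finally show ?thesis using t by simp
qed

text \<open>The integral of f (z + t w) \<phi> w interpolates between the two sides as t runs from 1
  to 0, and its derivative in t is the radial integral, which vanishes. The differentiation takes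
  place on an open interval around [0, 1].\<close>

lemma holomorphic_mean_value:
  fixes f \<phi> :: "complex ^ 'n::finite \<Rightarrow> complex"
  assumes hol: "holomorphic_several f \<Omega>" and r: "r > 0" "cball z (4 * r) \<subseteq> \<Omega>"
    and \<phi>: "smooth_on UNIV \<phi>" "\<And>w. norm w \<ge> r \<Longrightarrow> \<phi> w = 0"
    and inv: "\<And>w. dir_deriv (\<i> *s w) \<phi> w = 0"
  shows "(\<integral>w. f (z + w) * \<phi> w \<partial>lborel) = f z * (\<integral>w. \<phi> w \<partial>lborel)"
proof -
  obtain L where L: "L \<ge> 0" "\<And>u v. u \<in> cball z (2 * r) \<Longrightarrow> cmod (dir_deriv v f u) \<le> L * norm v"
    "\<And>x y. x \<in> cball z (2 * r) \<Longrightarrow> y \<in> cball z (2 * r) \<Longrightarrow> cmod (f x - f y) \<le> L * norm (x - y)"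
    using holomorphic_several_lipschitz[OF hol, of "2 * r" z] r by auto
  have supp: "\<phi> w = 0" if "w \<notin> cball 0 r" for w using that by (intro \<phi>(2)) simp
  have int\<phi>: "integrable lborel (\<lambda>w. r * L * cmod (\<phi> w))"
  proof -
    obtain P where P: "\<And>w. cmod (\<phi> w) \<le> P"
      using smooth_compact_support_bounded[OF \<phi>(1) compact_cball[of 0 r] supp, of "[]"] by auto
    have "integrable lborel \<phi>"
      by (rule integrable_lborel_compact_support[OF
            borel_measurable_continuous_onI[OF smooth_on_imp_continuous_on[OF \<phi>(1)]] compact_cball[of 0 r] supp P])
    then show ?thesis by simp
  qed
  let ?I = "\<lambda>t. \<integral>w. f (z + t *\<^sub>R w) * \<phi> w \<partial>lborel"
  have in_cball: "z + t *\<^sub>R w \<in> cball z (2 * r)" if "norm w < r" "\<bar>t\<bar> < 3 / 2" for t w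
    using that mult_mono[of "\<bar>t\<bar>" "3 / 2" "norm w" r] r by (simp add: dist_norm)
  have D: "(?I has_derivative (\<lambda>h. \<integral>w. h *\<^sub>R dir_deriv w f (z + t *\<^sub>R w) * \<phi> w \<partial>lborel)) (at t)"
    if t: "t \<in> {- 3 / 2<..<3 / 2}" for t
  proof (rule has_derivative_integral_dominated(1)[OF _ t _ _ _ int\<phi>])
    show "open {- 3 / 2<..<3 / 2::real}" by simp
    fix x :: real assume x: "x \<in> {- 3 / 2<..<3 / 2}"
    show "integrable lborel (\<lambda>w. f (z + x *\<^sub>R w) * \<phi> w)"
      using x by (intro holomorphic_mult_compact_support(1)[OF hol r _ \<phi>]) auto
    fix w
    show "cmod (f (z + x *\<^sub>R w) * \<phi> w - f (z + t *\<^sub>R w) * \<phi> w) \<le> r * L * cmod (\<phi> w) * norm (x - t)"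
    proof (cases "norm w < r")
      case True
      have "cmod (f (z + x *\<^sub>R w) - f (z + t *\<^sub>R w)) \<le> L * norm ((x - t) *\<^sub>R w)"
        using L(3)[OF in_cball[OF True, of x] in_cball[OF True, of t]] x t by (auto simp: scaleR_diff_left abs_less_iff)
      also have "\<dots> \<le> L * (\<bar>x - t\<bar> * r)"
        using True L(1) by (intro mult_left_mono) (auto intro!: mult_left_mono)
      finally have "cmod (f (z + x *\<^sub>R w) - f (z + t *\<^sub>R w)) * cmod (\<phi> w) \<le> L * (\<bar>x - t\<bar> * r) * cmod (\<phi> w)"
        by (intro mult_right_mono) auto
      then show ?thesis
        unfolding left_diff_distrib[symmetric] norm_mult real_norm_def by (simp only: mult_ac)
    next
      case False
      then show ?thesis using \<phi>(2) by simp
    qed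
  next
    fix w
    show "((\<lambda>t. f (z + t *\<^sub>R w) * \<phi> w) has_derivative (\<lambda>h. h *\<^sub>R dir_deriv w f (z + t *\<^sub>R w) * \<phi> w)) (at t)"
    proof (cases "norm w < r")
      case True
      have abs_t: "\<bar>t\<bar> < 3 / 2" using t by (auto simp: abs_less_iff)
      have "z + t *\<^sub>R w \<in> \<Omega>"
        using in_cball[OF True abs_t] r subset_cball[of "2 * r" "4 * r" z] by auto
      note Df = holomorphic_several_has_derivative[OF hol this]
      have "((\<lambda>t. z + t *\<^sub>R w) has_derivative (\<lambda>h. h *\<^sub>R w)) (at t)"
        by (auto intro!: derivative_eq_intros)
      from has_derivative_mult_left[OF has_derivative_compose[OF this Df], of "\<phi> w"]
      show ?thesis using linear_scale[OF has_derivative_linear[OF Df]] by simp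
    next
      case False
      then show ?thesis using \<phi>(2) by simp
    qed
  qed
  \<comment> \<open>t = 0 is excepted, because the radial identity is obtained by dividing by t; at
    this point continuity suffices.\<close>
  have "?I 1 = ?I 0"
  proof (rule has_derivative_zero_unique_strong_interval[of "{0}" 0 1 ?I])
    show "continuous_on {0..1} ?I"
      by (intro continuous_at_imp_continuous_on ballI has_derivative_continuous[OF D]) auto
    fix x :: real assume x: "x \<in> {0..1} - {0}"
    have "(?I has_derivative (\<lambda>h. h *\<^sub>R (\<integral>w. dir_deriv w f (z + x *\<^sub>R w) * \<phi> w \<partial>lborel))) (at x)"
      using D[of x] x by simp
    then show "(?I has_derivative (\<lambda>h. 0)) (at x within {0..1})"
      using integral_radial_deriv_eq_0[OF hol r _ _ \<phi> inv, of x] x by (simp add: has_derivative_at_withinI)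
  qed auto
  then show ?thesis by simp
qed

section \<open>Mollification\<close>

definition convol :: "('a::euclidean_space \<Rightarrow> complex) \<Rightarrow> ('a \<Rightarrow> complex) \<Rightarrow> 'a \<Rightarrow> complex" where
  "convol G \<psi> z = (\<integral>w. G w * \<psi> (z - w) \<partial>lborel)"

lemma integrable_convol:
  fixes G :: "'a::euclidean_space \<Rightarrow> complex"
  assumes G: "integrable lborel G" and \<psi>: "continuous_on UNIV \<psi>" "\<And>x. norm (\<psi> x) \<le> C"
  shows "integrable lborel (\<lambda>w. G w * \<psi> (z - w))"
proof (rule Bochner_Integration.integrable_bound)
  show "integrable lborel (\<lambda>w. C * norm (G w))" using G by simp
  have "(\<lambda>w. \<psi> (z - w)) \<in> borel_measurable borel"
    by (intro borel_measurable_continuous_onI continuous_on_compose2[OF \<psi>(1)] continuous_intros) auto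
  then show "(\<lambda>w. G w * \<psi> (z - w)) \<in> borel_measurable lborel"
    using G by (intro borel_measurable_times borel_measurable_lborelI) auto
  show "AE w in lborel. norm (G w * \<psi> (z - w)) \<le> norm (C * norm (G w))"
  proof (intro AE_I2)
    fix w
    have "C \<ge> 0" using \<psi>(2)[of z] norm_ge_zero order_trans by blast
    then show "norm (G w * \<psi> (z - w)) \<le> norm (C * norm (G w))"
      using mult_right_mono[OF \<psi>(2)[of "z - w"], of "norm (G w)"] by (simp add: norm_mult mult.commute)
  qed
qed

text \<open>All derivatives fall on \<psi>, so integrability of \<open>G\<close> is enough for
  smoothness.\<close>

lemma has_derivative_convol:
  fixes G :: "'a::euclidean_space \<Rightarrow> complex"
  assumes G: "integrable lborel G" and \<psi>: "smooth_on UNIV \<psi>" "compact K" "\<And>x. x \<notin> K \<Longrightarrow> \<psi> x = 0"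
  shows "(convol G \<psi> has_derivative (\<lambda>h. convol G (dir_deriv h \<psi>) z)) (at z)"
proof -
  obtain L where L: "L \<ge> 0" "\<And>x y. norm (\<psi> x - \<psi> y) \<le> L * norm (x - y)"
    using smooth_compact_support_lipschitz[OF \<psi>] by blast
  obtain C where C: "C \<ge> 0" "\<And>x. norm (iter_deriv [] \<psi> x) \<le> C"
    using smooth_compact_support_bounded[OF \<psi>] by blast
  show ?thesis
    unfolding convol_def
  proof (rule has_derivative_integral_dominated(1)[OF open_UNIV UNIV_I, where B = "\<lambda>w. L * norm (G w)"])
  show "integrable lborel (\<lambda>w. G w * \<psi> (x - w))" for x
    using C(2) by (intro integrable_convol[OF G smooth_on_imp_continuous_on[OF \<psi>(1)], of C]) simp
  show "integrable lborel (\<lambda>w. L * norm (G w))" using G by simp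
  fix w
  have "((\<lambda>z. z - w) has_derivative (\<lambda>h. h)) (at z)" by (auto intro!: derivative_eq_intros)
  from has_derivative_compose[OF this smooth_on_has_derivative[OF \<psi>(1) UNIV_I]]
  show "((\<lambda>z. G w * \<psi> (z - w)) has_derivative (\<lambda>h. G w * dir_deriv h \<psi> (z - w))) (at z)"
    by (rule has_derivative_mult_right)
  show "norm (G w * \<psi> (x - w) - G w * \<psi> (z - w)) \<le> L * norm (G w) * norm (x - z)" for x
    using mult_left_mono[OF L(2)[of "x - w" "z - w"], of "norm (G w)"]
    by (simp add: right_diff_distrib[symmetric] norm_mult mult_ac)
  qed
qed

lemma iter_deriv_convol:
  fixes G :: "'a::euclidean_space \<Rightarrow> complex"
  assumes G: "integrable lborel G" and \<psi>: "smooth_on UNIV \<psi>" "compact K" "\<And>x. x \<notin> K \<Longrightarrow> \<psi> x = 0"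
  shows "iter_deriv vs (convol G \<psi>) = convol G (iter_deriv vs \<psi>)"
proof (induction vs)
  case (Cons v vs)
  have "dir_deriv v (convol G (iter_deriv vs \<psi>)) z = convol G (dir_deriv v (iter_deriv vs \<psi>)) z" for z
    by (rule dir_deriv_eqI[OF has_derivative_convol[OF G smooth_on_iter_deriv[OF \<psi>(1)] \<psi>(2)]])
       (rule iter_deriv_outside_support[OF compact_imp_closed[OF \<psi>(2)] \<psi>(3)])
  then show ?case unfolding iter_deriv_Cons Cons by (intro ext)
qed simp

lemma smooth_on_convol:
  fixes G :: "'a::euclidean_space \<Rightarrow> complex"
  assumes G: "integrable lborel G" and \<psi>: "smooth_on UNIV \<psi>" "compact K" "\<And>x. x \<notin> K \<Longrightarrow> \<psi> x = 0"
  shows "smooth_on UNIV (convol G \<psi>)"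
  unfolding smooth_on_def
proof (intro allI ballI)
  fix vs z
  have "iter_deriv vs (convol G \<psi>) = convol G (iter_deriv vs \<psi>)"
    by (rule iter_deriv_convol[OF G \<psi>(1,2)]) (rule \<psi>(3))
  then show "iter_deriv vs (convol G \<psi>) differentiable (at z)"
    using differentiableI[OF has_derivative_convol[OF G smooth_on_iter_deriv[OF \<psi>(1)] \<psi>(2)
        iter_deriv_outside_support[OF compact_imp_closed[OF \<psi>(2)] \<psi>(3)]]]
    by simp
qed

text \<open>Nothing is known about f outside its domain; after truncation its convolution is smooth
  on the whole space.\<close>

definition ball_part :: "'a::euclidean_space \<Rightarrow> real \<Rightarrow> ('a \<Rightarrow> complex) \<Rightarrow> 'a \<Rightarrow> complex" where
  "ball_part z r f w = indicator (ball z r) w *\<^sub>R f w"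

lemma integrable_ball_part:
  assumes "continuous_on (cball z r) f"
  shows "integrable lborel (ball_part z r f)"
proof -
  have "bounded (f ` cball z r)"
    by (intro compact_imp_bounded compact_continuous_image assms compact_cball)
  then obtain M where M: "\<And>u. u \<in> cball z r \<Longrightarrow> cmod (f u) \<le> M"
    unfolding bounded_iff by (auto simp del: mem_cball)
  have "continuous_on (ball z r) f" using continuous_on_subset[OF assms ball_subset_cball] .
  from borel_measurable_continuous_on_indicator[OF _ this]
  have meas: "ball_part z r f \<in> borel_measurable borel" by (simp add: ball_part_def[abs_def])
  have bound: "cmod (ball_part z r f w) \<le> max M 0" for w
    using M[of w] by (auto simp: ball_part_def indicator_def)
  have supp: "ball_part z r f w = 0" if "w \<notin> cball z r" for w
    using that by (auto simp: ball_part_def indicator_def)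
  show ?thesis
    by (rule integrable_lborel_compact_support[OF meas compact_cball[of z r] supp bound])
qed

lemma convol_ball_part_bound:
  fixes z :: "'a::euclidean_space"
  assumes f: "continuous_on (cball z r) f" "\<And>u. u \<in> ball z r \<Longrightarrow> cmod (f u) \<le> A"
    and \<psi>: "continuous_on UNIV \<psi>" "\<And>x. cmod (\<psi> x) \<le> C" and "A \<ge> 0" "r \<ge> 0"
  shows "cmod (convol (ball_part z r f) \<psi> x) \<le> A * C * (unit_ball_vol (DIM('a)) * r ^ DIM('a))"
proof -
  have int: "integrable lborel (\<lambda>w. ball_part z r f w * \<psi> (x - w))"
    by (rule integrable_convol[OF integrable_ball_part[OF f(1)] \<psi>])
  have int2: "integrable lborel (\<lambda>w. indicator (ball z r) w *\<^sub>R (A * C))"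
    by (intro integrable_indicator) (use emeasure_lborel_ball_finite[of z r] in auto)
  have "C \<ge> 0" using \<psi>(2)[of x] norm_ge_zero order_trans by blast
  have "cmod (convol (ball_part z r f) \<psi> x) \<le> (\<integral>w. norm (ball_part z r f w * \<psi> (x - w)) \<partial>lborel)"
    unfolding convol_def by (rule integral_norm_bound)
  also have "\<dots> \<le> (\<integral>w. indicator (ball z r) w *\<^sub>R (A * C) \<partial>lborel)"
  proof (rule integral_mono[OF _ int2])
    fix w
    show "norm (ball_part z r f w * \<psi> (x - w)) \<le> indicator (ball z r) w *\<^sub>R (A * C)"
      using f(2)[of w] \<psi>(2) \<open>A \<ge> 0\<close> \<open>C \<ge> 0\<close>
      by (auto simp: ball_part_def indicator_def norm_mult intro!: mult_mono)
  qed (use int in simp)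
  also have "\<dots> = A * C * measure lborel (ball z r)" by simp
  finally show ?thesis using content_ball[of r z] assms by simp
qed

section \<open>The normalised rotation-invariant mollifier\<close>

definition kernel_mass :: "'a::euclidean_space itself \<Rightarrow> real \<Rightarrow> real" where
  "kernel_mass _ r = (\<integral>w. bump (0::'a) (r / 2) r w \<partial>lborel)"

definition kernel :: "real \<Rightarrow> 'a::euclidean_space \<Rightarrow> complex" where
  "kernel r w = of_real (bump 0 (r / 2) r w / kernel_mass TYPE('a) r)"

lemma integrable_bump:
  assumes "r > 0"
  shows "integrable lborel (bump (0::'a::euclidean_space) (r / 2) r)"
proof (rule integrable_lborel_compact_support[OF _ compact_cball[of 0 r]])
  show "bump 0 (r / 2) r \<in> borel_measurable borel"
    by (intro borel_measurable_continuous_onI smooth_on_imp_continuous_on smooth_on_bump)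
  show "norm (bump 0 (r / 2) r x) \<le> 1" for x :: 'a
    using bump_ge_0[of 0 "r / 2" r x] bump_le_1[of 0 "r / 2" r x] by simp
  show "bump 0 (r / 2) r x = 0" if "x \<notin> cball 0 r" for x :: 'a
    using that assms by (intro bump_eq_0) auto
qed

text \<open>The bump is 1 on the ball of radius r / 2. This lower bound on the mass produces the
  factor r^-DIM in the kernel estimates.\<close>

lemma kernel_mass_ge:
  assumes "r > 0"
  shows "unit_ball_vol (DIM('a)) * (r / 2) ^ DIM('a) \<le> kernel_mass TYPE('a::euclidean_space) r"
proof -
  have "unit_ball_vol (DIM('a)) * (r / 2) ^ DIM('a) = (\<integral>w. indicator (cball (0::'a) (r / 2)) w \<partial>lborel)"
    using content_cball[of "r / 2" "0::'a"] assms by simp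
  also have "\<dots> \<le> kernel_mass TYPE('a) r"
    unfolding kernel_mass_def
  proof (rule integral_mono[OF _ integrable_bump[OF assms]])
    show "integrable lborel (indicat_real (cball (0::'a) (r / 2)))"
      by (intro integrable_real_indicator) (use emeasure_lborel_cball_finite[of "0::'a" "r / 2"] in auto)
    show "indicat_real (cball 0 (r / 2)) w \<le> bump 0 (r / 2) r w" for w :: 'a
      using assms bump_ge_0[of 0 "r / 2" r w] bump_eq_1[of "r / 2" r w 0] by (auto simp: indicator_def)
  qed
  finally show ?thesis .
qed

lemma kernel_mass_pos: "r > 0 \<Longrightarrow> kernel_mass TYPE('a::euclidean_space) r > 0"
  by (rule less_le_trans[OF _ kernel_mass_ge]) auto

lemma smooth_on_kernel: "smooth_on UNIV (kernel r :: 'a::euclidean_space \<Rightarrow> complex)"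
proof -
  have "smooth_on UNIV (\<lambda>w::'a. bump 0 (r / 2) r w * inverse (kernel_mass TYPE('a) r))"
    by (intro smooth_on_mult smooth_on_bump smooth_on_const open_UNIV)
  from smooth_on_of_real[OF open_UNIV this] show ?thesis
    unfolding kernel_def[abs_def] divide_inverse[of _ "kernel_mass TYPE('a) r"] .
qed

lemma kernel_eq_0: "r > 0 \<Longrightarrow> r \<le> norm w \<Longrightarrow> kernel r w = 0"
  by (simp add: kernel_def bump_eq_0)

lemma kernel_outside: "r > 0 \<Longrightarrow> w \<notin> cball 0 r \<Longrightarrow> kernel r w = 0"
  by (rule kernel_eq_0) auto

lemma kernel_uminus: "kernel r (- w) = kernel r w"
  by (simp add: kernel_def bump_def)

lemma integral_kernel:
  assumes "r > 0"
  shows "(\<integral>w. kernel r (w::'a::euclidean_space) \<partial>lborel) = 1"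
proof -
  have "(\<integral>w. kernel r (w::'a) \<partial>lborel) = of_real (\<integral>w. bump (0::'a) (r / 2) r w / kernel_mass TYPE('a) r \<partial>lborel)"
    unfolding kernel_def by (rule integral_complex_of_real)
  also have "(\<integral>w. bump (0::'a) (r / 2) r w / kernel_mass TYPE('a) r \<partial>lborel) = kernel_mass TYPE('a) r / kernel_mass TYPE('a) r"
    unfolding kernel_mass_def by (rule integral_divide_zero)
  also have "\<dots> = 1" using kernel_mass_pos[OF assms, where 'a = 'a] by simp
  finally show ?thesis by simp
qed

text \<open>The kernel is a function of w \<bullet> w, so its derivative along v is governed by v
  \<bullet> w, which is zero for v = \<i> w.\<close>

lemma kernel_dir_deriv_rotation: "dir_deriv (\<i> *s w) (kernel r) (w :: complex ^ 'n::finite) = 0"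
proof -
  \<comment> \<open>c, d and m rewrite the kernel as a constant multiple of 1 - smooth_step applied
    to an affine function of x \<bullet> x.\<close>
  define c where "c = inverse (r\<^sup>2 - (r / 2)\<^sup>2)"
  define d where "d = 1 - (r / 2)\<^sup>2 * c"
  define m where "m = inverse (kernel_mass TYPE(complex ^ 'n) r)"
  let ?q = "\<lambda>x::complex ^ 'n. (x \<bullet> x) * c + d"
  have q: "(?q has_derivative (\<lambda>v. 2 * (v \<bullet> w) * c)) (at w)"
    by (auto intro!: derivative_eq_intros simp: inner_commute)
  note S = has_derivative_compose[OF q smooth_on_has_derivative[OF smooth_on_smooth_step UNIV_I]]
  note B = has_derivative_mult_left[OF has_derivative_diff[OF has_derivative_const[of 1] S], of m]
  have "1 + ((norm x)\<^sup>2 - (r / 2)\<^sup>2) / (r\<^sup>2 - (r / 2)\<^sup>2) = ?q x" for x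
    unfolding power2_norm_eq_inner divide_inverse[of _ "r\<^sup>2 - (r / 2)\<^sup>2"] c_def[symmetric] d_def
    by (simp add: algebra_simps)
  then have k: "kernel r = (\<lambda>x. complex_of_real ((1 - smooth_step (?q x)) * m))"
    unfolding kernel_def[abs_def] bump_def diff_zero divide_inverse[of _ "kernel_mass _ r"] m_def by simp
  have "(kernel r has_derivative (\<lambda>v. of_real ((0 - dir_deriv (2 * (v \<bullet> w) * c) smooth_step (?q w)) * m))) (at w)"
    unfolding k by (rule bounded_linear.has_derivative[OF bounded_linear_of_real B])
  note D = dir_deriv_eqI[OF this]
  have "dir_deriv 0 smooth_step t = 0" for t
    using linear_0[OF has_derivative_linear[OF smooth_on_has_derivative[OF smooth_on_smooth_step UNIV_I]]] .
  then show ?thesis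
    unfolding D by (simp add: inner_i_smult_self)
qed

text \<open>Every kernel is a rescaled copy of the one profile with r = 1: normalising the mass
  costs r^-DIM and each derivative costs 1/r.\<close>

lemma iter_deriv_kernel_bound:
  obtains C where "C \<ge> 0"
    "\<And>r w. r > 0 \<Longrightarrow> cmod (iter_deriv vs (kernel r) (w::'a::euclidean_space)) \<le> C / r ^ (DIM('a) + length vs)"
proof -
  let ?\<beta> = "\<lambda>w::'a. complex_of_real (bump 0 (1 / 2) 1 w)"
  have \<beta>: "smooth_on UNIV ?\<beta>" by (intro smooth_on_of_real smooth_on_bump open_UNIV)
  have supp: "?\<beta> w = 0" if "w \<notin> cball 0 1" for w
    using that by (simp add: bump_eq_0)
  obtain C where C: "C \<ge> 0" "\<And>w. cmod (iter_deriv vs ?\<beta> w) \<le> C"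
    using smooth_compact_support_bounded[OF \<beta> compact_cball[of 0 1] supp] by blast
  let ?V = "unit_ball_vol (DIM('a))"
  define C' where "C' = C * 2 ^ DIM('a) / ?V"
  have V: "?V > 0" by simp
  have bound: "cmod (iter_deriv vs (kernel r) w) \<le> C' / r ^ (DIM('a) + length vs)" if r: "r > 0" for r and w :: 'a
  proof -
    let ?c = "complex_of_real (inverse (kernel_mass TYPE('a) r))"
    have "bump 0 (r / 2) r x = bump 0 (1 / 2) 1 ((1 / r) *\<^sub>R x + 0)" for x :: 'a
      using r by (simp add: bump_def power_divide power_mult_distrib field_simps)
    then have k: "kernel r = (\<lambda>x::'a. ?c * ?\<beta> ((1 / r) *\<^sub>R x + 0))"
      unfolding kernel_def[abs_def] divide_inverse[of _ "kernel_mass TYPE('a) r"]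
      by (simp only: of_real_mult mult.commute)
    have "iter_deriv vs (kernel r) w = ?c * iter_deriv vs (\<lambda>x. ?\<beta> ((1 / r) *\<^sub>R x + 0)) w"
      unfolding k by (rule iter_deriv_linear[OF bounded_linear_mult_right smooth_on_affine[OF \<beta>] open_UNIV UNIV_I])
    also have "\<dots> = ?c * ((1 / r) ^ length vs *\<^sub>R iter_deriv vs ?\<beta> ((1 / r) *\<^sub>R w + 0))"
      unfolding iter_deriv_affine[OF \<beta>] ..
    finally have "cmod (iter_deriv vs (kernel r) w)
        = inverse (kernel_mass TYPE('a) r) * ((1 / r) ^ length vs * cmod (iter_deriv vs ?\<beta> ((1 / r) *\<^sub>R w + 0)))"
      using r kernel_mass_pos[OF r, where 'a = 'a] by (simp only: norm_mult norm_of_real norm_scaleR abs_inverse abs_of_pos abs_of_nonneg zero_le_power zero_le_divide_1_iff less_imp_le)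
    also have "\<dots> \<le> inverse (?V * (r / 2) ^ DIM('a)) * ((1 / r) ^ length vs * C)"
      using r C V kernel_mass_ge[OF r, where 'a = 'a] kernel_mass_pos[OF r, where 'a = 'a]
      by (intro mult_mono le_imp_inverse_le) auto
    also have "\<dots> = C' / r ^ (DIM('a) + length vs)"
      using r by (simp add: C'_def power_add power_divide field_simps)
    finally show ?thesis .
  qed
  have "C' \<ge> 0" using C(1) V by (simp add: C'_def)
  from that[OF this bound] show ?thesis .
qed

text \<open>The kernel reaches distance r from z, and z lies within r of \<open>z0\<close>, so
  truncating f at radius 2 r loses nothing. The mean value property asks for 4 r around z, hence for
  5 r around \<open>z0\<close>.\<close>

lemma holomorphic_eq_convol:
  fixes f :: "complex ^ 'n::finite \<Rightarrow> complex"
  assumes hol: "holomorphic_several f \<Omega>" and r: "r > 0" "cball z0 (5 * r) \<subseteq> \<Omega>" and z: "z \<in> ball z0 r"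
  shows "f z = convol (ball_part z0 (2 * r) f) (kernel r) z"
proof -
  have sub: "cball z (4 * r) \<subseteq> \<Omega>"
    using z r by (intro order_trans[OF _ r(2)]) (auto simp: cball_subset_cball_iff dist_commute)
  let ?g = "\<lambda>u. ball_part z0 (2 * r) f u * kernel r (z - u)"
  have "continuous_on (cball z0 (2 * r)) f"
    using r by (intro continuous_on_subset[OF holomorphic_several_continuous_on[OF hol]] order_trans[OF _ r(2)] subset_cball) simp
  then have "ball_part z0 (2 * r) f \<in> borel_measurable borel"
    using borel_measurable_integrable[OF integrable_ball_part] by auto
  moreover have "(\<lambda>u. kernel r (z - u)) \<in> borel_measurable borel"
    by (intro borel_measurable_continuous_onI
        continuous_on_compose2[OF smooth_on_imp_continuous_on[OF smooth_on_kernel]] continuous_intros) auto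
  ultimately have meas: "?g \<in> borel_measurable borel" by simp
  have "convol (ball_part z0 (2 * r) f) (kernel r) z = (\<integral>u. ?g u \<partial>distr lborel borel ((+) z))"
    by (simp add: convol_def lborel_distr_plus)
  also have "\<dots> = (\<integral>w. ?g (z + w) \<partial>lborel)"
    using meas by (intro integral_distr) auto
  also have "\<dots> = (\<integral>w. f (z + w) * kernel r w \<partial>lborel)"
  proof (rule Bochner_Integration.integral_cong[OF refl])
    fix w
    show "?g (z + w) = f (z + w) * kernel r w"
    proof (cases "norm w < r")
      case True
      have "dist z0 (z + w) \<le> dist z0 z + norm w" using dist_triangle[of z0 "z + w" z] by (simp add: dist_norm)
      then show ?thesis using True z by (simp add: ball_part_def kernel_uminus indicator_def)
    next
      case False
      then show ?thesis using r by (simp add: kernel_eq_0 kernel_uminus)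
    qed
  qed
  also have "\<dots> = f z * (\<integral>w. kernel r (w :: complex ^ 'n) \<partial>lborel)"
    by (intro holomorphic_mean_value[OF hol r(1) sub smooth_on_kernel] kernel_dir_deriv_rotation kernel_eq_0 r(1))
  finally show ?thesis using integral_kernel[OF r(1), where 'a = "complex ^ 'n"] by simp
qed

section \<open>Interior regularity and locally uniform limits of holomorphic functions\<close>

lemma obtain_cball_subset:
  fixes \<Omega> :: "'a::metric_space set"
  assumes "open \<Omega>" "z \<in> \<Omega>"
  obtains r where "r > 0" "cball z (5 * r) \<subseteq> \<Omega>"
proof -
  obtain e where "e > 0" "cball z e \<subseteq> \<Omega>" using assms open_contains_cball[of \<Omega>] by blast
  then show ?thesis using that[of "e / 5"] by simp
qed

lemma smooth_on_holomorphic: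
  assumes hol: "holomorphic_several f \<Omega>" and "open \<Omega>"
  shows "smooth_on \<Omega> f"
proof -
  have "\<exists>r>0. smooth_on (ball z0 r) f" if z0: "z0 \<in> \<Omega>" for z0
  proof -
    obtain r where r: "r > 0" "cball z0 (5 * r) \<subseteq> \<Omega>" by (rule obtain_cball_subset[OF \<open>open \<Omega>\<close> z0])
    have "continuous_on (cball z0 (2 * r)) f"
      using r by (intro continuous_on_subset[OF holomorphic_several_continuous_on[OF hol]] order_trans[OF _ r(2)] subset_cball) simp
    note smooth = smooth_on_convol[OF integrable_ball_part[OF this] smooth_on_kernel compact_cball[of 0 r] kernel_outside[OF r(1)]]
    have "smooth_on (ball z0 r) f"
      by (rule iffD2[OF smooth_on_cong[OF open_ball holomorphic_eq_convol[OF hol r]] smooth_on_subset[OF smooth subset_UNIV]])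
    then show ?thesis using r(1) by blast
  qed
  note loc = this
  show ?thesis
    unfolding smooth_on_def
  proof (intro allI ballI)
    fix vs z0 assume "z0 \<in> \<Omega>"
    then obtain r where "r > 0" "smooth_on (ball z0 r) f" using loc by blast
    then show "iter_deriv vs f differentiable (at z0)" unfolding smooth_on_def by simp
  qed
qed

text \<open>In the convolution formula the derivatives fall on the kernel; the volume of the ball of
  radius 2 r cancels the factor r^-DIM. The constant is uniform in f, \<Omega>, r, z and A.\<close>

lemma holomorphic_iter_deriv_bound:
  obtains C where "C \<ge> 0" "\<And>f (\<Omega> :: (complex ^ 'n::finite) set) r z A. holomorphic_several f \<Omega> \<Longrightarrow> r > 0 \<Longrightarrow>
    cball z (5 * r) \<subseteq> \<Omega> \<Longrightarrow> A \<ge> 0 \<Longrightarrow> (\<And>u. u \<in> ball z (2 * r) \<Longrightarrow> cmod (f u) \<le> A) \<Longrightarrow>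
    cmod (iter_deriv vs f z) \<le> C * A / r ^ length vs"
proof -
  let ?d = "DIM(complex ^ 'n)"
  let ?V = "unit_ball_vol (real ?d)"
  obtain C where C: "C \<ge> 0" "\<And>r w. r > 0 \<Longrightarrow> cmod (iter_deriv vs (kernel r) (w::complex ^ 'n)) \<le> C / r ^ (?d + length vs)"
    using iter_deriv_kernel_bound[where 'a = "complex ^ 'n" and vs = vs] by blast
  have bound: "cmod (iter_deriv vs f z) \<le> (C * ?V * 2 ^ ?d) * A / r ^ length vs"
    if hol: "holomorphic_several f \<Omega>" and r: "r > 0" "cball z (5 * r) \<subseteq> \<Omega>" and "A \<ge> 0"
      and A: "\<And>u. u \<in> ball z (2 * r) \<Longrightarrow> cmod (f u) \<le> A"
    for f and \<Omega> :: "(complex ^ 'n) set" and r z A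
  proof -
    have cont: "continuous_on (cball z (2 * r)) f"
      using r by (intro continuous_on_subset[OF holomorphic_several_continuous_on[OF hol]] order_trans[OF _ r(2)] subset_cball) simp
    have "iter_deriv vs f z = iter_deriv vs (convol (ball_part z (2 * r) f) (kernel r)) z"
      using r by (intro iter_deriv_cong[OF open_ball holomorphic_eq_convol[OF hol r]]) auto
    also have "\<dots> = convol (ball_part z (2 * r) f) (iter_deriv vs (kernel r)) z"
      using iter_deriv_convol[OF integrable_ball_part[OF cont] smooth_on_kernel compact_cball[of 0 r] kernel_outside[OF r(1)]] by simp
    also have "cmod \<dots> \<le> A * (C / r ^ (?d + length vs)) * (?V * (2 * r) ^ ?d)"
      using r by (intro convol_ball_part_bound[OF cont A] C \<open>A \<ge> 0\<close> smooth_on_imp_continuous_on smooth_on_iter_deriv smooth_on_kernel) auto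
    also have "\<dots> = (C * ?V * 2 ^ ?d) * A / r ^ length vs"
      using r by (simp add: power_add power_mult_distrib)
    finally show ?thesis .
  qed
  have "C * ?V * 2 ^ ?d \<ge> 0" using C(1) by simp
  from that[OF this bound] show ?thesis .
qed

text \<open>The convolution formula survives the limit, so f is differentiable. The same formula for
  derivatives shows that those of \<open>F n\<close> converge to those of f, which carries complex
  linearity over.\<close>

lemma holomorphic_locally_uniform_limit:
  fixes f :: "complex ^ 'n::finite \<Rightarrow> complex"
  assumes "open \<Omega>" and hol: "\<And>n. holomorphic_several (F n) \<Omega>"
    and lim: "\<And>K. compact K \<Longrightarrow> K \<subseteq> \<Omega> \<Longrightarrow> uniform_limit K F f sequentially"
  shows "holomorphic_several f \<Omega>"
proof -
  have "f differentiable (at z0) \<and> (\<forall>c v. dir_deriv (c *s v) f z0 = c * dir_deriv v f z0)" if z0: "z0 \<in> \<Omega>" for z0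
  proof -
    obtain r where r: "r > 0" "cball z0 (5 * r) \<subseteq> \<Omega>" by (rule obtain_cball_subset[OF \<open>open \<Omega>\<close> z0])
    have sub: "cball z0 (2 * r) \<subseteq> \<Omega>" using r by (intro order_trans[OF _ r(2)] subset_cball) simp
    have contF: "continuous_on (cball z0 (2 * r)) (F n)" for n
      using continuous_on_subset[OF holomorphic_several_continuous_on[OF hol] sub] .
    have unif: "uniform_limit (cball z0 (2 * r)) F f sequentially" by (rule lim[OF compact_cball sub])
    have contf: "continuous_on (cball z0 (2 * r)) f"
      by (rule uniform_limit_theorem[OF _ unif]) (auto intro: contF always_eventually)
    let ?V = "unit_ball_vol (real DIM(complex ^ 'n)) * (2 * r) ^ DIM(complex ^ 'n)"
    have conv: "(\<lambda>n. convol (ball_part z0 (2 * r) (F n)) \<psi> z) \<longlonglongrightarrow> convol (ball_part z0 (2 * r) f) \<psi> z"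
      if \<psi>: "continuous_on UNIV \<psi>" "\<And>x. cmod (\<psi> x) \<le> C" for \<psi> C z
    proof (rule LIMSEQ_I)
      fix e :: real assume "e > 0"
      have "C \<ge> 0" using \<psi>(2)[of z] norm_ge_zero order_trans by blast
      \<comment> \<open>The added 1 keeps the denominator positive when C = 0.\<close>
      define d where "d = e / (C * ?V + 1)"
      have V: "?V \<ge> 0" using r by simp
      have d: "d > 0" "d * C * ?V < e"
      proof -
        have pos: "C * ?V + 1 > 0" using V \<open>C \<ge> 0\<close> by (simp add: add_nonneg_pos)
        then show "d > 0" using \<open>e > 0\<close> by (simp add: d_def)
        have "d * (C * ?V + 1) = e" using pos by (simp add: d_def)
        then show "d * C * ?V < e" using \<open>d > 0\<close> by (simp add: algebra_simps)
      qed
      have "\<forall>\<^sub>F n in sequentially. \<forall>x\<in>cball z0 (2 * r). dist (F n x) (f x) < d"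
        using unif d(1) unfolding uniform_limit_iff by blast
      then obtain N where N: "\<And>n x. n \<ge> N \<Longrightarrow> x \<in> cball z0 (2 * r) \<Longrightarrow> dist (F n x) (f x) < d"
        unfolding eventually_sequentially by blast
      show "\<exists>N. \<forall>n\<ge>N. norm (convol (ball_part z0 (2 * r) (F n)) \<psi> z - convol (ball_part z0 (2 * r) f) \<psi> z) < e"
      proof (intro exI[of _ N] allI impI)
        fix n assume n: "n \<ge> N"
        have "convol (ball_part z0 (2 * r) (F n)) \<psi> z - convol (ball_part z0 (2 * r) f) \<psi> z
            = convol (ball_part z0 (2 * r) (\<lambda>x. F n x - f x)) \<psi> z"
          unfolding convol_def
            Bochner_Integration.integral_diff[OF integrable_convol[OF integrable_ball_part[OF contF] \<psi>]
              integrable_convol[OF integrable_ball_part[OF contf] \<psi>], symmetric]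
          by (intro Bochner_Integration.integral_cong refl) (simp add: ball_part_def algebra_simps)
        also have "norm \<dots> \<le> d * C * ?V"
          using N[OF n] r d(1)
          by (intro convol_ball_part_bound \<psi> continuous_on_diff contF contf) (auto simp: dist_norm less_imp_le)
        finally show "norm (convol (ball_part z0 (2 * r) (F n)) \<psi> z - convol (ball_part z0 (2 * r) f) \<psi> z) < e"
          using d(2) by simp
      qed
    qed
    note outside = kernel_outside[OF r(1), where 'a = "complex ^ 'n"]
    note D = has_derivative_convol[OF integrable_ball_part smooth_on_kernel compact_cball[of 0 r] outside]
    have bdd: "\<exists>C. \<forall>x::complex ^ 'n. cmod (iter_deriv vs (kernel r) x) \<le> C" for vs
    proof -
      obtain C where "C \<ge> 0" and C: "\<And>r w. r > 0 \<Longrightarrow> cmod (iter_deriv vs (kernel r) (w::complex ^ 'n)) \<le> C / r ^ (DIM(complex ^ 'n) + length vs)"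
        using iter_deriv_kernel_bound[where 'a = "complex ^ 'n" and vs = vs] by blast
      show ?thesis
        by (intro exI[of _ "C / r ^ (DIM(complex ^ 'n) + length vs)"] allI C r(1))
    qed
    have eq: "f z = convol (ball_part z0 (2 * r) f) (kernel r) z" if z: "z \<in> ball z0 r" for z
    proof (rule LIMSEQ_unique)
      have "uniform_limit {z} F f sequentially"
        using z sub r by (intro lim) auto
      then show "(\<lambda>n. F n z) \<longlonglongrightarrow> f z" by (rule tendsto_uniform_limitI) simp
      obtain C where "\<And>x::complex ^ 'n. cmod (kernel r x) \<le> C" using bdd[of "[]"] by auto
      from conv[OF smooth_on_imp_continuous_on[OF smooth_on_kernel] this, of z]
      show "(\<lambda>n. F n z) \<longlonglongrightarrow> convol (ball_part z0 (2 * r) f) (kernel r) z"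
        unfolding holomorphic_eq_convol[OF hol r z, symmetric] .
    qed
    have Df: "(f has_derivative (\<lambda>h. convol (ball_part z0 (2 * r) f) (dir_deriv h (kernel r)) z0)) (at z0)"
      by (rule has_derivative_transform_within_open[OF D[OF contf] open_ball[of z0 r]]) (use r eq in auto)
    have DF: "dir_deriv h (F n) z0 = convol (ball_part z0 (2 * r) (F n)) (dir_deriv h (kernel r)) z0" for h n
      by (rule dir_deriv_eqI, rule has_derivative_transform_within_open[OF D[OF contF] open_ball[of z0 r]])
         (use r holomorphic_eq_convol[OF hol r] in auto)
    have limD: "(\<lambda>n. dir_deriv h (F n) z0) \<longlonglongrightarrow> dir_deriv h f z0" for h
    proof -
      obtain C where "\<And>x::complex ^ 'n. cmod (dir_deriv h (kernel r) x) \<le> C"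
        using bdd[of "[h]"] by (auto simp: dir_deriv_def)
      from conv[OF smooth_on_imp_continuous_on[OF smooth_on_dir_deriv[OF smooth_on_kernel]] this, of z0]
      show ?thesis unfolding DF dir_deriv_eqI[OF Df] .
    qed
    have "dir_deriv (c *s v) f z0 = c * dir_deriv v f z0" for c v
      by (rule LIMSEQ_unique[OF limD])
         (unfold holomorphic_several_dir_deriv_smult[OF hol z0], intro tendsto_mult tendsto_const limD)
    then show ?thesis using differentiableI[OF Df] by blast
  qed
  then show ?thesis by (intro holomorphic_severalI) auto
qed

section \<open>Weak derivatives of smooth functions\<close>

lemma test_functionsE:
  assumes "\<phi> \<in> test_functions \<Omega>"
  obtains K where "smooth_on UNIV \<phi>" "compact K" "K \<subseteq> \<Omega>" "\<And>x. x \<notin> K \<Longrightarrow> \<phi> x = 0"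
  using assms unfolding test_functions_def by auto

lemma test_functions_smooth: "\<phi> \<in> test_functions \<Omega> \<Longrightarrow> smooth_on UNIV \<phi>"
  unfolding test_functions_def by simp

text \<open>F is arbitrary outside \<Omega>, but the product is smooth on \<Omega> and zero off K,
  and these two open sets cover the space.\<close>

lemma smooth_on_mult_compact_support:
  fixes F \<phi> :: "'a::euclidean_space \<Rightarrow> complex"
  assumes "open \<Omega>" "smooth_on \<Omega> F" "smooth_on UNIV \<phi>" "compact K" "K \<subseteq> \<Omega>" "\<And>x. x \<notin> K \<Longrightarrow> \<phi> x = 0"
  shows "smooth_on UNIV (\<lambda>x. F x * \<phi> x)"
proof -
  have 1: "smooth_on \<Omega> (\<lambda>x. F x * \<phi> x)"
    by (intro smooth_on_mult assms(1,2) smooth_on_subset[OF assms(3)]) simp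
  have op: "open (- K)" using compact_imp_closed[OF assms(4)] by (simp add: open_Compl)
  have 2: "smooth_on (- K) (\<lambda>x. F x * \<phi> x)"
    by (rule iffD2[OF smooth_on_cong[OF op] smooth_on_const[OF op, of 0]]) (use assms(6) in auto)
  have "\<Omega> \<union> - K = UNIV" using assms(5) by blast
  with smooth_on_Un[OF 1 2] show ?thesis by simp
qed

lemma test_functions_mult:
  assumes "open \<Omega>" "smooth_on \<Omega> F" "\<phi> \<in> test_functions \<Omega>"
  shows "(\<lambda>x. F x * \<phi> x) \<in> test_functions \<Omega>"
proof -
  obtain K where K: "smooth_on UNIV \<phi>" "compact K" "K \<subseteq> \<Omega>" "\<And>x. x \<notin> K \<Longrightarrow> \<phi> x = 0"
    using test_functionsE[OF assms(3)] by blast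
  show ?thesis
    by (rule test_functionsI[OF smooth_on_mult_compact_support[OF assms(1,2) K] K(2,3)]) (auto simp: K(4))
qed

lemma test_functions_iter_deriv:
  assumes "\<phi> \<in> test_functions \<Omega>"
  shows "iter_deriv vs \<phi> \<in> test_functions \<Omega>"
proof -
  obtain K where K: "smooth_on UNIV \<phi>" "compact K" "K \<subseteq> \<Omega>" "\<And>x. x \<notin> K \<Longrightarrow> \<phi> x = 0"
    using test_functionsE[OF assms] by blast
  show ?thesis
    by (rule test_functionsI[OF smooth_on_iter_deriv[OF K(1)] K(2,3)
          iter_deriv_outside_support[OF compact_imp_closed[OF K(2)] K(4)]])
qed

lemma test_functions_cmult: "\<phi> \<in> test_functions \<Omega> \<Longrightarrow> (\<lambda>x. c * \<phi> x) \<in> test_functions \<Omega>"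
  unfolding test_functions_def by (auto intro!: smooth_on_mult smooth_on_const)

lemma test_functions_zero: "(\<lambda>_. 0) \<in> test_functions \<Omega>"
  by (rule test_functionsI[of _ "{}"]) (auto intro: smooth_on_const)

lemma integral_test_function:
  assumes "open \<Omega>" "\<phi> \<in> test_functions \<Omega>"
  shows "(LINT x|lebesgue_on \<Omega>. \<phi> x) = (\<integral>x. \<phi> x \<partial>lborel)" "integrable (lebesgue_on \<Omega>) \<phi>" "integrable lborel \<phi>"
proof -
  obtain K where K: "smooth_on UNIV \<phi>" "compact K" "K \<subseteq> \<Omega>" "\<And>x. x \<notin> K \<Longrightarrow> \<phi> x = 0"
    using test_functionsE[OF assms(2)] by blast
  obtain C where "C \<ge> 0" and C: "\<And>x. norm (\<phi> x) \<le> C"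
    using compact_support_bounded[OF smooth_on_imp_continuous_on[OF K(1)] K(2,4)] by blast
  have eq: "(\<lambda>x. indicator \<Omega> x *\<^sub>R \<phi> x) = \<phi>"
    using K(3,4) by (auto simp: indicator_def fun_eq_iff)
  have meas: "\<phi> \<in> borel_measurable borel"
    by (intro borel_measurable_continuous_onI smooth_on_imp_continuous_on K(1))
  show int: "integrable lborel \<phi>"
    by (rule integrable_lborel_compact_support[OF meas K(2,4) C])
  show "(LINT x|lebesgue_on \<Omega>. \<phi> x) = (\<integral>x. \<phi> x \<partial>lborel)" "integrable (lebesgue_on \<Omega>) \<phi>"
    using integral_lebesgue_on_eq_lborel[OF assms(1), of \<phi>] meas int unfolding eq by auto
qed

lemma integral_by_parts:
  assumes "open \<Omega>" "smooth_on \<Omega> F" "\<phi> \<in> test_functions \<Omega>"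
  shows "(LINT x|lebesgue_on \<Omega>. F x * dir_deriv v \<phi> x) = - (LINT x|lebesgue_on \<Omega>. dir_deriv v F x * \<phi> x)"
proof -
  obtain K where K: "smooth_on UNIV \<phi>" "compact K" "K \<subseteq> \<Omega>" "\<And>x. x \<notin> K \<Longrightarrow> \<phi> x = 0"
    using test_functionsE[OF assms(3)] by blast
  have t: "dir_deriv v \<phi> \<in> test_functions \<Omega>"
    using test_functions_iter_deriv[OF assms(3), of "[v]"] by (simp add: dir_deriv_def)
  note t1 = integral_test_function[OF assms(1) test_functions_mult[OF assms(1,2) t]]
  note t2 = integral_test_function[OF assms(1) test_functions_mult[OF assms(1) smooth_on_dir_deriv[OF assms(2)] assms(3)]]
  note smooth = smooth_on_mult_compact_support[OF assms(1,2) K]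
  have "dir_deriv v (\<lambda>x. F x * \<phi> x) x = F x * dir_deriv v \<phi> x + dir_deriv v F x * \<phi> x" for x
  proof (cases "x \<in> \<Omega>")
    case True
    show ?thesis
      by (rule smooth_on_dir_deriv_mult[OF assms(2) smooth_on_subset[OF K(1)] True]) simp
  next
    case False
    then have x: "x \<notin> K" using K(3) by blast
    have "iter_deriv [v] (\<lambda>x. F x * \<phi> x) x = 0" "iter_deriv [v] \<phi> x = 0"
      by (rule iter_deriv_outside_support[OF compact_imp_closed[OF K(2)] _ x]; simp add: K(4))+
    then show ?thesis using K(4)[OF x] by (simp add: dir_deriv_def)
  qed
  then have "dir_deriv v (\<lambda>x. F x * \<phi> x) = (\<lambda>x. F x * dir_deriv v \<phi> x + dir_deriv v F x * \<phi> x)" by (rule ext)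
  moreover have "(\<integral>x. dir_deriv v (\<lambda>x. F x * \<phi> x) x \<partial>lborel) = 0"
    by (rule integral_smooth_dir_deriv_eq_0[OF smooth K(2)]) (auto simp: K(4))
  ultimately have "(\<integral>x. F x * dir_deriv v \<phi> x \<partial>lborel) + (\<integral>x. dir_deriv v F x * \<phi> x \<partial>lborel) = 0"
    using t1(3) t2(3) by simp
  then show ?thesis unfolding t1(1) t2(1) by (simp add: add_eq_0_iff)
qed

text \<open>The outermost derivative of \<phi> is moved first and becomes the innermost one on F;
  hence the reversal of the list. In this form the interchange of mixed derivatives never
  enters.\<close>

lemma integral_by_parts_iter:
  assumes "open \<Omega>" "smooth_on \<Omega> F" "\<phi> \<in> test_functions \<Omega>"
  shows "(LINT x|lebesgue_on \<Omega>. F x * iter_deriv vs \<phi> x)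
    = (-1) ^ length vs * (LINT x|lebesgue_on \<Omega>. iter_deriv (rev vs) F x * \<phi> x)"
  using assms(2)
proof (induction vs arbitrary: F)
  case (Cons v vs)
  have "(LINT x|lebesgue_on \<Omega>. F x * iter_deriv (v # vs) \<phi> x) = - (LINT x|lebesgue_on \<Omega>. dir_deriv v F x * iter_deriv vs \<phi> x)"
    unfolding iter_deriv_Cons by (rule integral_by_parts[OF assms(1) Cons.prems test_functions_iter_deriv[OF assms(3)]])
  also have "\<dots> = - ((-1) ^ length vs * (LINT x|lebesgue_on \<Omega>. iter_deriv (rev vs) (dir_deriv v F) x * \<phi> x))"
    by (subst Cons.IH[OF smooth_on_dir_deriv[OF Cons.prems]]) (rule refl)
  finally show ?case by (simp add: iter_deriv_snoc)
qed simp

text \<open>Names the choice made inside \<open>partial_deriv\<close>, so that weak derivatives of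
  smooth functions are iterated derivatives along this very list.\<close>

definition index_list :: "'a multiset \<Rightarrow> 'a list" where
  "index_list \<alpha> = (SOME vs. mset vs = \<alpha>)"

lemma mset_index_list: "mset (index_list \<alpha>) = \<alpha>"
  unfolding index_list_def using ex_mset[of \<alpha>] by (rule someI_ex)

lemma length_index_list: "length (index_list \<alpha>) = size \<alpha>"
  by (metis mset_index_list size_mset)

lemma partial_deriv_eq: "partial_deriv \<alpha> \<phi> = iter_deriv (index_list \<alpha>) \<phi>"
  unfolding partial_deriv_def index_list_def ..

lemma has_weak_deriv_smooth:
  assumes "open \<Omega>" "smooth_on \<Omega> F"
  shows "has_weak_deriv \<Omega> \<alpha> F (iter_deriv (rev (index_list \<alpha>)) F)"
  unfolding has_weak_deriv_def partial_deriv_eq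
  using integral_by_parts_iter[OF assms] by (simp add: length_index_list)

section \<open>Uniqueness of weak derivatives and bounds for Sobolev norms\<close>

lemma has_weak_deriv_unique:
  assumes \<Omega>: "open \<Omega>" "bounded \<Omega>" and w: "w1 \<in> L2 \<Omega>" "w2 \<in> L2 \<Omega>"
    and D: "has_weak_deriv \<Omega> \<alpha> f w1" "has_weak_deriv \<Omega> \<alpha> f w2"
  shows "AE x in lebesgue_on \<Omega>. w1 x = w2 x"
proof -
  have "AE x in lebesgue_on \<Omega>. w1 x - w2 x = 0"
  proof (rule AE_eq_0_if_integral_test_functions_eq_0[OF \<Omega>(1) L2_integrable[OF \<Omega> L2_diff[OF w]]])
    fix \<phi> :: "'a \<Rightarrow> complex" assume \<phi>: "\<phi> \<in> test_functions \<Omega>"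
    obtain K where K: "smooth_on UNIV \<phi>" "compact K" "K \<subseteq> \<Omega>" "\<And>x. x \<notin> K \<Longrightarrow> \<phi> x = 0"
      using test_functionsE[OF \<phi>] by blast
    obtain C where "C \<ge> 0" and C: "\<And>x. norm (\<phi> x) \<le> C"
      using compact_support_bounded[OF smooth_on_imp_continuous_on[OF K(1)] K(2,4)] by blast
    have L: "\<phi> \<in> L2 \<Omega>"
      by (rule L2_boundedI[OF \<Omega> borel_measurable_lebesgue_on_continuous(1)[OF \<Omega>(1)] C])
         (rule continuous_on_subset[OF smooth_on_imp_continuous_on[OF K(1)] subset_UNIV])
    have "(LINT x|lebesgue_on \<Omega>. w1 x * \<phi> x) = (LINT x|lebesgue_on \<Omega>. w2 x * \<phi> x)"
      using D \<phi> unfolding has_weak_deriv_def by force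
    then show "(LINT x|lebesgue_on \<Omega>. (w1 x - w2 x) * \<phi> x) = 0"
      unfolding left_diff_distrib
      by (simp add: Bochner_Integration.integral_diff[OF L2_mult_integrable[OF w(1) L] L2_mult_integrable[OF w(2) L]])
  qed
  then show ?thesis by (rule eventually_mono) simp
qed

lemma L2_norm_weak_deriv:
  assumes \<Omega>: "open \<Omega>" "bounded \<Omega>" and w: "w \<in> L2 \<Omega>" "has_weak_deriv \<Omega> \<alpha> f w"
  shows "L2_norm \<Omega> (weak_deriv \<Omega> \<alpha> f) = L2_norm \<Omega> w"
proof -
  have *: "weak_deriv \<Omega> \<alpha> f \<in> L2 \<Omega> \<and> has_weak_deriv \<Omega> \<alpha> f (weak_deriv \<Omega> \<alpha> f)"
    unfolding weak_deriv_def by (rule someI[of _ w]) (use w in simp)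
  then show ?thesis
    using has_weak_deriv_unique[OF \<Omega> _ w(1) _ w(2)]
    by (intro L2_norm_cong_AE L2_measurable) (use w in auto)
qed

lemma sobolev_norm_nonneg: "sobolev_norm \<Omega> k f \<ge> 0"
  unfolding sobolev_norm_def by (simp add: sum_nonneg)

text \<open>Converts a uniform bound on derivatives into a bound on \<open>sobolev_norm\<close>; the
  added 1 makes it positive, so that it can be divided by.\<close>

definition sup_const :: "'a::euclidean_space set \<Rightarrow> nat \<Rightarrow> real" where
  "sup_const \<Omega> k = sqrt (real (card (multi_indices k :: 'a multiset set)) * measure lebesgue \<Omega>) + 1"

lemma sup_const_pos: "sup_const \<Omega> k > 0"
  unfolding sup_const_def by (intro add_nonneg_pos) simp_all

lemma sobolev_bounded_derivs:
  fixes \<Omega> :: "'a::euclidean_space set"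
  assumes \<Omega>: "open \<Omega>" "bounded \<Omega>" and F: "smooth_on \<Omega> F"
    and C: "\<And>vs x. set vs \<subseteq> Basis \<Longrightarrow> length vs \<le> k \<Longrightarrow> x \<in> \<Omega> \<Longrightarrow> cmod (iter_deriv vs F x) \<le> C" "C \<ge> 0"
  shows "F \<in> sobolev \<Omega> k" "sobolev_norm \<Omega> k F \<le> C * sup_const \<Omega> k"
proof -
  have meas: "iter_deriv vs F \<in> borel_measurable (lebesgue_on \<Omega>)" for vs
    by (intro borel_measurable_lebesgue_on_continuous(1) \<Omega> smooth_on_imp_continuous_on smooth_on_iter_deriv F)
  have L2: "iter_deriv vs F \<in> L2 \<Omega>" "L2_norm \<Omega> (iter_deriv vs F) \<le> C * sqrt (measure lebesgue \<Omega>)"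
    if "set vs \<subseteq> Basis" "length vs \<le> k" for vs
    using L2_boundedI[OF \<Omega> meas C(1)[OF that]] L2_norm_boundedI[OF \<Omega> meas C(1)[OF that] C(2)] by auto
  have idx: "set (rev (index_list \<alpha>)) \<subseteq> Basis" "length (rev (index_list \<alpha>)) \<le> k" if "\<alpha> \<in> multi_indices k" for \<alpha> :: "'a multiset"
    using that mset_index_list[of \<alpha>] length_index_list[of \<alpha>] set_mset_mset[of "index_list \<alpha>"]
    by (auto simp: multi_indices_def)
  note weak = has_weak_deriv_smooth[OF \<Omega>(1) F]
  have "F \<in> L2 \<Omega>" using L2(1)[of "[]"] by simp
  then show "F \<in> sobolev \<Omega> k"
    unfolding sobolev_def using L2(1)[OF idx] weak by blast
  have "(\<Sum>\<alpha>\<in>multi_indices k. (L2_norm \<Omega> (weak_deriv \<Omega> \<alpha> F))\<^sup>2)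
      \<le> (\<Sum>\<alpha>\<in>(multi_indices k :: 'a multiset set). (C * sqrt (measure lebesgue \<Omega>))\<^sup>2)"
  proof (rule sum_mono)
    fix \<alpha> :: "'a multiset" assume \<alpha>: "\<alpha> \<in> multi_indices k"
    show "(L2_norm \<Omega> (weak_deriv \<Omega> \<alpha> F))\<^sup>2 \<le> (C * sqrt (measure lebesgue \<Omega>))\<^sup>2"
      unfolding L2_norm_weak_deriv[OF \<Omega> L2(1)[OF idx[OF \<alpha>]] weak]
      by (rule power_mono[OF L2(2)[OF idx[OF \<alpha>]] L2_norm_nonneg])
  qed
  also have "\<dots> = C\<^sup>2 * (real (card (multi_indices k :: 'a multiset set)) * measure lebesgue \<Omega>)"
    by (simp add: power_mult_distrib)
  finally have "sobolev_norm \<Omega> k F \<le> sqrt (C\<^sup>2 * (real (card (multi_indices k :: 'a multiset set)) * measure lebesgue \<Omega>))"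
    unfolding sobolev_norm_def by (rule real_sqrt_le_mono)
  also have "\<dots> \<le> C * sup_const \<Omega> k"
    using C(2) by (simp add: real_sqrt_mult sup_const_def distrib_left)
  finally show "sobolev_norm \<Omega> k F \<le> C * sup_const \<Omega> k" .
qed

lemma test_functions_iter_deriv_bounded:
  assumes "\<phi> \<in> test_functions (\<Omega> :: 'a::euclidean_space set)"
  obtains C where "C \<ge> 0" "\<And>vs x. set vs \<subseteq> Basis \<Longrightarrow> length vs \<le> k \<Longrightarrow> cmod (iter_deriv vs \<phi> x) \<le> C"
proof -
  obtain K where K: "smooth_on UNIV \<phi>" "compact K" "K \<subseteq> \<Omega>" "\<And>x. x \<notin> K \<Longrightarrow> \<phi> x = 0"
    using test_functionsE[OF assms] by blast
  let ?V = "{vs :: 'a list. set vs \<subseteq> Basis \<and> length vs \<le> k}"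
  have "\<exists>C. C \<ge> 0 \<and> (\<forall>x. cmod (iter_deriv vs \<phi> x) \<le> C)" for vs
    using smooth_compact_support_bounded[OF K(1,2,4)] by blast
  then have "\<exists>C. \<forall>vs. C vs \<ge> 0 \<and> (\<forall>x. cmod (iter_deriv vs \<phi> x) \<le> C vs)"
    by (intro choice) blast
  then obtain C where C: "\<And>vs. C vs \<ge> 0" "\<And>vs x. cmod (iter_deriv vs \<phi> x) \<le> C vs" by blast
  have fin: "finite ?V" by (rule finite_lists_length_le[OF finite_Basis])
  have bound: "cmod (iter_deriv vs \<phi> x) \<le> sum C ?V" if "set vs \<subseteq> Basis" "length vs \<le> k" for vs x
  proof -
    have "C vs \<le> sum C ?V" by (rule member_le_sum) (use fin that C(1) in auto)
    then show ?thesis using C(2)[of vs x] by linarith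
  qed
  have "sum C ?V \<ge> 0" by (intro sum_nonneg C(1))
  from that[OF this bound] show ?thesis .
qed

lemma test_functions_sobolev:
  assumes "open \<Omega>" "bounded \<Omega>" "\<phi> \<in> test_functions \<Omega>"
  shows "\<phi> \<in> sobolev \<Omega> k"
proof -
  obtain C where C: "C \<ge> 0" "\<And>vs x. set vs \<subseteq> Basis \<Longrightarrow> length vs \<le> k \<Longrightarrow> cmod (iter_deriv vs \<phi> x) \<le> C"
    using test_functions_iter_deriv_bounded[OF assms(3), of k] by blast
  show ?thesis
    by (rule sobolev_bounded_derivs(1)[OF assms(1,2) smooth_on_subset[OF test_functions_smooth[OF assms(3)] subset_UNIV] C(2,1)])
qed

lemma test_functions_sobolev0:
  assumes "open \<Omega>" "bounded \<Omega>" "\<phi> \<in> test_functions \<Omega>"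
  shows "\<phi> \<in> sobolev0 \<Omega> k"
proof -
  have "sobolev_norm \<Omega> k (\<lambda>x. \<phi> x - \<phi> x) \<le> 0 * sup_const \<Omega> k"
    by (rule sobolev_bounded_derivs(2)[OF assms(1,2)])
       (auto simp: iter_deriv_0 intro: smooth_on_const[OF assms(1)])
  then have "sobolev_norm \<Omega> k (\<lambda>x. \<phi> x - \<phi> x) < \<epsilon>" if "\<epsilon> > 0" for \<epsilon> using that by simp
  then show ?thesis
    unfolding sobolev0_def using test_functions_sobolev[OF assms] assms(3) by blast
qed

lemma L2_norm_le_sobolev_norm:
  fixes \<Omega> :: "'a::euclidean_space set"
  assumes "open \<Omega>" "bounded \<Omega>" "f \<in> sobolev \<Omega> k"
  shows "L2_norm \<Omega> f \<le> sobolev_norm \<Omega> k f"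
proof -
  have f: "f \<in> L2 \<Omega>" using assms(3) by (simp add: sobolev_def)
  have "index_list ({#} :: 'a multiset) = []" using length_index_list[of "{#} :: 'a multiset"] by simp
  then have "has_weak_deriv \<Omega> {#} f f" by (simp add: has_weak_deriv_def partial_deriv_eq)
  note eq = L2_norm_weak_deriv[OF assms(1,2) f this]
  have "(L2_norm \<Omega> (weak_deriv \<Omega> {#} f))\<^sup>2 \<le> (\<Sum>\<alpha>\<in>multi_indices k. (L2_norm \<Omega> (weak_deriv \<Omega> \<alpha> f))\<^sup>2)"
    by (rule member_le_sum[OF _ _ finite_multi_indices]) (auto simp: multi_indices_def)
  then show ?thesis
    unfolding sobolev_norm_def eq by (rule real_le_rsqrt)
qed

section \<open>Functionals tested on smooth functions\<close>

text \<open>The two properties behind estimates by the negative norm: homogeneity, for rescaling a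
  test function into the unit ball, and boundedness, for a finite supremum. Both pass to differences
  T - \<open>embed_L2\<close> directly.\<close>

definition tame_functional :: "'a::euclidean_space set \<Rightarrow> nat \<Rightarrow> 'a functional \<Rightarrow> bool" where
  "tame_functional \<Omega> k T \<longleftrightarrow>
     (\<forall>c. \<forall>\<phi>\<in>test_functions \<Omega>. T (\<lambda>x. c * \<phi> x) = cnj c * T \<phi>) \<and>
     (\<exists>M. \<forall>h\<in>sobolev0 \<Omega> k. cmod (T h) \<le> M * sobolev_norm \<Omega> k h)"

lemma tame_functional_neg_sobolev:
  assumes "open \<Omega>" "bounded \<Omega>" "T \<in> neg_sobolev \<Omega> k"
  shows "tame_functional \<Omega> k T"
  using assms(3) test_functions_sobolev0[OF assms(1,2)]
  unfolding tame_functional_def neg_sobolev_def by simp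

lemma tame_functional_embed:
  assumes "open \<Omega>" "bounded \<Omega>" "f \<in> L2 \<Omega>"
  shows "tame_functional \<Omega> k (embed_L2 \<Omega> k f)"
  unfolding tame_functional_def
proof (intro conjI allI ballI)
  fix c and \<phi> :: "'a \<Rightarrow> complex" assume \<phi>: "\<phi> \<in> test_functions \<Omega>"
  have "L2_inner \<Omega> f (\<lambda>x. c * \<phi> x) = (LINT x|lebesgue_on \<Omega>. cnj c * (f x * cnj (\<phi> x)))"
    unfolding L2_inner_def by (simp add: mult_ac)
  then show "embed_L2 \<Omega> k f (\<lambda>x. c * \<phi> x) = cnj c * embed_L2 \<Omega> k f \<phi>"
    using test_functions_sobolev0[OF assms(1,2) \<phi>] test_functions_sobolev0[OF assms(1,2) test_functions_cmult[OF \<phi>]]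
    by (simp add: embed_L2_def L2_inner_def)
next
  have "cmod (embed_L2 \<Omega> k f h) \<le> L2_norm \<Omega> f * sobolev_norm \<Omega> k h" if h: "h \<in> sobolev0 \<Omega> k" for h
  proof -
    have s: "h \<in> sobolev \<Omega> k" "h \<in> L2 \<Omega>" using h by (auto simp: sobolev0_def sobolev_def)
    have "cmod (embed_L2 \<Omega> k f h) \<le> L2_norm \<Omega> f * L2_norm \<Omega> h"
      using L2_inner_Cauchy_Schwarz[OF assms(3) s(2)] h by (simp add: embed_L2_def)
    also have "\<dots> \<le> L2_norm \<Omega> f * sobolev_norm \<Omega> k h"
      by (intro mult_left_mono L2_norm_le_sobolev_norm assms s L2_norm_nonneg)
    finally show ?thesis .
  qed
  then show "\<exists>M. \<forall>h\<in>sobolev0 \<Omega> k. cmod (embed_L2 \<Omega> k f h) \<le> M * sobolev_norm \<Omega> k h" by blast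
qed

lemma tame_functional_diff:
  assumes "tame_functional \<Omega> k S" "tame_functional \<Omega> k T"
  shows "tame_functional \<Omega> k (\<lambda>h. S h - T h)"
proof -
  obtain M N where M: "\<And>h. h \<in> sobolev0 \<Omega> k \<Longrightarrow> cmod (S h) \<le> M * sobolev_norm \<Omega> k h"
    and N: "\<And>h. h \<in> sobolev0 \<Omega> k \<Longrightarrow> cmod (T h) \<le> N * sobolev_norm \<Omega> k h"
    using assms unfolding tame_functional_def by blast
  have "cmod (S h - T h) \<le> (M + N) * sobolev_norm \<Omega> k h" if "h \<in> sobolev0 \<Omega> k" for h
    using norm_triangle_ineq4[of "S h" "T h"] M[OF that] N[OF that] by (simp add: distrib_right)
  then show ?thesis
    using assms unfolding tame_functional_def by (auto simp: right_diff_distrib)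
qed

lemma neg_sobolev_norm_bdd:
  assumes "tame_functional \<Omega> k T"
  shows "bdd_above ((\<lambda>h. cmod (T h)) ` {h \<in> sobolev0 \<Omega> k. sobolev_norm \<Omega> k h \<le> 1})"
proof -
  obtain M where M: "\<And>h. h \<in> sobolev0 \<Omega> k \<Longrightarrow> cmod (T h) \<le> M * sobolev_norm \<Omega> k h"
    using assms unfolding tame_functional_def by blast
  have "cmod (T h) \<le> \<bar>M\<bar>" if "h \<in> sobolev0 \<Omega> k" "sobolev_norm \<Omega> k h \<le> 1" for h
  proof -
    have "cmod (T h) \<le> \<bar>M\<bar> * sobolev_norm \<Omega> k h"
      using M[OF that(1)] mult_right_mono[OF abs_ge_self[of M] sobolev_norm_nonneg[of \<Omega> k h]] by linarith
    also have "\<dots> \<le> \<bar>M\<bar> * 1" using that(2) by (intro mult_left_mono) auto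
    finally show ?thesis by simp
  qed
  then show ?thesis by (intro bdd_aboveI2[of _ _ "\<bar>M\<bar>"]) auto
qed

lemma tame_functional_le:
  assumes "tame_functional \<Omega> k T" "h \<in> sobolev0 \<Omega> k" "sobolev_norm \<Omega> k h \<le> 1"
  shows "cmod (T h) \<le> neg_sobolev_norm \<Omega> k T"
  unfolding neg_sobolev_norm_def
  by (rule cSUP_upper[OF _ neg_sobolev_norm_bdd[OF assms(1)]]) (use assms in simp)

lemma neg_sobolev_norm_nonneg:
  assumes "open \<Omega>" "bounded \<Omega>" "tame_functional \<Omega> k T"
  shows "neg_sobolev_norm \<Omega> k T \<ge> 0"
proof -
  have "sobolev_norm \<Omega> k (\<lambda>x. 0) \<le> 0 * sup_const \<Omega> k"
    by (rule sobolev_bounded_derivs(2)[OF assms(1,2)])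
       (auto simp: iter_deriv_0 intro: smooth_on_const[OF assms(1)])
  then have "cmod (T (\<lambda>x. 0)) \<le> neg_sobolev_norm \<Omega> k T"
    by (intro tame_functional_le[OF assms(3)] test_functions_sobolev0 assms test_functions_zero) simp
  then show ?thesis using norm_ge_zero order_trans by blast
qed

text \<open>Dividing \<phi> by C times \<open>sup_const\<close> puts it into the unit ball over
  which the negative norm takes its supremum; homogeneity undoes the scaling.\<close>

lemma tame_functional_test_bound:
  fixes \<Omega> :: "'a::euclidean_space set"
  assumes \<Omega>: "open \<Omega>" "bounded \<Omega>" and T: "tame_functional \<Omega> k T" and \<phi>: "\<phi> \<in> test_functions \<Omega>"
    and C: "\<And>vs x. set vs \<subseteq> Basis \<Longrightarrow> length vs \<le> k \<Longrightarrow> cmod (iter_deriv vs \<phi> x) \<le> C" "C > 0"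
  shows "cmod (T \<phi>) \<le> C * sup_const \<Omega> k * neg_sobolev_norm \<Omega> k T"
proof -
  define s where "s = C * sup_const \<Omega> k"
  have s: "s > 0" using mult_pos_pos[OF C(2) sup_const_pos[of \<Omega> k]] by (simp add: s_def)
  let ?h = "\<lambda>x. complex_of_real (1 / s) * \<phi> x"
  have h: "?h \<in> test_functions \<Omega>" by (rule test_functions_cmult[OF \<phi>])
  have "sobolev_norm \<Omega> k ?h \<le> (C / s) * sup_const \<Omega> k"
  proof (rule sobolev_bounded_derivs(2)[OF \<Omega> smooth_on_subset[OF test_functions_smooth[OF h] subset_UNIV]])
    fix vs :: "'a list" and x assume vs: "set vs \<subseteq> Basis" "length vs \<le> k"
    have "iter_deriv vs ?h x = complex_of_real (1 / s) * iter_deriv vs \<phi> x"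
      by (rule iter_deriv_linear[OF bounded_linear_mult_right test_functions_smooth[OF \<phi>] open_UNIV UNIV_I])
    then show "cmod (iter_deriv vs ?h x) \<le> C / s"
      using C(1)[OF vs] s by (simp add: norm_mult norm_divide divide_right_mono)
  qed (use C(2) s in simp)
  also have "\<dots> = 1" using C(2) sup_const_pos[of \<Omega> k] by (simp add: s_def)
  finally have "cmod (T ?h) \<le> neg_sobolev_norm \<Omega> k T"
    by (rule tame_functional_le[OF T test_functions_sobolev0[OF \<Omega> h]])
  moreover have "T ?h = complex_of_real (1 / s) * T \<phi>"
    using T \<phi> unfolding tame_functional_def by (metis complex_cnj_complex_of_real)
  ultimately have "cmod (T \<phi>) / s \<le> neg_sobolev_norm \<Omega> k T"
    using s by (simp add: norm_mult norm_divide)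
  then show ?thesis using s by (simp add: s_def field_simps)
qed

section \<open>The Bergman projection\<close>

definition kernel_at :: "real \<Rightarrow> 'a::euclidean_space \<Rightarrow> 'a \<Rightarrow> complex" where
  "kernel_at r z w = kernel r (w - z)"

lemma smooth_on_kernel_at: "smooth_on UNIV (kernel_at r z)"
  using smooth_on_affine[OF smooth_on_kernel, of r 1 "- z"] by (simp add: kernel_at_def[abs_def])

lemma iter_deriv_kernel_at: "iter_deriv vs (kernel_at r z) w = iter_deriv vs (kernel r) (w - z)"
  using iter_deriv_affine[OF smooth_on_kernel, of vs r 1 "- z" w] by (simp add: kernel_at_def[abs_def])

lemma test_functions_kernel_at:
  assumes "r > 0" "cball z r \<subseteq> \<Omega>"
  shows "kernel_at r z \<in> test_functions \<Omega>"
proof (rule test_functionsI[OF smooth_on_kernel_at compact_cball[of z r] assms(2)])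
  show "kernel_at r z w = 0" if "w \<notin> cball z r" for w
    using that assms(1) unfolding kernel_at_def by (intro kernel_outside) (auto simp: dist_norm norm_minus_commute)
qed

lemma cnj_kernel_at: "cnj (kernel_at r z w) = kernel_at r z w"
  by (simp add: kernel_at_def kernel_def)

text \<open>Integrating over \<Omega> turns point evaluation into a pairing with a test function, to
  which both the Cauchy-Schwarz inequality and functionals of negative order apply.\<close>

lemma holomorphic_eq_integral_kernel:
  fixes f :: "complex ^ 'n::finite \<Rightarrow> complex"
  assumes "open \<Omega>" "holomorphic_several f \<Omega>" "r > 0" "cball z (5 * r) \<subseteq> \<Omega>"
  shows "f z = (LINT w|lebesgue_on \<Omega>. f w * kernel_at r z w)"
proof -
  have sub: "cball z r \<subseteq> \<Omega>" using assms(3) by (intro order_trans[OF _ assms(4)] subset_cball) simp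
  have "f z = convol (ball_part z (2 * r) f) (kernel r) z"
    by (rule holomorphic_eq_convol[OF assms(2-4)]) (use assms(3) in simp)
  also have "\<dots> = (\<integral>w. f w * kernel_at r z w \<partial>lborel)"
    unfolding convol_def
  proof (rule Bochner_Integration.integral_cong[OF refl])
    fix w
    have k: "kernel r (z - w) = kernel_at r z w"
      using kernel_uminus[of r "w - z"] by (simp add: kernel_at_def)
    show "ball_part z (2 * r) f w * kernel r (z - w) = f w * kernel_at r z w"
    proof (cases "dist z w < 2 * r")
      case True
      then show ?thesis unfolding k by (simp add: ball_part_def)
    next
      case False
      then have "r \<le> norm (w - z)" using assms(3) by (simp add: dist_norm norm_minus_commute)
      then have "kernel_at r z w = 0" unfolding kernel_at_def by (rule kernel_eq_0[OF assms(3)])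
      then show ?thesis unfolding k by simp
    qed
  qed
  also have "\<dots> = (LINT w|lebesgue_on \<Omega>. f w * kernel_at r z w)"
    by (rule integral_test_function(1)[symmetric, OF assms(1) test_functions_mult[OF assms(1)
            smooth_on_holomorphic[OF assms(2,1)] test_functions_kernel_at[OF assms(3) sub]]])
  finally show ?thesis .
qed

lemma test_functions_L2:
  assumes "open \<Omega>" "bounded \<Omega>" "\<phi> \<in> test_functions \<Omega>"
  shows "\<phi> \<in> L2 \<Omega>"
  using test_functions_sobolev[OF assms, of 0] by (simp add: sobolev_def)

lemma bergman_space_L2: "f \<in> bergman_space \<Omega> \<Longrightarrow> f \<in> L2 \<Omega>"
  by (simp add: bergman_space_def)

lemma bergman_space_holomorphic: "f \<in> bergman_space \<Omega> \<Longrightarrow> holomorphic_several f \<Omega>"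
  by (simp add: bergman_space_def)

lemma bergman_space_add: "f \<in> bergman_space \<Omega> \<Longrightarrow> g \<in> bergman_space \<Omega> \<Longrightarrow> (\<lambda>z. f z + g z) \<in> bergman_space \<Omega>"
  by (simp add: bergman_space_def L2_add holomorphic_several_add)

lemma bergman_space_scale: "f \<in> bergman_space \<Omega> \<Longrightarrow> (\<lambda>z. c * f z) \<in> bergman_space \<Omega>"
  by (simp add: bergman_space_def L2_scale holomorphic_several_mult[OF holomorphic_several_const])

lemma bergman_space_diff: "f \<in> bergman_space \<Omega> \<Longrightarrow> g \<in> bergman_space \<Omega> \<Longrightarrow> (\<lambda>z. f z - g z) \<in> bergman_space \<Omega>"
  using bergman_space_add[OF _ bergman_space_scale[of g \<Omega> "-1"], of f] by simp

lemma bergman_space_zero: "(\<lambda>_. 0) \<in> bergman_space \<Omega>"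
  by (simp add: bergman_space_def L2_def holomorphic_several_const)

text \<open>One radius serves all of K by compactness; then f z is an inner product with a kernel of
  bounded norm.\<close>

lemma bergman_space_bound_compact:
  fixes \<Omega> :: "(complex ^ 'n::finite) set"
  assumes \<Omega>: "open \<Omega>" "bounded \<Omega>" and K: "compact K" "K \<subseteq> \<Omega>"
  obtains C where "C \<ge> 0" "\<And>f z. f \<in> bergman_space \<Omega> \<Longrightarrow> z \<in> K \<Longrightarrow> cmod (f z) \<le> C * L2_norm \<Omega> f"
proof -
  obtain e where e: "e > 0" "(\<Union>x\<in>K. cball x e) \<subseteq> \<Omega>"
    by (rule compact_subset_open_imp_cball_epsilon_subset[OF K(1) \<Omega>(1) K(2)])
  define r where "r = e / 5"
  have r: "r > 0" using e by (simp add: r_def)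
  obtain C where C: "C \<ge> 0" "\<And>x. cmod (kernel r (x :: complex ^ 'n)) \<le> C"
    using compact_support_bounded[OF smooth_on_imp_continuous_on[OF smooth_on_kernel] compact_cball[of 0 r]
        kernel_outside[OF r, where 'a = "complex ^ 'n"]] by blast
  have "cmod (f z) \<le> (C * sqrt (measure lebesgue \<Omega>)) * L2_norm \<Omega> f"
    if f: "f \<in> bergman_space \<Omega>" and z: "z \<in> K" for f z
  proof -
    have sub: "cball z (5 * r) \<subseteq> \<Omega>" using e z by (auto simp: r_def)
    have sub': "cball z r \<subseteq> \<Omega>" using r by (intro order_trans[OF _ sub] subset_cball) simp
    note t = test_functions_kernel_at[OF r sub']
    have "cmod (f z) = cmod (L2_inner \<Omega> f (kernel_at r z))"
      using holomorphic_eq_integral_kernel[OF \<Omega>(1) bergman_space_holomorphic[OF f] r sub]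
      by (simp add: L2_inner_def cnj_kernel_at)
    also have "\<dots> \<le> L2_norm \<Omega> f * L2_norm \<Omega> (kernel_at r z)"
      by (rule L2_inner_Cauchy_Schwarz[OF bergman_space_L2[OF f] test_functions_L2[OF \<Omega> t]])
    also have "\<dots> \<le> L2_norm \<Omega> f * (C * sqrt (measure lebesgue \<Omega>))"
      using C by (intro mult_left_mono L2_norm_nonneg
          L2_norm_boundedI[OF \<Omega> L2_measurable[OF test_functions_L2[OF \<Omega> t]]]) (auto simp: kernel_at_def)
    finally show ?thesis by (simp only: mult.commute)
  qed
  note bound = this
  have "C * sqrt (measure lebesgue \<Omega>) \<ge> 0" using C(1) by simp
  from that[OF this bound] show ?thesis .
qed

lemma bergman_space_eq_0:
  assumes "open \<Omega>" "bounded \<Omega>" "f \<in> bergman_space \<Omega>" "L2_norm \<Omega> f = 0" "z \<in> \<Omega>"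
  shows "f z = 0"
proof -
  obtain C where "C \<ge> 0" and C: "\<And>f y. f \<in> bergman_space \<Omega> \<Longrightarrow> y \<in> {z} \<Longrightarrow> cmod (f y) \<le> C * L2_norm \<Omega> f"
    using bergman_space_bound_compact[OF assms(1,2), of "{z}"] assms(5) by auto
  show ?thesis using C[OF assms(3), of z] assms(4) by simp
qed

section \<open>Construction of the orthogonal projection\<close>

lemma L2_inner_add_left:
  "f \<in> L2 \<Omega> \<Longrightarrow> g \<in> L2 \<Omega> \<Longrightarrow> h \<in> L2 \<Omega> \<Longrightarrow> L2_inner \<Omega> (\<lambda>x. f x + g x) h = L2_inner \<Omega> f h + L2_inner \<Omega> g h"
  unfolding L2_inner_def distrib_right by (rule Bochner_Integration.integral_add[OF L2_inner_integrable L2_inner_integrable])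

lemma L2_inner_diff_left:
  "f \<in> L2 \<Omega> \<Longrightarrow> g \<in> L2 \<Omega> \<Longrightarrow> h \<in> L2 \<Omega> \<Longrightarrow> L2_inner \<Omega> (\<lambda>x. f x - g x) h = L2_inner \<Omega> f h - L2_inner \<Omega> g h"
  unfolding L2_inner_def left_diff_distrib by (rule Bochner_Integration.integral_diff[OF L2_inner_integrable L2_inner_integrable])

lemma L2_inner_scale_left: "L2_inner \<Omega> (\<lambda>x. c * f x) h = c * L2_inner \<Omega> f h"
  unfolding L2_inner_def mult.assoc by simp

lemma L2_norm_diff_scale:
  assumes "f \<in> L2 \<Omega>" "g \<in> L2 \<Omega>"
  shows "(L2_norm \<Omega> (\<lambda>x. f x - c * g x))\<^sup>2
    = (L2_norm \<Omega> f)\<^sup>2 - 2 * Re (cnj c * L2_inner \<Omega> f g) + (cmod c)\<^sup>2 * (L2_norm \<Omega> g)\<^sup>2"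
proof -
  have pt: "(cmod (a - c * b))\<^sup>2 = (cmod a)\<^sup>2 - 2 * Re (cnj c * (a * cnj b)) + (cmod c)\<^sup>2 * (cmod b)\<^sup>2" for a b
    unfolding cmod_power2 by (simp add: power2_eq_square algebra_simps)
  note int = integrable_mult_right[OF L2_inner_integrable[OF assms], of "cnj c"]
  note i1 = L2_integrable_power2[OF assms(1)]
  note i2 = integrable_mult_right[OF integrable_Re[OF int], of 2]
  note i3 = integrable_mult_right[OF L2_integrable_power2[OF assms(2)], of "(cmod c)\<^sup>2"]
  have "(LINT x|lebesgue_on \<Omega>. 2 * Re (cnj c * (f x * cnj (g x)))) = 2 * Re (cnj c * L2_inner \<Omega> f g)"
    unfolding L2_inner_def integral_mult_right_zero integral_Re[OF int] by (rule refl)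
  then show ?thesis
    unfolding L2_norm_power2 pt
    using Bochner_Integration.integral_add[OF Bochner_Integration.integrable_diff[OF i1 i2] i3]
      Bochner_Integration.integral_diff[OF i1 i2]
    by (simp only: integral_mult_right_zero)
qed

lemma L2_parallelogram:
  assumes "f \<in> L2 \<Omega>" "g \<in> L2 \<Omega>"
  shows "(L2_norm \<Omega> (\<lambda>x. f x - g x))\<^sup>2 = 2 * (L2_norm \<Omega> f)\<^sup>2 + 2 * (L2_norm \<Omega> g)\<^sup>2
    - 4 * (L2_norm \<Omega> (\<lambda>x. (f x + g x) / 2))\<^sup>2"
proof -
  have pt: "(cmod (a - b))\<^sup>2 = 2 * (cmod a)\<^sup>2 + 2 * (cmod b)\<^sup>2 - 4 * (cmod ((a + b) / 2))\<^sup>2" for a b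
    unfolding norm_divide power_divide cmod_power2 by (simp add: power2_eq_square algebra_simps)
  have half: "(\<lambda>x. (f x + g x) / 2) \<in> L2 \<Omega>"
    using L2_scale[OF L2_add[OF assms], of "1 / 2"] by simp
  show ?thesis
    unfolding L2_norm_power2 pt
    using L2_integrable_power2[OF assms(1)] L2_integrable_power2[OF assms(2)] L2_integrable_power2[OF half] by simp
qed

text \<open>Lets the minimising sequence be treated through its pointwise limit, in place of
  completeness of the space of square-integrable functions.\<close>

lemma L2_Fatou:
  assumes f: "\<And>n. f n \<in> L2 \<Omega>" "\<And>n. (L2_norm \<Omega> (f n))\<^sup>2 \<le> D + 1 / real (Suc n)"
    and lim: "\<And>x. x \<in> \<Omega> \<Longrightarrow> (\<lambda>n. f n x) \<longlonglongrightarrow> h x"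
    and h: "h \<in> borel_measurable (lebesgue_on \<Omega>)" and "D \<ge> 0"
  shows "h \<in> L2 \<Omega>" "(L2_norm \<Omega> h)\<^sup>2 \<le> D"
proof -
  let ?M = "lebesgue_on \<Omega>"
  have eq: "(\<integral>\<^sup>+x. ennreal ((cmod (f n x))\<^sup>2) \<partial>?M) = ennreal ((L2_norm \<Omega> (f n))\<^sup>2)" for n
    unfolding L2_norm_power2 by (rule nn_integral_eq_integral[OF L2_integrable_power2[OF f(1)]]) simp
  have "(\<integral>\<^sup>+x. ennreal ((cmod (h x))\<^sup>2) \<partial>?M) = (\<integral>\<^sup>+x. liminf (\<lambda>n. ennreal ((cmod (f n x))\<^sup>2)) \<partial>?M)"
  proof (rule nn_integral_cong)
    fix x assume "x \<in> space ?M"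
    then have "(\<lambda>n. ennreal ((cmod (f n x))\<^sup>2)) \<longlonglongrightarrow> ennreal ((cmod (h x))\<^sup>2)"
      by (intro tendsto_ennrealI tendsto_power tendsto_norm lim) simp
    then show "ennreal ((cmod (h x))\<^sup>2) = liminf (\<lambda>n. ennreal ((cmod (f n x))\<^sup>2))"
      by (rule lim_imp_Liminf[OF sequentially_bot, symmetric])
  qed
  also have "\<dots> \<le> liminf (\<lambda>n. \<integral>\<^sup>+x. ennreal ((cmod (f n x))\<^sup>2) \<partial>?M)"
    by (rule nn_integral_liminf) (use L2_measurable[OF f(1)] in measurable)
  also have "\<dots> \<le> liminf (\<lambda>n. ennreal (D + 1 / real (Suc n)))"
    unfolding eq by (intro Liminf_mono always_eventually allI ennreal_leI f(2))
  also have "(\<lambda>n. ennreal (D + 1 / real (Suc n))) \<longlonglongrightarrow> ennreal (D + 0)"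
    by (intro tendsto_ennrealI tendsto_add tendsto_const LIMSEQ_Suc[OF lim_1_over_n])
  then have "liminf (\<lambda>n. ennreal (D + 1 / real (Suc n))) = ennreal D"
    using lim_imp_Liminf[OF sequentially_bot] by fastforce
  finally have le: "(\<integral>\<^sup>+x. ennreal ((cmod (h x))\<^sup>2) \<partial>?M) \<le> ennreal D" .
  have int: "integrable ?M (\<lambda>x. (cmod (h x))\<^sup>2)"
  proof (rule integrableI_bounded)
    show "(\<lambda>x. (cmod (h x))\<^sup>2) \<in> borel_measurable ?M" using h by measurable
    show "(\<integral>\<^sup>+x. ennreal (norm ((cmod (h x))\<^sup>2)) \<partial>?M) < \<infinity>"
      using le by (simp add: le_less_trans[OF _ ennreal_less_top])
  qed
  then show "h \<in> L2 \<Omega>" using h by (simp add: L2_def)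
  have "(\<integral>\<^sup>+x. ennreal ((cmod (h x))\<^sup>2) \<partial>?M) = ennreal ((L2_norm \<Omega> h)\<^sup>2)"
    unfolding L2_norm_power2 by (rule nn_integral_eq_integral[OF int]) simp
  then show "(L2_norm \<Omega> h)\<^sup>2 \<le> D" using le \<open>D \<ge> 0\<close> by (simp add: ennreal_le_iff)
qed

lemma bergman_space_Cauchy_limit:
  fixes \<Omega> :: "(complex ^ 'n::finite) set"
  assumes \<Omega>: "open \<Omega>" "bounded \<Omega>" and u: "\<And>n. u n \<in> bergman_space \<Omega>"
    and Cauchy: "\<And>e. e > 0 \<Longrightarrow> \<exists>N. \<forall>m\<ge>N. \<forall>n\<ge>N. L2_norm \<Omega> (\<lambda>z. u m z - u n z) < e"
  obtains v where "holomorphic_several v \<Omega>" "\<And>z. z \<in> \<Omega> \<Longrightarrow> (\<lambda>n. u n z) \<longlonglongrightarrow> v z"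
proof -
  have unif: "uniform_limit K u (\<lambda>z. lim (\<lambda>n. u n z)) sequentially" if K: "compact K" "K \<subseteq> \<Omega>" for K
  proof -
    obtain C where C: "C \<ge> 0" "\<And>f z. f \<in> bergman_space \<Omega> \<Longrightarrow> z \<in> K \<Longrightarrow> cmod (f z) \<le> C * L2_norm \<Omega> f"
      using bergman_space_bound_compact[OF \<Omega> K] by blast
    have "uniformly_Cauchy_on K u"
      unfolding uniformly_Cauchy_on_def
    proof (intro allI impI)
      fix e :: real assume "e > 0"
      then have "e / (C + 1) > 0" using C(1) by simp
      from Cauchy[OF this] obtain N where N: "\<And>m n. m \<ge> N \<Longrightarrow> n \<ge> N \<Longrightarrow> L2_norm \<Omega> (\<lambda>z. u m z - u n z) < e / (C + 1)"
        by blast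
      have "dist (u m z) (u n z) < e" if "z \<in> K" "m \<ge> N" "n \<ge> N" for m n z
      proof -
        let ?l = "L2_norm \<Omega> (\<lambda>z. u m z - u n z)"
        have "dist (u m z) (u n z) \<le> C * ?l"
          using C(2)[OF bergman_space_diff[OF u u] that(1), of m n] by (simp add: dist_norm)
        also have "\<dots> \<le> (C + 1) * ?l" using L2_norm_nonneg by (intro mult_right_mono) auto
        also have "\<dots> < e" using N[OF that(2,3)] C(1) by (simp add: pos_less_divide_eq mult.commute)
        finally show ?thesis .
      qed
      then show "\<exists>M. \<forall>x\<in>K. \<forall>m\<ge>M. \<forall>n\<ge>M. dist (u m x) (u n x) < e" by blast
    qed
    then show ?thesis
      using Cauchy_uniformly_convergent uniformly_convergent_uniform_limit_iff by blast
  qed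
  show ?thesis
  proof (rule that)
    show "holomorphic_several (\<lambda>z. lim (\<lambda>n. u n z)) \<Omega>"
      by (rule holomorphic_locally_uniform_limit[OF \<Omega>(1) bergman_space_holomorphic[OF u] unif])
    fix z assume "z \<in> \<Omega>"
    then have "uniform_limit {z} u (\<lambda>z. lim (\<lambda>n. u n z)) sequentially" by (intro unif) auto
    then show "(\<lambda>n. u n z) \<longlonglongrightarrow> lim (\<lambda>n. u n z)" by (rule tendsto_uniform_limitI) simp
  qed
qed

text \<open>A minimising sequence is Cauchy by the parallelogram law. By the bounds on compact sets
  it converges locally uniformly to a holomorphic function, and Fatou's lemma shows that the minimum
  is attained there.\<close>

lemma bergman_space_closest:
  fixes \<Omega> :: "(complex ^ 'n::finite) set"
  assumes \<Omega>: "open \<Omega>" "bounded \<Omega>" and f: "f \<in> L2 \<Omega>"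
  obtains h where "h \<in> bergman_space \<Omega>"
    "\<And>u. u \<in> bergman_space \<Omega> \<Longrightarrow> (L2_norm \<Omega> (\<lambda>z. f z - h z))\<^sup>2 \<le> (L2_norm \<Omega> (\<lambda>z. f z - u z))\<^sup>2"
proof -
  let ?S = "(\<lambda>u. (L2_norm \<Omega> (\<lambda>z. f z - u z))\<^sup>2) ` bergman_space \<Omega>"
  define D where "D = Inf ?S"
  have ne: "?S \<noteq> {}" using bergman_space_zero by blast
  have bdd: "bdd_below ?S" by (rule bdd_belowI2[where m = 0]) simp
  have D_le: "D \<le> (L2_norm \<Omega> (\<lambda>z. f z - u z))\<^sup>2" if "u \<in> bergman_space \<Omega>" for u
    unfolding D_def by (rule cINF_lower[OF bdd that])
  have "D \<ge> 0" unfolding D_def by (rule cINF_greatest) (use ne in auto)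
  have "\<exists>u\<in>bergman_space \<Omega>. (L2_norm \<Omega> (\<lambda>z. f z - u z))\<^sup>2 < D + 1 / real (Suc n)" for n
  proof -
    have "Inf ?S < D + 1 / real (Suc n)" by (simp add: D_def)
    then show ?thesis unfolding cInf_less_iff[OF ne bdd] by blast
  qed
  then obtain u where u: "\<And>n. u n \<in> bergman_space \<Omega>"
    "\<And>n. (L2_norm \<Omega> (\<lambda>z. f z - u n z))\<^sup>2 < D + 1 / real (Suc n)" by metis
  have fu: "(\<lambda>z. f z - u n z) \<in> L2 \<Omega>" for n by (rule L2_diff[OF f bergman_space_L2[OF u(1)]])
  have dist: "(L2_norm \<Omega> (\<lambda>z. u m z - u n z))\<^sup>2 \<le> 2 / real (Suc m) + 2 / real (Suc n)" for m n
  proof -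
    have "(L2_norm \<Omega> (\<lambda>z. (f z - u n z) - (f z - u m z)))\<^sup>2 = 2 * (L2_norm \<Omega> (\<lambda>z. f z - u n z))\<^sup>2
        + 2 * (L2_norm \<Omega> (\<lambda>z. f z - u m z))\<^sup>2 - 4 * (L2_norm \<Omega> (\<lambda>z. ((f z - u n z) + (f z - u m z)) / 2))\<^sup>2"
      by (rule L2_parallelogram[OF fu fu])
    moreover have "(\<lambda>z. ((f z - u n z) + (f z - u m z)) / 2) = (\<lambda>z. f z - (1 / 2) * (u n z + u m z))"
      by (intro ext) (simp add: field_simps)
    moreover have "(\<lambda>z. (f z - u n z) - (f z - u m z)) = (\<lambda>z. u m z - u n z)"
      by (intro ext) simp
    ultimately have "(L2_norm \<Omega> (\<lambda>z. u m z - u n z))\<^sup>2 = 2 * (L2_norm \<Omega> (\<lambda>z. f z - u n z))\<^sup>2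
        + 2 * (L2_norm \<Omega> (\<lambda>z. f z - u m z))\<^sup>2 - 4 * (L2_norm \<Omega> (\<lambda>z. f z - (1 / 2) * (u n z + u m z)))\<^sup>2"
      by (simp only:)
    \<comment> \<open>The midpoint of two candidates is a candidate, so its distance to f is no
      smaller than the infimum.\<close>
    moreover have "D \<le> (L2_norm \<Omega> (\<lambda>z. f z - (1 / 2) * (u n z + u m z)))\<^sup>2"
      by (intro D_le bergman_space_scale bergman_space_add u(1))
    moreover have "2 / real (Suc m) = 2 * (1 / real (Suc m))" "2 / real (Suc n) = 2 * (1 / real (Suc n))"
      by simp_all
    ultimately show ?thesis using u(2)[of n] u(2)[of m] by linarith
  qed
  have Cauchy: "\<exists>N. \<forall>m\<ge>N. \<forall>n\<ge>N. L2_norm \<Omega> (\<lambda>z. u m z - u n z) < e" if "e > 0" for e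
  proof -
    obtain N where N: "4 / e\<^sup>2 < real (Suc N)" using reals_Archimedean2 less_Suc_eq of_nat_less_iff less_trans by (metis of_nat_less_iff lessI)
    have "L2_norm \<Omega> (\<lambda>z. u m z - u n z) < e" if "m \<ge> N" "n \<ge> N" for m n
    proof -
      have "2 / real (Suc m) \<le> 2 / real (Suc N)" "2 / real (Suc n) \<le> 2 / real (Suc N)"
        using that by (auto intro!: divide_left_mono)
      then have "(L2_norm \<Omega> (\<lambda>z. u m z - u n z))\<^sup>2 \<le> 4 / real (Suc N)" using dist[of m n] by simp
      also have "\<dots> < e\<^sup>2" using N \<open>e > 0\<close> by (simp add: divide_less_eq mult.commute del: of_nat_Suc)
      finally show ?thesis using \<open>e > 0\<close> by (auto intro: power_less_imp_less_base)
    qed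
    then show ?thesis by blast
  qed
  obtain h where h: "holomorphic_several h \<Omega>" "\<And>z. z \<in> \<Omega> \<Longrightarrow> (\<lambda>n. u n z) \<longlonglongrightarrow> h z"
    using bergman_space_Cauchy_limit[OF \<Omega> u(1) Cauchy] by blast
  have meas: "h \<in> borel_measurable (lebesgue_on \<Omega>)"
    by (rule borel_measurable_lebesgue_on_continuous(1)[OF \<Omega>(1) holomorphic_several_continuous_on[OF h(1)]])
  have fh: "(\<lambda>z. f z - h z) \<in> L2 \<Omega>" "(L2_norm \<Omega> (\<lambda>z. f z - h z))\<^sup>2 \<le> D"
    by (rule L2_Fatou[OF fu less_imp_le[OF u(2)] _ _ \<open>D \<ge> 0\<close>];
        intro tendsto_diff tendsto_const h(2) borel_measurable_diff L2_measurable[OF f] meas; assumption)+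
  have "h \<in> bergman_space \<Omega>"
    using L2_diff[OF f fh(1)] h(1) by (simp add: bergman_space_def)
  then show ?thesis
    by (rule that) (use fh(2) D_le order_trans in blast)
qed

lemma bergman_projection_exists:
  fixes \<Omega> :: "(complex ^ 'n::finite) set"
  assumes \<Omega>: "open \<Omega>" "bounded \<Omega>" and f: "f \<in> L2 \<Omega>"
  obtains h where "h \<in> bergman_space \<Omega>" "\<And>u. u \<in> bergman_space \<Omega> \<Longrightarrow> L2_inner \<Omega> (\<lambda>z. f z - h z) u = 0"
proof -
  obtain h where h: "h \<in> bergman_space \<Omega>"
    "\<And>u. u \<in> bergman_space \<Omega> \<Longrightarrow> (L2_norm \<Omega> (\<lambda>z. f z - h z))\<^sup>2 \<le> (L2_norm \<Omega> (\<lambda>z. f z - u z))\<^sup>2"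
    using bergman_space_closest[OF assms] by blast
  have fh: "(\<lambda>z. f z - h z) \<in> L2 \<Omega>" by (rule L2_diff[OF f bergman_space_L2[OF h(1)]])
  have "L2_inner \<Omega> (\<lambda>z. f z - h z) u = 0" if u: "u \<in> bergman_space \<Omega>" for u
  proof (rule ccontr)
    define a where "a = L2_inner \<Omega> (\<lambda>z. f z - h z) u"
    assume "L2_inner \<Omega> (\<lambda>z. f z - h z) u \<noteq> 0"
    then have a: "a \<noteq> 0" by (simp add: a_def)
    define b where "b = (L2_norm \<Omega> u)\<^sup>2"
    have "cmod a \<le> L2_norm \<Omega> (\<lambda>z. f z - h z) * L2_norm \<Omega> u"
      unfolding a_def by (rule L2_inner_Cauchy_Schwarz[OF fh bergman_space_L2[OF u]])
    then have "b > 0" using a by (auto simp: b_def)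
    \<comment> \<open>With this coefficient h + c u would be closer to f, by (cmod a)^2 / b in
      squared norm.\<close>
    define c where "c = a / of_real b"
    have "(L2_norm \<Omega> (\<lambda>z. f z - h z))\<^sup>2 \<le> (L2_norm \<Omega> (\<lambda>z. f z - (h z + c * u z)))\<^sup>2"
      by (intro h(2) bergman_space_add bergman_space_scale h(1) u)
    also have "\<dots> = (L2_norm \<Omega> (\<lambda>z. (f z - h z) - c * u z))\<^sup>2" by (simp add: algebra_simps)
    also have "\<dots> = (L2_norm \<Omega> (\<lambda>z. f z - h z))\<^sup>2 - 2 * Re (cnj c * a) + (cmod c)\<^sup>2 * b"
      unfolding a_def b_def by (rule L2_norm_diff_scale[OF fh bergman_space_L2[OF u]])
    finally have "2 * Re (cnj c * a) \<le> (cmod c)\<^sup>2 * b" by simp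
    moreover have "cnj c * a = of_real ((cmod a)\<^sup>2 / b)"
      using complex_norm_square[of a] by (simp add: c_def mult.commute)
    moreover have "(cmod c)\<^sup>2 * b = (cmod a)\<^sup>2 / b"
      using \<open>b > 0\<close> by (simp add: c_def norm_divide power_divide power2_eq_square)
    ultimately have "(cmod a)\<^sup>2 / b \<le> 0" by simp
    then show False using a \<open>b > 0\<close> by (simp add: divide_le_0_iff)
  qed
  with h(1) show ?thesis by (rule that)
qed

lemma L2_cong: "(\<And>x. x \<in> \<Omega> \<Longrightarrow> f x = g x) \<Longrightarrow> f \<in> L2 \<Omega> \<longleftrightarrow> g \<in> L2 \<Omega>"
proof -
  assume eq: "\<And>x. x \<in> \<Omega> \<Longrightarrow> f x = g x"
  have "f \<in> borel_measurable (lebesgue_on \<Omega>) \<longleftrightarrow> g \<in> borel_measurable (lebesgue_on \<Omega>)"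
    using eq by (intro measurable_cong) simp
  moreover have "integrable (lebesgue_on \<Omega>) (\<lambda>x. (cmod (f x))\<^sup>2) \<longleftrightarrow> integrable (lebesgue_on \<Omega>) (\<lambda>x. (cmod (g x))\<^sup>2)"
    using eq by (intro Bochner_Integration.integrable_cong) auto
  ultimately show ?thesis by (simp add: L2_def)
qed

lemma holomorphic_several_cong:
  assumes "open \<Omega>" "\<And>z. z \<in> \<Omega> \<Longrightarrow> f z = g z" "holomorphic_several f \<Omega>"
  shows "holomorphic_several g \<Omega>"
  using assms unfolding holomorphic_several_def by (meson has_derivative_transform_within_open)

lemma L2_inner_cong_left: "(\<And>x. x \<in> \<Omega> \<Longrightarrow> f x = g x) \<Longrightarrow> L2_inner \<Omega> f u = L2_inner \<Omega> g u"
  unfolding L2_inner_def by (intro Bochner_Integration.integral_cong) auto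

text \<open>The difference of two candidates is orthogonal to itself, so its norm vanishes, and the
  pointwise bound makes it zero at every point of \<Omega> rather than almost everywhere.\<close>

lemma bergman_projection_unique:
  fixes \<Omega> :: "(complex ^ 'n::finite) set"
  assumes \<Omega>: "open \<Omega>" "bounded \<Omega>" and f: "f \<in> L2 \<Omega>"
    and h1: "h1 \<in> bergman_space \<Omega>" "\<And>u. u \<in> bergman_space \<Omega> \<Longrightarrow> L2_inner \<Omega> (\<lambda>z. f z - h1 z) u = 0"
    and h2: "h2 \<in> bergman_space \<Omega>" "\<And>u. u \<in> bergman_space \<Omega> \<Longrightarrow> L2_inner \<Omega> (\<lambda>z. f z - h2 z) u = 0"
    and "z \<in> \<Omega>"
  shows "h1 z = h2 z"
proof -
  let ?d = "\<lambda>z. h1 z - h2 z"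
  have d: "?d \<in> bergman_space \<Omega>" by (rule bergman_space_diff[OF h1(1) h2(1)])
  have "L2_inner \<Omega> ?d ?d = L2_inner \<Omega> (\<lambda>z. (f z - h2 z) - (f z - h1 z)) ?d"
    by (rule L2_inner_cong_left) simp
  also have "\<dots> = 0"
    using h1(2)[OF d] h2(2)[OF d]
      L2_inner_diff_left[OF L2_diff[OF f bergman_space_L2[OF h2(1)]] L2_diff[OF f bergman_space_L2[OF h1(1)]] bergman_space_L2[OF d]]
    by simp
  finally have "L2_norm \<Omega> ?d = 0" unfolding L2_inner_self by simp
  from bergman_space_eq_0[OF \<Omega> d this \<open>z \<in> \<Omega>\<close>] show ?thesis by simp
qed

lemma bergman_projection_eqI:
  fixes \<Omega> :: "(complex ^ 'n::finite) set"
  assumes \<Omega>: "open \<Omega>" "bounded \<Omega>" and f: "f \<in> L2 \<Omega>"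
    and h: "h \<in> bergman_space \<Omega>" "\<And>u. u \<in> bergman_space \<Omega> \<Longrightarrow> L2_inner \<Omega> (\<lambda>z. f z - h z) u = 0"
      "\<And>z. z \<notin> \<Omega> \<Longrightarrow> h z = 0"
  shows "bergman_projection \<Omega> f = h"
  unfolding bergman_projection_def
proof (rule the_equality)
  show "h \<in> bergman_space \<Omega> \<and> (\<forall>u\<in>bergman_space \<Omega>. L2_inner \<Omega> (\<lambda>z. f z - h z) u = 0) \<and> (\<forall>z. z \<notin> \<Omega> \<longrightarrow> h z = 0)"
    using h by blast
  fix h' assume h': "h' \<in> bergman_space \<Omega> \<and> (\<forall>u\<in>bergman_space \<Omega>. L2_inner \<Omega> (\<lambda>z. f z - h' z) u = 0) \<and> (\<forall>z. z \<notin> \<Omega> \<longrightarrow> h' z = 0)"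
  show "h' = h"
  proof
    fix z
    show "h' z = h z"
    proof (cases "z \<in> \<Omega>")
      case True
      show ?thesis by (rule bergman_projection_unique[OF \<Omega> f _ _ h(1,2) True]) (use h' in auto)
    next
      case False
      then show ?thesis using h' h(3) by simp
    qed
  qed
qed

lemma bergman_projection_props:
  fixes \<Omega> :: "(complex ^ 'n::finite) set"
  assumes \<Omega>: "open \<Omega>" "bounded \<Omega>" and f: "f \<in> L2 \<Omega>"
  shows "bergman_projection \<Omega> f \<in> bergman_space \<Omega>"
    and "u \<in> bergman_space \<Omega> \<Longrightarrow> L2_inner \<Omega> (\<lambda>z. f z - bergman_projection \<Omega> f z) u = 0"
    and "z \<notin> \<Omega> \<Longrightarrow> bergman_projection \<Omega> f z = 0"
proof -
  obtain h where h: "h \<in> bergman_space \<Omega>" "\<And>u. u \<in> bergman_space \<Omega> \<Longrightarrow> L2_inner \<Omega> (\<lambda>z. f z - h z) u = 0"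
    using bergman_projection_exists[OF assms] by blast
  \<comment> \<open>Meets the normalisation outside \<Omega> that singles out one representative in
    the definition of the projection.\<close>
  define h0 where "h0 z = (if z \<in> \<Omega> then h z else 0)" for z
  have eq: "h z = h0 z" if "z \<in> \<Omega>" for z using that by (simp add: h0_def)
  have 1: "h0 \<in> bergman_space \<Omega>"
    using h(1) L2_cong[of \<Omega> h h0, OF eq] holomorphic_several_cong[OF \<Omega>(1) eq]
    by (simp add: bergman_space_def)
  have 2: "L2_inner \<Omega> (\<lambda>z. f z - h0 z) u = 0" if "u \<in> bergman_space \<Omega>" for u
    using h(2)[OF that] L2_inner_cong_left[of \<Omega> "\<lambda>z. f z - h z" "\<lambda>z. f z - h0 z" u] eq by simp
  have 3: "h0 z = 0" if "z \<notin> \<Omega>" for z using that by (simp add: h0_def)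
  have "bergman_projection \<Omega> f = h0" by (rule bergman_projection_eqI[OF \<Omega> f 1 2 3])
  then show "bergman_projection \<Omega> f \<in> bergman_space \<Omega>"
    and "u \<in> bergman_space \<Omega> \<Longrightarrow> L2_inner \<Omega> (\<lambda>z. f z - bergman_projection \<Omega> f z) u = 0"
    and "z \<notin> \<Omega> \<Longrightarrow> bergman_projection \<Omega> f z = 0"
    using 1 2 3 by auto
qed

lemma bergman_projection_add:
  fixes \<Omega> :: "(complex ^ 'n::finite) set"
  assumes \<Omega>: "open \<Omega>" "bounded \<Omega>" and f: "f \<in> L2 \<Omega>" and g: "g \<in> L2 \<Omega>"
  shows "bergman_projection \<Omega> (\<lambda>z. f z + g z) = (\<lambda>z. bergman_projection \<Omega> f z + bergman_projection \<Omega> g z)"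
proof (rule bergman_projection_eqI[OF \<Omega> L2_add[OF f g]])
  note F = bergman_projection_props[OF \<Omega> f] and G = bergman_projection_props[OF \<Omega> g]
  show "(\<lambda>z. bergman_projection \<Omega> f z + bergman_projection \<Omega> g z) \<in> bergman_space \<Omega>"
    by (rule bergman_space_add[OF F(1) G(1)])
  show "bergman_projection \<Omega> f z + bergman_projection \<Omega> g z = 0" if "z \<notin> \<Omega>" for z
    using F(3)[OF that] G(3)[OF that] by simp
  fix u assume u: "u \<in> bergman_space \<Omega>"
  have "L2_inner \<Omega> (\<lambda>z. f z + g z - (bergman_projection \<Omega> f z + bergman_projection \<Omega> g z)) u
      = L2_inner \<Omega> (\<lambda>z. (f z - bergman_projection \<Omega> f z) + (g z - bergman_projection \<Omega> g z)) u"
    by (rule L2_inner_cong_left) simp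
  also have "\<dots> = 0"
    using F(2)[OF u] G(2)[OF u]
      L2_inner_add_left[OF L2_diff[OF f bergman_space_L2[OF F(1)]] L2_diff[OF g bergman_space_L2[OF G(1)]] bergman_space_L2[OF u]]
    by simp
  finally show "L2_inner \<Omega> (\<lambda>z. f z + g z - (bergman_projection \<Omega> f z + bergman_projection \<Omega> g z)) u = 0" .
qed

lemma bergman_projection_scale:
  fixes \<Omega> :: "(complex ^ 'n::finite) set"
  assumes \<Omega>: "open \<Omega>" "bounded \<Omega>" and f: "f \<in> L2 \<Omega>"
  shows "bergman_projection \<Omega> (\<lambda>z. c * f z) = (\<lambda>z. c * bergman_projection \<Omega> f z)"
proof (rule bergman_projection_eqI[OF \<Omega> L2_scale[OF f]])
  note F = bergman_projection_props[OF \<Omega> f]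
  show "(\<lambda>z. c * bergman_projection \<Omega> f z) \<in> bergman_space \<Omega>"
    by (rule bergman_space_scale[OF F(1)])
  show "c * bergman_projection \<Omega> f z = 0" if "z \<notin> \<Omega>" for z
    using F(3)[OF that] by simp
  fix u assume u: "u \<in> bergman_space \<Omega>"
  have "L2_inner \<Omega> (\<lambda>z. c * f z - c * bergman_projection \<Omega> f z) u = c * L2_inner \<Omega> (\<lambda>z. f z - bergman_projection \<Omega> f z) u"
    unfolding right_diff_distrib[symmetric] by (rule L2_inner_scale_left)
  then show "L2_inner \<Omega> (\<lambda>z. c * f z - c * bergman_projection \<Omega> f z) u = 0"
    using F(2)[OF u] by simp
qed

lemma bergman_projection_eq_if_orthogonal:
  fixes \<Omega> :: "(complex ^ 'n::finite) set"
  assumes \<Omega>: "open \<Omega>" "bounded \<Omega>" and f: "f \<in> L2 \<Omega>" and g: "g \<in> L2 \<Omega>"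
    and orth: "\<And>u. u \<in> bergman_space \<Omega> \<Longrightarrow> L2_inner \<Omega> (\<lambda>z. f z - g z) u = 0"
  shows "bergman_projection \<Omega> f = bergman_projection \<Omega> g"
proof (rule bergman_projection_eqI[OF \<Omega> f])
  note G = bergman_projection_props[OF \<Omega> g]
  show "bergman_projection \<Omega> g \<in> bergman_space \<Omega>" by (rule G(1))
  show "bergman_projection \<Omega> g z = 0" if "z \<notin> \<Omega>" for z using G(3)[OF that] .
  fix u assume u: "u \<in> bergman_space \<Omega>"
  have "L2_inner \<Omega> (\<lambda>z. f z - bergman_projection \<Omega> g z) u = L2_inner \<Omega> (\<lambda>z. (f z - g z) + (g z - bergman_projection \<Omega> g z)) u"
    by (rule L2_inner_cong_left) simp
  also have "\<dots> = 0"
    using orth[OF u] G(2)[OF u]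
      L2_inner_add_left[OF L2_diff[OF f g] L2_diff[OF g bergman_space_L2[OF G(1)]] bergman_space_L2[OF u]]
    by simp
  finally show "L2_inner \<Omega> (\<lambda>z. f z - bergman_projection \<Omega> g z) u = 0" .
qed

section \<open>Flat corrections\<close>

text \<open>Twice the (1,0) derivative in direction v: it gives 2 \<open>dir_deriv v f\<close> for
  holomorphic f and 0 for conjugates of holomorphic functions.\<close>

definition wirt :: "complex ^ 'n::finite \<Rightarrow> (complex ^ 'n \<Rightarrow> complex) \<Rightarrow> complex ^ 'n \<Rightarrow> complex" where
  "wirt v f z = dir_deriv v f z - \<i> * dir_deriv (\<i> *s v) f z"

lemma wirt_cong: "open U \<Longrightarrow> z \<in> U \<Longrightarrow> (\<And>y. y \<in> U \<Longrightarrow> f y = g y) \<Longrightarrow> wirt v f z = wirt v g z"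
  unfolding wirt_def by (simp add: dir_deriv_cong[of U z f g])

lemma wirt_zero: "wirt v (\<lambda>_. 0) z = 0"
  using fun_cong[OF iter_deriv_0[of "[v]"], of z] fun_cong[OF iter_deriv_0[of "[\<i> *s v]"], of z]
  unfolding wirt_def by (simp add: dir_deriv_def)

lemma wirt_mult:
  assumes "smooth_on U f" "smooth_on U g" "z \<in> U"
  shows "wirt v (\<lambda>z. f z * g z) z = f z * wirt v g z + wirt v f z * g z"
  unfolding wirt_def smooth_on_dir_deriv_mult[OF assms] by (simp add: algebra_simps)

lemma wirt_cmult:
  assumes "smooth_on U f" "z \<in> U"
  shows "wirt v (\<lambda>z. c * f z) z = c * wirt v f z"
  unfolding wirt_def smooth_on_dir_deriv_linear[OF bounded_linear_mult_right assms] by (simp add: algebra_simps)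

lemma smooth_on_wirt: "open U \<Longrightarrow> smooth_on U f \<Longrightarrow> smooth_on U (wirt v f)"
  unfolding wirt_def[abs_def] by (intro smooth_on_diff smooth_on_mult smooth_on_const smooth_on_dir_deriv)

lemma bsmooth_on_cmult: "open U \<Longrightarrow> bsmooth_on U f \<Longrightarrow> bsmooth_on U (\<lambda>z. (c::complex) * f z)"
  by (intro bsmooth_on_mult bsmooth_on_const)

lemma bsmooth_on_diff: "open U \<Longrightarrow> bsmooth_on U f \<Longrightarrow> bsmooth_on U g \<Longrightarrow> bsmooth_on U (\<lambda>z. f z - g z :: complex)"
  using bsmooth_on_add[OF _ _ bsmooth_on_cmult[of U g "-1"], of f] by simp

lemma bsmooth_on_wirt: "open U \<Longrightarrow> bsmooth_on U f \<Longrightarrow> bsmooth_on U (wirt v f)"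
  unfolding wirt_def[abs_def] by (intro bsmooth_on_diff bsmooth_on_cmult bsmooth_on_dir_deriv)

lemma bsmooth_on_inverse:
  fixes f :: "'a::real_normed_vector \<Rightarrow> complex"
  assumes "open U" "bsmooth_on U f" "c > 0" "\<And>z. z \<in> U \<Longrightarrow> c \<le> cmod (f z)"
  shows "bsmooth_on U (\<lambda>z. inverse (f z))"
proof -
  have ne: "f z \<noteq> 0" if "z \<in> U" for z using assms(3) assms(4)[OF that] by auto
  have "bounded ((\<lambda>z. inverse (f z)) ` U)"
    unfolding bounded_iff
    by (intro exI[of _ "inverse c"] ballI) (use assms(3,4) in \<open>auto simp: norm_inverse intro!: le_imp_inverse_le\<close>)
  then show ?thesis
    using assms(2) unfolding bsmooth_on_iff by (intro allI diff_order_inverse[OF assms(1) _ ne]) auto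
qed

lemma bsmooth_on_power:
  fixes f :: "'a::real_normed_vector \<Rightarrow> complex"
  assumes "open U" "bsmooth_on U f"
  shows "bsmooth_on U (\<lambda>z. f z ^ n)"
proof (induction n)
  case 0
  show ?case by (simp add: bsmooth_on_const[OF assms(1)])
next
  case (Suc n)
  show ?case unfolding power_Suc by (rule bsmooth_on_mult[OF assms Suc])
qed

lemma bsmooth_on_bounded0: "bsmooth_on U f \<Longrightarrow> bounded (f ` U)"
  using bsmooth_on_bounded[of U f "[]"] by simp

lemma wirt_cnj_holomorphic:
  assumes "open \<Omega>" "holomorphic_several h \<Omega>" "z \<in> \<Omega>"
  shows "wirt v (\<lambda>z. cnj (h z)) z = 0"
proof -
  note s = smooth_on_holomorphic[OF assms(2,1)]
  show ?thesis
    unfolding wirt_def smooth_on_dir_deriv_linear[OF bounded_linear_cnj s assms(3)]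
      holomorphic_several_dir_deriv_smult[OF assms(2,3)] by simp
qed

definition bdist :: "'a::metric_space set \<Rightarrow> 'a \<Rightarrow> real" where
  "bdist \<Omega> z = infdist z (- \<Omega>)"

definition flat_on :: "'a::euclidean_space set \<Rightarrow> nat \<Rightarrow> ('a \<Rightarrow> complex) \<Rightarrow> bool" where
  "flat_on \<Omega> N G \<longleftrightarrow> (\<forall>vs. length vs \<le> N \<longrightarrow>
     (\<exists>C. \<forall>z\<in>\<Omega>. cmod (iter_deriv vs G z) \<le> C * bdist \<Omega> z ^ (N - length vs)))"

text \<open>The test class is the integrable holomorphic functions, because h will be the product of
  two square-integrable ones, cnj \<mu> and an element of \<open>bergman_space\<close>.\<close>

definition conj_orthogonal :: "(complex ^ 'n::finite) set \<Rightarrow> (complex ^ 'n \<Rightarrow> complex) \<Rightarrow> bool" where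
  "conj_orthogonal \<Omega> f \<longleftrightarrow> (\<forall>h. holomorphic_several h \<Omega> \<longrightarrow> integrable (lebesgue_on \<Omega>) h \<longrightarrow>
     (LINT z|lebesgue_on \<Omega>. f z * cnj (h z)) = 0)"

text \<open>Since \<open>g\<close> may vanish on open sets, a product \<open>m g\<close> need not determine \<open>m\<close>; this property
  makes it determine \<open>m G\<close>.\<close>

definition vanishes_with :: "'a::topological_space set \<Rightarrow> ('a \<Rightarrow> complex) \<Rightarrow> ('a \<Rightarrow> complex) \<Rightarrow> bool" where
  "vanishes_with \<Omega> g G \<longleftrightarrow> (\<forall>V. open V \<longrightarrow> V \<subseteq> \<Omega> \<longrightarrow> (\<forall>z\<in>V. g z = 0) \<longrightarrow> (\<forall>z\<in>V. G z = 0))"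

definition flat_correction ::
  "(complex ^ 'n::finite) set \<Rightarrow> nat \<Rightarrow> (complex ^ 'n \<Rightarrow> complex) \<Rightarrow> (complex ^ 'n \<Rightarrow> complex) \<Rightarrow> bool" where
  "flat_correction \<Omega> N g G \<longleftrightarrow> bsmooth_on \<Omega> G \<and> flat_on \<Omega> N G \<and>
     conj_orthogonal \<Omega> (\<lambda>z. g z - G z) \<and> vanishes_with \<Omega> g G"

lemma integrable_bounded_mult:
  fixes h :: "'a::euclidean_space \<Rightarrow> complex"
  assumes "open \<Omega>" "continuous_on \<Omega> f" "bounded (f ` \<Omega>)" "integrable (lebesgue_on \<Omega>) h"
  shows "integrable (lebesgue_on \<Omega>) (\<lambda>z. f z * cnj (h z))"
proof -
  obtain C where C: "\<And>z. z \<in> \<Omega> \<Longrightarrow> cmod (f z) \<le> C" using assms(3) unfolding bounded_iff by auto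
  show ?thesis
  proof (rule Bochner_Integration.integrable_bound)
    show "integrable (lebesgue_on \<Omega>) (\<lambda>z. C * norm (h z))" using assms(4) by simp
    show "(\<lambda>z. f z * cnj (h z)) \<in> borel_measurable (lebesgue_on \<Omega>)"
      by (intro borel_measurable_times borel_measurable_lebesgue_on_continuous(1)[OF assms(1,2)]
          borel_measurable_integrable integrable_cnj assms(4))
    show "AE z in lebesgue_on \<Omega>. norm (f z * cnj (h z)) \<le> norm (C * norm (h z))"
    proof (intro AE_I2)
      fix z assume "z \<in> space (lebesgue_on \<Omega>)"
      then have "z \<in> \<Omega>" by simp
      have "norm (f z * cnj (h z)) \<le> C * norm (h z)"
        using C[OF \<open>z \<in> \<Omega>\<close>] by (simp add: norm_mult mult_right_mono)
      then show "norm (f z * cnj (h z)) \<le> norm (C * norm (h z))" by simp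
    qed
  qed
qed

lemma bsmooth_on_integrable:
  fixes h :: "'a::euclidean_space \<Rightarrow> complex"
  assumes "open \<Omega>" "bsmooth_on \<Omega> f" "integrable (lebesgue_on \<Omega>) h"
  shows "integrable (lebesgue_on \<Omega>) (\<lambda>z. f z * cnj (h z))"
  by (rule integrable_bounded_mult[OF assms(1) smooth_on_imp_continuous_on[OF bsmooth_on_smooth_on[OF assms(2)]]
        bsmooth_on_bounded0[OF assms(2)] assms(3)])

lemma conj_orthogonal_add:
  assumes "open \<Omega>" "bsmooth_on \<Omega> f1" "bsmooth_on \<Omega> f2" "conj_orthogonal \<Omega> f1" "conj_orthogonal \<Omega> f2"
    and "\<And>z. z \<in> \<Omega> \<Longrightarrow> f z = f1 z + f2 z"
  shows "conj_orthogonal \<Omega> f"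
  unfolding conj_orthogonal_def
proof (intro allI impI)
  fix h assume h: "holomorphic_several h \<Omega>" "integrable (lebesgue_on \<Omega>) h"
  have "(LINT z|lebesgue_on \<Omega>. f z * cnj (h z)) = (LINT z|lebesgue_on \<Omega>. f1 z * cnj (h z) + f2 z * cnj (h z))"
    by (intro Bochner_Integration.integral_cong) (auto simp: assms(6) distrib_right)
  also have "\<dots> = (LINT z|lebesgue_on \<Omega>. f1 z * cnj (h z)) + (LINT z|lebesgue_on \<Omega>. f2 z * cnj (h z))"
    by (rule Bochner_Integration.integral_add[OF bsmooth_on_integrable[OF assms(1,2) h(2)] bsmooth_on_integrable[OF assms(1,3) h(2)]])
  also have "\<dots> = 0" using assms(4,5) h unfolding conj_orthogonal_def by simp
  finally show "(LINT z|lebesgue_on \<Omega>. f z * cnj (h z)) = 0" .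
qed

lemma flat_on_add:
  assumes "open \<Omega>" "smooth_on \<Omega> G1" "smooth_on \<Omega> G2" "flat_on \<Omega> N G1" "flat_on \<Omega> N G2"
  shows "flat_on \<Omega> N (\<lambda>z. G1 z + G2 z)"
  unfolding flat_on_def
proof (intro allI impI)
  fix vs :: "'a list" assume vs: "length vs \<le> N"
  obtain C1 C2 where C: "\<And>z. z \<in> \<Omega> \<Longrightarrow> cmod (iter_deriv vs G1 z) \<le> C1 * bdist \<Omega> z ^ (N - length vs)"
    "\<And>z. z \<in> \<Omega> \<Longrightarrow> cmod (iter_deriv vs G2 z) \<le> C2 * bdist \<Omega> z ^ (N - length vs)"
    using assms(4,5) vs unfolding flat_on_def by blast
  have "cmod (iter_deriv vs (\<lambda>z. G1 z + G2 z) z) \<le> (C1 + C2) * bdist \<Omega> z ^ (N - length vs)" if z: "z \<in> \<Omega>" for z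
    unfolding iter_deriv_add[OF assms(2,3,1) z]
    using norm_triangle_ineq[of "iter_deriv vs G1 z" "iter_deriv vs G2 z"] C(1)[OF z] C(2)[OF z]
    by (simp add: distrib_right)
  then show "\<exists>C. \<forall>z\<in>\<Omega>. cmod (iter_deriv vs (\<lambda>z. G1 z + G2 z) z) \<le> C * bdist \<Omega> z ^ (N - length vs)" by blast
qed

text \<open>A closed ball around a boundary point p on which r describes \<Omega> and v stays
  transversal to the level sets of r. The uniform bound c0 is what makes \<open>q\<close> and all
  its derivatives bounded.\<close>

locale boundary_patch =
  fixes \<Omega> V :: "(complex ^ 'n::finite) set" and p v :: "complex ^ 'n" and \<rho> c0 :: real and r :: "complex ^ 'n \<Rightarrow> real"
  assumes open_dom: "open \<Omega>" and \<rho>: "\<rho> > 0"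
    and V: "open V" "cball p \<rho> \<subseteq> V" and r: "smooth_on V r"
    and sign: "\<And>z. z \<in> cball p \<rho> \<Longrightarrow> z \<in> \<Omega> \<longleftrightarrow> r z < 0"
    and c0: "c0 > 0" "\<And>z. z \<in> cball p \<rho> \<Longrightarrow> c0 \<le> \<bar>dir_deriv v r z\<bar>"
begin

definition W where "W = \<Omega> \<inter> ball p \<rho>"
text \<open>\<open>W\<close> and \<open>E\<close> are open, overlap and cover \<Omega>. A function
  that is zero on \<open>E\<close> is therefore controlled by its behaviour on
  \<open>W\<close>.\<close>

definition E where "E = \<Omega> - cball p (\<rho> / 2)"
definition rc where "rc z = complex_of_real (r z)"
definition q where "q z = inverse (wirt v rc z)"

lemma open_W: "open W" unfolding W_def using open_dom by auto
lemma open_E: "open E" unfolding E_def using open_dom by auto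
lemma W_Un_E: "W \<union> E = \<Omega>" unfolding W_def E_def using \<rho> by auto
lemma W_sub: "W \<subseteq> \<Omega>" unfolding W_def by auto
lemma W_V: "W \<subseteq> V" unfolding W_def using V(2) ball_subset_cball by blast

lemma rc_smooth: "smooth_on V rc"
  unfolding rc_def[abs_def] by (rule smooth_on_of_real[OF V(1) r])

lemma rc_bsmooth: "bsmooth_on W rc"
  by (rule bsmooth_on_compactI[OF rc_smooth compact_cball[of p \<rho>] _ V(2)]) (auto simp: W_def)

lemma wirt_rc: assumes "z \<in> V"
  shows "wirt v rc z = Complex (dir_deriv v r z) (- dir_deriv (\<i> *s v) r z)"
proof -
  have "dir_deriv u rc z = complex_of_real (dir_deriv u r z)" for u
    unfolding rc_def[abs_def] by (rule smooth_on_dir_deriv_linear[OF bounded_linear_of_real r assms])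
  then show ?thesis unfolding wirt_def by (simp add: complex_eq_iff)
qed

text \<open>For real r the real part of \<open>wirt v rc\<close> is the derivative of r along v, so
  transversality keeps it away from zero.\<close>

lemma wirt_rc_ge: assumes "z \<in> W" shows "c0 \<le> cmod (wirt v rc z)"
proof -
  have z: "z \<in> V" "z \<in> cball p \<rho>" using assms W_V by (auto simp: W_def)
  have "c0 \<le> \<bar>Re (wirt v rc z)\<bar>" using c0(2)[OF z(2)] by (simp add: wirt_rc[OF z(1)])
  also have "\<dots> \<le> cmod (wirt v rc z)" by (rule abs_Re_le_cmod)
  finally show ?thesis .
qed

lemma q_bsmooth: "bsmooth_on W q"
  unfolding q_def[abs_def]
  by (rule bsmooth_on_inverse[OF open_W bsmooth_on_wirt[OF open_W rc_bsmooth] c0(1) wirt_rc_ge])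

lemma wirt_rc_q: "z \<in> W \<Longrightarrow> wirt v rc z * q z = 1"
proof -
  assume "z \<in> W"
  then have "wirt v rc z \<noteq> 0" using wirt_rc_ge[of z] c0(1) by auto
  then show ?thesis unfolding q_def by simp
qed

definition supported :: "(complex ^ 'n \<Rightarrow> complex) \<Rightarrow> bool" where
  "supported f \<longleftrightarrow> bsmooth_on W f \<and> (\<forall>z\<in>E. f z = 0)"

lemma supported_bsmooth: "supported f \<Longrightarrow> bsmooth_on \<Omega> f"
proof -
  assume f: "supported f"
  have "bsmooth_on E f"
    by (rule iffD2[OF bsmooth_on_cong[OF open_E] bsmooth_on_const[OF open_E, of 0]])
       (use f in \<open>auto simp: supported_def\<close>)
  then show "bsmooth_on \<Omega> f"
    using bsmooth_on_Un[of W f E] f unfolding W_Un_E supported_def by blast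
qed

lemma supported_mult: "bsmooth_on W f \<Longrightarrow> supported g \<Longrightarrow> supported (\<lambda>z. f z * g z)"
  unfolding supported_def using bsmooth_on_mult[OF open_W, of f g] by simp

lemma supported_wirt: "supported f \<Longrightarrow> supported (wirt v f)"
  unfolding supported_def using bsmooth_on_wirt[OF open_W] wirt_cong[OF open_E, of _ f "\<lambda>_. 0"] wirt_zero by auto

text \<open>A point w of the complement inside the patch has r w \<ge> 0 > r z, so -r z is at most r
  w - r z, which is Lipschitz-controlled. A point outside the patch is at distance at least \<rho> /
  2 from z, where boundedness of r is enough. The maximum in C covers both cases.\<close>

lemma rc_le_bdist:
  assumes "- \<Omega> \<noteq> {}"
  obtains C where "C \<ge> 0" "\<And>z. z \<in> \<Omega> \<Longrightarrow> z \<in> cball p (\<rho> / 2) \<Longrightarrow> cmod (rc z) \<le> C * bdist \<Omega> z"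
proof -
  have cont: "continuous_on (cball p \<rho>) (iter_deriv vs rc)" for vs
    by (rule continuous_on_subset[OF smooth_on_imp_continuous_on[OF smooth_on_iter_deriv[OF rc_smooth]] V(2)])
  have "\<exists>B. \<forall>z\<in>cball p \<rho>. cmod (iter_deriv vs rc z) \<le> B" for vs
    using compact_imp_bounded[OF compact_continuous_image[OF cont[of vs] compact_cball]]
    by (simp only: bounded_iff ball_simps)
  then have "\<exists>B. \<forall>vs. \<forall>z\<in>cball p \<rho>. cmod (iter_deriv vs rc z) \<le> B vs" by (intro choice allI)
  then obtain B where "\<forall>vs. \<forall>z\<in>cball p \<rho>. cmod (iter_deriv vs rc z) \<le> B vs" ..
  then have B: "cmod (iter_deriv vs rc z) \<le> B vs" if "z \<in> cball p \<rho>" for vs z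
    using that by (simp del: mem_cball)
  have B0: "B vs \<ge> 0" for vs
    by (rule order_trans[OF norm_ge_zero B[of p]]) (use \<rho> in simp)
  define L where "L = (\<Sum>i\<in>Basis. B [i]) * DIM(complex ^ 'n)"
  have lip: "cmod (rc x - rc y) \<le> L * norm (x - y)" if "x \<in> cball p \<rho>" "y \<in> cball p \<rho>" for x y
    unfolding L_def
  proof (rule lipschitz_of_dir_derivs[OF convex_cball _ _ that])
    fix u and i :: "complex ^ 'n" assume u: "u \<in> cball p \<rho>"
    show "rc differentiable (at u)" using u V(2) by (intro smooth_on_differentiable[OF rc_smooth]) auto
    assume i: "i \<in> Basis"
    have "cmod (dir_deriv i rc u) \<le> B [i]" using B[OF u, of "[i]"] by (simp add: dir_deriv_def)
    also have "\<dots> \<le> (\<Sum>i\<in>Basis. B [i])" by (rule member_le_sum[OF i]) (auto simp: B0)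
    finally show "cmod (dir_deriv i rc u) \<le> (\<Sum>i\<in>Basis. B [i])" .
  qed
  define C where "C = max L (2 * B [] / \<rho>)"
  have "C \<ge> 0" using B0[of "[]"] \<rho> by (simp add: C_def le_max_iff_disj)
  have "cmod (rc z) \<le> C * bdist \<Omega> z" if z: "z \<in> \<Omega>" "z \<in> cball p (\<rho> / 2)" for z
  proof -
    have z': "z \<in> cball p \<rho>" using z(2) \<rho> by auto
    have rz: "r z < 0" using sign[OF z'] z(1) by simp
    have le: "cmod (rc z) \<le> C * dist z w" if w: "w \<in> - \<Omega>" for w
    proof (cases "w \<in> cball p \<rho>")
      case True
      then have "r w \<ge> 0" using sign[OF True] w by auto
      then have "cmod (rc z) \<le> cmod (rc z - rc w)"
        using rz by (simp add: rc_def flip: of_real_diff)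
      also have "\<dots> \<le> L * norm (z - w)" by (rule lip[OF z' True])
      also have "\<dots> \<le> C * dist z w" by (simp add: C_def dist_norm mult_right_mono)
      finally show ?thesis .
    next
      case False
      have "\<rho> / 2 \<le> dist z w"
        using False z(2) dist_triangle[of p w z] by simp
      have "cmod (rc z) \<le> B []" using B[OF z', of "[]"] by simp
      also have "\<dots> = 2 * B [] / \<rho> * (\<rho> / 2)" using \<rho> by simp
      also have "\<dots> \<le> 2 * B [] / \<rho> * dist z w"
        using \<open>\<rho> / 2 \<le> dist z w\<close> B0[of "[]"] \<rho> by (intro mult_left_mono) auto
      also have "\<dots> \<le> C * dist z w"
        unfolding C_def by (intro mult_right_mono max.cobounded2 zero_le_dist)
      finally show ?thesis .
    qed
    show ?thesis
    proof (cases "C = 0")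
      case True
      then show ?thesis using le assms by auto
    next
      case False
      then have "C > 0" using \<open>C \<ge> 0\<close> by simp
      have "cmod (rc z) / C \<le> infdist z (- \<Omega>)"
        unfolding infdist_notempty[OF assms]
        using le \<open>C > 0\<close> by (intro cINF_greatest[OF assms]) (simp add: pos_divide_le_eq mult.commute)
      then show ?thesis using \<open>C > 0\<close> by (simp add: bdist_def pos_divide_le_eq mult.commute)
    qed
  qed
  note bound = this
  from that[OF \<open>C \<ge> 0\<close> bound] show ?thesis .
qed

text \<open>A derivative either hits the power of \<open>rc\<close>, lowering it by one, or spares
  it; so each derivative costs at most one factor, and the cofactor keeps bounded
  derivatives.\<close>

lemma iter_deriv_rc_power:
  assumes "bsmooth_on W f" "length vs \<le> N"
  shows "\<exists>b. bsmooth_on W b \<and> (\<forall>z\<in>W. iter_deriv vs (\<lambda>z. rc z ^ N * f z) z = rc z ^ (N - length vs) * b z)"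
  using assms(2)
proof (induction vs)
  case Nil
  show ?case using assms(1) by auto
next
  case (Cons u vs)
  then obtain b where b: "bsmooth_on W b" "\<And>z. z \<in> W \<Longrightarrow> iter_deriv vs (\<lambda>z. rc z ^ N * f z) z = rc z ^ (N - length vs) * b z"
    by auto
  define m where "m = N - length (u # vs)"
  have m: "N - length vs = Suc m" using Cons.prems by (simp add: m_def)
  define b' where "b' z = of_nat (Suc m) * dir_deriv u rc z * b z + rc z * dir_deriv u b z" for z
  have "bsmooth_on W b'"
    unfolding b'_def[abs_def]
    by (intro bsmooth_on_add bsmooth_on_mult bsmooth_on_const bsmooth_on_dir_deriv open_W rc_bsmooth b(1))
  moreover have "iter_deriv (u # vs) (\<lambda>z. rc z ^ N * f z) z = rc z ^ m * b' z" if z: "z \<in> W" for z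
  proof -
    have "iter_deriv (u # vs) (\<lambda>z. rc z ^ N * f z) z = dir_deriv u (\<lambda>z. rc z ^ Suc m * b z) z"
      unfolding iter_deriv_Cons by (rule dir_deriv_cong[OF open_W z]) (simp add: b(2) m)
    also have "\<dots> = rc z ^ Suc m * dir_deriv u b z + dir_deriv u (\<lambda>z. rc z ^ Suc m) z * b z"
      by (rule smooth_on_dir_deriv_mult[OF bsmooth_on_smooth_on[OF bsmooth_on_power[OF open_W rc_bsmooth]]
            bsmooth_on_smooth_on[OF b(1)] z])
    also have "dir_deriv u (\<lambda>z. rc z ^ Suc m) z = of_nat (Suc m) * dir_deriv u rc z * rc z ^ m"
    proof (rule dir_deriv_eqI[where f' = "\<lambda>u. of_nat (Suc m) * dir_deriv u rc z * rc z ^ m"])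
      show "((\<lambda>z. rc z ^ Suc m) has_derivative (\<lambda>u. of_nat (Suc m) * dir_deriv u rc z * rc z ^ m)) (at z)"
        using has_derivative_power[OF smooth_on_has_derivative[OF bsmooth_on_smooth_on[OF rc_bsmooth] z], of "Suc m"]
        by (simp add: mult_ac)
    qed
    finally show ?thesis by (simp add: b'_def algebra_simps)
  qed
  ultimately show ?case unfolding m_def by blast
qed

lemma flat_rc_power:
  assumes ne: "- \<Omega> \<noteq> {}" and f: "supported f"
  shows "flat_on \<Omega> N (\<lambda>z. rc z ^ N * f z)"
  unfolding flat_on_def
proof (intro allI impI)
  fix vs :: "(complex ^ 'n) list" assume vs: "length vs \<le> N"
  obtain b where b: "bsmooth_on W b" "\<And>z. z \<in> W \<Longrightarrow> iter_deriv vs (\<lambda>z. rc z ^ N * f z) z = rc z ^ (N - length vs) * b z"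
    using iter_deriv_rc_power[OF _ vs] f unfolding supported_def by blast
  obtain B where "B > 0" and B: "\<And>z. z \<in> W \<Longrightarrow> cmod (b z) \<le> B"
    using bsmooth_on_bounded0[OF b(1)] unfolding bounded_pos by auto
  obtain C where C: "C \<ge> 0" "\<And>z. z \<in> \<Omega> \<Longrightarrow> z \<in> cball p (\<rho> / 2) \<Longrightarrow> cmod (rc z) \<le> C * bdist \<Omega> z"
    using rc_le_bdist[OF ne] by blast
  let ?m = "N - length vs"
  have "cmod (iter_deriv vs (\<lambda>z. rc z ^ N * f z) z) \<le> (C ^ ?m * B) * bdist \<Omega> z ^ ?m" if z: "z \<in> \<Omega>" for z
  proof (cases "z \<in> cball p (\<rho> / 2)")
    case True
    then have zW: "z \<in> W" using z \<rho> by (auto simp: W_def)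
    have "cmod (iter_deriv vs (\<lambda>z. rc z ^ N * f z) z) = cmod (rc z) ^ ?m * cmod (b z)"
      by (simp add: b(2)[OF zW] norm_mult norm_power)
    also have "\<dots> \<le> (C * bdist \<Omega> z) ^ ?m * B"
      using C(2)[OF z True] B[OF zW] by (intro mult_mono power_mono) (auto simp: bdist_def infdist_nonneg C(1))
    finally show ?thesis by (simp add: power_mult_distrib mult_ac)
  next
    case False
    then have "z \<in> E" using z by (simp add: E_def)
    then have "iter_deriv vs (\<lambda>z. rc z ^ N * f z) z = iter_deriv vs (\<lambda>_. 0) z"
      using f by (intro iter_deriv_cong[OF open_E]) (auto simp: supported_def)
    then show ?thesis using C(1) \<open>B > 0\<close> by (simp add: iter_deriv_0 bdist_def infdist_nonneg)
  qed
  then show "\<exists>C. \<forall>z\<in>\<Omega>. cmod (iter_deriv vs (\<lambda>z. rc z ^ N * f z) z) \<le> C * bdist \<Omega> z ^ ?m" by blast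
qed

text \<open>Zero in the layer where -(n + 1) r \<le> 1, and equal to 1 once -(n + 1) r \<ge> 2; the
  layer shrinks to the boundary as n grows.\<close>

definition cutoff where "cutoff n z = smooth_step (- real (Suc n) * r z)"

lemma cutoff_smooth: "smooth_on W (\<lambda>z. complex_of_real (cutoff n z))"
  unfolding cutoff_def
  by (intro smooth_on_of_real smooth_on_compose[OF open_W _ smooth_on_smooth_step] smooth_on_mult smooth_on_const
      smooth_on_subset[OF r W_V] open_W)

lemma wirt_cutoff:
  assumes "z \<in> W"
  shows "wirt v (\<lambda>z. complex_of_real (cutoff n z)) z
    = complex_of_real (dir_deriv 1 smooth_step (- real (Suc n) * r z) * (- real (Suc n))) * wirt v rc z"
proof -
  have z: "z \<in> V" using assms W_V by blast
  have D: "dir_deriv u (\<lambda>z. complex_of_real (cutoff n z)) z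
      = complex_of_real (dir_deriv 1 smooth_step (- real (Suc n) * r z) * (- real (Suc n) * dir_deriv u r z))" for u
  proof (rule dir_deriv_eqI[where f' = "\<lambda>u. complex_of_real (dir_deriv 1 smooth_step (- real (Suc n) * r z) * (- real (Suc n) * dir_deriv u r z))"])
    note S = smooth_on_has_derivative[OF smooth_on_smooth_step UNIV_I]
    have S': "(smooth_step has_derivative (\<lambda>t. dir_deriv 1 smooth_step x * t)) (at x)" for x
    proof (rule has_derivative_eq_rhs[OF S])
      show "(\<lambda>t. dir_deriv t smooth_step x) = (\<lambda>t. dir_deriv 1 smooth_step x * t)"
      proof
        fix t
        show "dir_deriv t smooth_step x = dir_deriv 1 smooth_step x * t"
          using linear_scale[OF has_derivative_linear[OF S], of t 1 x] by (simp add: mult.commute)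
      qed
    qed
    note R = has_derivative_mult_right[OF smooth_on_has_derivative[OF r z], of "- real (Suc n)"]
    show "((\<lambda>z. complex_of_real (cutoff n z)) has_derivative
        (\<lambda>u. complex_of_real (dir_deriv 1 smooth_step (- real (Suc n) * r z) * (- real (Suc n) * dir_deriv u r z)))) (at z)"
      unfolding cutoff_def
      by (rule bounded_linear.has_derivative[OF bounded_linear_of_real has_derivative_compose[OF R S']])
  qed
  show ?thesis
    unfolding wirt_rc[OF z] unfolding wirt_def D by (simp add: complex_eq_iff)
qed

lemma cutoff_eventually:
  assumes "r z < 0"
  shows "\<forall>\<^sub>F n in sequentially. - real (Suc n) * r z > 2"
proof -
  obtain N where "2 < real N * (- r z)" using ex_less_of_nat_mult[of "- r z" 2] assms by auto
  then have "- real (Suc n) * r z > 2" if "n \<ge> N" for n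
    using that mult_right_mono[of "real N" "real (Suc n)" "- r z"] assms by linarith
  then show ?thesis by (auto simp: eventually_sequentially)
qed

text \<open>\<open>wirt v\<close> annihilates conjugates of holomorphic functions, so this is an integration by parts;
  the boundary term disappears because \<open>rc\<close> vanishes on the boundary to first order, which balances the
  growth of the derivative of the cutoff.\<close>

lemma conj_orthogonal_wirt:
  assumes c: "supported c"
  shows "conj_orthogonal \<Omega> (wirt v (\<lambda>z. rc z * c z))"
  unfolding conj_orthogonal_def
proof (intro allI impI)
  fix h assume h: "holomorphic_several h \<Omega>" and int: "integrable (lebesgue_on \<Omega>) h"
  let ?\<theta> = "\<lambda>z. rc z * c z"
  have \<theta>: "supported ?\<theta>" by (rule supported_mult[OF rc_bsmooth c])
  \<comment> \<open>The cutoff and extension by zero produce test functions, supported in the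
    compact sets \<open>K n\<close>, for which integration by parts is exact.\<close>
  define \<psi> where "\<psi> n z = (if z \<in> \<Omega> then ?\<theta> z * complex_of_real (cutoff n z) else 0)" for n z
  define K where "K n = {z \<in> cball p (\<rho> / 2). - real (Suc n) * r z \<ge> 1}" for n
  have \<psi>_eq: "\<psi> n z = ?\<theta> z * complex_of_real (cutoff n z)" if "z \<in> \<Omega>" for n z using that by (simp add: \<psi>_def)
  have KV: "cball p (\<rho> / 2) \<subseteq> V" using V(2) \<rho> by (auto simp: subset_iff)
  have K: "compact (K n)" "K n \<subseteq> \<Omega>" for n
  proof -
    have "continuous_on (cball p (\<rho> / 2)) (\<lambda>z. - real (Suc n) * r z)"
      by (intro continuous_intros continuous_on_subset[OF smooth_on_imp_continuous_on[OF r] KV])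
    from continuous_closed_preimage[OF this closed_cball closed_atLeast[of 1]]
    have "closed (K n)" by (simp add: K_def vimage_def Int_def atLeast_def)
    from compact_Int_closed[OF compact_cball[of p "\<rho> / 2"] this]
    show "compact (K n)" by (simp add: K_def Int_def conj_assoc[symmetric])
    show "K n \<subseteq> \<Omega>"
    proof
      fix z assume z: "z \<in> K n"
      then have "real (Suc n) * r z < 0" by (simp add: K_def del: of_nat_Suc)
      then have "r z < 0" by (simp add: mult_less_0_iff)
      moreover have "z \<in> cball p \<rho>" using z \<rho> by (auto simp: K_def)
      ultimately show "z \<in> \<Omega>" using sign by blast
    qed
  qed
  have out: "\<psi> n z = 0" if "z \<notin> K n" for n z
  proof (cases "z \<in> E \<or> z \<notin> \<Omega>")
    case True
    then show ?thesis using c by (auto simp: \<psi>_def supported_def)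
  next
    case False
    then have "z \<in> cball p (\<rho> / 2)" by (simp add: E_def)
    then have "- real (Suc n) * r z \<le> 1" using that by (simp add: K_def del: of_nat_Suc)
    then have "cutoff n z = 0" unfolding cutoff_def by (rule smooth_step_eq_0)
    then show ?thesis by (simp add: \<psi>_def)
  qed
  have smooth\<Omega>: "smooth_on \<Omega> (\<psi> n)" for n
  proof -
    have "smooth_on W (\<lambda>z. ?\<theta> z * complex_of_real (cutoff n z))"
      using \<theta> by (intro smooth_on_mult[OF open_W] cutoff_smooth bsmooth_on_smooth_on[of W ?\<theta>]) (simp add: supported_def)
    then have 1: "smooth_on W (\<psi> n)"
      using W_sub by (subst smooth_on_cong[OF open_W \<psi>_eq]) auto
    have "\<psi> n z = 0" if "z \<in> E" for z using that c by (simp add: \<psi>_def supported_def)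
    then have 2: "smooth_on E (\<psi> n)"
      by (subst smooth_on_cong[OF open_E, of _ "\<lambda>_. 0"]) (auto intro: smooth_on_const[OF open_E])
    show ?thesis using smooth_on_Un[OF 1 2] unfolding W_Un_E .
  qed
  have test: "\<psi> n \<in> test_functions \<Omega>" for n
  proof (rule test_functionsI[OF _ K[of n] out])
    have op: "open (- K n)" using compact_imp_closed[OF K(1)] by (simp add: open_Compl)
    have "smooth_on (- K n) (\<psi> n)"
      by (subst smooth_on_cong[OF op, of _ "\<lambda>_. 0"]) (auto intro: smooth_on_const[OF op] out)
    moreover have "\<Omega> \<union> - K n = UNIV" using K(2)[of n] by blast
    ultimately show "smooth_on UNIV (\<psi> n)" using smooth_on_Un[OF smooth\<Omega>[of n], of "- K n"] by simp
  qed
  have zero: "(LINT z|lebesgue_on \<Omega>. wirt v (\<psi> n) z * cnj (h z)) = 0" for n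
  proof -
    have sh: "smooth_on \<Omega> (\<lambda>z. cnj (h z))"
      by (rule smooth_on_cnj[OF open_dom smooth_on_holomorphic[OF h open_dom]])
    have D: "dir_deriv u (\<psi> n) \<in> test_functions \<Omega>" for u
      using test_functions_iter_deriv[OF test, of "[u]" n] by (simp add: dir_deriv_def)
    note i1 = integral_test_function(2)[OF open_dom test_functions_mult[OF open_dom sh D]]
    note i2 = integral_test_function(2)[OF open_dom test_functions_mult[OF open_dom smooth_on_dir_deriv[OF sh] test[of n]]]
    have "(LINT z|lebesgue_on \<Omega>. wirt v (\<psi> n) z * cnj (h z))
      = (LINT z|lebesgue_on \<Omega>. cnj (h z) * dir_deriv v (\<psi> n) z - \<i> * (cnj (h z) * dir_deriv (\<i> *s v) (\<psi> n) z))"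
      by (intro Bochner_Integration.integral_cong) (auto simp: wirt_def algebra_simps)
    also have "\<dots> = (LINT z|lebesgue_on \<Omega>. cnj (h z) * dir_deriv v (\<psi> n) z)
        - \<i> * (LINT z|lebesgue_on \<Omega>. cnj (h z) * dir_deriv (\<i> *s v) (\<psi> n) z)"
      using Bochner_Integration.integral_diff[OF i1 integrable_mult_right[OF i1]] by simp
    also have "\<dots> = - ((LINT z|lebesgue_on \<Omega>. dir_deriv v (\<lambda>z. cnj (h z)) z * \<psi> n z)
        - \<i> * (LINT z|lebesgue_on \<Omega>. dir_deriv (\<i> *s v) (\<lambda>z. cnj (h z)) z * \<psi> n z))"
      unfolding integral_by_parts[OF open_dom sh test] by simp
    also have "\<dots> = - (LINT z|lebesgue_on \<Omega>. dir_deriv v (\<lambda>z. cnj (h z)) z * \<psi> n z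
        - \<i> * (dir_deriv (\<i> *s v) (\<lambda>z. cnj (h z)) z * \<psi> n z))"
      using Bochner_Integration.integral_diff[OF i2 integrable_mult_right[OF i2]] by simp
    also have "\<dots> = - (LINT z|lebesgue_on \<Omega>. wirt v (\<lambda>z. cnj (h z)) z * \<psi> n z)"
      by (simp add: wirt_def algebra_simps)
    also have "\<dots> = - (LINT z|lebesgue_on \<Omega>. 0)"
      using wirt_cnj_holomorphic[OF open_dom h] by (intro arg_cong[of _ _ uminus] Bochner_Integration.integral_cong) auto
    finally show ?thesis by simp
  qed
  have wirt_\<psi>: "wirt v (\<psi> n) z = ?\<theta> z * wirt v (\<lambda>z. complex_of_real (cutoff n z)) z
      + wirt v ?\<theta> z * complex_of_real (cutoff n z)" if z: "z \<in> W" for n z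
  proof -
    have "wirt v (\<psi> n) z = wirt v (\<lambda>z. ?\<theta> z * complex_of_real (cutoff n z)) z"
      using W_sub by (intro wirt_cong[OF open_W z] \<psi>_eq) auto
    also have "\<dots> = ?\<theta> z * wirt v (\<lambda>z. complex_of_real (cutoff n z)) z + wirt v ?\<theta> z * complex_of_real (cutoff n z)"
      using \<theta> by (intro wirt_mult[OF _ cutoff_smooth z] bsmooth_on_smooth_on) (simp add: supported_def)
    finally show ?thesis .
  qed
  have wirt_E: "wirt v f z = 0" if "z \<in> E" "\<And>y. y \<in> E \<Longrightarrow> f y = 0" for f z
    using wirt_cong[OF open_E that(1), of f "\<lambda>_. 0" v] that(2) wirt_zero by simp
  obtain S where S: "S \<ge> 0" "\<And>t. \<bar>dir_deriv 1 smooth_step t\<bar> \<le> S" using smooth_step_deriv_bounded by blast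
  obtain B1 where B1: "B1 > 0" "\<And>z. z \<in> W \<Longrightarrow> cmod (c z) \<le> B1"
    using bsmooth_on_bounded0[of W c] c unfolding supported_def bounded_pos by auto
  obtain B2 where B2: "B2 > 0" "\<And>z. z \<in> W \<Longrightarrow> cmod (wirt v rc z) \<le> B2"
    using bsmooth_on_bounded0[OF bsmooth_on_wirt[OF open_W rc_bsmooth, of v]] unfolding bounded_pos by auto
  obtain B3 where B3: "B3 > 0" "\<And>z. z \<in> W \<Longrightarrow> cmod (wirt v ?\<theta> z) \<le> B3"
    using bsmooth_on_bounded0[OF bsmooth_on_wirt[OF open_W, of ?\<theta> v]] \<theta> unfolding supported_def bounded_pos by auto
  define B where "B = B1 * (2 * S * B2) + B3"
  have "B \<ge> 0" using B1(1) B2(1) B3(1) S(1) by (simp add: B_def)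
  have bound: "cmod (wirt v (\<psi> n) z) \<le> B" if z: "z \<in> \<Omega>" for n z
  proof (cases "z \<in> E")
    case True
    have "wirt v (\<psi> n) z = 0" by (rule wirt_E[OF True]) (use c in \<open>auto simp: \<psi>_def supported_def\<close>)
    then show ?thesis using \<open>B \<ge> 0\<close> by simp
  next
    case False
    then have zW: "z \<in> W" using z W_Un_E by blast
    let ?t = "- real (Suc n) * r z"
    \<comment> \<open>The derivative of the step is zero off 1 \<le> t \<le> 2, so multiplying it by
      t = -(n + 1) r costs at most a factor 2. Here the factor \<open>rc\<close> absorbs the growth
      n + 1, uniformly in n.\<close>
    have St: "\<bar>dir_deriv 1 smooth_step ?t * ?t\<bar> \<le> 2 * S"
    proof (cases "?t < 1 \<or> ?t > 2")
      case True
      then show ?thesis using smooth_step_deriv_eq_0[of ?t 1] S(1) by auto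
    next
      case False
      then have "\<bar>?t\<bar> \<le> 2" by linarith
      then show ?thesis using mult_mono[OF S(2)[of ?t], of "\<bar>?t\<bar>" 2] S(1) by (simp only: abs_mult) (simp add: mult.commute)
    qed
    have "?\<theta> z * wirt v (\<lambda>z. complex_of_real (cutoff n z)) z
        = c z * (complex_of_real (dir_deriv 1 smooth_step ?t * ?t) * wirt v rc z)"
      unfolding wirt_cutoff[OF zW] by (simp add: rc_def mult_ac)
    also have "cmod \<dots> \<le> B1 * (2 * S * B2)"
      unfolding norm_mult[of "c z"] norm_mult[of "complex_of_real _"] norm_of_real
      using St B1 B2 zW S(1) by (intro mult_mono) auto
    finally have 1: "cmod (?\<theta> z * wirt v (\<lambda>z. complex_of_real (cutoff n z)) z) \<le> B1 * (2 * S * B2)" .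
    have "cmod (wirt v ?\<theta> z * complex_of_real (cutoff n z)) \<le> B3 * 1"
      unfolding norm_mult norm_of_real
      using B3 zW smooth_step_ge_0 smooth_step_le_1 by (intro mult_mono) (auto simp: cutoff_def)
    then show ?thesis
      unfolding wirt_\<psi>[OF zW] B_def using 1 by (intro norm_triangle_mono) auto
  qed
  have lim: "(\<lambda>n. wirt v (\<psi> n) z) \<longlonglongrightarrow> wirt v ?\<theta> z" if z: "z \<in> \<Omega>" for z
  proof (cases "z \<in> E")
    case True
    have "wirt v (\<psi> n) z = 0" for n by (rule wirt_E[OF True]) (use c in \<open>auto simp: \<psi>_def supported_def\<close>)
    moreover have "wirt v ?\<theta> z = 0" by (rule wirt_E[OF True]) (use c in \<open>auto simp: supported_def\<close>)
    ultimately show ?thesis by simp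
  next
    case False
    then have zW: "z \<in> W" using z W_Un_E by blast
    then have "r z < 0" using sign[of z] z by (auto simp: W_def)
    have "\<forall>\<^sub>F n in sequentially. wirt v ?\<theta> z = wirt v (\<psi> n) z"
      using cutoff_eventually[OF \<open>r z < 0\<close>]
    proof eventually_elim
      case (elim n)
      then have "cutoff n z = 1" "dir_deriv 1 smooth_step (- real (Suc n) * r z) = 0"
        unfolding cutoff_def by (auto intro: smooth_step_eq_1 smooth_step_deriv_eq_0 simp del: of_nat_Suc)
      then show ?case unfolding wirt_\<psi>[OF zW] wirt_cutoff[OF zW] by simp
    qed
    then show ?thesis by (rule Lim_transform_eventually[OF tendsto_const])
  qed
  have "(\<lambda>n. LINT z|lebesgue_on \<Omega>. wirt v (\<psi> n) z * cnj (h z)) \<longlonglongrightarrow> (LINT z|lebesgue_on \<Omega>. wirt v ?\<theta> z * cnj (h z))"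
  proof (rule integral_dominated_convergence[where w = "\<lambda>z. B * norm (h z)"])
    have hm: "(\<lambda>z. cnj (h z)) \<in> borel_measurable (lebesgue_on \<Omega>)"
      by (intro borel_measurable_integrable integrable_cnj int)
    show "(\<lambda>z. wirt v ?\<theta> z * cnj (h z)) \<in> borel_measurable (lebesgue_on \<Omega>)"
      by (intro borel_measurable_times hm borel_measurable_lebesgue_on_continuous(1)[OF open_dom]
          smooth_on_imp_continuous_on smooth_on_wirt[OF open_dom] bsmooth_on_smooth_on supported_bsmooth \<theta>)
    show "(\<lambda>z. wirt v (\<psi> n) z * cnj (h z)) \<in> borel_measurable (lebesgue_on \<Omega>)" for n
      by (intro borel_measurable_times hm borel_measurable_lebesgue_on_continuous(1)[OF open_dom]
          smooth_on_imp_continuous_on smooth_on_wirt[OF open_dom] smooth\<Omega>)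
    show "integrable (lebesgue_on \<Omega>) (\<lambda>z. B * norm (h z))" using int by simp
    show "AE z in lebesgue_on \<Omega>. (\<lambda>n. wirt v (\<psi> n) z * cnj (h z)) \<longlonglongrightarrow> wirt v ?\<theta> z * cnj (h z)"
      by (intro AE_I2 tendsto_mult tendsto_const lim) simp
    show "AE z in lebesgue_on \<Omega>. norm (wirt v (\<psi> n) z * cnj (h z)) \<le> B * norm (h z)" for n
      by (intro AE_I2) (auto simp: norm_mult intro!: mult_right_mono bound)
  qed
  from LIMSEQ_unique[OF this[unfolded zero] tendsto_const]
  show "(LINT z|lebesgue_on \<Omega>. wirt v ?\<theta> z * cnj (h z)) = 0" .
qed

text \<open>From the product rule: for c = q c_s / (s + 1), \<open>wirt v\<close> of rc^(s+1) c is
  rc^s c_s + rc^(s+1) wirt v c, because \<open>q\<close> inverts \<open>wirt v rc\<close>. The next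
  term c_(s+1) is - wirt v c.\<close>

primrec corr :: "(complex ^ 'n \<Rightarrow> complex) \<Rightarrow> nat \<Rightarrow> complex ^ 'n \<Rightarrow> complex" where
  "corr g 0 = g"
| "corr g (Suc s) = (\<lambda>z. - (1 / of_nat (Suc s)) * wirt v (\<lambda>z. q z * corr g s z) z)"

lemma corr_supported: "supported g \<Longrightarrow> supported (corr g s)"
proof (induction s)
  case (Suc s)
  then show ?case
    unfolding corr.simps
    by (intro supported_mult[OF bsmooth_on_const[OF open_W]] supported_wirt supported_mult[OF q_bsmooth])
qed simp

text \<open>The construction uses only products and derivatives, so it is local; this is the source
  of \<open>vanishes_with\<close>.\<close>

lemma corr_vanishes:
  assumes "open U" "\<And>z. z \<in> U \<Longrightarrow> g z = 0" "z \<in> U"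
  shows "corr g s z = 0"
  using assms(3)
proof (induction s arbitrary: z)
  case (Suc s)
  have "wirt v (\<lambda>z. q z * corr g s z) z = wirt v (\<lambda>_. 0) z"
    by (rule wirt_cong[OF assms(1) Suc.prems]) (simp add: Suc.IH)
  then show ?case by (simp add: wirt_zero)
qed (use assms in simp)

text \<open>One factor \<open>rc\<close> is split off inside \<open>wirt v\<close>, the shape that
  \<open>conj_orthogonal_wirt\<close> accepts; the remaining factors form a supported
  function.\<close>

lemma corr_step:
  assumes g: "supported g" and z: "z \<in> \<Omega>"
  shows "rc z ^ s * corr g s z - rc z ^ Suc s * corr g (Suc s) z
    = wirt v (\<lambda>z. rc z * (rc z ^ s * ((1 / of_nat (Suc s)) * (q z * corr g s z)))) z"
proof (cases "z \<in> E")
  case True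
  have 0: "corr g s y = 0" if "y \<in> E" for s y
    using corr_supported[OF g] that by (simp add: supported_def)
  have "wirt v (\<lambda>z. rc z * (rc z ^ s * ((1 / of_nat (Suc s)) * (q z * corr g s z)))) z = wirt v (\<lambda>_. 0) z"
    by (rule wirt_cong[OF open_E True]) (simp add: 0)
  then show ?thesis using 0[OF True, of s] 0[OF True, of "Suc s"] by (simp only: wirt_zero) simp
next
  case False
  then have zW: "z \<in> W" using z W_Un_E by blast
  define u where "u = (\<lambda>z. q z * corr g s z)"
  have u: "smooth_on W u"
    using supported_mult[OF q_bsmooth corr_supported[OF g], of s] bsmooth_on_smooth_on
    unfolding supported_def u_def by blast
  have rcW: "smooth_on W rc" by (rule bsmooth_on_smooth_on[OF rc_bsmooth])
  have pow: "smooth_on W (\<lambda>z. rc z ^ k)" for k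
    by (rule bsmooth_on_smooth_on[OF bsmooth_on_power[OF open_W rc_bsmooth]])
  have wpow: "wirt v (\<lambda>z. rc z ^ Suc k) z = of_nat (Suc k) * rc z ^ k * wirt v rc z" for k
  proof (induction k)
    case (Suc k)
    have "wirt v (\<lambda>z. rc z ^ Suc (Suc k)) z = rc z * wirt v (\<lambda>z. rc z ^ Suc k) z + wirt v rc z * rc z ^ Suc k"
      using wirt_mult[OF rcW pow zW, of v "Suc k"] by simp
    then show ?case unfolding Suc by (simp add: algebra_simps)
  qed simp
  let ?k = "1 / of_nat (Suc s) :: complex"
  have "(\<lambda>z. rc z * (rc z ^ s * (?k * u z))) = (\<lambda>z. rc z ^ Suc s * (?k * u z))"
    by (simp add: mult.assoc)
  then have "wirt v (\<lambda>z. rc z * (rc z ^ s * (?k * u z))) z = wirt v (\<lambda>z. rc z ^ Suc s * (?k * u z)) z"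
    by (simp only:)
  also have "\<dots> = rc z ^ Suc s * wirt v (\<lambda>z. ?k * u z) z + wirt v (\<lambda>z. rc z ^ Suc s) z * (?k * u z)"
    by (rule wirt_mult[OF pow smooth_on_mult[OF open_W smooth_on_const[OF open_W] u] zW])
  also have "wirt v (\<lambda>z. ?k * u z) z = ?k * wirt v u z" by (rule wirt_cmult[OF u zW])
  also have "wirt v (\<lambda>z. rc z ^ Suc s) z * (?k * u z) = rc z ^ s * (wirt v rc z * q z * corr g s z)"
    unfolding wpow u_def by (simp add: field_simps del: of_nat_Suc)
  also have "\<dots> = rc z ^ s * corr g s z" by (simp add: wirt_rc_q[OF zW])
  also have "?k * wirt v u z = - corr g (Suc s) z" by (simp add: u_def)
  finally show ?thesis unfolding u_def by simp
qed

text \<open>The steps telescope: each replaces rc^s c_s by rc^(s+1) c_(s+1) at the price of an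
  orthogonal term.\<close>

lemma conj_orthogonal_corr:
  assumes g: "supported g"
  shows "conj_orthogonal \<Omega> (\<lambda>z. g z - rc z ^ s * corr g s z)"
proof (induction s)
  case 0
  show ?case by (simp add: conj_orthogonal_def)
next
  case (Suc s)
  have sup: "supported (\<lambda>z. rc z ^ k * corr g k z)" for k
    by (intro supported_mult bsmooth_on_power open_W rc_bsmooth corr_supported g)
  have sup2: "supported (\<lambda>z. rc z ^ s * ((1 / of_nat (Suc s)) * (q z * corr g s z)))"
    by (intro supported_mult bsmooth_on_power bsmooth_on_const open_W rc_bsmooth q_bsmooth corr_supported g)
  show ?case
  proof (rule conj_orthogonal_add[OF open_dom _ _ Suc conj_orthogonal_wirt[OF sup2]])
    show "bsmooth_on \<Omega> (\<lambda>z. g z - rc z ^ s * corr g s z)"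
      by (intro bsmooth_on_diff open_dom supported_bsmooth g sup)
    show "bsmooth_on \<Omega> (wirt v (\<lambda>z. rc z * (rc z ^ s * ((1 / of_nat (Suc s)) * (q z * corr g s z)))))"
      by (intro supported_bsmooth supported_wirt supported_mult[OF rc_bsmooth] sup2)
    show "g z - rc z ^ Suc s * corr g (Suc s) z = (g z - rc z ^ s * corr g s z)
        + wirt v (\<lambda>z. rc z * (rc z ^ s * ((1 / of_nat (Suc s)) * (q z * corr g s z)))) z" if "z \<in> \<Omega>" for z
      unfolding corr_step[OF g that, symmetric] by simp
  qed
qed

lemma flat_correction_corr:
  assumes "- \<Omega> \<noteq> {}" "bsmooth_on \<Omega> g" "\<And>z. z \<in> \<Omega> \<Longrightarrow> z \<notin> cball p (\<rho> / 2) \<Longrightarrow> g z = 0"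
  shows "flat_correction \<Omega> N g (\<lambda>z. rc z ^ N * corr g N z)"
proof -
  have g: "supported g"
    unfolding supported_def using bsmooth_on_subset[OF assms(2) W_sub] assms(3) by (auto simp: E_def)
  have "vanishes_with \<Omega> g (\<lambda>z. rc z ^ N * corr g N z)"
    unfolding vanishes_with_def using corr_vanishes[of _ g] by auto
  moreover have "bsmooth_on \<Omega> (\<lambda>z. rc z ^ N * corr g N z)"
    by (intro supported_bsmooth supported_mult bsmooth_on_power open_W rc_bsmooth corr_supported g)
  ultimately show ?thesis
    unfolding flat_correction_def
    using flat_rc_power[OF assms(1) corr_supported[OF g]] conj_orthogonal_corr[OF g] by blast
qed

end

section \<open>Local corrections and their patching\<close>

lemma boundary_correction:
  fixes \<Omega> :: "(complex ^ 'n::finite) set"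
  assumes "smooth_bounded_domain \<Omega>" and p: "p \<in> frontier \<Omega>"
  shows "\<exists>\<rho>>0. \<forall>g. bsmooth_on \<Omega> g \<and> (\<forall>z\<in>\<Omega>. z \<notin> cball p (\<rho> / 2) \<longrightarrow> g z = 0) \<longrightarrow> (\<exists>G. flat_correction \<Omega> N g G)"
proof -
  have dom: "open \<Omega>" "bounded \<Omega>" "smooth_boundary \<Omega>" using assms(1) by (auto simp: smooth_bounded_domain_def)
  have ne: "- \<Omega> \<noteq> {}"
  proof
    assume "- \<Omega> = {}"
    then have "\<Omega> = UNIV" by blast
    then show False using dom(2) not_bounded_UNIV by simp
  qed
  obtain U and r :: "complex ^ 'n \<Rightarrow> real" where U: "open U" "p \<in> U" "smooth_on U r"
    "\<forall>x\<in>U. frechet_derivative r (at x) \<noteq> (\<lambda>v. 0)" "\<Omega> \<inter> U = {x\<in>U. r x < 0}"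
    using dom(3) p unfolding smooth_boundary_def by blast
  have "frechet_derivative r (at p) \<noteq> (\<lambda>v. 0)" using U(2,4) by blast
  then obtain v where v: "dir_deriv v r p \<noteq> 0" unfolding dir_deriv_def by blast
  \<comment> \<open>Half the value at p, so that by continuity the lower bound persists in a
    neighbourhood.\<close>
  define c0 where "c0 = \<bar>dir_deriv v r p\<bar> / 2"
  have c0: "c0 > 0" "c0 < \<bar>dir_deriv v r p\<bar>" using v by (auto simp: c0_def)
  define U' where "U' = {z \<in> U. c0 < \<bar>dir_deriv v r z\<bar>}"
  have "continuous_on U (\<lambda>z. \<bar>dir_deriv v r z\<bar>)"
    by (intro continuous_intros smooth_on_imp_continuous_on smooth_on_dir_deriv U)
  from continuous_open_preimage[OF this U(1) open_greaterThan[of c0]]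
  have "open U'" by (simp add: U'_def vimage_def Int_def)
  moreover have "p \<in> U'" using U(2) c0 by (simp add: U'_def)
  ultimately obtain \<rho> where \<rho>: "\<rho> > 0" "cball p \<rho> \<subseteq> U'" using open_contains_cball[of U'] by blast
  have sub: "cball p \<rho> \<subseteq> U" using \<rho>(2) by (auto simp: U'_def)
  interpret boundary_patch \<Omega> U p v \<rho> c0 r
  proof
    show "z \<in> \<Omega> \<longleftrightarrow> r z < 0" if "z \<in> cball p \<rho>" for z
    proof -
      have "z \<in> U" using that sub by blast
      then have "z \<in> \<Omega> \<longleftrightarrow> z \<in> \<Omega> \<inter> U" by simp
      also have "\<dots> \<longleftrightarrow> r z < 0" unfolding U(5) using \<open>z \<in> U\<close> by simp
      finally show ?thesis .
    qed
    show "c0 \<le> \<bar>dir_deriv v r z\<bar>" if "z \<in> cball p \<rho>" for z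
      using subsetD[OF \<rho>(2) that] by (simp add: U'_def)
  qed (use dom U c0 \<rho> sub in auto)
  show ?thesis
    using \<rho>(1) flat_correction_corr[OF ne] by blast
qed

text \<open>The support of g keeps distance at least \<rho> / 2 from the complement, so g is already
  flat to every order and serves as its own correction.\<close>

lemma interior_correction:
  fixes \<Omega> :: "(complex ^ 'n::finite) set"
  assumes "open \<Omega>" and ne: "- \<Omega> \<noteq> {}" and p: "p \<in> \<Omega>"
  shows "\<exists>\<rho>>0. \<forall>g. bsmooth_on \<Omega> g \<and> (\<forall>z\<in>\<Omega>. z \<notin> cball p (\<rho> / 2) \<longrightarrow> g z = 0) \<longrightarrow> (\<exists>G. flat_correction \<Omega> N g G)"
proof -
  obtain \<rho> where \<rho>: "\<rho> > 0" "cball p \<rho> \<subseteq> \<Omega>" using assms(1) p open_contains_cball[of \<Omega>] by blast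
  have d: "\<rho> / 2 \<le> bdist \<Omega> z" if z: "z \<in> cball p (\<rho> / 2)" for z
    unfolding bdist_def infdist_notempty[OF ne]
  proof (rule cINF_greatest[OF ne])
    fix w assume "w \<in> - \<Omega>"
    then have "w \<notin> cball p \<rho>" using \<rho>(2) by blast
    then show "\<rho> / 2 \<le> dist z w" using z dist_triangle[of p w z] by simp
  qed
  have "flat_correction \<Omega> N g g" if g: "bsmooth_on \<Omega> g" "\<And>z. z \<in> \<Omega> \<Longrightarrow> z \<notin> cball p (\<rho> / 2) \<Longrightarrow> g z = 0" for g
  proof -
    have "flat_on \<Omega> N g"
      unfolding flat_on_def
    proof (intro allI impI)
      fix vs :: "(complex ^ 'n) list"
      let ?m = "N - length vs"
      obtain B where B: "B > 0" "\<And>z. z \<in> \<Omega> \<Longrightarrow> cmod (iter_deriv vs g z) \<le> B"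
        using bsmooth_on_bounded[OF g(1), of vs] unfolding bounded_pos by auto
      have "cmod (iter_deriv vs g z) \<le> B / (\<rho> / 2) ^ ?m * bdist \<Omega> z ^ ?m" if z: "z \<in> \<Omega>" for z
      proof (cases "z \<in> cball p (\<rho> / 2)")
        case True
        have "cmod (iter_deriv vs g z) \<le> B / (\<rho> / 2) ^ ?m * (\<rho> / 2) ^ ?m" using B(2)[OF z] \<rho>(1) by simp
        also have "\<dots> \<le> B / (\<rho> / 2) ^ ?m * bdist \<Omega> z ^ ?m"
          using d[OF True] \<rho>(1) B(1) by (intro mult_left_mono power_mono) auto
        finally show ?thesis .
      next
        case False
        have "iter_deriv vs g z = iter_deriv vs (\<lambda>_. 0) z"
          by (rule iter_deriv_cong[of "\<Omega> - cball p (\<rho> / 2)"]) (use assms(1) g(2) z False in auto)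
        then show ?thesis using \<rho>(1) B(1) by (simp add: iter_deriv_0 bdist_def infdist_nonneg)
      qed
      then show "\<exists>C. \<forall>z\<in>\<Omega>. cmod (iter_deriv vs g z) \<le> C * bdist \<Omega> z ^ ?m" by blast
    qed
    then show ?thesis
      using g(1) by (simp add: flat_correction_def conj_orthogonal_def vanishes_with_def)
  qed
  then show ?thesis using \<rho>(1) by blast
qed

text \<open>The two implications about zeros say that the pieces vanish wherever g does, as products
  of g with cutoffs do; without cancellation between the pieces \<open>vanishes_with\<close> passes
  to the sum.\<close>

lemma flat_correction_add:
  assumes "open \<Omega>" "bsmooth_on \<Omega> g1" "bsmooth_on \<Omega> g2" "flat_correction \<Omega> N g1 G1" "flat_correction \<Omega> N g2 G2"
    and g: "\<And>z. g z = g1 z + g2 z" "\<And>z. g z = 0 \<Longrightarrow> g1 z = 0" "\<And>z. g z = 0 \<Longrightarrow> g2 z = 0"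
  shows "flat_correction \<Omega> N g (\<lambda>z. G1 z + G2 z)"
proof -
  have s: "bsmooth_on \<Omega> G1" "bsmooth_on \<Omega> G2" using assms(4,5) by (auto simp: flat_correction_def)
  have 1: "bsmooth_on \<Omega> (\<lambda>z. G1 z + G2 z)" by (intro bsmooth_on_add assms(1) s)
  have 2: "flat_on \<Omega> N (\<lambda>z. G1 z + G2 z)"
    using assms(4,5) by (intro flat_on_add assms(1) s[THEN bsmooth_on_smooth_on]) (auto simp: flat_correction_def)
  have 3: "conj_orthogonal \<Omega> (\<lambda>z. g z - (G1 z + G2 z))"
    by (rule conj_orthogonal_add[OF assms(1) bsmooth_on_diff[OF assms(1,2) s(1)] bsmooth_on_diff[OF assms(1,3) s(2)]])
       (use assms(4,5) g(1) in \<open>auto simp: flat_correction_def\<close>)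
  have 4: "vanishes_with \<Omega> g (\<lambda>z. G1 z + G2 z)"
    using assms(4,5) g(2,3) unfolding flat_correction_def vanishes_with_def by simp
  show ?thesis unfolding flat_correction_def using 1 2 3 4 by blast
qed

text \<open>Induction over finitely many balls that cover the set where g is nonzero: a cutoff
  splits off the part near one ball, and what remains is zero off the others. This is a partition of
  unity built one factor at a time.\<close>

lemma flat_correction_exists:
  fixes \<Omega> :: "(complex ^ 'n::finite) set"
  assumes dom: "smooth_bounded_domain \<Omega>" and "bsmooth_on \<Omega> g"
  obtains G where "flat_correction \<Omega> N g G"
proof -
  have \<Omega>: "open \<Omega>" "bounded \<Omega>" using dom by (auto simp: smooth_bounded_domain_def)
  have ne: "- \<Omega> \<noteq> {}"
  proof
    assume "- \<Omega> = {}"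
    then have "\<Omega> = UNIV" by blast
    then show False using \<Omega>(2) not_bounded_UNIV by simp
  qed
  have "\<exists>\<rho>>0. \<forall>g. bsmooth_on \<Omega> g \<and> (\<forall>z\<in>\<Omega>. z \<notin> cball p (\<rho> / 2) \<longrightarrow> g z = 0) \<longrightarrow> (\<exists>G. flat_correction \<Omega> N g G)"
    if "p \<in> closure \<Omega>" for p
  proof (cases "p \<in> \<Omega>")
    case True
    then show ?thesis by (rule interior_correction[OF \<Omega>(1) ne])
  next
    case False
    then have "p \<in> frontier \<Omega>" using that \<Omega>(1) by (simp add: frontier_def interior_open)
    then show ?thesis by (rule boundary_correction[OF dom])
  qed
  then have "\<forall>p\<in>closure \<Omega>. \<exists>\<rho>>0. \<forall>g. bsmooth_on \<Omega> g \<and> (\<forall>z\<in>\<Omega>. z \<notin> cball p (\<rho> / 2) \<longrightarrow> g z = 0) \<longrightarrow> (\<exists>G. flat_correction \<Omega> N g G)"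
    by blast
  from bchoice[OF this] obtain \<rho> where \<rho>: "\<And>p. p \<in> closure \<Omega> \<Longrightarrow> \<rho> p > 0"
    "\<And>p g. p \<in> closure \<Omega> \<Longrightarrow> bsmooth_on \<Omega> g \<Longrightarrow> (\<And>z. z \<in> \<Omega> \<Longrightarrow> z \<notin> cball p (\<rho> p / 2) \<Longrightarrow> g z = 0) \<Longrightarrow> \<exists>G. flat_correction \<Omega> N g G"
    by blast
  have "compact (closure \<Omega>)" using \<Omega>(2) by (simp add: compact_closure)
  moreover have "closure \<Omega> \<subseteq> (\<Union>p\<in>closure \<Omega>. ball p (\<rho> p / 4))" using \<rho>(1) by force
  ultimately obtain I where I: "I \<subseteq> closure \<Omega>" "finite I" "closure \<Omega> \<subseteq> (\<Union>p\<in>I. ball p (\<rho> p / 4))"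
    by (rule compactE_image[OF _ open_ball])
  have "\<exists>G. flat_correction \<Omega> N g G"
    if "finite J" "J \<subseteq> closure \<Omega>" "bsmooth_on \<Omega> g" "\<And>z. z \<in> \<Omega> \<Longrightarrow> z \<notin> (\<Union>p\<in>J. ball p (\<rho> p / 4)) \<Longrightarrow> g z = 0" for J g
    using that
  proof (induction J arbitrary: g)
    case empty
    have "flat_on \<Omega> N (\<lambda>_. 0)"
      unfolding flat_on_def iter_deriv_0 by (intro allI impI exI[of _ 0]) simp
    moreover have "conj_orthogonal \<Omega> (\<lambda>z. g z - 0)"
      unfolding conj_orthogonal_def
    proof (intro allI impI)
      fix h
      have "(LINT z|lebesgue_on \<Omega>. (g z - 0) * cnj (h z)) = (LINT z|lebesgue_on \<Omega>. 0)"
        using empty.prems(3) by (intro Bochner_Integration.integral_cong) auto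
      then show "(LINT z|lebesgue_on \<Omega>. (g z - 0) * cnj (h z)) = 0" by simp
    qed
    ultimately have "flat_correction \<Omega> N g (\<lambda>_. 0)"
      using bsmooth_on_const[OF \<Omega>(1)] unfolding flat_correction_def vanishes_with_def by blast
    then show ?case by blast
  next
    case (insert p J)
    have p: "p \<in> closure \<Omega>" using insert.prems(1) by simp
    \<comment> \<open>Equal to 1 on the covering ball of radius \<rho> p / 4 and zero beyond \<rho>
      p / 2, the support that the local corrections admit.\<close>
    define \<beta> where "\<beta> z = complex_of_real (bump p (\<rho> p / 4) (\<rho> p / 2) z)" for z
    have \<beta>s: "bsmooth_on \<Omega> \<beta>"
      unfolding \<beta>_def
      by (rule bsmooth_on_compactI[OF smooth_on_of_real[OF open_UNIV smooth_on_bump] _ closure_subset subset_UNIV])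
         (simp add: compact_closure \<Omega>(2))
    have s: "bsmooth_on \<Omega> (\<lambda>z. \<beta> z * g z)" "bsmooth_on \<Omega> (\<lambda>z. (1 - \<beta> z) * g z)"
      by (intro bsmooth_on_mult bsmooth_on_diff bsmooth_on_const \<Omega>(1) \<beta>s insert.prems(2))+
    have "\<beta> z * g z = 0" if "z \<notin> cball p (\<rho> p / 2)" for z
      using that \<rho>(1)[OF p] bump_eq_0[of "\<rho> p / 4" "\<rho> p / 2" z p] by (simp add: \<beta>_def dist_norm norm_minus_commute)
    then have "\<exists>G1. flat_correction \<Omega> N (\<lambda>z. \<beta> z * g z) G1" by (intro \<rho>(2)[OF p s(1)])
    then obtain G1 where G1: "flat_correction \<Omega> N (\<lambda>z. \<beta> z * g z) G1" ..
    have "(1 - \<beta> z) * g z = 0" if "z \<in> \<Omega>" "z \<notin> (\<Union>p\<in>J. ball p (\<rho> p / 4))" for z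
    proof (cases "z \<in> ball p (\<rho> p / 4)")
      case True
      then show ?thesis
        using \<rho>(1)[OF p] bump_eq_1[of "\<rho> p / 4" "\<rho> p / 2" z p] by (simp add: \<beta>_def dist_norm norm_minus_commute)
    next
      case False
      then show ?thesis using insert.prems(3)[OF that(1)] that(2) by simp
    qed
    note vanish = this
    have "\<exists>G2. flat_correction \<Omega> N (\<lambda>z. (1 - \<beta> z) * g z) G2"
      by (rule insert.IH[OF _ s(2)]) (use insert.prems(1) vanish in auto)
    then obtain G2 where G2: "flat_correction \<Omega> N (\<lambda>z. (1 - \<beta> z) * g z) G2" ..
    have "flat_correction \<Omega> N g (\<lambda>z. G1 z + G2 z)"
      by (rule flat_correction_add[OF \<Omega>(1) s G1 G2]) (auto simp: algebra_simps)
    then show ?case by blast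
  qed
  note claim = this
  have "\<exists>G. flat_correction \<Omega> N g G"
  proof (rule claim[OF I(2,1) assms(2)])
    fix z assume "z \<in> \<Omega>" "z \<notin> (\<Union>p\<in>I. ball p (\<rho> p / 4))"
    then show "g z = 0" using I(3) closure_subset[of \<Omega>] by (meson subsetD)
  qed
  then obtain G where "flat_correction \<Omega> N g G" ..
  then show ?thesis by (rule that)
qed

lemma smooth_up_to_boundary_bsmooth_on:
  assumes "smooth_up_to_boundary \<Omega> g" "bounded \<Omega>"
  shows "bsmooth_on \<Omega> g"
  unfolding bsmooth_on_def
proof (intro conjI allI)
  show "smooth_on \<Omega> g" using assms(1) by (simp add: smooth_up_to_boundary_def)
  fix vs
  obtain G where G: "continuous_on (closure \<Omega>) G" "\<And>x. x \<in> \<Omega> \<Longrightarrow> G x = iter_deriv vs g x"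
    using assms(1) unfolding smooth_up_to_boundary_def by blast
  have "bounded (G ` closure \<Omega>)"
    by (intro compact_imp_bounded compact_continuous_image G(1)) (simp add: compact_closure assms(2))
  then have "bounded (G ` \<Omega>)" by (rule bounded_subset) (intro image_mono closure_subset)
  then show "bounded (iter_deriv vs g ` \<Omega>)" using G(2) by (simp cong: image_cong)
qed

section \<open>Weighted estimates\<close>

locale weighted_domain =
  fixes \<Omega> :: "(complex ^ 'n::finite) set"
  assumes open_dom: "open \<Omega>" and bounded_dom: "bounded \<Omega>"
begin

abbreviation d where "d \<equiv> bdist \<Omega>"

lemma compl_ne: "- \<Omega> \<noteq> {}"
proof
  assume "- \<Omega> = {}"
  then have "\<Omega> = UNIV" by blast
  then show False using bounded_dom not_bounded_UNIV by simp
qed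

lemma d_pos: "z \<in> \<Omega> \<Longrightarrow> d z > 0"
  unfolding bdist_def using open_dom compl_ne
  by (intro infdist_pos_not_in_closed) (auto simp: closed_Compl)

lemma d_nonneg: "d z \<ge> 0"
  unfolding bdist_def by (rule infdist_nonneg)

lemma ball_d_subset: "ball z (d z) \<subseteq> \<Omega>"
proof
  fix w assume w: "w \<in> ball z (d z)"
  show "w \<in> \<Omega>"
  proof (rule ccontr)
    assume "w \<notin> \<Omega>"
    then have "infdist z (- \<Omega>) \<le> dist z w" by (intro infdist_le) simp
    then show False using w by (simp add: bdist_def)
  qed
qed

lemma d_le_dist: "d z \<le> d w + dist z w"
  unfolding bdist_def by (rule infdist_triangle)

lemma continuous_on_d: "continuous_on S d"
  unfolding bdist_def[abs_def] by (intro continuous_intros)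

lemma d_le: obtains D where "D \<ge> 1" "\<And>z. z \<in> \<Omega> \<Longrightarrow> d z \<le> D"
proof -
  have "bounded (d ` closure \<Omega>)"
    by (intro compact_imp_bounded compact_continuous_image continuous_on_d) (simp add: compact_closure bounded_dom)
  then obtain D where D: "\<And>z. z \<in> closure \<Omega> \<Longrightarrow> \<bar>d z\<bar> \<le> D" unfolding bounded_iff by auto
  have "d z \<le> max 1 D" if "z \<in> \<Omega>" for z using D[of z] closure_subset[of \<Omega>] that by force
  then show ?thesis using that[of "max 1 D"] by simp
qed

lemma compact_d_ge:
  assumes "compact K" "K \<subseteq> \<Omega>"
  obtains e where "e > 0" "\<And>z. z \<in> K \<Longrightarrow> e \<le> d z"
proof (cases "K = {}")
  case True
  then show ?thesis using that[of 1] by simp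
next
  case False
  obtain x where "x \<in> K" "\<And>y. y \<in> K \<Longrightarrow> d x \<le> d y"
    using continuous_attains_inf[OF assms(1) False continuous_on_d] by blast
  then show ?thesis using that[of "d x"] d_pos assms(2) by blast
qed

text \<open>Integer powers, because the exponent is negative for functions that blow up at the
  boundary; each derivative costs one power of the distance. The constant is explicit so that linear
  dependence on it can be followed.\<close>

definition wbound :: "nat \<Rightarrow> int \<Rightarrow> real \<Rightarrow> (complex ^ 'n \<Rightarrow> complex) \<Rightarrow> bool" where
  "wbound n e C f \<longleftrightarrow> (\<forall>vs. set vs \<subseteq> Basis \<longrightarrow> length vs \<le> n \<longrightarrow>
     (\<forall>z\<in>\<Omega>. cmod (iter_deriv vs f z) \<le> C * d z powi (e - int (length vs))))"

lemma wboundD: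
  "wbound n e C f \<Longrightarrow> set vs \<subseteq> Basis \<Longrightarrow> length vs \<le> n \<Longrightarrow> z \<in> \<Omega> \<Longrightarrow>
    cmod (iter_deriv vs f z) \<le> C * d z powi (e - int (length vs))"
  unfolding wbound_def by blast

lemma wbound_dir_deriv:
  assumes "wbound (Suc n) e C f" "i \<in> Basis"
  shows "wbound n (e - 1) C (dir_deriv i f)"
  unfolding wbound_def
proof (intro allI impI ballI)
  fix vs :: "(complex ^ 'n) list" and z assume vs: "set vs \<subseteq> Basis" "length vs \<le> n" and z: "z \<in> \<Omega>"
  have "cmod (iter_deriv (vs @ [i]) f z) \<le> C * d z powi (e - int (length (vs @ [i])))"
    by (rule wboundD[OF assms(1) _ _ z]) (use vs assms(2) in auto)
  then show "cmod (iter_deriv vs (dir_deriv i f) z) \<le> C * d z powi (e - 1 - int (length vs))"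
    unfolding iter_deriv_snoc by (simp add: algebra_simps)
qed

lemma wbound_SucD: "wbound (Suc n) e C f \<Longrightarrow> wbound n e C f"
  unfolding wbound_def by simp

text \<open>Leibniz rule by induction on the order: one derivative yields two products, each with
  the total exponent lowered by one, so the constant doubles.\<close>

lemma wbound_mult:
  assumes "smooth_on \<Omega> f" "smooth_on \<Omega> g" "wbound n e C f" "wbound n e' C' g" "C \<ge> 0" "C' \<ge> 0"
  shows "wbound n (e + e') (2 ^ n * (C * C')) (\<lambda>z. f z * g z)"
  using assms(1-4)
proof (induction n arbitrary: f g e e')
  case 0
  show ?case
    unfolding wbound_def
  proof (intro allI impI ballI)
    fix vs :: "(complex ^ 'n) list" and z assume "length vs \<le> 0" and z: "z \<in> \<Omega>"
    then have vs: "vs = []" by simp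
    have "cmod (f z) \<le> C * d z powi e" "cmod (g z) \<le> C' * d z powi e'"
      using wboundD[OF 0(3), of "[]" z] wboundD[OF 0(4), of "[]" z] z by auto
    then have "cmod (f z * g z) \<le> (C * d z powi e) * (C' * d z powi e')"
      unfolding norm_mult using assms(5) d_nonneg[of z] by (intro mult_mono) auto
    also have "\<dots> = C * C' * d z powi (e + e')"
      using d_pos[OF z] by (simp add: power_int_add)
    finally show "cmod (iter_deriv vs (\<lambda>z. f z * g z) z) \<le> 2 ^ 0 * (C * C') * d z powi (e + e' - int (length vs))"
      using vs by simp
  qed
next
  case (Suc n)
  show ?case
    unfolding wbound_def
  proof (intro allI impI ballI)
    fix vs :: "(complex ^ 'n) list" and z assume vs: "set vs \<subseteq> Basis" "length vs \<le> Suc n" and z: "z \<in> \<Omega>"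
    have fn: "wbound n e C f" "wbound n e' C' g" using Suc.prems(3,4) wbound_SucD by blast+
    show "cmod (iter_deriv vs (\<lambda>z. f z * g z) z) \<le> 2 ^ Suc n * (C * C') * d z powi (e + e' - int (length vs))"
    proof (cases vs rule: rev_cases)
      case Nil
      have "wbound n (e + e') (2 ^ n * (C * C')) (\<lambda>z. f z * g z)"
        by (rule Suc.IH[OF Suc.prems(1,2) fn])
      then have "cmod (iter_deriv [] (\<lambda>z. f z * g z) z) \<le> 2 ^ n * (C * C') * d z powi (e + e' - int (length ([] :: (complex ^ 'n) list)))"
        by (rule wboundD) (use z in auto)
      also have "\<dots> \<le> 2 ^ Suc n * (C * C') * d z powi (e + e' - int (length ([] :: (complex ^ 'n) list)))"
        using assms(5,6) d_nonneg[of z] by (intro mult_right_mono) auto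
      finally show ?thesis using Nil by simp
    next
      case (snoc us i)
      have i: "i \<in> Basis" and us: "set us \<subseteq> Basis" "length us \<le> n" using vs snoc by auto
      note sf = smooth_on_dir_deriv[OF Suc.prems(1), of i] and sg = smooth_on_dir_deriv[OF Suc.prems(2), of i]
      have "iter_deriv vs (\<lambda>z. f z * g z) z = iter_deriv us (\<lambda>z. f z * dir_deriv i g z + dir_deriv i f z * g z) z"
        unfolding snoc iter_deriv_snoc
        by (rule iter_deriv_cong[OF open_dom smooth_on_dir_deriv_mult[OF Suc.prems(1,2)] z])
      also have "\<dots> = iter_deriv us (\<lambda>z. f z * dir_deriv i g z) z + iter_deriv us (\<lambda>z. dir_deriv i f z * g z) z"
        by (rule iter_deriv_add[OF smooth_on_mult[OF open_dom Suc.prems(1) sg] smooth_on_mult[OF open_dom sf Suc.prems(2)] open_dom z])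
      also have "cmod \<dots> \<le> 2 ^ n * (C * C') * d z powi (e + (e' - 1) - int (length us))
          + 2 ^ n * (C * C') * d z powi (e - 1 + e' - int (length us))"
        using Suc.IH[OF Suc.prems(1) sg fn(1) wbound_dir_deriv[OF Suc.prems(4) i]]
          Suc.IH[OF sf Suc.prems(2) wbound_dir_deriv[OF Suc.prems(3) i] fn(2)] us z
        unfolding wbound_def by (intro norm_triangle_mono) auto
      also have "\<dots> = 2 ^ Suc n * (C * C') * d z powi (e + e' - int (length vs))"
        using snoc by (simp add: algebra_simps)
      finally show ?thesis .
    qed
  qed
qed

text \<open>There are finitely many lists of basis vectors of bounded length, so constants chosen
  list by list merge into one.\<close>

lemma finite_lists_bound:
  fixes P :: "(complex ^ 'n) list \<Rightarrow> real \<Rightarrow> bool"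
  assumes "\<And>vs. set vs \<subseteq> Basis \<Longrightarrow> length vs \<le> n \<Longrightarrow> \<exists>C. P vs C" and mono: "\<And>vs C C'. P vs C \<Longrightarrow> C \<le> C' \<Longrightarrow> P vs C'"
  shows "\<exists>C>0. \<forall>vs. set vs \<subseteq> Basis \<longrightarrow> length vs \<le> n \<longrightarrow> P vs C"
proof -
  let ?V = "{vs :: (complex ^ 'n) list. set vs \<subseteq> Basis \<and> length vs \<le> n}"
  have "\<forall>vs\<in>?V. \<exists>C. P vs C" using assms(1) by simp
  from bchoice[OF this] obtain C where C: "\<And>vs. vs \<in> ?V \<Longrightarrow> P vs (C vs)" by blast
  have fin: "finite ?V" by (rule finite_lists_length_le[OF finite_Basis])
  define M where "M = (\<Sum>vs\<in>?V. \<bar>C vs\<bar>) + 1"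
  have "M > 0" unfolding M_def by (intro add_nonneg_pos sum_nonneg) auto
  have "P vs M" if vs: "set vs \<subseteq> Basis" "length vs \<le> n" for vs
  proof (rule mono[OF C])
    show "vs \<in> ?V" using vs by simp
    then have "\<bar>C vs\<bar> \<le> (\<Sum>vs\<in>?V. \<bar>C vs\<bar>)" by (intro member_le_sum fin) auto
    then show "C vs \<le> M" unfolding M_def by linarith
  qed
  then show ?thesis using \<open>M > 0\<close> by (intro exI[of _ M]) simp
qed

lemma flat_on_wbound:
  assumes "flat_on \<Omega> N G" "n \<le> N"
  obtains C where "C > 0" "wbound n (int N) C G"
proof -
  let ?P = "\<lambda>vs C. \<forall>z\<in>\<Omega>. cmod (iter_deriv vs G z) \<le> C * d z ^ (N - length vs)"
  have flat: "\<forall>vs. length vs \<le> N \<longrightarrow> (\<exists>C. ?P vs C)"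
    using assms(1) unfolding flat_on_def .
  have ex: "\<exists>C. ?P vs C" if "set vs \<subseteq> Basis" "length vs \<le> n" for vs :: "(complex ^ 'n) list"
    by (rule mp[OF spec[OF flat] order_trans[OF that(2) assms(2)]])
  have mono: "?P vs C'" if *: "?P vs C" "C \<le> C'" for vs :: "(complex ^ 'n) list" and C C'
  proof
    fix z assume "z \<in> \<Omega>"
    then have "cmod (iter_deriv vs G z) \<le> C * d z ^ (N - length vs)" by (rule bspec[OF *(1)])
    also have "\<dots> \<le> C' * d z ^ (N - length vs)" 
      by (rule mult_right_mono[OF *(2) zero_le_power[OF d_nonneg]])
    finally show "cmod (iter_deriv vs G z) \<le> C' * d z ^ (N - length vs)" .
  qed
  obtain C where *: "C > 0 \<and> (\<forall>vs. set vs \<subseteq> Basis \<longrightarrow> length vs \<le> n \<longrightarrow> ?P vs C)"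
    using finite_lists_bound[of n ?P, OF ex mono] ..
  note C0 = conjunct1[OF *] and C = conjunct2[OF *]
  have "wbound n (int N) C G"
    unfolding wbound_def
  proof (intro allI impI ballI)
    fix vs :: "(complex ^ 'n) list" and z assume vs: "set vs \<subseteq> Basis" "length vs \<le> n" and z: "z \<in> \<Omega>"
    have e: "int N - int (length vs) = int (N - length vs)" using vs(2) assms(2) by linarith
    have "?P vs C" by (rule mp[OF mp[OF spec[OF C] vs(1)] vs(2)])
    then show "cmod (iter_deriv vs G z) \<le> C * d z powi (int N - int (length vs))"
      unfolding e power_int_of_nat by (rule bspec[OF _ z])
  qed
  from that[OF C0 this] show ?thesis .
qed

definition conj_growth :: "nat \<Rightarrow> real \<Rightarrow> (complex ^ 'n \<Rightarrow> complex) \<Rightarrow> bool" where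
  "conj_growth M A m \<longleftrightarrow> holomorphic_several (\<lambda>z. cnj (m z)) \<Omega> \<and> (\<forall>z\<in>\<Omega>. cmod (m z) \<le> A / d z ^ M)"

lemma conj_growth_smooth: "conj_growth M A m \<Longrightarrow> smooth_on \<Omega> m"
  using smooth_on_cnj[OF open_dom smooth_on_holomorphic[OF _ open_dom], of "\<lambda>z. cnj (m z)"]
  unfolding conj_growth_def by simp

lemma conj_growth_iter_deriv:
  obtains C where "C \<ge> 0" "\<And>A m z. conj_growth M A m \<Longrightarrow> A \<ge> 0 \<Longrightarrow> z \<in> \<Omega> \<Longrightarrow>
    cmod (iter_deriv vs m z) \<le> C * A / d z ^ (M + length vs)"
proof (rule holomorphic_iter_deriv_bound[where vs = vs and ?'n = 'n])
  fix C :: real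
  assume C: "C \<ge> 0" "\<And>f (\<Omega> :: (complex ^ 'n) set) r z A. holomorphic_several f \<Omega> \<Longrightarrow> r > 0 \<Longrightarrow>
    cball z (5 * r) \<subseteq> \<Omega> \<Longrightarrow> A \<ge> 0 \<Longrightarrow> (\<And>u. u \<in> ball z (2 * r) \<Longrightarrow> cmod (f u) \<le> A) \<Longrightarrow>
    cmod (iter_deriv vs f z) \<le> C * A / r ^ length vs"
  have "cmod (iter_deriv vs m z) \<le> (C * 2 ^ M * 10 ^ length vs) * A / d z ^ (M + length vs)"
    if m: "conj_growth M A m" and A: "A \<ge> 0" and z: "z \<in> \<Omega>" for A m z
  proof -
    \<comment> \<open>Then 5 r is half the distance to the complement, and on the ball of radius 2 r
      the distance stays above d z / 2, which bounds m there by 2^M times the bound at z.\<close>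
    define r where "r = d z / 10"
    have r: "r > 0" using d_pos[OF z] by (simp add: r_def)
    have hol: "holomorphic_several (\<lambda>z. cnj (m z)) \<Omega>" using m by (simp add: conj_growth_def)
    have sub: "cball z (5 * r) \<subseteq> \<Omega>"
      using d_pos[OF z] by (intro order_trans[OF _ ball_d_subset[of z]]) (auto simp: r_def)
    have bound: "cmod (cnj (m u)) \<le> A / (d z / 2) ^ M" if u: "u \<in> ball z (2 * r)" for u
    proof -
      have "u \<in> \<Omega>" using u sub r by (intro subsetD[OF sub]) auto
      have "d z / 2 \<le> d u" using d_le_dist[of z u] u d_pos[OF z] by (simp add: r_def)
      have "cmod (m u) \<le> A / d u ^ M" using m \<open>u \<in> \<Omega>\<close> by (simp add: conj_growth_def)
      also have "\<dots> \<le> A / (d z / 2) ^ M"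
        using \<open>d z / 2 \<le> d u\<close> d_pos[OF z] A d_pos[OF \<open>u \<in> \<Omega>\<close>]
        by (intro divide_left_mono power_mono mult_pos_pos zero_less_power) auto
      finally show ?thesis by simp
    qed
    have "m = (\<lambda>z. cnj (cnj (m z)))" by simp
    then have "iter_deriv vs m z = cnj (iter_deriv vs (\<lambda>z. cnj (m z)) z)"
      using iter_deriv_linear[OF bounded_linear_cnj smooth_on_holomorphic[OF hol open_dom] open_dom z] by simp
    then have "cmod (iter_deriv vs m z) = cmod (iter_deriv vs (\<lambda>z. cnj (m z)) z)" by simp
    also have "\<dots> \<le> C * (A / (d z / 2) ^ M) / r ^ length vs"
      by (rule C(2)[OF hol r sub _ bound]) (use A d_pos[OF z] in auto)
    also have "\<dots> = (C * 2 ^ M * 10 ^ length vs) * A / d z ^ (M + length vs)"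
      by (simp add: r_def power_divide power_add)
    finally show ?thesis .
  qed
  note bound = this
  have "C * 2 ^ M * 10 ^ length vs \<ge> 0" using C(1) by simp
  from that[OF this bound] show ?thesis .
qed

lemma conj_growth_wbound:
  obtains C where "C > 0" "\<And>A m. conj_growth M A m \<Longrightarrow> A \<ge> 0 \<Longrightarrow> wbound n (- int M) (C * A) m"
proof -
  let ?P = "\<lambda>vs C. \<forall>A m z. conj_growth M A m \<longrightarrow> A \<ge> 0 \<longrightarrow> z \<in> \<Omega> \<longrightarrow> cmod (iter_deriv vs m z) \<le> C * A / d z ^ (M + length vs)"
  have "\<exists>C>0. \<forall>vs. set vs \<subseteq> Basis \<longrightarrow> length vs \<le> n \<longrightarrow> ?P vs C"
  proof (rule finite_lists_bound[where P = ?P])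
    fix vs :: "(complex ^ 'n) list"
    obtain C where "C \<ge> 0" "\<And>A m z. conj_growth M A m \<Longrightarrow> A \<ge> 0 \<Longrightarrow> z \<in> \<Omega> \<Longrightarrow>
      cmod (iter_deriv vs m z) \<le> C * A / d z ^ (M + length vs)"
      by (rule conj_growth_iter_deriv[of M vs]; rule that; blast)
    then show "\<exists>C. ?P vs C" by (intro exI[of _ C]) simp
  next
    fix vs :: "(complex ^ 'n) list" and C C' :: real
    assume P: "?P vs C" and le: "C \<le> C'"
    show "?P vs C'"
    proof (intro allI impI)
      fix A m z assume *: "conj_growth M A m" "A \<ge> 0" "z \<in> \<Omega>"
      then have "cmod (iter_deriv vs m z) \<le> C * A / d z ^ (M + length vs)" by (intro P[rule_format])
      also have "\<dots> \<le> C' * A / d z ^ (M + length vs)"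
        using le * d_nonneg[of z] by (intro divide_right_mono mult_right_mono) auto
      finally show "cmod (iter_deriv vs m z) \<le> C' * A / d z ^ (M + length vs)" .
    qed
  qed
  then obtain C where *: "C > 0 \<and> (\<forall>vs. set vs \<subseteq> Basis \<longrightarrow> length vs \<le> n \<longrightarrow> ?P vs C)" ..
  note C0 = conjunct1[OF *] and C = conjunct2[OF *]
  have "wbound n (- int M) (C * A) m" if "conj_growth M A m" "A \<ge> 0" for A m
    unfolding wbound_def
  proof (intro allI impI ballI)
    fix vs :: "(complex ^ 'n) list" and z assume vs: "set vs \<subseteq> Basis" "length vs \<le> n" and z: "z \<in> \<Omega>"
    have "- int M - int (length vs) = - int (M + length vs)" by simp
    moreover have "cmod (iter_deriv vs m z) \<le> C * A / d z ^ (M + length vs)" by (rule C[rule_format, OF vs that z])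
    ultimately show "cmod (iter_deriv vs m z) \<le> C * A * d z powi (- int M - int (length vs))"
      by (simp only: power_int_minus power_int_of_nat divide_inverse)
  qed
  note bound = this
  from that[OF C0 bound] show ?thesis .
qed

text \<open>The exponents -M of m and M + l of G add up to l, so derivatives of m G up to order l
  remain bounded at the boundary, with a bound linear in A.\<close>

lemma conj_growth_mult_flat:
  assumes G: "smooth_on \<Omega> G" "flat_on \<Omega> (M + l) G"
  obtains C where "C > 0" "\<And>A m. conj_growth M A m \<Longrightarrow> A \<ge> 0 \<Longrightarrow>
    (\<lambda>z. m z * G z) \<in> sobolev \<Omega> l \<and> sobolev_norm \<Omega> l (\<lambda>z. m z * G z) \<le> C * A"
proof -
  obtain C1 where C1: "C1 > 0" "wbound l (int (M + l)) C1 G"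
    using flat_on_wbound[OF G(2), of l] by auto
  obtain C2 where C2: "C2 > 0" "\<And>A m. conj_growth M A m \<Longrightarrow> A \<ge> 0 \<Longrightarrow> wbound l (- int M) (C2 * A) m"
    by (rule conj_growth_wbound[of M l]; rule that; blast)
  obtain D where D: "D \<ge> 1" "\<And>z. z \<in> \<Omega> \<Longrightarrow> d z \<le> D" using d_le by blast
  define K where "K = 2 ^ l * (C2 * C1) * D ^ l"
  have K: "K > 0" using C1(1) C2(1) D(1) by (simp add: K_def)
  have "(\<lambda>z. m z * G z) \<in> sobolev \<Omega> l \<and> sobolev_norm \<Omega> l (\<lambda>z. m z * G z) \<le> (K * sup_const \<Omega> l) * A"
    if m: "conj_growth M A m" and A: "A \<ge> 0" for A m
  proof -
    note ms = conj_growth_smooth[OF m]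
    have s: "smooth_on \<Omega> (\<lambda>z. m z * G z)" by (rule smooth_on_mult[OF open_dom ms G(1)])
    have w: "wbound l (- int M + int (M + l)) (2 ^ l * (C2 * A * C1)) (\<lambda>z. m z * G z)"
      using C1 C2 A by (intro wbound_mult ms G(1) C2(2) m C1(2)) auto
    have bound: "cmod (iter_deriv vs (\<lambda>z. m z * G z) z) \<le> K * A"
      if vs: "set vs \<subseteq> Basis" "length vs \<le> l" and z: "z \<in> \<Omega>" for vs z
    proof -
      have e: "- int M + int (M + l) - int (length vs) = int (l - length vs)" using vs(2) by simp
      have "cmod (iter_deriv vs (\<lambda>z. m z * G z) z) \<le> 2 ^ l * (C2 * A * C1) * d z powi (- int M + int (M + l) - int (length vs))"
        by (rule wboundD[OF w vs z])
      also have "\<dots> = 2 ^ l * (C2 * A * C1) * d z ^ (l - length vs)" unfolding e by simp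
      also have "\<dots> \<le> 2 ^ l * (C2 * A * C1) * D ^ l"
      proof (intro mult_left_mono)
        have "d z ^ (l - length vs) \<le> D ^ (l - length vs)" using D(2)[OF z] d_nonneg by (intro power_mono) auto
        also have "\<dots> \<le> D ^ l" using D(1) by (intro power_increasing) auto
        finally show "d z ^ (l - length vs) \<le> D ^ l" .
        show "0 \<le> 2 ^ l * (C2 * A * C1)" using C1(1) C2(1) A by simp
      qed
      finally show ?thesis by (simp add: K_def mult_ac)
    qed
    have "K * A \<ge> 0" using K A by simp
    from sobolev_bounded_derivs[OF open_dom bounded_dom s bound this]
    show ?thesis by (simp add: mult_ac)
  qed
  note bound = this
  have "K * sup_const \<Omega> l > 0" using K sup_const_pos[of \<Omega> l] by simp
  from that[OF this bound] show ?thesis .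
qed

section \<open>Representing functions of functionals\<close>

text \<open>DIM is the real dimension. A kernel of radius proportional to d z has height of order d
  z ^ -DIM, and each of up to k derivatives costs one more power.\<close>

definition growth_order :: "nat \<Rightarrow> nat" where
  "growth_order k = DIM(complex ^ 'n) + k"

text \<open>With a tenth of the distance, five times the radius still fits into \<Omega>, as the
  reproducing formula requires.\<close>

definition point_kernel :: "complex ^ 'n \<Rightarrow> complex ^ 'n \<Rightarrow> complex" where
  "point_kernel z = kernel_at (d z / 10) z"

lemma cball_d_subset: "z \<in> \<Omega> \<Longrightarrow> cball z (5 * (d z / 10)) \<subseteq> \<Omega>"
  by (intro order_trans[OF _ ball_d_subset[of z]]) (use d_pos[of z] in auto)

lemma test_functions_point_kernel: "z \<in> \<Omega> \<Longrightarrow> point_kernel z \<in> test_functions \<Omega>"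
  unfolding point_kernel_def using d_pos[of z]
  by (intro test_functions_kernel_at order_trans[OF _ cball_d_subset] subset_cball) auto

lemma point_kernel_bound:
  obtains C where "C > 0" "\<And>S z. tame_functional \<Omega> k S \<Longrightarrow> z \<in> \<Omega> \<Longrightarrow>
    cmod (S (point_kernel z)) \<le> C * neg_sobolev_norm \<Omega> k S / d z ^ growth_order k"
proof -
  let ?n = "DIM(complex ^ 'n)"
  let ?P = "\<lambda>vs C. \<forall>r>0. \<forall>w::complex ^ 'n. cmod (iter_deriv vs (kernel r) w) \<le> C / r ^ (?n + length vs)"
  have "\<exists>C>0. \<forall>vs. set vs \<subseteq> Basis \<longrightarrow> length vs \<le> k \<longrightarrow> ?P vs C"
  proof (rule finite_lists_bound[where P = ?P])
    fix vs :: "(complex ^ 'n) list"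
    obtain C where "C \<ge> 0" "\<And>r w. r > 0 \<Longrightarrow> cmod (iter_deriv vs (kernel r) (w::complex ^ 'n)) \<le> C / r ^ (?n + length vs)"
      by (rule iter_deriv_kernel_bound[where 'a = "complex ^ 'n" and vs = vs]; rule that; simp)
    then show "\<exists>C. ?P vs C" by (intro exI[of _ C]) simp
  next
    fix vs :: "(complex ^ 'n) list" and C C' :: real
    assume P: "?P vs C" and le: "C \<le> C'"
    show "?P vs C'"
    proof (intro allI impI)
      fix r :: real and w :: "complex ^ 'n" assume r: "r > 0"
      then have "cmod (iter_deriv vs (kernel r) w) \<le> C / r ^ (?n + length vs)" by (rule P[rule_format])
      also have "\<dots> \<le> C' / r ^ (?n + length vs)" using le r by (intro divide_right_mono) auto
      finally show "cmod (iter_deriv vs (kernel r) w) \<le> C' / r ^ (?n + length vs)" .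
    qed
  qed
  then obtain C where *: "C > 0 \<and> (\<forall>vs. set vs \<subseteq> Basis \<longrightarrow> length vs \<le> k \<longrightarrow> ?P vs C)" ..
  note C0 = conjunct1[OF *] and C = conjunct2[OF *]
  obtain D where D: "D \<ge> 1" "\<And>z. z \<in> \<Omega> \<Longrightarrow> d z \<le> D" using d_le by blast
  define K where "K = C * D ^ k * 10 ^ (?n + k) * sup_const \<Omega> k"
  have "K > 0" using C0 D(1) sup_const_pos[of \<Omega> k] by (simp add: K_def)
  have "cmod (S (point_kernel z)) \<le> K * neg_sobolev_norm \<Omega> k S / d z ^ growth_order k"
    if S: "tame_functional \<Omega> k S" and z: "z \<in> \<Omega>" for S z
  proof -
    define r where "r = d z / 10"
    have r: "r > 0" "r \<le> D" using d_pos[OF z] D(2)[OF z] by (auto simp: r_def)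
    have "cmod (S (point_kernel z)) \<le> (C * D ^ k / r ^ (?n + k)) * sup_const \<Omega> k * neg_sobolev_norm \<Omega> k S"
    proof (rule tame_functional_test_bound[OF open_dom bounded_dom S test_functions_point_kernel[OF z]])
      fix vs and w :: "complex ^ 'n" assume vs: "set vs \<subseteq> (Basis :: (complex ^ 'n) set)" "length vs \<le> k"
      have "cmod (iter_deriv vs (point_kernel z) w) \<le> C / r ^ (?n + length vs)"
        unfolding point_kernel_def iter_deriv_kernel_at r_def[symmetric] using C[rule_format, OF vs r(1)] .
      \<comment> \<open>Brings all orders to the common exponent DIM + k; the surplus power of r is
        then at most D^k, since r \<le> D and D \<ge> 1.\<close>
      also have "\<dots> = C * r ^ (k - length vs) / r ^ (?n + k)"
      proof -
        have "?n + k = (?n + length vs) + (k - length vs)" using vs(2) by simp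
        then have "r ^ (?n + k) = r ^ (?n + length vs) * r ^ (k - length vs)" by (metis power_add)
        then show ?thesis using r(1) by simp
      qed
      also have "\<dots> \<le> C * D ^ k / r ^ (?n + k)"
      proof (intro divide_right_mono mult_left_mono)
        have "r ^ (k - length vs) \<le> D ^ (k - length vs)" using r by (intro power_mono) auto
        also have "\<dots> \<le> D ^ k" using D(1) by (intro power_increasing) auto
        finally show "r ^ (k - length vs) \<le> D ^ k" .
      qed (use C0 r in auto)
      finally show "cmod (iter_deriv vs (point_kernel z) w) \<le> C * D ^ k / r ^ (?n + k)" .
    qed (use C0 D(1) r in simp)
    then show ?thesis by (simp add: K_def r_def growth_order_def power_divide mult_ac)
  qed
  note bound = this
  from that[OF \<open>K > 0\<close> bound] show ?thesis .
qed

lemma conj_bergman_L2: "\<mu> \<in> conj_bergman \<Omega> \<Longrightarrow> \<mu> \<in> L2 \<Omega>"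
  using L2_cnj[of "\<lambda>z. cnj (\<mu> z)" \<Omega>] by (simp add: conj_bergman_def bergman_space_def)

text \<open>The right side makes sense for every functional in \<open>neg_sobolev\<close> and so
  defines the representing function of a limit.\<close>

lemma conj_bergman_eq_embed:
  assumes \<mu>: "\<mu> \<in> conj_bergman \<Omega>" and z: "z \<in> \<Omega>"
  shows "\<mu> z = embed_L2 \<Omega> k \<mu> (point_kernel z)"
proof -
  have hol: "holomorphic_several (\<lambda>z. cnj (\<mu> z)) \<Omega>" using \<mu> by (simp add: conj_bergman_def bergman_space_def)
  have "cnj (\<mu> z) = (LINT w|lebesgue_on \<Omega>. cnj (\<mu> w) * point_kernel z w)"
    unfolding point_kernel_def
    by (rule holomorphic_eq_integral_kernel[OF open_dom hol _ cball_d_subset[OF z]]) (use d_pos[OF z] in simp)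
  also have "\<dots> = (LINT w|lebesgue_on \<Omega>. cnj (\<mu> w * cnj (point_kernel z w)))" by simp
  also have "\<dots> = cnj (LINT w|lebesgue_on \<Omega>. \<mu> w * cnj (point_kernel z w))" by (rule Bochner_Integration.integral_cnj)
  finally have "cnj (\<mu> z) = cnj (L2_inner \<Omega> \<mu> (\<lambda>w. point_kernel z w))" by (simp add: L2_inner_def)
  then have "\<mu> z = L2_inner \<Omega> \<mu> (point_kernel z)" by simp
  then show ?thesis
    using test_functions_sobolev0[OF open_dom bounded_dom test_functions_point_kernel[OF z]] by (simp add: embed_L2_def)
qed

text \<open>Stated for test functions only, since m may grow too fast at the boundary to be
  integrated against general elements of \<open>sobolev0\<close>.\<close>

definition represents :: "(complex ^ 'n) functional \<Rightarrow> (complex ^ 'n \<Rightarrow> complex) \<Rightarrow> bool" where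
  "represents T f \<longleftrightarrow> (\<forall>\<phi>\<in>test_functions \<Omega>. T \<phi> = (LINT z|lebesgue_on \<Omega>. f z * cnj (\<phi> z)))"

text \<open>The kernel bounds turn convergence in \<open>neg_sobolev_norm\<close> into locally
  uniform convergence of the approximating functions. The last conclusion supplies the growth bound
  for square-integrable \<mu>, on which the extension has to agree with the projection.\<close>

lemma conj_bergman_neg_representation:
  obtains C where "C > 0" "\<And>T. T \<in> conj_bergman_neg \<Omega> k \<Longrightarrow>
    \<exists>m. conj_growth (growth_order k) (C * neg_sobolev_norm \<Omega> k T) m \<and> represents T m"
    "\<And>\<mu>. \<mu> \<in> conj_bergman \<Omega> \<Longrightarrow> conj_growth (growth_order k) (C * neg_sobolev_norm \<Omega> k (embed_L2 \<Omega> k \<mu>)) \<mu>"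
proof -
  let ?M = "growth_order k"
  obtain C where C: "C > 0" "\<And>S z. tame_functional \<Omega> k S \<Longrightarrow> z \<in> \<Omega> \<Longrightarrow>
    cmod (S (point_kernel z)) \<le> C * neg_sobolev_norm \<Omega> k S / d z ^ ?M"
    using point_kernel_bound by blast
  have 2: "conj_growth ?M (C * neg_sobolev_norm \<Omega> k (embed_L2 \<Omega> k \<mu>)) \<mu>" if \<mu>: "\<mu> \<in> conj_bergman \<Omega>" for \<mu>
    unfolding conj_growth_def
  proof (intro conjI ballI)
    show "holomorphic_several (\<lambda>z. cnj (\<mu> z)) \<Omega>" using \<mu> by (simp add: conj_bergman_def bergman_space_def)
    show "cmod (\<mu> z) \<le> C * neg_sobolev_norm \<Omega> k (embed_L2 \<Omega> k \<mu>) / d z ^ ?M" if "z \<in> \<Omega>" for z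
      using C(2)[OF tame_functional_embed[OF open_dom bounded_dom conj_bergman_L2[OF \<mu>]] that]
      unfolding conj_bergman_eq_embed[OF \<mu> that, of k, symmetric] .
  qed
  have 1: "\<exists>m. conj_growth ?M (C * neg_sobolev_norm \<Omega> k T) m \<and> represents T m" if T: "T \<in> conj_bergman_neg \<Omega> k" for T
  proof -
    have tT: "tame_functional \<Omega> k T"
      using T by (intro tame_functional_neg_sobolev open_dom bounded_dom) (simp add: conj_bergman_neg_def)
    have "\<forall>n. \<exists>\<mu>. \<mu> \<in> conj_bergman \<Omega> \<and> neg_sobolev_norm \<Omega> k (\<lambda>h. T h - embed_L2 \<Omega> k \<mu> h) < 1 / real (Suc n)"
    proof
      fix n
      have "1 / real (Suc n) > 0" by simp
      then show "\<exists>\<mu>. \<mu> \<in> conj_bergman \<Omega> \<and> neg_sobolev_norm \<Omega> k (\<lambda>h. T h - embed_L2 \<Omega> k \<mu> h) < 1 / real (Suc n)"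
        using T unfolding conj_bergman_neg_def by blast
    qed
    from choice[OF this] obtain \<mu> where \<mu>: "\<And>n. \<mu> n \<in> conj_bergman \<Omega>"
      "\<And>n. neg_sobolev_norm \<Omega> k (\<lambda>h. T h - embed_L2 \<Omega> k (\<mu> n) h) < 1 / real (Suc n)" by blast
    have tame: "tame_functional \<Omega> k (\<lambda>h. T h - embed_L2 \<Omega> k (\<mu> n) h)" for n
      by (intro tame_functional_diff tT tame_functional_embed open_dom bounded_dom conj_bergman_L2 \<mu>(1))
    \<comment> \<open>Point evaluation as in \<open>conj_bergman_eq_embed\<close>, now applied to
      the limit functional.\<close>
    define m where "m z = T (point_kernel z)" for z
    have close: "cmod (m z - \<mu> n z) \<le> C / d z ^ ?M * (1 / real (Suc n))" if z: "z \<in> \<Omega>" for z n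
    proof -
      have "cmod (m z - \<mu> n z) \<le> C * neg_sobolev_norm \<Omega> k (\<lambda>h. T h - embed_L2 \<Omega> k (\<mu> n) h) / d z ^ ?M"
        using C(2)[OF tame z, of n] unfolding conj_bergman_eq_embed[OF \<mu>(1) z, of _ k] m_def .
      also have "\<dots> \<le> C * (1 / real (Suc n)) / d z ^ ?M"
        using \<mu>(2)[of n] C(1) d_pos[OF z] by (intro divide_right_mono mult_left_mono) auto
      finally show ?thesis by (simp add: mult.commute)
    qed
    have lim0: "(\<lambda>n. B * (1 / real (Suc n))) \<longlonglongrightarrow> 0" for B :: real
      using tendsto_mult[OF tendsto_const LIMSEQ_Suc[OF lim_1_over_n], of B] by simp
    have lim: "(\<lambda>n. \<mu> n z) \<longlonglongrightarrow> m z" if z: "z \<in> \<Omega>" for z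
    proof (rule Lim_transform2[OF tendsto_const])
      show "(\<lambda>n. m z - \<mu> n z) \<longlonglongrightarrow> 0"
        by (rule Lim_null_comparison[OF always_eventually[OF allI[OF close[OF z]]] lim0])
    qed
    have hol: "holomorphic_several (\<lambda>z. cnj (m z)) \<Omega>"
    proof (rule holomorphic_locally_uniform_limit[OF open_dom])
      show "holomorphic_several (\<lambda>z. cnj (\<mu> n z)) \<Omega>" for n
        using \<mu>(1)[of n] by (simp add: conj_bergman_def bergman_space_def)
      fix K assume K: "compact K" "K \<subseteq> \<Omega>"
      obtain e where e: "e > 0" "\<And>z. z \<in> K \<Longrightarrow> e \<le> d z" using compact_d_ge[OF K] by blast
      have le: "dist (cnj (\<mu> n z)) (cnj (m z)) \<le> C / e ^ ?M * (1 / real (Suc n))" if z: "z \<in> K" for z n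
      proof -
        have "dist (cnj (\<mu> n z)) (cnj (m z)) = cmod (m z - \<mu> n z)"
          unfolding dist_norm complex_cnj_diff[symmetric] complex_mod_cnj by (rule norm_minus_commute)
        also have "\<dots> \<le> C / d z ^ ?M * (1 / real (Suc n))" using close z K(2) by blast
        also have "\<dots> \<le> C / e ^ ?M * (1 / real (Suc n))"
          using e(1) e(2)[OF z] C(1) by (intro mult_right_mono divide_left_mono power_mono mult_pos_pos zero_less_power) auto
        finally show ?thesis .
      qed
      show "uniform_limit K (\<lambda>n z. cnj (\<mu> n z)) (\<lambda>z. cnj (m z)) sequentially"
      proof (rule uniform_limitI)
        fix \<epsilon> :: real assume "\<epsilon> > 0"
        then have "\<forall>\<^sub>F n in sequentially. C / e ^ ?M * (1 / real (Suc n)) < \<epsilon>"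
          using order_tendstoD(2)[OF lim0] by blast
        then show "\<forall>\<^sub>F n in sequentially. \<forall>z\<in>K. dist (cnj (\<mu> n z)) (cnj (m z)) < \<epsilon>"
          by (rule eventually_mono) (auto intro: le_less_trans[OF le])
      qed
    qed
    have growth: "conj_growth ?M (C * neg_sobolev_norm \<Omega> k T) m"
      unfolding conj_growth_def using hol C(2)[OF tT] by (simp add: m_def)
    \<comment> \<open>Both sides are limits of the pairings of the approximants with \<phi>: one by
      closeness in the negative norm, the other by dominated convergence on the support of
      \<phi>.\<close>
    have "T \<phi> = (LINT z|lebesgue_on \<Omega>. m z * cnj (\<phi> z))" if \<phi>: "\<phi> \<in> test_functions \<Omega>" for \<phi>
    proof (rule LIMSEQ_unique)
      obtain B where B: "B \<ge> 0" "\<And>vs x. set vs \<subseteq> Basis \<Longrightarrow> length vs \<le> k \<Longrightarrow> cmod (iter_deriv vs \<phi> x) \<le> B"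
        using test_functions_iter_deriv_bounded[OF \<phi>, of k] by blast
      have B': "cmod (iter_deriv vs \<phi> x) \<le> B + 1" if "set vs \<subseteq> Basis" "length vs \<le> k" for vs x
        using B(2)[OF that, of x] by simp
      have s0: "\<phi> \<in> sobolev0 \<Omega> k" by (rule test_functions_sobolev0[OF open_dom bounded_dom \<phi>])
      show "(\<lambda>n. embed_L2 \<Omega> k (\<mu> n) \<phi>) \<longlonglongrightarrow> T \<phi>"
      proof (rule Lim_transform2[OF tendsto_const])
        have cl: "cmod (T \<phi> - embed_L2 \<Omega> k (\<mu> n) \<phi>) \<le> ((B + 1) * sup_const \<Omega> k) * (1 / real (Suc n))" for n
        proof -
          have "cmod (T \<phi> - embed_L2 \<Omega> k (\<mu> n) \<phi>)
              \<le> (B + 1) * sup_const \<Omega> k * neg_sobolev_norm \<Omega> k (\<lambda>h. T h - embed_L2 \<Omega> k (\<mu> n) h)"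
          proof (rule tame_functional_test_bound[OF open_dom bounded_dom tame \<phi>])
            show "cmod (iter_deriv vs \<phi> x) \<le> B + 1" if "set vs \<subseteq> Basis" "length vs \<le> k" for vs x
              by (rule B'[OF that])
            show "0 < B + 1" using B(1) by linarith
          qed
          also have "\<dots> \<le> ((B + 1) * sup_const \<Omega> k) * (1 / real (Suc n))"
            using \<mu>(2)[of n] B(1) sup_const_pos[of \<Omega> k] by (intro mult_left_mono) auto
          finally show ?thesis .
        qed
        show "(\<lambda>n. T \<phi> - embed_L2 \<Omega> k (\<mu> n) \<phi>) \<longlonglongrightarrow> 0"
          by (rule Lim_null_comparison[OF always_eventually[OF allI[OF cl]] lim0])
      qed
      obtain K where K: "smooth_on UNIV \<phi>" "compact K" "K \<subseteq> \<Omega>" "\<And>x. x \<notin> K \<Longrightarrow> \<phi> x = 0"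
        using test_functionsE[OF \<phi>] by blast
      obtain e where e: "e > 0" "\<And>z. z \<in> K \<Longrightarrow> e \<le> d z" using compact_d_ge[OF K(2,3)] by blast
      have c\<phi>: "(\<lambda>z. cnj (\<phi> z)) \<in> test_functions \<Omega>"
        by (rule test_functionsI[OF smooth_on_cnj[OF open_UNIV K(1)] K(2,3)]) (simp add: K(4))
      have tm: "(\<lambda>z. m z * cnj (\<phi> z)) \<in> test_functions \<Omega>"
        by (rule test_functions_mult[OF open_dom conj_growth_smooth[OF growth] c\<phi>])
      have t\<mu>: "(\<lambda>z. \<mu> n z * cnj (\<phi> z)) \<in> test_functions \<Omega>" for n
        by (rule test_functions_mult[OF open_dom conj_growth_smooth[OF 2[OF \<mu>(1)]] c\<phi>])
      note int = integral_test_function(2)[OF open_dom]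
      have "(\<lambda>n. LINT z|lebesgue_on \<Omega>. \<mu> n z * cnj (\<phi> z)) \<longlonglongrightarrow> (LINT z|lebesgue_on \<Omega>. m z * cnj (\<phi> z))"
      proof (rule integral_dominated_convergence[where w = "\<lambda>z. norm (m z * cnj (\<phi> z)) + C / e ^ ?M * norm (cnj (\<phi> z))"])
        show "integrable (lebesgue_on \<Omega>) (\<lambda>z. norm (m z * cnj (\<phi> z)) + C / e ^ ?M * norm (cnj (\<phi> z)))"
          by (intro Bochner_Integration.integrable_add integrable_norm integrable_mult_right int tm c\<phi>)
        show "AE z in lebesgue_on \<Omega>. (\<lambda>n. \<mu> n z * cnj (\<phi> z)) \<longlonglongrightarrow> m z * cnj (\<phi> z)"
          by (intro AE_I2 tendsto_mult tendsto_const lim) simp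
        show "AE z in lebesgue_on \<Omega>. norm (\<mu> n z * cnj (\<phi> z)) \<le> norm (m z * cnj (\<phi> z)) + C / e ^ ?M * norm (cnj (\<phi> z))" for n
        proof (intro AE_I2)
          fix z
          show "norm (\<mu> n z * cnj (\<phi> z)) \<le> norm (m z * cnj (\<phi> z)) + C / e ^ ?M * norm (cnj (\<phi> z))"
          proof (cases "z \<in> K")
            case True
            have "cmod (m z - \<mu> n z) \<le> C / d z ^ ?M * (1 / real (Suc n))" using close True K(3) by blast
            also have "\<dots> \<le> C / e ^ ?M * 1"
              using e(1) e(2)[OF True] C(1)
              by (intro mult_mono divide_left_mono power_mono mult_pos_pos zero_less_power) auto
            finally have "cmod (\<mu> n z) \<le> cmod (m z) + C / e ^ ?M"
              using norm_triangle_sub[of "\<mu> n z" "m z"] by (simp add: norm_minus_commute)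
            then have "cmod (\<mu> n z) * cmod (\<phi> z) \<le> (cmod (m z) + C / e ^ ?M) * cmod (\<phi> z)"
              by (intro mult_right_mono) auto
            then show ?thesis by (simp add: norm_mult distrib_right)
          next
            case False
            then show ?thesis using K(4) by simp
          qed
        qed
      qed (intro borel_measurable_integrable int tm t\<mu>)+
      then show "(\<lambda>n. embed_L2 \<Omega> k (\<mu> n) \<phi>) \<longlonglongrightarrow> (LINT z|lebesgue_on \<Omega>. m z * cnj (\<phi> z))"
        using s0 by (simp add: embed_L2_def L2_inner_def)
    qed
    note rep = this
    have "represents T m" unfolding represents_def by (intro ballI rep)
    then show ?thesis by (intro exI[of _ m] conjI growth)
  qed
  from that[OF C(1) 1 2] show ?thesis .
qed

text \<open>Tested with u times a bump at z, the hypothesis makes the integral of the bump times the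
  square of |u| vanish; by continuity the integrand is zero everywhere, and at z the bump is
  1.\<close>

lemma smooth_eq_0_if_represents_0:
  assumes u: "smooth_on \<Omega> u" and 0: "\<And>\<phi>. \<phi> \<in> test_functions \<Omega> \<Longrightarrow> (LINT z|lebesgue_on \<Omega>. u z * cnj (\<phi> z)) = 0"
    and z: "z \<in> \<Omega>"
  shows "u z = 0"
proof -
  let ?b = "\<lambda>w. complex_of_real (bump z (d z / 4) (d z / 2) w)"
  have dz: "d z > 0" by (rule d_pos[OF z])
  have sub: "cball z (d z / 2) \<subseteq> \<Omega>" using dz by (intro order_trans[OF _ ball_d_subset[of z]]) auto
  have b: "?b \<in> test_functions \<Omega>"
    by (rule test_functionsI[OF smooth_on_of_real[OF open_UNIV smooth_on_bump] compact_cball sub])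
       (use dz in \<open>auto intro!: bump_eq_0 simp: dist_norm norm_minus_commute\<close>)
  have ub: "(\<lambda>w. u w * ?b w) \<in> test_functions \<Omega>" by (rule test_functions_mult[OF open_dom u b])
  have cub: "(\<lambda>w. cnj (u w) * (u w * ?b w)) \<in> test_functions \<Omega>"
    by (rule test_functions_mult[OF open_dom smooth_on_cnj[OF open_dom u] ub])
  let ?v = "\<lambda>w. (cmod (u w))\<^sup>2 * bump z (d z / 4) (d z / 2) w"
  have eq: "cnj (u w) * (u w * ?b w) = of_real (?v w)" for w
    using complex_norm_square[of "u w"] by (simp add: mult_ac)
  have "(LINT w|lebesgue_on \<Omega>. u w * cnj (u w * ?b w)) = 0" by (rule 0[OF ub])
  also have "(LINT w|lebesgue_on \<Omega>. u w * cnj (u w * ?b w)) = (LINT w|lebesgue_on \<Omega>. cnj (u w) * (u w * ?b w))"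
    by (intro Bochner_Integration.integral_cong) (auto simp: mult_ac)
  also have "\<dots> = (\<integral>w. cnj (u w) * (u w * ?b w) \<partial>lborel)" by (rule integral_test_function(1)[OF open_dom cub])
  finally have "(\<integral>w. complex_of_real (?v w) \<partial>lborel) = 0" unfolding eq .
  then have int0: "(\<integral>w. ?v w \<partial>lborel) = 0" by (simp only: integral_complex_of_real of_real_eq_0_iff)
  have "integrable lborel (\<lambda>w. complex_of_real (?v w))"
    using integral_test_function(3)[OF open_dom cub] unfolding eq .
  then have int: "integrable lborel ?v" by (simp only: complex_of_real_integrable_eq)
  have "AE w in lborel. 0 \<le> ?v w"
    by (intro AE_I2 mult_nonneg_nonneg bump_ge_0 zero_le_power2)
  from integral_nonneg_eq_0_iff_AE[OF int this] int0 have "AE w in lborel. ?v w = 0" by (simp only: simp_thms)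
  then have ae: "AE w in lebesgue. w \<in> {w. ?v w = 0}" by (simp add: AE_completion)
  have "continuous_on UNIV (\<lambda>w. Re (cnj (u w) * (u w * ?b w)))"
    by (intro continuous_intros smooth_on_imp_continuous_on test_functions_smooth[OF cub])
  then have "continuous_on UNIV ?v" unfolding eq Re_complex_of_real .
  from continuous_closed_preimage_constant[OF this closed_UNIV, of 0]
  have "closed {w. ?v w = 0}" by (simp only: UNIV_I simp_thms)
  from mem_closed_if_AE_lebesgue[OF this ae] have "?v z = 0" by auto
  then show ?thesis using bump_eq_1[of "d z / 4" "d z / 2" z z] dz by simp
qed

end

section \<open>The extension of the Bergman projection\<close>

locale corrected_domain = weighted_domain \<Omega> for \<Omega> :: "(complex ^ 'n::finite) set" +
  fixes g G :: "complex ^ 'n \<Rightarrow> complex" and k l :: nat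
  assumes g: "bsmooth_on \<Omega> g" and correction: "flat_correction \<Omega> (growth_order k + l) g G"
begin

lemma smooth_g: "smooth_on \<Omega> g" and smooth_G: "smooth_on \<Omega> G"
  and flat_G: "flat_on \<Omega> (growth_order k + l) G"
  and bsmooth_G: "bsmooth_on \<Omega> G"
  and orthogonal_G: "conj_orthogonal \<Omega> (\<lambda>z. g z - G z)"
  and vanishes_G: "vanishes_with \<Omega> g G"
  using g correction unfolding flat_correction_def by (auto intro: bsmooth_on_smooth_on)

definition moderate :: "(complex ^ 'n \<Rightarrow> complex) \<Rightarrow> bool" where
  "moderate m \<longleftrightarrow> (\<exists>A\<ge>0. conj_growth (growth_order k) A m)"

lemma moderate_smooth: "moderate m \<Longrightarrow> smooth_on \<Omega> m"
  unfolding moderate_def by (auto intro: conj_growth_smooth)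

lemma moderate_add:
  assumes "moderate m1" "moderate m2"
  shows "moderate (\<lambda>z. m1 z + m2 z)"
proof -
  obtain A1 A2 where A: "A1 \<ge> 0" "A2 \<ge> 0"
    and m: "conj_growth (growth_order k) A1 m1" "conj_growth (growth_order k) A2 m2"
    using assms unfolding moderate_def by blast
  have "conj_growth (growth_order k) (A1 + A2) (\<lambda>z. m1 z + m2 z)"
    unfolding conj_growth_def
  proof (intro conjI ballI)
    show "holomorphic_several (\<lambda>z. cnj (m1 z + m2 z)) \<Omega>"
      unfolding complex_cnj_add using m by (intro holomorphic_several_add) (simp_all add: conj_growth_def)
    fix z assume z: "z \<in> \<Omega>"
    have "cmod (m1 z + m2 z) \<le> A1 / d z ^ growth_order k + A2 / d z ^ growth_order k"
      using m z by (intro norm_triangle_le add_mono) (simp_all add: conj_growth_def)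
    then show "cmod (m1 z + m2 z) \<le> (A1 + A2) / d z ^ growth_order k"
      by (simp only: add_divide_distrib)
  qed
  moreover have "A1 + A2 \<ge> 0" using A by simp
  ultimately show ?thesis unfolding moderate_def by (intro exI[of _ "A1 + A2"] conjI)
qed

lemma moderate_scale:
  assumes "moderate m"
  shows "moderate (\<lambda>z. c * m z)"
proof -
  obtain A where A: "A \<ge> 0" and m: "conj_growth (growth_order k) A m"
    using assms unfolding moderate_def by blast
  have "conj_growth (growth_order k) (cmod c * A) (\<lambda>z. c * m z)"
    unfolding conj_growth_def
  proof (intro conjI ballI)
    show "holomorphic_several (\<lambda>z. cnj (c * m z)) \<Omega>"
      unfolding complex_cnj_mult using m
      by (intro holomorphic_several_mult holomorphic_several_const) (simp add: conj_growth_def)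
    fix z assume z: "z \<in> \<Omega>"
    have "cmod c * cmod (m z) \<le> cmod c * (A / d z ^ growth_order k)"
      using m z by (intro mult_left_mono) (simp_all add: conj_growth_def)
    then show "cmod (c * m z) \<le> cmod c * A / d z ^ growth_order k"
      by (simp only: norm_mult times_divide_eq_right)
  qed
  moreover have "cmod c * A \<ge> 0" using A by simp
  ultimately show ?thesis unfolding moderate_def by (intro exI[of _ "cmod c * A"] conjI)
qed

lemma moderate_sobolev:
  assumes "moderate m"
  shows "(\<lambda>z. m z * G z) \<in> sobolev \<Omega> l"
proof -
  obtain A where A: "A \<ge> 0" "conj_growth (growth_order k) A m"
    using assms unfolding moderate_def by blast
  show ?thesis
  proof (rule conj_growth_mult_flat[OF smooth_G flat_G])
    fix C
    assume *: "\<And>A m. conj_growth (growth_order k) A m \<Longrightarrow> A \<ge> 0 \<Longrightarrow>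
      (\<lambda>z. m z * G z) \<in> sobolev \<Omega> l \<and> sobolev_norm \<Omega> l (\<lambda>z. m z * G z) \<le> C * A"
    show ?thesis by (rule conjunct1[OF *[OF A(2,1)]])
  qed
qed

lemma moderate_L2: "moderate m \<Longrightarrow> (\<lambda>z. m z * G z) \<in> L2 \<Omega>"
  using moderate_sobolev unfolding sobolev_def by simp

text \<open>A relation rather than a function of T, because m is determined only up to what
  \<open>g\<close> annihilates.\<close>

definition ext_repr :: "(complex ^ 'n) functional \<Rightarrow> (complex ^ 'n \<Rightarrow> complex) \<Rightarrow> bool" where
  "ext_repr T m \<longleftrightarrow> moderate m \<and> represents T (\<lambda>z. m z * g z)"

lemma integrable_moderate:
  assumes "moderate m" "\<phi> \<in> test_functions \<Omega>"
  shows "integrable (lebesgue_on \<Omega>) (\<lambda>z. m z * g z * cnj (\<phi> z))"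
proof -
  have "integrable (lebesgue_on \<Omega>) (\<lambda>z. cnj (m z * g z) * \<phi> z)"
    by (intro integral_test_function(2) open_dom test_functions_mult smooth_on_cnj smooth_on_mult
        moderate_smooth smooth_g assms)
  from integrable_cnj[OF this] show ?thesis by simp
qed

lemma ext_repr_add:
  assumes "ext_repr S m1" "ext_repr T m2"
  shows "ext_repr (\<lambda>h. S h + T h) (\<lambda>z. m1 z + m2 z)"
  unfolding ext_repr_def represents_def
proof (intro conjI ballI)
  show "moderate (\<lambda>z. m1 z + m2 z)" using assms by (intro moderate_add) (simp_all add: ext_repr_def)
  fix \<phi> assume \<phi>: "\<phi> \<in> test_functions \<Omega>"
  have "S \<phi> + T \<phi> = (LINT z|lebesgue_on \<Omega>. m1 z * g z * cnj (\<phi> z)) + (LINT z|lebesgue_on \<Omega>. m2 z * g z * cnj (\<phi> z))"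
    using assms \<phi> by (simp add: ext_repr_def represents_def)
  also have "\<dots> = (LINT z|lebesgue_on \<Omega>. m1 z * g z * cnj (\<phi> z) + m2 z * g z * cnj (\<phi> z))"
    using assms \<phi> by (intro Bochner_Integration.integral_add[symmetric] integrable_moderate) (simp_all add: ext_repr_def)
  finally show "S \<phi> + T \<phi> = (LINT z|lebesgue_on \<Omega>. (m1 z + m2 z) * g z * cnj (\<phi> z))"
    by (simp only: distrib_right)
qed

lemma ext_repr_scale:
  assumes "ext_repr T m"
  shows "ext_repr (\<lambda>h. c * T h) (\<lambda>z. c * m z)"
  using assms unfolding ext_repr_def represents_def by (simp add: moderate_scale mult.assoc)

text \<open>The difference of the two representatives times \<open>g\<close> is zero. Where the
  difference is nonzero, an open set, \<open>g\<close> vanishes, and then so does \<open>G\<close>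
  by \<open>vanishes_with\<close>.\<close>

lemma ext_repr_unique:
  assumes "ext_repr T m1" "ext_repr T m2" and z: "z \<in> \<Omega>"
  shows "m1 z * G z = m2 z * G z"
proof -
  let ?m = "\<lambda>z. m1 z + (-1) * m2 z"
  have "ext_repr (\<lambda>h. T h + (-1) * T h) ?m"
    by (rule ext_repr_add[OF assms(1) ext_repr_scale[OF assms(2)]])
  then have mod: "moderate ?m" and rep: "represents (\<lambda>h. T h + (-1) * T h) (\<lambda>z. ?m z * g z)"
    by (simp_all add: ext_repr_def)
  have s: "smooth_on \<Omega> (\<lambda>z. ?m z * g z)"
    by (rule smooth_on_mult[OF open_dom moderate_smooth[OF mod] smooth_g])
  have 0: "?m z * g z = 0" if z: "z \<in> \<Omega>" for z
  proof (rule smooth_eq_0_if_represents_0[OF s _ z])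
    show "(LINT z|lebesgue_on \<Omega>. ?m z * g z * cnj (\<phi> z)) = 0" if "\<phi> \<in> test_functions \<Omega>" for \<phi>
      using rep that by (simp add: represents_def)
  qed
  let ?V = "\<Omega> \<inter> ?m -` (- {0})"
  have "open ?V"
    by (rule continuous_open_preimage[OF smooth_on_imp_continuous_on[OF moderate_smooth[OF mod]] open_dom]) auto
  moreover have "\<forall>z\<in>?V. g z = 0"
  proof
    fix z assume "z \<in> ?V"
    then show "g z = 0" using 0[of z] by simp
  qed
  ultimately have "\<forall>z\<in>?V. G z = 0"
    by (rule mp[OF mp[OF mp[OF spec[OF vanishes_G[unfolded vanishes_with_def]]] Int_lower1]])
  then have "?m z = 0 \<or> G z = 0" using z by auto
  then show ?thesis by auto
qed

text \<open>Any representative may be chosen: on \<Omega> the product with \<open>G\<close> depends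
  on T alone.\<close>

definition extension :: "(complex ^ 'n) functional \<Rightarrow> complex ^ 'n \<Rightarrow> complex" where
  "extension T = bergman_projection \<Omega> (\<lambda>z. (SOME m. ext_repr T m) z * G z)"

lemma extension_eq:
  assumes m: "ext_repr T m"
  shows "extension T = bergman_projection \<Omega> (\<lambda>z. m z * G z)"
  unfolding extension_def
proof (rule bergman_projection_eq_if_orthogonal[OF open_dom bounded_dom])
  have some: "ext_repr T (SOME m. ext_repr T m)" by (rule someI[of "ext_repr T", OF m])
  show "(\<lambda>z. (SOME m. ext_repr T m) z * G z) \<in> L2 \<Omega>" "(\<lambda>z. m z * G z) \<in> L2 \<Omega>"
    using some m by (intro moderate_L2; simp add: ext_repr_def)+
  fix u
  have "L2_inner \<Omega> (\<lambda>z. (SOME m. ext_repr T m) z * G z - m z * G z) u = L2_inner \<Omega> (\<lambda>z. 0) u"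
    by (rule L2_inner_cong_left) (simp add: ext_repr_unique[OF some m])
  then show "L2_inner \<Omega> (\<lambda>z. (SOME m. ext_repr T m) z * G z - m z * G z) u = 0"
    by (simp add: L2_inner_def)
qed

lemma linear_op_on_extension:
  assumes X: "\<And>T. T \<in> X \<Longrightarrow> \<exists>m. ext_repr T m"
  shows "linear_op_on \<Omega> X extension"
  unfolding linear_op_on_def
proof (intro conjI ballI allI)
  fix S T assume "S \<in> X" "T \<in> X"
  obtain m1 where m1: "ext_repr S m1" using X[OF \<open>S \<in> X\<close>] ..
  obtain m2 where m2: "ext_repr T m2" using X[OF \<open>T \<in> X\<close>] ..
  have "extension (\<lambda>h. S h + T h) = bergman_projection \<Omega> (\<lambda>z. m1 z * G z + m2 z * G z)"
    using extension_eq[OF ext_repr_add[OF m1 m2]] by (simp only: distrib_right)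
  also have "\<dots> = (\<lambda>z. extension S z + extension T z)"
    unfolding extension_eq[OF m1] extension_eq[OF m2] using m1 m2
    by (intro bergman_projection_add open_dom bounded_dom moderate_L2) (simp_all add: ext_repr_def)
  finally show "AE x in lebesgue_on \<Omega>. extension (\<lambda>h. S h + T h) x = extension S x + extension T x"
    by simp
next
  fix c S assume "S \<in> X"
  obtain m where m: "ext_repr S m" using X[OF \<open>S \<in> X\<close>] ..
  have "extension (\<lambda>h. c * S h) = bergman_projection \<Omega> (\<lambda>z. c * (m z * G z))"
    using extension_eq[OF ext_repr_scale[OF m]] by (simp only: mult.assoc)
  also have "\<dots> = (\<lambda>z. c * extension S z)"
    unfolding extension_eq[OF m] using m
    by (intro bergman_projection_scale open_dom bounded_dom moderate_L2) (simp add: ext_repr_def)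
  finally show "AE x in lebesgue_on \<Omega>. extension (\<lambda>h. c * S h) x = c * extension S x"
    by simp
qed

lemma ext_repr_mult_functional:
  assumes T: "represents T m" and m: "moderate m"
  shows "ext_repr (mult_functional \<Omega> k T g) m"
  unfolding ext_repr_def represents_def
proof (intro conjI ballI m)
  fix \<phi> assume \<phi>: "\<phi> \<in> test_functions \<Omega>"
  have "(\<lambda>z. cnj (g z) * \<phi> z) \<in> test_functions \<Omega>"
    by (rule test_functions_mult[OF open_dom smooth_on_cnj[OF open_dom smooth_g] \<phi>])
  then have "T (\<lambda>z. cnj (g z) * \<phi> z) = (LINT z|lebesgue_on \<Omega>. m z * cnj (cnj (g z) * \<phi> z))"
    by (rule bspec[OF T[unfolded represents_def]])
  then show "mult_functional \<Omega> k T g \<phi> = (LINT z|lebesgue_on \<Omega>. m z * g z * cnj (\<phi> z))"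
    using test_functions_sobolev0[OF open_dom bounded_dom \<phi>, of k] by (simp add: mult_functional_def mult.assoc)
qed

lemma mult_bsmooth_L2:
  assumes "\<mu> \<in> L2 \<Omega>" "bsmooth_on \<Omega> f"
  shows "(\<lambda>z. \<mu> z * f z) \<in> L2 \<Omega>"
proof -
  obtain C where C: "\<forall>x\<in>f ` \<Omega>. cmod x \<le> C"
    using bsmooth_on_bounded0[OF assms(2)] unfolding bounded_iff ..
  have "\<Omega> \<in> sets lebesgue" using open_dom by simp
  from continuous_imp_measurable_on_sets_lebesgue[OF smooth_on_imp_continuous_on[OF bsmooth_on_smooth_on[OF assms(2)]] this]
  show ?thesis using C by (intro L2_bounded_mult[OF assms(1)]) auto
qed

text \<open>The pairing of \<mu> (g - G) with u is that of g - G with cnj \<mu> u, which is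
  holomorphic, and integrable as a product of square-integrable functions.\<close>

lemma bergman_projection_correction:
  assumes \<mu>: "\<mu> \<in> conj_bergman \<Omega>"
  shows "bergman_projection \<Omega> (\<lambda>z. \<mu> z * G z) = bergman_projection \<Omega> (\<lambda>z. \<mu> z * g z)"
proof (rule bergman_projection_eq_if_orthogonal[OF open_dom bounded_dom, symmetric])
  have \<mu>2: "\<mu> \<in> L2 \<Omega>" by (rule conj_bergman_L2[OF \<mu>])
  show "(\<lambda>z. \<mu> z * g z) \<in> L2 \<Omega>" by (rule mult_bsmooth_L2[OF \<mu>2 g])
  show "(\<lambda>z. \<mu> z * G z) \<in> L2 \<Omega>" by (rule mult_bsmooth_L2[OF \<mu>2 bsmooth_G])
  fix u assume u: "u \<in> bergman_space \<Omega>"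
  let ?h = "\<lambda>z. cnj (\<mu> z) * u z"
  have "holomorphic_several ?h \<Omega>"
    using \<mu> u by (intro holomorphic_several_mult) (simp_all add: conj_bergman_def bergman_space_def)
  moreover have "integrable (lebesgue_on \<Omega>) ?h"
    using u by (intro L2_mult_integrable L2_cnj \<mu>2) (simp add: bergman_space_def)
  ultimately have "(LINT z|lebesgue_on \<Omega>. (g z - G z) * cnj (?h z)) = 0"
    by (rule mp[OF mp[OF spec[OF orthogonal_G[unfolded conj_orthogonal_def]]]])
  then show "L2_inner \<Omega> (\<lambda>z. \<mu> z * g z - \<mu> z * G z) u = 0"
    unfolding L2_inner_def by (simp add: algebra_simps)
qed

text \<open>The embedded product \<mu> g is given as a functional without reference to
  \<open>mult_functional\<close>; both kinds of functional reach \<open>extension\<close> through a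
  moderate representative.\<close>

lemma ext_repr_embed:
  assumes "moderate \<mu>"
  shows "ext_repr (embed_L2 \<Omega> k (\<lambda>z. \<mu> z * g z)) \<mu>"
  unfolding ext_repr_def represents_def
  using assms test_functions_sobolev0[OF open_dom bounded_dom] by (simp add: embed_L2_def L2_inner_def)

lemma extension_exists:
  assumes B: "\<exists>C>0. \<forall>f\<in>sobolev \<Omega> l. bergman_projection \<Omega> f \<in> sobolev \<Omega> l' \<and>
           sobolev_norm \<Omega> l' (bergman_projection \<Omega> f) \<le> C * sobolev_norm \<Omega> l f"
  shows "\<exists>B' C'. C' > 0 \<and>
           (\<forall>T\<in>conj_bergman_neg_mult \<Omega> k g. B' T \<in> sobolev \<Omega> l') \<and>
           linear_op_on \<Omega> (conj_bergman_neg_mult \<Omega> k g) B' \<and>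
           (\<forall>\<mu>\<in>conj_bergman \<Omega>. AE z in lebesgue_on \<Omega>.
              B' (embed_L2 \<Omega> k (\<lambda>z. \<mu> z * g z)) z = bergman_projection \<Omega> (\<lambda>z. \<mu> z * g z) z) \<and>
           (\<forall>\<mu>\<in>conj_bergman_neg \<Omega> k.
              sobolev_norm \<Omega> l' (B' (mult_functional \<Omega> k \<mu> g)) \<le> C' * neg_sobolev_norm \<Omega> k \<mu>)"
proof (rule conj_bergman_neg_representation, rule conj_growth_mult_flat[OF smooth_G flat_G])
  fix C1 C2 :: real
  assume C1: "C1 > 0" "\<And>T. T \<in> conj_bergman_neg \<Omega> k \<Longrightarrow>
      \<exists>m. conj_growth (growth_order k) (C1 * neg_sobolev_norm \<Omega> k T) m \<and> represents T m"
    "\<And>\<mu>. \<mu> \<in> conj_bergman \<Omega> \<Longrightarrow> conj_growth (growth_order k) (C1 * neg_sobolev_norm \<Omega> k (embed_L2 \<Omega> k \<mu>)) \<mu>"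
  assume C2: "C2 > 0" "\<And>A m. conj_growth (growth_order k) A m \<Longrightarrow> A \<ge> 0 \<Longrightarrow>
      (\<lambda>z. m z * G z) \<in> sobolev \<Omega> l \<and> sobolev_norm \<Omega> l (\<lambda>z. m z * G z) \<le> C2 * A"
  obtain C where C: "C > 0" "\<forall>f\<in>sobolev \<Omega> l. bergman_projection \<Omega> f \<in> sobolev \<Omega> l' \<and>
           sobolev_norm \<Omega> l' (bergman_projection \<Omega> f) \<le> C * sobolev_norm \<Omega> l f"
    using B by blast
  \<comment> \<open>The one appeal to the assumed estimate, applied to m G. The factors of the
    constant bound the projection, multiplication by \<open>G\<close> and the representing
    function.\<close>
  have main: "\<exists>m. ext_repr (mult_functional \<Omega> k T g) m \<and> extension (mult_functional \<Omega> k T g) \<in> sobolev \<Omega> l' \<and>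
      sobolev_norm \<Omega> l' (extension (mult_functional \<Omega> k T g)) \<le> C * C2 * C1 * neg_sobolev_norm \<Omega> k T"
    if T: "T \<in> conj_bergman_neg \<Omega> k" for T
  proof -
    obtain m where m: "conj_growth (growth_order k) (C1 * neg_sobolev_norm \<Omega> k T) m" "represents T m"
      using C1(2)[OF T] by blast
    have "tame_functional \<Omega> k T"
      using T by (intro tame_functional_neg_sobolev open_dom bounded_dom) (simp add: conj_bergman_neg_def)
    then have pos: "C1 * neg_sobolev_norm \<Omega> k T \<ge> 0"
      using neg_sobolev_norm_nonneg[OF open_dom bounded_dom] C1(1) by simp
    have "moderate m" unfolding moderate_def using pos m(1) by (intro exI conjI)
    then have r: "ext_repr (mult_functional \<Omega> k T g) m" by (rule ext_repr_mult_functional[OF m(2)])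
    note s = C2(2)[OF m(1) pos]
    note b = bspec[OF C(2) conjunct1[OF s]]
    have "sobolev_norm \<Omega> l' (extension (mult_functional \<Omega> k T g)) \<le> C * sobolev_norm \<Omega> l (\<lambda>z. m z * G z)"
      unfolding extension_eq[OF r] by (rule conjunct2[OF b])
    also have "\<dots> \<le> C * (C2 * (C1 * neg_sobolev_norm \<Omega> k T))"
      using s C(1) by (intro mult_left_mono) auto
    finally have "sobolev_norm \<Omega> l' (extension (mult_functional \<Omega> k T g)) \<le> C * C2 * C1 * neg_sobolev_norm \<Omega> k T"
      by (simp only: mult.assoc)
    moreover have "extension (mult_functional \<Omega> k T g) \<in> sobolev \<Omega> l'"
      unfolding extension_eq[OF r] by (rule conjunct1[OF b])
    ultimately show ?thesis using r by (intro exI[of _ m] conjI)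
  qed
  have "C * C2 * C1 > 0" using C(1) C1(1) C2(1) by simp
  moreover have "\<forall>T\<in>conj_bergman_neg_mult \<Omega> k g. extension T \<in> sobolev \<Omega> l'"
    unfolding conj_bergman_neg_mult_def using main by fastforce
  moreover have "linear_op_on \<Omega> (conj_bergman_neg_mult \<Omega> k g) extension"
    by (rule linear_op_on_extension) (use main in \<open>fastforce simp: conj_bergman_neg_mult_def\<close>)
  moreover have "\<forall>\<mu>\<in>conj_bergman \<Omega>. AE z in lebesgue_on \<Omega>.
      extension (embed_L2 \<Omega> k (\<lambda>z. \<mu> z * g z)) z = bergman_projection \<Omega> (\<lambda>z. \<mu> z * g z) z"
  proof
    fix \<mu> assume \<mu>: "\<mu> \<in> conj_bergman \<Omega>"
    have "C1 * neg_sobolev_norm \<Omega> k (embed_L2 \<Omega> k \<mu>) \<ge> 0"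
      using C1(1) neg_sobolev_norm_nonneg[OF open_dom bounded_dom
          tame_functional_embed[OF open_dom bounded_dom conj_bergman_L2[OF \<mu>]]] by simp
    then have mod: "moderate \<mu>" unfolding moderate_def using C1(3)[OF \<mu>] by (intro exI conjI)
    show "AE z in lebesgue_on \<Omega>.
        extension (embed_L2 \<Omega> k (\<lambda>z. \<mu> z * g z)) z = bergman_projection \<Omega> (\<lambda>z. \<mu> z * g z) z"
      unfolding extension_eq[OF ext_repr_embed[OF mod]] bergman_projection_correction[OF \<mu>] by simp
  qed
  moreover have "\<forall>\<mu>\<in>conj_bergman_neg \<Omega> k.
      sobolev_norm \<Omega> l' (extension (mult_functional \<Omega> k \<mu> g)) \<le> C * C2 * C1 * neg_sobolev_norm \<Omega> k \<mu>"
  proof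
    fix \<mu> assume "\<mu> \<in> conj_bergman_neg \<Omega> k"
    from main[OF this]
    show "sobolev_norm \<Omega> l' (extension (mult_functional \<Omega> k \<mu> g)) \<le> C * C2 * C1 * neg_sobolev_norm \<Omega> k \<mu>"
      by (elim exE conjE)
  qed
  ultimately show ?thesis by (intro exI[of _ extension] exI[of _ "C * C2 * C1"] conjI)
qed

end

theorem corollary1p7:
  fixes \<Omega> :: "(complex ^ 'n::finite) set" and k1 k2 k :: nat and g :: "complex ^ 'n \<Rightarrow> complex"
  assumes "smooth_bounded_domain \<Omega>"
    and "\<exists>C>0. \<forall>f\<in>sobolev \<Omega> k1. bergman_projection \<Omega> f \<in> sobolev \<Omega> k2 \<and>
           sobolev_norm \<Omega> k2 (bergman_projection \<Omega> f) \<le> C * sobolev_norm \<Omega> k1 f"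
    and "k \<ge> 1"
    and "smooth_up_to_boundary \<Omega> g"
  shows "\<exists>B' C'. C' > 0 \<and>
           (\<forall>T\<in>conj_bergman_neg_mult \<Omega> k g. B' T \<in> sobolev \<Omega> k2) \<and>
           linear_op_on \<Omega> (conj_bergman_neg_mult \<Omega> k g) B' \<and>
           (\<forall>\<mu>\<in>conj_bergman \<Omega>. AE z in lebesgue_on \<Omega>.
              B' (embed_L2 \<Omega> k (\<lambda>z. \<mu> z * g z)) z = bergman_projection \<Omega> (\<lambda>z. \<mu> z * g z) z) \<and>
           (\<forall>\<mu>\<in>conj_bergman_neg \<Omega> k.
              sobolev_norm \<Omega> k2 (B' (mult_functional \<Omega> k \<mu> g)) \<le> C' * neg_sobolev_norm \<Omega> k \<mu>)"
proof -
  have dom: "open \<Omega>" "bounded \<Omega>" using assms(1) by (auto simp: smooth_bounded_domain_def)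
  interpret weighted_domain \<Omega> by unfold_locales (rule dom)+
  have g: "bsmooth_on \<Omega> g" by (rule smooth_up_to_boundary_bsmooth_on[OF assms(4) dom(2)])
  \<comment> \<open>\<open>growth_order k\<close> orders of vanishing cancel the growth of the
    representing function, and k1 more place the product in the Sobolev space of order k1.\<close>
  obtain G where "flat_correction \<Omega> (growth_order k + k1) g G"
    by (rule flat_correction_exists[OF assms(1) g])
  then interpret corrected_domain \<Omega> g G k k1 by unfold_locales (rule g)
  show ?thesis by (rule extension_exists[OF assms(2)])
qed

end
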